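(* Let $X\subset\mathbb{P}^{n-1}$ be a smooth Fano variety over a finite field $\mathbb{F}_q$, defined by forms of degrees $d_1,\dots,d_R$ over $\mathbb{F}_q$, and let $U\subset X$ be a Zariski open subset. For $e\geq 1$ let $N_U(e)=\#\{x\in U(\mathbb{F}_q(t))\colon H(x)=q^e\}$, and let $\operatorname{Mor}_{e,U}(\mathbb{P}^1,X)$ be the scheme of morphisms $f\colon\mathbb{P}^1\to X$ with $\deg f^*\mathcal{O}_X(1)=e$ and $f(\mathbb{P}^1)\cap U\neq\emptyset$. Then \[ N_U(e)=O\big(C^e q^{\dim \operatorname{Mor}_{e,U}(\mathbb{P}^1,X)}\big),\qquad C=\prod_{i=1}^R d_i^{d_i}, \] where the implied constant depends only on $d_1,\dots,d_R$ and $q$.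
   Context: $H$ denotes the naive height on $\mathbb{P}^{n-1}(\mathbb{F}_q(t))$: writing a point as $(x_1:\dots:x_n)$ with $x_i\in\mathbb{F}_q[t]$ having no common factor, $H=q^{\max_i \deg x_i}$. The dimension of a scheme is the maximum of the dimensions of its irreducible components. *)

theory Defs
  imports
    "HOL-Analysis.Abstract_Topology"
    "HOL-Library.Poly_Mapping"
    "HOL-Library.Extended_Real"
    "HOL-Library.Cardinality"
    "HOL-Algebra.Algebraic_Closure_Type"
    "HOL-Computational_Algebra.Fraction_Field"
    "Jordan_Normal_Form.Determinant"
    "Jordan_Normal_Form.DL_Rank"
begin

text \<open>
  Schemes of finite type over a field \<open>k\<close> are represented classically.  A quasi-projective
  \<open>k\<close>-scheme is handled through its set of points over an algebraically closed field \<open>K\<close>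
  containing \<open>k\<close>, topologised by the zero loci of forms with coefficients in \<open>k\<close> (not in \<open>K\<close>).
  For \<open>K\<close> the algebraic closure of \<open>k\<close>, the lattice of closed sets of this space is the lattice of
  closed sets of the scheme over \<open>k\<close>, so irreducibility and dimension are those of the \<open>k\<close>-scheme.
  Throughout, \<open>\<phi>\<close> is the embedding of \<open>k\<close> into the field in which points have coordinates.
\<close>

subsection \<open>Polynomials and forms\<close>

text \<open>Polynomials in the variables \<open>x\<^sub>0, x\<^sub>1, \<dots>\<close>; monomials are exponent vectors.\<close>

type_synonym 'k mpoly = "(nat \<Rightarrow>\<^sub>0 nat) \<Rightarrow>\<^sub>0 'k"

definition meval :: "('k::comm_ring_1 \<Rightarrow> 'l::comm_ring_1) \<Rightarrow> 'k mpoly \<Rightarrow> (nat \<Rightarrow> 'l) \<Rightarrow> 'l" where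
  "meval \<phi> F x = (\<Sum>m\<in>Poly_Mapping.keys F.
     \<phi> (Poly_Mapping.lookup F m) * (\<Prod>i\<in>Poly_Mapping.keys m. x i ^ Poly_Mapping.lookup m i))"

definition mpderiv :: "nat \<Rightarrow> 'k::comm_ring_1 mpoly \<Rightarrow> 'k mpoly" where
  "mpderiv j F = (\<Sum>m\<in>Poly_Mapping.keys F.
     Poly_Mapping.single (m - Poly_Mapping.single j 1)
       (of_nat (Poly_Mapping.lookup m j) * Poly_Mapping.lookup F m))"

text \<open>Forms of degree \<open>d\<close> in \<open>x\<^sub>0, \<dots>, x\<^bsub>n-1\<^esub>\<close>, including the zero polynomial.\<close>

definition forms :: "nat \<Rightarrow> nat \<Rightarrow> 'k::comm_ring_1 mpoly set" where
  "forms n d = {F. \<forall>m\<in>Poly_Mapping.keys F.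
     Poly_Mapping.keys m \<subseteq> {..<n} \<and> (\<Sum>i\<in>Poly_Mapping.keys m. Poly_Mapping.lookup m i) = d}"

subsection \<open>Projective space and its Zariski topology\<close>

text \<open>
  A point of \<open>\<bbbP>\<^bsup>n-1\<^esup>\<close> is the set of all its vectors of homogeneous coordinates; vectors of length
  \<open>n\<close> are functions on \<open>nat\<close> vanishing from \<open>n\<close> on.
\<close>

type_synonym 'l ppoint = "(nat \<Rightarrow> 'l) set"

definition proj_pt :: "(nat \<Rightarrow> 'l::field) \<Rightarrow> 'l ppoint" where
  "proj_pt x = {(\<lambda>i. c * x i) | c. c \<noteq> 0}"

definition proj_space :: "nat \<Rightarrow> 'l::field ppoint set" where
  "proj_space n = proj_pt ` {x. (\<exists>i. x i \<noteq> 0) \<and> (\<forall>i\<ge>n. x i = 0)}"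

definition proj_zeros ::
  "('k::field \<Rightarrow> 'l::field) \<Rightarrow> nat \<Rightarrow> 'k mpoly set \<Rightarrow> 'l ppoint set" where
  "proj_zeros \<phi> n S = {P \<in> proj_space n. \<forall>F\<in>S. \<forall>x\<in>P. meval \<phi> F x = 0}"

definition zariski :: "('k::field \<Rightarrow> 'l::field) \<Rightarrow> nat \<Rightarrow> 'l ppoint topology" where
  "zariski \<phi> n = topology (\<lambda>V. \<exists>S \<subseteq> (\<Union>d. forms n d). V = proj_space n - proj_zeros \<phi> n S)"

lemma meval_superset:
  assumes "finite A" "Poly_Mapping.keys F \<subseteq> A" "\<phi> 0 = 0"
  shows "meval \<phi> F x = (\<Sum>m\<in>A. \<phi> (Poly_Mapping.lookup F m) * (\<Prod>i\<in>Poly_Mapping.keys m. x i ^ Poly_Mapping.lookup m i))"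
  unfolding meval_def
  by (rule sum.mono_neutral_left) (use assms in \<open>auto simp: in_keys_iff\<close>)

lemma meval_add:
  assumes "\<phi> 0 = 0" "\<And>a b. \<phi> (a + b) = \<phi> a + \<phi> b"
  shows "meval \<phi> (F + G) x = meval \<phi> F x + meval \<phi> G x"
proof -
  let ?A = "Poly_Mapping.keys F \<union> Poly_Mapping.keys G"
  have "Poly_Mapping.keys (F + G) \<subseteq> ?A" by (rule Poly_Mapping.keys_add)
  then show ?thesis
    using assms by (simp add: meval_superset[of ?A] lookup_add distrib_right sum.distrib)
qed

lemma meval_sum:
  assumes "\<phi> 0 = 0" "\<And>a b. \<phi> (a + b) = \<phi> a + \<phi> b"
  shows "meval \<phi> (\<Sum>a\<in>A. f a) x = (\<Sum>a\<in>A. meval \<phi> (f a) x)"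
proof (induction A rule: infinite_finite_induct)
  case (insert a A)
  then show ?case by (simp add: meval_add[of \<phi>, OF assms])
qed (simp_all add: meval_def)

lemma meval_single:
  assumes "\<phi> 0 = 0"
  shows "meval \<phi> (Poly_Mapping.single m c) x = \<phi> c * (\<Prod>i\<in>Poly_Mapping.keys m. x i ^ Poly_Mapping.lookup m i)"
  using assms by (simp add: meval_def lookup_single)

lemma mpoly_sum_single: "F = (\<Sum>m\<in>Poly_Mapping.keys F. Poly_Mapping.single m (Poly_Mapping.lookup F m))"
proof (rule poly_mapping_eqI)
  fix l
  have "(\<Sum>m\<in>Poly_Mapping.keys F. Poly_Mapping.lookup (Poly_Mapping.single m (Poly_Mapping.lookup F m)) l)
      = (\<Sum>m\<in>Poly_Mapping.keys F. if l = m then Poly_Mapping.lookup F l else 0)"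
    by (rule sum.cong) (auto simp: lookup_single when_def)
  also have "\<dots> = Poly_Mapping.lookup F l"
    by (simp add: in_keys_iff)
  finally show "Poly_Mapping.lookup F l = Poly_Mapping.lookup (\<Sum>m\<in>Poly_Mapping.keys F. Poly_Mapping.single m (Poly_Mapping.lookup F m)) l"
    by (simp add: lookup_sum)
qed

lemma monomial_add:
  fixes x :: "nat \<Rightarrow> 'l::comm_ring_1" and m m' :: "nat \<Rightarrow>\<^sub>0 nat"
  shows "(\<Prod>i\<in>Poly_Mapping.keys (m + m'). x i ^ Poly_Mapping.lookup (m + m') i)
     = (\<Prod>i\<in>Poly_Mapping.keys m. x i ^ Poly_Mapping.lookup m i) * (\<Prod>i\<in>Poly_Mapping.keys m'. x i ^ Poly_Mapping.lookup m' i)"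
proof -
  let ?A = "Poly_Mapping.keys m \<union> Poly_Mapping.keys m'"
  have *: "(\<Prod>i\<in>Poly_Mapping.keys k. x i ^ Poly_Mapping.lookup k i) = (\<Prod>i\<in>?A. x i ^ Poly_Mapping.lookup k i)"
    if "Poly_Mapping.keys k \<subseteq> ?A" for k :: "nat \<Rightarrow>\<^sub>0 nat"
    by (rule prod.mono_neutral_left) (use that in \<open>auto simp: in_keys_iff\<close>)
  have "(\<Prod>i\<in>Poly_Mapping.keys (m + m'). x i ^ Poly_Mapping.lookup (m + m') i)
      = (\<Prod>i\<in>?A. x i ^ Poly_Mapping.lookup (m + m') i)"
    by (rule *) (rule Poly_Mapping.keys_add)
  also have "\<dots> = (\<Prod>i\<in>?A. x i ^ Poly_Mapping.lookup m i) * (\<Prod>i\<in>?A. x i ^ Poly_Mapping.lookup m' i)"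
    by (simp add: lookup_add power_add prod.distrib)
  finally show ?thesis
    by (simp only: *[of m] *[of m'] Un_upper1 Un_upper2)
qed

lemma meval_mult:
  assumes "\<phi> 0 = 0" "\<And>a b. \<phi> (a + b) = \<phi> a + \<phi> b" "\<And>a b. \<phi> (a * b) = \<phi> a * \<phi> b"
  shows "meval \<phi> (F * G) x = meval \<phi> F x * meval \<phi> G x"
proof -
  let ?s = "Poly_Mapping.single"
  have "F * G = (\<Sum>m\<in>Poly_Mapping.keys F. \<Sum>k\<in>Poly_Mapping.keys G. ?s m (Poly_Mapping.lookup F m) * ?s k (Poly_Mapping.lookup G k))"
    by (subst mpoly_sum_single[of F], subst mpoly_sum_single[of G]) (rule sum_product)
  then have "meval \<phi> (F * G) x = (\<Sum>m\<in>Poly_Mapping.keys F. \<Sum>k\<in>Poly_Mapping.keys G.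
      meval \<phi> (?s m (Poly_Mapping.lookup F m) * ?s k (Poly_Mapping.lookup G k)) x)"
    by (simp only: meval_sum[of \<phi>, OF assms(1,2)])
  also have "\<dots> = meval \<phi> F x * meval \<phi> G x"
    using assms
    by (simp add: mult_single meval_single monomial_add meval_def[of \<phi> F] meval_def[of \<phi> G]
        sum_product mult_ac)
  finally show ?thesis .
qed

lemma forms_mult:
  fixes F G :: "'k::comm_ring_1 mpoly"
  assumes "F \<in> forms n d" "G \<in> forms n d'"
  shows "F * G \<in> forms n (d + d')"
proof -
  have "Poly_Mapping.keys m \<subseteq> {..<n} \<and> (\<Sum>i\<in>Poly_Mapping.keys m. Poly_Mapping.lookup m i) = d + d'" 
    if mem: "m \<in> Poly_Mapping.keys (F * G)" for m
  proof -
    obtain a b where ab: "m = a + b" "a \<in> Poly_Mapping.keys F" "b \<in> Poly_Mapping.keys G"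
      using mem Poly_Mapping.keys_mult[of F G] by blast
    have *: "(\<Sum>i\<in>Poly_Mapping.keys k. Poly_Mapping.lookup k i) = (\<Sum>i\<in>Poly_Mapping.keys a \<union> Poly_Mapping.keys b. Poly_Mapping.lookup k i)"
      if "Poly_Mapping.keys k \<subseteq> Poly_Mapping.keys a \<union> Poly_Mapping.keys b" for k :: "nat \<Rightarrow>\<^sub>0 nat"
      by (rule sum.mono_neutral_left) (use that in \<open>auto simp: in_keys_iff\<close>)
    have k: "Poly_Mapping.keys (a + b) \<subseteq> Poly_Mapping.keys a \<union> Poly_Mapping.keys b" by (rule Poly_Mapping.keys_add)
    have "(\<Sum>i\<in>Poly_Mapping.keys m. Poly_Mapping.lookup m i)
        = (\<Sum>i\<in>Poly_Mapping.keys a \<union> Poly_Mapping.keys b. Poly_Mapping.lookup (a + b) i)"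
      unfolding ab(1) by (rule *[OF k])
    also have "\<dots> = (\<Sum>i\<in>Poly_Mapping.keys a. Poly_Mapping.lookup a i)
        + (\<Sum>i\<in>Poly_Mapping.keys b. Poly_Mapping.lookup b i)"
      by (simp only: *[of a] *[of b] Un_upper1 Un_upper2 lookup_add sum.distrib)
    finally have "(\<Sum>i\<in>Poly_Mapping.keys m. Poly_Mapping.lookup m i)
        = (\<Sum>i\<in>Poly_Mapping.keys a. Poly_Mapping.lookup a i)
        + (\<Sum>i\<in>Poly_Mapping.keys b. Poly_Mapping.lookup b i)" .
    moreover have "Poly_Mapping.keys a \<subseteq> {..<n}" "Poly_Mapping.keys b \<subseteq> {..<n}"
      "(\<Sum>i\<in>Poly_Mapping.keys a. Poly_Mapping.lookup a i) = d" "(\<Sum>i\<in>Poly_Mapping.keys b. Poly_Mapping.lookup b i) = d'"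
      using assms ab unfolding forms_def by auto
    ultimately show ?thesis using k ab by auto
  qed
  then show ?thesis by (auto simp: forms_def)
qed

lemma meval_scale:
  assumes "F \<in> forms n d"
  shows "meval \<phi> F (\<lambda>i. c * x i) = c ^ d * meval \<phi> F x"
proof -
  have "(\<Prod>i\<in>Poly_Mapping.keys m. (c * x i) ^ Poly_Mapping.lookup m i) = c ^ d * (\<Prod>i\<in>Poly_Mapping.keys m. x i ^ Poly_Mapping.lookup m i)"
    if "m \<in> Poly_Mapping.keys F" for m
  proof -
    have "(\<Prod>i\<in>Poly_Mapping.keys m. (c * x i) ^ Poly_Mapping.lookup m i)
        = (\<Prod>i\<in>Poly_Mapping.keys m. c ^ Poly_Mapping.lookup m i) * (\<Prod>i\<in>Poly_Mapping.keys m. x i ^ Poly_Mapping.lookup m i)"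
      by (simp add: power_mult_distrib prod.distrib)
    also have "(\<Prod>i\<in>Poly_Mapping.keys m. c ^ Poly_Mapping.lookup m i) = c ^ (\<Sum>i\<in>Poly_Mapping.keys m. Poly_Mapping.lookup m i)"
      by (simp add: power_sum)
    also have "(\<Sum>i\<in>Poly_Mapping.keys m. Poly_Mapping.lookup m i) = d" using assms that by (auto simp: forms_def)
    finally show ?thesis .
  qed
  then show ?thesis by (simp add: meval_def sum_distrib_left mult_ac)
qed

lemma istopology_zariski:
  fixes \<phi> :: "'k::field \<Rightarrow> 'l::field"
  assumes hom: "\<phi> 0 = 0" "\<phi> 1 = 1" "\<And>a b. \<phi> (a + b) = \<phi> a + \<phi> b" "\<And>a b. \<phi> (a * b) = \<phi> a * \<phi> b"
  shows "istopology (\<lambda>V. \<exists>S \<subseteq> (\<Union>d. forms n d). V = proj_space n - proj_zeros \<phi> n S)"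
  unfolding istopology_def
proof (intro conjI allI impI)
  fix V W
  assume "\<exists>S \<subseteq> (\<Union>d. forms n d). V = proj_space n - proj_zeros \<phi> n S"
    and "\<exists>S \<subseteq> (\<Union>d. forms n d). W = proj_space n - proj_zeros \<phi> n S"
  then obtain S T where S: "S \<subseteq> (\<Union>d. forms n d)" "V = proj_space n - proj_zeros \<phi> n S"
    and T: "T \<subseteq> (\<Union>d. forms n d)" "W = proj_space n - proj_zeros \<phi> n T" by auto
  let ?U = "{F * G | F G. F \<in> S \<and> G \<in> T}"
  have "?U \<subseteq> (\<Union>d. forms n d)"
  proof
    fix E assume "E \<in> ?U"
    then obtain F G where E: "E = F * G" "F \<in> S" "G \<in> T" by blast
    then obtain d d' where "F \<in> forms n d" "G \<in> forms n d'" using S(1) T(1) by blast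
    then have "E \<in> forms n (d + d')" unfolding E(1) by (rule forms_mult)
    then show "E \<in> (\<Union>d. forms n d)" by blast
  qed
  moreover have "V \<inter> W = proj_space n - proj_zeros \<phi> n ?U"
  proof (intro equalityI subsetI)
    fix P assume "P \<in> V \<inter> W"
    then obtain F G x y where *: "P \<in> proj_space n" "F \<in> S" "G \<in> T" "x \<in> P" "y \<in> P"
      "meval \<phi> F x \<noteq> 0" "meval \<phi> G y \<noteq> 0"
      using S T by (auto simp: proj_zeros_def)
    then obtain z c c' where z: "P = proj_pt z" "c \<noteq> 0" "c' \<noteq> 0"
      "x = (\<lambda>i. c * z i)" "y = (\<lambda>i. c' * z i)"
      by (auto simp: proj_space_def proj_pt_def)
    obtain d d' where "F \<in> forms n d" "G \<in> forms n d'" using * S(1) T(1) by blast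
    then have "meval \<phi> F z \<noteq> 0" "meval \<phi> G z \<noteq> 0"
      using * z by (auto simp: meval_scale)
    then have "meval \<phi> (F * G) z \<noteq> 0" by (simp add: meval_mult[of \<phi>, OF hom(1,3,4)])
    moreover have "z \<in> P" using z by (auto simp: proj_pt_def intro!: exI[of _ 1])
    ultimately show "P \<in> proj_space n - proj_zeros \<phi> n ?U"
      using * by (auto simp: proj_zeros_def)
  next
    fix P assume P: "P \<in> proj_space n - proj_zeros \<phi> n ?U"
    then obtain E x where "E \<in> ?U" and x: "x \<in> P" "meval \<phi> E x \<noteq> 0"
      unfolding proj_zeros_def by blast
    then obtain F G where FG: "F \<in> S" "G \<in> T" "E = F * G" by blast
    have "meval \<phi> E x = meval \<phi> F x * meval \<phi> G x"
      unfolding FG(3) by (rule meval_mult[of \<phi>, OF hom(1,3,4)])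
    then have "meval \<phi> F x \<noteq> 0" "meval \<phi> G x \<noteq> 0" using x by auto
    then have "P \<notin> proj_zeros \<phi> n S" "P \<notin> proj_zeros \<phi> n T"
      using x(1) FG(1,2) unfolding proj_zeros_def by blast+
    then show "P \<in> V \<inter> W" using P unfolding S(2) T(2) by blast
  qed
  ultimately show "\<exists>S \<subseteq> (\<Union>d. forms n d). V \<inter> W = proj_space n - proj_zeros \<phi> n S" by blast
next
  fix \<V> assume "\<forall>V\<in>\<V>. \<exists>S \<subseteq> (\<Union>d. forms n d). V = proj_space n - proj_zeros \<phi> n S"
  then obtain S where S: "\<And>V. V \<in> \<V> \<Longrightarrow> S V \<subseteq> (\<Union>d. forms n d)"
    "\<And>V. V \<in> \<V> \<Longrightarrow> V = proj_space n - proj_zeros \<phi> n (S V)" by metis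
  let ?S = "\<Union>V\<in>\<V>. S V"
  have mem: "P \<in> V \<longleftrightarrow> P \<in> proj_space n \<and> (\<exists>F\<in>S V. \<exists>x\<in>P. meval \<phi> F x \<noteq> 0)" if "V \<in> \<V>" for P V
    by (subst S(2)[OF that]) (auto simp: proj_zeros_def)
  have "\<Union>\<V> = proj_space n - proj_zeros \<phi> n ?S"
  proof (intro equalityI subsetI)
    fix P assume "P \<in> \<Union>\<V>"
    then obtain V where V: "V \<in> \<V>" "P \<in> V" by blast
    then obtain F x where "P \<in> proj_space n" "F \<in> S V" "x \<in> P" "meval \<phi> F x \<noteq> 0"
      using mem[OF V(1)] by blast
    then show "P \<in> proj_space n - proj_zeros \<phi> n ?S" using V unfolding proj_zeros_def by blast
  next
    fix P assume "P \<in> proj_space n - proj_zeros \<phi> n ?S"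
    then obtain V F x where "P \<in> proj_space n" "V \<in> \<V>" "F \<in> S V" "x \<in> P" "meval \<phi> F x \<noteq> 0"
      unfolding proj_zeros_def by blast
    then have "P \<in> V" using mem[of V] by blast
    with \<open>V \<in> \<V>\<close> show "P \<in> \<Union>\<V>" by blast
  qed
  moreover have "(\<Union>V\<in>\<V>. S V) \<subseteq> (\<Union>d. forms n d)" using S(1) by blast
  ultimately show "\<exists>S \<subseteq> (\<Union>d. forms n d). \<Union>\<V> = proj_space n - proj_zeros \<phi> n S" by blast
qed

lemma openin_zariski:
  fixes \<phi> :: "'k::field \<Rightarrow> 'l::field"
  assumes "\<phi> 0 = 0" "\<phi> 1 = 1" "\<And>a b. \<phi> (a + b) = \<phi> a + \<phi> b" "\<And>a b. \<phi> (a * b) = \<phi> a * \<phi> b"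
  shows "openin (zariski \<phi> n) V \<longleftrightarrow>
    (\<exists>S \<subseteq> (\<Union>d. forms n d). V = proj_space n - proj_zeros \<phi> n S)"
  unfolding zariski_def by (subst topology_inverse'[OF istopology_zariski[of \<phi>, OF assms]]) (rule refl)

subsection \<open>Irreducibility and dimension\<close>

definition irreducible_space :: "'p topology \<Rightarrow> bool" where
  "irreducible_space T \<longleftrightarrow> topspace T \<noteq> {} \<and>
     (\<forall>A B. closedin T A \<and> closedin T B \<and> A \<union> B = topspace T \<longrightarrow> A = topspace T \<or> B = topspace T)"

definition irreducible_components :: "'p topology \<Rightarrow> 'p set set" where
  "irreducible_components T = {Z. Z \<subseteq> topspace T \<and> irreducible_space (subtopology T Z) \<and>
     (\<forall>Z'. Z \<subseteq> Z' \<and> Z' \<subseteq> topspace T \<and> irreducible_space (subtopology T Z') \<longrightarrow> Z' = Z)}"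

text \<open>Supremum of the lengths \<open>l\<close> of chains \<open>Z\<^sub>0 \<subset> \<dots> \<subset> Z\<^sub>l\<close> of irreducible closed subsets.\<close>

definition krull_dim :: "'p topology \<Rightarrow> ereal" where
  "krull_dim T = Sup {ereal (real l) | l. \<exists>Z :: nat \<Rightarrow> 'p set.
     (\<forall>i\<le>l. closedin T (Z i) \<and> irreducible_space (subtopology T (Z i))) \<and>
     (\<forall>i<l. Z i \<subset> Z (Suc i))}"

text \<open>The dimension of the empty scheme is \<open>-\<infinity>\<close>.\<close>

definition scheme_dim :: "'p topology \<Rightarrow> ereal" where
  "scheme_dim T = (SUP Z\<in>irreducible_components T. krull_dim (subtopology T Z))"

subsection \<open>Regular functions and maps\<close>

definition regular_fun :: "('k::field \<Rightarrow> 'l::field) \<Rightarrow> nat \<Rightarrow> 'l ppoint set \<Rightarrow> ('l ppoint \<Rightarrow> 'l) \<Rightarrow> bool"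
  where "regular_fun \<phi> n V f \<longleftrightarrow> (\<forall>P\<in>V. \<exists>d. \<exists>G\<in>forms n d. \<exists>H\<in>forms n d.
     (\<forall>x\<in>P. meval \<phi> H x \<noteq> 0) \<and>
     (\<forall>Q\<in>V. \<forall>x\<in>Q. meval \<phi> H x \<noteq> 0 \<longrightarrow> f Q = meval \<phi> G x / meval \<phi> H x))"

definition regular_map ::
  "('k::field \<Rightarrow> 'l::field) \<Rightarrow> nat \<Rightarrow> 'l ppoint set \<Rightarrow> nat \<Rightarrow> ('l ppoint \<Rightarrow> 'l ppoint) \<Rightarrow> bool"
  where "regular_map \<phi> n Y N g \<longleftrightarrow> g ` Y \<subseteq> proj_space N \<and>
    (\<forall>P\<in>Y. \<exists>d. \<exists>h :: nat \<Rightarrow> 'k mpoly. (\<forall>j<N. h j \<in> forms n d) \<and>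
       (\<forall>x\<in>P. \<exists>j<N. meval \<phi> (h j) x \<noteq> 0) \<and>
       (\<forall>Q\<in>Y. \<forall>x\<in>Q. (\<exists>j<N. meval \<phi> (h j) x \<noteq> 0) \<longrightarrow>
          g Q = proj_pt (\<lambda>j. if j < N then meval \<phi> (h j) x else 0)))"

definition closed_embedding ::
  "('k::field \<Rightarrow> 'l::field) \<Rightarrow> nat \<Rightarrow> 'l ppoint set \<Rightarrow> nat \<Rightarrow> ('l ppoint \<Rightarrow> 'l ppoint) \<Rightarrow> bool"
  where "closed_embedding \<phi> n Y N g \<longleftrightarrow> regular_map \<phi> n Y N g \<and> inj_on g Y \<and>
    closedin (zariski \<phi> N) (g ` Y) \<and> regular_map \<phi> N (g ` Y) n (inv_into Y g)"

subsection \<open>Tangent vectors and the anticanonical bundle\<close>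

text \<open>Representatives of elements of the local ring of \<open>Y\<close> at \<open>P\<close>.\<close>

definition regular_at ::
  "('k::field \<Rightarrow> 'l::field) \<Rightarrow> nat \<Rightarrow> 'l ppoint set \<Rightarrow> 'l ppoint \<Rightarrow> ('l ppoint \<Rightarrow> 'l) set" where
  "regular_at \<phi> n Y P =
     {f. \<exists>V. openin (subtopology (zariski \<phi> n) Y) V \<and> P \<in> V \<and> regular_fun \<phi> n V f}"

text \<open>A tangent vector at \<open>P\<close> is a point derivation over \<open>k\<close> of the local ring at \<open>P\<close>.\<close>

definition tangent_vector :: "('k::field \<Rightarrow> 'l::field) \<Rightarrow> nat \<Rightarrow> 'l ppoint set \<Rightarrow> 'l ppoint \<Rightarrow>
    (('l ppoint \<Rightarrow> 'l) \<Rightarrow> 'l) \<Rightarrow> bool" where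
  "tangent_vector \<phi> n Y P D \<longleftrightarrow>
     (\<forall>f\<in>regular_at \<phi> n Y P. \<forall>g\<in>regular_at \<phi> n Y P.
        ((\<exists>V. openin (subtopology (zariski \<phi> n) Y) V \<and> P \<in> V \<and> (\<forall>Q\<in>V. f Q = g Q)) \<longrightarrow> D f = D g) \<and>
        D (\<lambda>Q. f Q + g Q) = D f + D g \<and>
        D (\<lambda>Q. f Q * g Q) = f P * D g + g P * D f) \<and>
     (\<forall>a. D (\<lambda>Q. \<phi> a) = 0)"

definition tangent_basis :: "('k::field \<Rightarrow> 'l::field) \<Rightarrow> nat \<Rightarrow> 'l ppoint set \<Rightarrow> nat \<Rightarrow> 'l ppoint \<Rightarrow>
    (nat \<Rightarrow> ('l ppoint \<Rightarrow> 'l) \<Rightarrow> 'l) \<Rightarrow> bool" where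
  "tangent_basis \<phi> n Y m P v \<longleftrightarrow>
     (\<forall>j<m. tangent_vector \<phi> n Y P (v j)) \<and>
     (\<forall>D. tangent_vector \<phi> n Y P D \<longrightarrow>
        (\<exists>a. \<forall>f\<in>regular_at \<phi> n Y P. D f = (\<Sum>j<m. a j * v j f))) \<and>
     (\<forall>a. (\<forall>f\<in>regular_at \<phi> n Y P. (\<Sum>j<m. a j * v j f) = 0) \<longrightarrow> (\<forall>j<m. a j = 0))"

text \<open>
  For \<open>Y\<close> smooth of dimension \<open>m\<close>, the dual \<open>\<omega>\<^sub>Y\<^bsup>-1\<^esup>\<close> of the canonical bundle is \<open>\<Lambda>\<^sup>m T\<^sub>Y\<close>.  Given
  a basis \<open>v\<^sub>0(P), \<dots>, v\<^bsub>m-1\<^esub>(P)\<close> of each tangent space (no regularity in \<open>P\<close> is assumed), a set-theoretic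
  section of \<open>(\<omega>\<^sub>Y\<^bsup>-1\<^esup>)\<^sup>k\<close> is \<open>P \<mapsto> c(P) (v\<^sub>0(P) \<and> \<dots> \<and> v\<^bsub>m-1\<^esub>(P))\<^sup>k\<close>, and it is regular iff its
  pairing with \<open>(df\<^sub>0 \<and> \<dots> \<and> df\<^bsub>m-1\<^esub>)\<^sup>k\<close> is regular for all local regular functions
  \<open>f\<^sub>0, \<dots>, f\<^bsub>m-1\<^esub>\<close>; that pairing is \<open>c(P) det(v\<^sub>j(P) f\<^sub>i)\<^sup>k\<close>.
\<close>

definition anticanonical_section :: "('k::field \<Rightarrow> 'l::field) \<Rightarrow> nat \<Rightarrow> 'l ppoint set \<Rightarrow> nat \<Rightarrow>
    ('l ppoint \<Rightarrow> nat \<Rightarrow> ('l ppoint \<Rightarrow> 'l) \<Rightarrow> 'l) \<Rightarrow> nat \<Rightarrow> ('l ppoint \<Rightarrow> 'l) \<Rightarrow> bool" where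
  "anticanonical_section \<phi> n Y m v k c \<longleftrightarrow>
     (\<forall>V f. openin (subtopology (zariski \<phi> n) Y) V \<and> (\<forall>i<m. regular_fun \<phi> n V (f i)) \<longrightarrow>
        regular_fun \<phi> n V (\<lambda>P. c P * det (mat m m (\<lambda>(i, j). v P j (f i))) ^ k))"

text \<open>
  \<open>(\<omega>\<^sub>Y\<^bsup>-1\<^esup>)\<^sup>k\<close> is very ample: finitely many of its global sections have no common zero and define a
  closed embedding of \<open>Y\<close> into a projective space.
\<close>

definition anticanonical_power_very_ample ::
  "('k::field \<Rightarrow> 'l::field) \<Rightarrow> nat \<Rightarrow> 'l ppoint set \<Rightarrow> nat \<Rightarrow> nat \<Rightarrow> bool" where
  "anticanonical_power_very_ample \<phi> n Y m k \<longleftrightarrow>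
     (\<exists>v N c. (\<forall>P\<in>Y. tangent_basis \<phi> n Y m P (v P)) \<and>
        (\<forall>i<N. anticanonical_section \<phi> n Y m v k (c i)) \<and>
        (\<forall>P\<in>Y. \<exists>i<N. c i P \<noteq> 0) \<and>
        closed_embedding \<phi> n Y N (\<lambda>P. proj_pt (\<lambda>i. if i < N then c i P else 0)))"

definition anticanonical_ample ::
  "('k::field \<Rightarrow> 'l::field) \<Rightarrow> nat \<Rightarrow> 'l ppoint set \<Rightarrow> nat \<Rightarrow> bool" where
  "anticanonical_ample \<phi> n Y m \<longleftrightarrow> (\<exists>k\<ge>1. anticanonical_power_very_ample \<phi> n Y m k)"

subsection \<open>Smooth Fano varieties\<close>

definition jacobian_matrix ::
  "('k::field \<Rightarrow> 'l::field) \<Rightarrow> nat \<Rightarrow> 'k mpoly list \<Rightarrow> (nat \<Rightarrow> 'l) \<Rightarrow> 'l mat" where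
  "jacobian_matrix \<phi> n Fs x = mat (length Fs) n (\<lambda>(i, j). meval \<phi> (mpderiv j (Fs ! i)) x)"

text \<open>
  The closed subscheme of \<open>\<bbbP>\<^bsup>n-1\<^esup>\<close> over \<open>k\<close> cut out by the forms \<open>Fs\<close> is an irreducible variety of
  dimension \<open>m\<close>, smooth over \<open>k\<close>, with ample \<open>\<omega>\<^sub>Y\<^bsup>-1\<^esup>\<close>.  Smoothness is that of the scheme cut out by
  \<open>Fs\<close> (Jacobian matrix of rank \<open>n - 1 - m\<close> at all geometric points), which is therefore reduced and
  determined by its geometric points.  \<open>Y\<close> need not be a complete intersection.
\<close>

definition smooth_fano :: "nat \<Rightarrow> 'k::field mpoly list \<Rightarrow> bool" where
  "smooth_fano n Fs \<longleftrightarrow>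
     (let Y = proj_zeros to_ac n (set Fs); T = subtopology (zariski to_ac n) Y in
      irreducible_space T \<and>
      (\<exists>m. scheme_dim T = ereal (real m) \<and>
           (\<forall>P\<in>Y. \<forall>x\<in>P. vec_space.rank (length Fs) (jacobian_matrix to_ac n Fs x) + m + 1 = n) \<and>
           anticanonical_ample to_ac n Y m))"

text \<open>
  \<open>L\<close>-valued points of the open subscheme \<open>U\<close> of \<open>Y = V(Fs)\<close> that is the complement of the common
  zeros of the set \<open>Gs\<close> of forms; every open subscheme of \<open>Y\<close> arises in this way.
\<close>

definition open_points ::
  "('k::field \<Rightarrow> 'l::field) \<Rightarrow> nat \<Rightarrow> 'k mpoly list \<Rightarrow> 'k mpoly set \<Rightarrow> 'l ppoint set" where
  "open_points \<phi> n Fs Gs = proj_zeros \<phi> n (set Fs) - proj_zeros \<phi> n Gs"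

subsection \<open>Rational points of given height\<close>

definition const_fract :: "'k::field \<Rightarrow> 'k poly fract" where
  "const_fract a = Fraction_Field.Fract [:a:] 1"

definition primitive_rep :: "nat \<Rightarrow> 'k::field poly fract ppoint \<Rightarrow> (nat \<Rightarrow> 'k poly) \<Rightarrow> bool" where
  "primitive_rep n P x \<longleftrightarrow>
     (\<lambda>i. if i < n then Fraction_Field.Fract (x i) 1 else 0) \<in> P \<and>
     (\<forall>p. (\<forall>i<n. p dvd x i) \<longrightarrow> is_unit p)"

definition height :: "nat \<Rightarrow> 'k::{finite,field} poly fract ppoint \<Rightarrow> nat" where
  "height n P = (THE h. \<exists>x. primitive_rep n P x \<and>
     h = CARD('k) ^ Max ((\<lambda>i. Polynomial.degree (x i)) ` {..<n}))"

definition N_open :: "nat \<Rightarrow> 'k::{finite,field} mpoly list \<Rightarrow> 'k mpoly set \<Rightarrow> nat \<Rightarrow> nat" where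
  "N_open n Fs Gs e = card {P \<in> open_points const_fract n Fs Gs. height n P = CARD('k) ^ e}"

subsection \<open>The scheme of morphisms\<close>

text \<open>
  A morphism \<open>f\<close> from \<open>\<bbbP>\<^sup>1\<close> to \<open>\<bbbP>\<^bsup>n-1\<^esup>\<close> with \<open>deg f\<^sup>* O(1) = e\<close> is an \<open>n\<close>-tuple of binary forms
  of degree \<open>e\<close> without a common zero on \<open>\<bbbP>\<^sup>1\<close> over the algebraic closure, up to scaling.  The coefficient
  vector \<open>z\<close> of such a tuple is a point of \<open>\<bbbP>\<^bsup>n(e+1)-1\<^esup>\<close>: entry \<open>i (e + 1) + j\<close> is the coefficient of
  \<open>s\<^sup>j t\<^bsup>e-j\<^esup>\<close> in the \<open>i\<close>-th form.
\<close>

definition mor_eval :: "nat \<Rightarrow> nat \<Rightarrow> (nat \<Rightarrow> 'l::field) \<Rightarrow> 'l \<Rightarrow> 'l \<Rightarrow> nat \<Rightarrow> 'l" where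
  "mor_eval n e z s t =
     (\<lambda>i. if i < n then (\<Sum>j\<le>e. z (i * (e + 1) + j) * s ^ j * t ^ (e - j)) else 0)"

text \<open>
  In the following definition \<open>mor_eval n e z s t = 0\<close> would give \<open>proj_pt \<dots> \<notin> proj_space n\<close>, so the
  first condition says both that \<open>f\<close> is a morphism and that its image lies in \<open>Y\<close>.
\<close>

definition Mor_points ::
  "nat \<Rightarrow> 'k::field mpoly list \<Rightarrow> 'k mpoly set \<Rightarrow> nat \<Rightarrow> 'k alg_closure ppoint set" where
  "Mor_points n Fs Gs e = {Q \<in> proj_space (n * (e + 1)). \<forall>z\<in>Q.
     (\<forall>s t. (s, t) \<noteq> (0, 0) \<longrightarrow>
        proj_pt (mor_eval n e z s t) \<in> proj_zeros to_ac n (set Fs)) \<and>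
     (\<exists>s t. (s, t) \<noteq> (0, 0) \<and>
        proj_pt (mor_eval n e z s t) \<in> open_points to_ac n Fs Gs)}"

definition Mor_scheme ::
  "nat \<Rightarrow> 'k::field mpoly list \<Rightarrow> 'k mpoly set \<Rightarrow> nat \<Rightarrow> 'k alg_closure ppoint topology" where
  "Mor_scheme n Fs Gs e = subtopology (zariski to_ac (n * (e + 1))) (Mor_points n Fs Gs e)"

text \<open>\<open>q\<^sup>d\<close> for \<open>q > 1\<close> and a dimension \<open>d\<close>, with \<open>q\<^bsup>-\<infinity>\<^esup> = 0\<close>.\<close>

definition ext_power :: "real \<Rightarrow> ereal \<Rightarrow> ereal" where
  "ext_power q d = (case d of ereal r \<Rightarrow> ereal (q powr r) | PInfty \<Rightarrow> \<infinity> | MInfty \<Rightarrow> 0)"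

end

theory Submission
  imports Defs
begin

text \<open>
  A rational point of height \<open>q\<^sup>e\<close> is given by \<open>N = n (e + 1)\<close> coefficients in \<open>\<bbbF>\<^sub>q\<close>, and these satisfy
  \<open>d\<^sub>i e + 1\<close> equations of degree \<open>d\<^sub>i\<close> for each \<open>i\<close>, namely the equations of the affine cone over the
  scheme of morphisms.  Let \<open>D\<close> be the largest local dimension of the cone at such points.

  Upper bound: at a zero \<open>z\<close> the initial forms (for the filtration by powers of the maximal ideal) of
  a presentation with variables for the coordinates and for the equations define a cone of dimension
  at least \<open>N\<close> in which at most \<open>D\<close> linear forms in the coordinates are independent.  So a generic
  choice of at most \<open>D\<close> combinations of the polynomials \<open>x\<^sub>j\<^sup>q - x\<^sub>j\<close> and of further combinations of the
  equations, ordered by decreasing degree, gives \<open>N\<close> polynomials \<open>\<theta>\<^sub>l\<close> that are independent at every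
  \<open>z\<close> of one stratum.  Polynomials that interpolate the points are then independent over the algebra
  generated by the \<open>\<theta>\<^sub>l\<close>, and comparing Hilbert functions as in Bezout's theorem bounds the number of
  points by \<open>\<Prod> deg \<theta>\<^sub>l \<le> q\<^sup>D \<Prod> d\<^sub>i\<^bsup>d\<^sub>i e + 1\<^esup>\<close>.

  Lower bound for the dimension: growth of a local Hilbert function beyond degree \<open>D - 1\<close> produces a
  chain of \<open>D\<close> homogeneous primes through \<open>z\<close>.  Near \<open>z\<close> the scheme of morphisms is an open
  part of the projective zero locus, so its dimension is at least \<open>D - 1\<close>.
\<close>

text \<open>Nothing guarantees that the cone over the scheme of morphisms is a complete
  intersection: the number of equations may exceed its codimension, and its local dimension may vary
  from point to point. Intersection multiplicities are therefore avoided; algebraic independence of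
  initial forms at every counted point takes their place. The extra variables for the equations keep
  the dimension of the ring of initial forms from dropping below \<open>N\<close>. Giving their
  degree precedence makes the part of degree 0 in them the tangent cone of the zero locus, whose
  dimension limits the number of independent coordinate forms. Each such form costs a factor q: the
  polynomial attached to a coordinate vanishes at all rational points and looks the same near each
  of them, so one choice serves all points. Generic choices need an infinite field, hence the
  passage to the algebraic closure. Since one choice also needs one number of coordinate forms, the
  points are sorted by this number; the resulting geometric series gives the factor 2. Dimension is
  used throughout as the growth exponent of a Hilbert function.\<close>

abbreviation lkp where "lkp \<equiv> Poly_Mapping.lookup"
abbreviation kys where "kys \<equiv> Poly_Mapping.keys"
abbreviation sgl where "sgl \<equiv> Poly_Mapping.single"

subsection \<open>Evaluation homomorphisms\<close>

text \<open>A plain predicate, so that the same lemmas on evaluation serve coefficient maps,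
  substitutions, translations and evaluation of univariate polynomials.\<close>

definition rhom :: "('r::comm_ring_1 \<Rightarrow> 's::comm_ring_1) \<Rightarrow> bool" where
  "rhom h \<longleftrightarrow> h 0 = 0 \<and> h 1 = 1 \<and> (\<forall>a b. h (a + b) = h a + h b) \<and> (\<forall>a b. h (a * b) = h a * h b)"

lemma rhomD:
  assumes "rhom h"
  shows "h 0 = 0" "h 1 = 1" "h (a + b) = h a + h b" "h (a * b) = h a * h b"
  using assms by (auto simp: rhom_def)

lemma rhom_uminus: "rhom h \<Longrightarrow> h (- a) = - h a"
  by (metis rhomD(1,3) add.right_inverse add_eq_0_iff)

lemma rhom_minus: "rhom h \<Longrightarrow> h (a - b) = h a - h b"
  using rhom_uminus[of h b] rhomD(3)[of h a "-b"] by simp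

lemma rhom_sum: "rhom h \<Longrightarrow> h (sum f A) = (\<Sum>a\<in>A. h (f a))"
  by (induction A rule: infinite_finite_induct) (auto simp: rhomD)

lemma rhom_prod: "rhom h \<Longrightarrow> h (prod f A) = (\<Prod>a\<in>A. h (f a))"
  by (induction A rule: infinite_finite_induct) (auto simp: rhomD)

lemma rhom_power: "rhom h \<Longrightarrow> h (a ^ n) = h a ^ n"
  by (induction n) (auto simp: rhomD)

lemma rhom_id: "rhom (\<lambda>x. x)" and rhom_to_ac: "rhom to_ac"
  and rhom_comp: "rhom h \<Longrightarrow> rhom g \<Longrightarrow> rhom (\<lambda>x. h (g x))"
  by (auto simp: rhom_def)

definition Cst :: "'k::comm_ring_1 \<Rightarrow> 'k mpoly" where "Cst c = sgl 0 c"
definition Vr :: "nat \<Rightarrow> 'k::comm_ring_1 mpoly" where "Vr i = sgl (sgl i 1) 1"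

lemma rhom_Cst: "rhom Cst"
  by (auto simp: rhom_def Cst_def single_add mult_single)

lemma meval_rhom:
  assumes "rhom \<phi>"
  shows "rhom (\<lambda>F. meval \<phi> F x)"
  using assms
  by (simp add: rhom_def meval_add[of \<phi>] meval_mult[of \<phi>])
    (auto simp: meval_def meval_single simp flip: single_one)

lemmas meval_hom = meval_rhom[THEN rhomD(1)] meval_rhom[THEN rhomD(2)]
  meval_rhom[THEN rhomD(3)] meval_rhom[THEN rhomD(4)]
  meval_rhom[THEN rhom_uminus] meval_rhom[THEN rhom_minus]
  meval_rhom[THEN rhom_sum] meval_rhom[THEN rhom_prod] meval_rhom[THEN rhom_power]

lemma meval_Vr: "rhom \<phi> \<Longrightarrow> meval \<phi> (Vr i) x = x i"
  by (simp add: Vr_def meval_single rhomD)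

lemma meval_Cst: "rhom \<phi> \<Longrightarrow> meval \<phi> (Cst c) x = \<phi> c"
  by (simp add: Cst_def meval_single rhomD)

lemma rhom_meval: "rhom h \<Longrightarrow> h (meval \<phi> F x) = meval (\<lambda>c. h (\<phi> c)) F (\<lambda>i. h (x i))"
  unfolding meval_def by (simp add: rhom_sum rhom_prod rhom_power rhomD)

lemma meval_meval: "rhom \<phi>' \<Longrightarrow> meval \<phi>' (meval \<phi> F v) x
    = meval (\<lambda>c. meval \<phi>' (\<phi> c) x) F (\<lambda>i. meval \<phi>' (v i) x)"
  using rhom_meval[OF meval_rhom, of \<phi>'] by simp

abbreviation psub :: "(nat \<Rightarrow> 'k::comm_ring_1 mpoly) \<Rightarrow> 'k mpoly \<Rightarrow> 'k mpoly" where
  "psub w F \<equiv> meval Cst F w"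

lemmas rhom_psub = meval_rhom[OF rhom_Cst]
lemmas psub_hom = meval_hom[OF rhom_Cst]

lemma meval_psub: "rhom \<phi> \<Longrightarrow> meval \<phi> (psub v F) x = meval \<phi> F (\<lambda>i. meval \<phi> (v i) x)"
  by (simp add: meval_meval meval_Cst)

lemma psub_psub: "psub w (psub v F) = psub (\<lambda>i. psub w (v i)) F"
  by (simp add: meval_psub rhom_Cst)

lemma psub_Vr [simp]: "psub w (Vr i) = w i" and psub_Cst [simp]: "psub w (Cst c) = Cst c"
  by (simp_all add: meval_Vr meval_Cst rhom_Cst)

lemma mpoly_induct [case_names single add]:
  assumes "\<And>m c. P (sgl m c)" "\<And>F G. P F \<Longrightarrow> P G \<Longrightarrow> P (F + G)"
  shows "P (F :: 'k::comm_ring_1 mpoly)"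
proof -
  have "finite A \<Longrightarrow> P (\<Sum>m\<in>A. sgl m (c m))" for A :: "(nat \<Rightarrow>\<^sub>0 nat) set" and c :: "_ \<Rightarrow> 'k"
    by (induction A rule: finite_induct) (use assms(1)[of 0 0] assms in auto)
  then show ?thesis by (subst mpoly_sum_single) simp
qed

lemma Vr_power: "Vr i ^ n = sgl (sgl i n) (1::'k::comm_ring_1)"
  by (induction n) (auto simp: Vr_def mult_single simp flip: single_add)

lemma prod_sgl: "(\<Prod>i\<in>A. sgl (f i) (1::'k::comm_ring_1)) = sgl (\<Sum>i\<in>A. f i) (1::'k)"
  for f :: "nat \<Rightarrow> (nat \<Rightarrow>\<^sub>0 nat)"
  by (induction A rule: infinite_finite_induct) (auto simp: mult_single)

lemma exponent_sum: "(\<Sum>i\<in>kys m. sgl i (lkp m i)) = (m :: nat \<Rightarrow>\<^sub>0 nat)"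
proof (rule poly_mapping_eqI)
  fix l
  have "(\<Sum>i\<in>kys m. lkp (sgl i (lkp m i)) l) = (\<Sum>i\<in>kys m. if l = i then lkp m l else 0)"
    by (rule sum.cong) (auto simp: lookup_single when_def)
  then show "lkp (\<Sum>i\<in>kys m. sgl i (lkp m i)) l = lkp m l"
    by (simp add: lookup_sum in_keys_iff)
qed

lemma sgl_eq: "sgl m c = Cst c * (\<Prod>i\<in>kys m. Vr i ^ lkp m i)"
  by (simp add: Vr_power prod_sgl exponent_sum Cst_def mult_single)

lemma psub_id [simp]: "psub Vr F = F"
proof (induction F rule: mpoly_induct)
  case (single m c)
  show ?case by (simp add: meval_single rhomD(1)[OF rhom_Cst] flip: sgl_eq)
qed (simp add: psub_hom)

lemma meval_cong_keys:
  assumes "\<And>m i. m \<in> kys F \<Longrightarrow> i \<in> kys m \<Longrightarrow> x i = y i"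
  shows "meval \<phi> F x = meval \<phi> F y"
  unfolding meval_def using assms by (intro sum.cong prod.cong arg_cong2[where f="(*)"] arg_cong2[where f="(^)"]) auto

subsection \<open>Polynomials with prescribed monomials\<close>

text \<open>Nearly all families of polynomials below are cut out by conditions on exponents: few
  variables, degree at most or at least d, a given bidegree. One calculus of exponent sets handles
  closure under sums and products for all of them.\<close>

definition kset :: "(nat \<Rightarrow>\<^sub>0 nat) set \<Rightarrow> 'k::comm_ring_1 mpoly set" where
  "kset A = {F. kys F \<subseteq> A}"

lemma kset_0 [simp]: "0 \<in> kset A"
  and kset_single: "m \<in> A \<Longrightarrow> sgl m c \<in> kset A"
  and kset_uminus: "F \<in> kset A \<Longrightarrow> - F \<in> kset A"
  and kset_UNIV [simp]: "F \<in> kset UNIV"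
  and kset_mono: "A \<subseteq> B \<Longrightarrow> F \<in> kset A \<Longrightarrow> F \<in> kset B"
  by (auto simp: kset_def)

lemma kset_add: "F \<in> kset A \<Longrightarrow> G \<in> kset A \<Longrightarrow> F + G \<in> kset A"
  using Poly_Mapping.keys_add[of F G] by (auto simp: kset_def)

lemma kset_minus: "F \<in> kset A \<Longrightarrow> G \<in> kset A \<Longrightarrow> F - G \<in> kset A"
  using kset_add[of F A "-G"] kset_uminus[of G A] by simp

lemma kset_sum: "(\<And>i. i \<in> I \<Longrightarrow> f i \<in> kset A) \<Longrightarrow> sum f I \<in> kset A"
  by (induction I rule: infinite_finite_induct) (auto intro: kset_add)

lemma kset_mult:
  assumes "F \<in> kset A" "G \<in> kset B" "\<And>a b. a \<in> A \<Longrightarrow> b \<in> B \<Longrightarrow> a + b \<in> D"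
  shows "F * G \<in> kset D"
  using assms keys_mult[of F G] by (fastforce simp: kset_def)

lemma kset_Cst_mult: "F \<in> kset A \<Longrightarrow> Cst c * F \<in> kset A"
  by (rule kset_mult[of _ "{0}" _ A]) (auto simp: kset_def Cst_def)

lemma kset_induct [consumes 1, case_names zero single add]:
  assumes "F \<in> kset A" "P 0" "\<And>m c. m \<in> A \<Longrightarrow> P (sgl m c)"
    "\<And>F G. F \<in> kset A \<Longrightarrow> G \<in> kset A \<Longrightarrow> P F \<Longrightarrow> P G \<Longrightarrow> P (F + G)"
  shows "P F"
proof -
  have "finite B \<Longrightarrow> B \<subseteq> A \<Longrightarrow> P (\<Sum>m\<in>B. sgl m (lkp F m)) \<and> (\<Sum>m\<in>B. sgl m (lkp F m)) \<in> kset A" for B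
  proof (induction B rule: finite_induct)
    case (insert m B)
    then show ?case using assms(3)[of m "lkp F m"] assms(4) kset_single[of m A]
      by (auto intro!: assms(4) kset_add)
  qed (use assms(2) in auto)
  then show ?thesis using assms(1) by (subst mpoly_sum_single) (auto simp: kset_def)
qed

definition prt :: "(nat \<Rightarrow>\<^sub>0 nat) set \<Rightarrow> 'k::comm_ring_1 mpoly \<Rightarrow> 'k mpoly" where
  "prt A F = (\<Sum>m\<in>kys F \<inter> A. sgl m (lkp F m))"

lemma lkp_prt: "lkp (prt A F) m = (if m \<in> A then lkp F m else 0)"
proof -
  have "(\<Sum>l\<in>kys F \<inter> A. lkp (sgl l (lkp F l)) m) = (\<Sum>l\<in>kys F \<inter> A. if m = l then lkp F m else 0)"
    by (rule sum.cong) (auto simp: lookup_single when_def)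
  then show ?thesis by (auto simp: prt_def lookup_sum in_keys_iff)
qed

lemma kys_prt: "kys (prt A F) = kys F \<inter> A"
  by (auto simp: in_keys_iff lkp_prt split: if_splits)

lemma prt_kset [simp]: "prt A F \<in> kset A"
  by (simp add: kset_def kys_prt)

lemma prt_add: "prt A (F + G) = prt A F + prt A G"
  by (rule poly_mapping_eqI) (simp add: lkp_prt lookup_add)

lemma prt_0 [simp]: "prt A 0 = 0"
  by (rule poly_mapping_eqI) (simp add: lkp_prt)

lemma prt_single: "prt A (sgl m c) = (if m \<in> A then sgl m c else 0)"
  by (rule poly_mapping_eqI) (auto simp: lkp_prt lookup_single when_def)

lemma prt_same: "F \<in> kset A \<Longrightarrow> prt A F = F"
  by (rule poly_mapping_eqI) (auto simp: lkp_prt kset_def in_keys_iff)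

lemma prt_disjoint: "F \<in> kset B \<Longrightarrow> A \<inter> B = {} \<Longrightarrow> prt A F = 0"
  by (rule poly_mapping_eqI) (auto simp: lkp_prt kset_def in_keys_iff)

lemma prt_compl: "F = prt A F + prt (- A) F"
  by (rule poly_mapping_eqI) (auto simp: lkp_prt lookup_add)

lemma prt_eq_diff: "prt A F = F - prt (- A) F"
  by (rule poly_mapping_eqI) (auto simp: lkp_prt lookup_minus)

lemma prt_prt: "prt A (prt B F) = prt (A \<inter> B) F"
  by (rule poly_mapping_eqI) (auto simp: lkp_prt)

lemma prt_subset: "F \<in> kset B \<Longrightarrow> prt A F \<in> kset B"
  by (auto simp: kset_def kys_prt)

lemma lkp_Cst_mult: "lkp (Cst c * F) m = c * lkp F m"
  unfolding Cst_def mult_map_scale_conv_mult[symmetric] by (simp add: Poly_Mapping.map.rep_eq when_def)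

lemma prt_Cst_mult: "prt A (Cst c * F) = Cst c * prt A F"
  by (rule poly_mapping_eqI) (simp add: lkp_Cst_mult lkp_prt)

lemma lkp_sgl_mult: "lkp (sgl \<mu> c * F) (\<mu> + x) = c * lkp F x" for F :: "'k::comm_ring_1 mpoly"
  by (induction F rule: mpoly_induct)
    (auto simp: mult_single lookup_single when_def lookup_add distrib_left)

section \<open>Degrees and weighted degrees of monomials\<close>

definition wdg :: "(nat \<Rightarrow> nat) \<Rightarrow> (nat \<Rightarrow>\<^sub>0 nat) \<Rightarrow> nat" where
  "wdg w m = (\<Sum>i\<in>kys m. w i * lkp m i)"

definition mdeg :: "(nat \<Rightarrow>\<^sub>0 nat) \<Rightarrow> nat" where "mdeg m = (\<Sum>i\<in>kys m. lkp m i)"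

lemma wdg_superset: "finite A \<Longrightarrow> kys m \<subseteq> A \<Longrightarrow> wdg w m = (\<Sum>i\<in>A. w i * lkp m i)"
  unfolding wdg_def by (rule sum.mono_neutral_left) (auto simp: in_keys_iff)

lemma wdg_add: "wdg w (m + m') = wdg w m + wdg w m'"
proof -
  let ?A = "kys m \<union> kys m'"
  have "kys (m + m') \<subseteq> ?A" by (rule Poly_Mapping.keys_add)
  then show ?thesis
    by (simp add: wdg_superset[of ?A] lookup_add distrib_left sum.distrib)
qed

lemma wdg_0 [simp]: "wdg w 0 = 0" and wdg_sgl [simp]: "wdg w (sgl i n) = w i * n"
  by (auto simp: wdg_def)

lemma mdeg_wdg: "mdeg m = wdg (\<lambda>_. 1) m"
  by (simp add: mdeg_def wdg_def)

lemma mdeg_add: "mdeg (m + m') = mdeg m + mdeg m'"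
  and mdeg_0 [simp]: "mdeg 0 = 0" and mdeg_sgl [simp]: "mdeg (sgl i n) = n"
  by (simp_all add: mdeg_wdg wdg_add)

abbreviation vset :: "nat \<Rightarrow> (nat \<Rightarrow>\<^sub>0 nat) set" where "vset n \<equiv> {m. kys m \<subseteq> {..<n}}"
abbreviation PV :: "nat \<Rightarrow> 'k::comm_ring_1 mpoly set" where "PV n \<equiv> kset (vset n)"
abbreviation dle :: "nat \<Rightarrow> 'k::comm_ring_1 mpoly set" where "dle d \<equiv> kset {m. mdeg m \<le> d}"
abbreviation dge :: "nat \<Rightarrow> 'k::comm_ring_1 mpoly set" where "dge d \<equiv> kset {m. d \<le> mdeg m}"

lemma forms_eq: "forms n d = kset {m. kys m \<subseteq> {..<n} \<and> mdeg m = d}"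
  by (auto simp: forms_def kset_def mdeg_def)

lemma vset_add: "m \<in> vset n \<Longrightarrow> m' \<in> vset n \<Longrightarrow> m + m' \<in> vset n"
  using Poly_Mapping.keys_add[of m m'] by auto

lemma Cst_kset: "0 \<in> A \<Longrightarrow> Cst c \<in> kset A" and Vr_kset: "sgl i 1 \<in> A \<Longrightarrow> Vr i \<in> kset A"
  and one_kset: "0 \<in> A \<Longrightarrow> 1 \<in> kset A"
  by (auto simp: Cst_def Vr_def kset_def)

lemma PV_mult: "F \<in> PV n \<Longrightarrow> G \<in> PV n \<Longrightarrow> F * G \<in> PV n"
  by (rule kset_mult[of _ "vset n" _ "vset n"]) (use vset_add in auto)

lemma PV_Cst [simp]: "Cst c \<in> PV n" and PV_Vr: "i < n \<Longrightarrow> Vr i \<in> PV n" and PV_1 [simp]: "1 \<in> PV n"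
  by (auto intro!: Cst_kset Vr_kset one_kset)

lemma PV_power: "F \<in> PV n \<Longrightarrow> F ^ k \<in> PV n"
  by (induction k) (auto intro: PV_mult)

lemma PV_prod: "(\<And>i. i \<in> I \<Longrightarrow> f i \<in> PV n) \<Longrightarrow> prod f I \<in> PV n"
  by (induction I rule: infinite_finite_induct) (auto intro: PV_mult)

lemma dle_mult: "F \<in> dle a \<Longrightarrow> G \<in> dle b \<Longrightarrow> F * G \<in> dle (a + b)"
  by (rule kset_mult) (auto simp: mdeg_add)

lemma dge_mult: "F \<in> dge a \<Longrightarrow> G \<in> dge b \<Longrightarrow> F * G \<in> dge (a + b)"
  by (rule kset_mult) (auto simp: mdeg_add)

lemma dle_power: "F \<in> dle a \<Longrightarrow> F ^ k \<in> dle (a * k)"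
  by (induction k) (auto intro: dle_mult one_kset)

lemma dge_power: "F \<in> dge a \<Longrightarrow> F ^ k \<in> dge (a * k)"
  by (induction k) (auto intro: dge_mult one_kset)

lemma kset_psub:
  assumes "F \<in> kset A" "\<And>m. m \<in> A \<Longrightarrow> (\<Prod>i\<in>kys m. w i ^ lkp m i) \<in> kset B"
  shows "psub w F \<in> kset B"
  using assms(1)
proof (induction rule: kset_induct)
  case (single m c)
  then show ?case using assms(2)[of m] by (simp add: meval_single rhomD(1)[OF rhom_Cst] kset_Cst_mult)
qed (auto simp: psub_hom kset_add)

lemma PV_psub: "F \<in> PV n \<Longrightarrow> (\<And>i. i < n \<Longrightarrow> w i \<in> PV k) \<Longrightarrow> psub w F \<in> PV k"
  by (rule kset_psub) (auto intro!: PV_prod PV_power)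

lemma dle_prod_wdg:
  assumes "\<And>i. i \<in> kys m \<Longrightarrow> w i \<in> dle (\<delta> i)"
  shows "(\<Prod>i\<in>kys m. w i ^ lkp m i) \<in> dle (wdg \<delta> m)"
proof -
  have "(\<Prod>i\<in>A. w i ^ lkp m i) \<in> dle (\<Sum>i\<in>A. \<delta> i * lkp m i)" if "A \<subseteq> kys m" for A
    using finite_subset[OF that finite_keys] that
    by (induction A rule: finite_induct) (auto intro!: dle_mult dle_power assms one_kset)
  then show ?thesis by (simp add: wdg_def)
qed

lemma dge_prod_wdg:
  assumes "\<And>i. i \<in> kys m \<Longrightarrow> w i \<in> dge (\<delta> i)"
  shows "(\<Prod>i\<in>kys m. w i ^ lkp m i) \<in> dge (wdg \<delta> m)"
proof -
  have "(\<Prod>i\<in>A. w i ^ lkp m i) \<in> dge (\<Sum>i\<in>A. \<delta> i * lkp m i)" if "A \<subseteq> kys m" for A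
    using finite_subset[OF that finite_keys] that
    by (induction A rule: finite_induct) (auto intro!: dge_mult dge_power assms one_kset)
  then show ?thesis by (simp add: wdg_def)
qed

lemma finite_bounded_exponents: "finite {m :: nat \<Rightarrow>\<^sub>0 nat. kys m \<subseteq> {..<n} \<and> (\<forall>i. lkp m i \<le> s)}"
proof (rule finite_subset)
  show "{m. kys m \<subseteq> {..<n} \<and> (\<forall>i. lkp m i \<le> s)} \<subseteq>
    (\<lambda>f. Abs_poly_mapping (\<lambda>i. if i < n then f i else 0)) ` ({..<n} \<rightarrow>\<^sub>E {..s})"
  proof
    fix m :: "nat \<Rightarrow>\<^sub>0 nat" assume m: "m \<in> {m. kys m \<subseteq> {..<n} \<and> (\<forall>i. lkp m i \<le> s)}"
    have "m = Abs_poly_mapping (\<lambda>i. if i < n then restrict (lkp m) {..<n} i else 0)"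
    proof (rule poly_mapping_eqI)
      fix i show "lkp m i = lkp (Abs_poly_mapping (\<lambda>i. if i < n then restrict (lkp m) {..<n} i else 0)) i"
        using m by (subst lookup_Abs_poly_mapping) (auto simp: in_keys_iff)
    qed
    then show "m \<in> (\<lambda>f. Abs_poly_mapping (\<lambda>i. if i < n then f i else 0)) ` ({..<n} \<rightarrow>\<^sub>E {..s})"
      using m by (intro image_eqI[of _ _ "restrict (lkp m) {..<n}"]) auto
  qed
qed (auto intro!: finite_imageI finite_PiE)

lemma lkp_le_mdeg: "lkp m i \<le> mdeg m"
proof (cases "i \<in> kys m")
  case True
  then show ?thesis using member_le_sum[of i "kys m" "lkp m"] by (simp add: mdeg_def)
qed (simp add: in_keys_iff)

lemma finite_vset_le: "finite {m \<in> vset n. mdeg m \<le> s}"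
  by (rule finite_subset[OF _ finite_bounded_exponents[of n s]])
    (use lkp_le_mdeg order_trans in blast)

subsection \<open>Codimension\<close>

text \<open>Two module structures on one ring: \<open>mp\<close> is linear algebra over the field
  and serves to count dimensions; \<open>rm\<close> below is the ring as a module over itself, so
  that its subspaces are the ideals.\<close>

interpretation mp: vector_space "\<lambda>(c::'k::field) (F::'k mpoly). Cst c * F"
  by unfold_locales (auto simp: algebra_simps rhomD[OF rhom_Cst])

declare mp.scale_scale [simp del]

lemma Cst_0: "Cst 0 = 0" and Cst_1: "Cst 1 = 1" and Cst_add: "Cst (a + b) = Cst a + Cst b"
  and Cst_mult: "Cst (a * b) = Cst a * Cst b" and Cst_uminus: "Cst (- a) = - Cst a"
  by (simp_all add: rhomD[OF rhom_Cst] rhom_uminus[OF rhom_Cst])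

lemma Cst_inverse: "c \<noteq> 0 \<Longrightarrow> Cst (inverse c) * (Cst c * F) = F" for c :: "'k::field"
  by (metis Cst_1 Cst_mult left_inverse mult.assoc mult_1)

interpretation rm: Modules.module "(*) :: 'r::comm_ring_1 \<Rightarrow> 'r \<Rightarrow> 'r"
  by unfold_locales (auto simp: algebra_simps)

text \<open>As a simplification rule this clashes with associativity of multiplication.\<close>

declare rm.scale_scale [simp del]

lemma ideal_subspace: "rm.subspace I \<Longrightarrow> mp.subspace I"
  by (auto simp: rm.subspace_def mp.subspace_def)

lemma kset_subspace: "mp.subspace (kset A)"
  by (auto simp: mp.subspace_def kset_add kset_Cst_mult)

text \<open>Linear independence of the images in the quotient by \<open>V\<close>. The family is
  indexed, so that equal values at different indices count as dependent.\<close>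

definition indm :: "'k::field mpoly set \<Rightarrow> 'i set \<Rightarrow> ('i \<Rightarrow> 'k mpoly) \<Rightarrow> bool" where
  "indm V I f \<longleftrightarrow> (\<forall>c. (\<Sum>i\<in>I. Cst (c i) * f i) \<in> V \<longrightarrow> (\<forall>i\<in>I. c i = 0))"

lemma indmD: "indm V I f \<Longrightarrow> (\<Sum>i\<in>I. Cst (c i) * f i) \<in> V \<Longrightarrow> i \<in> I \<Longrightarrow> c i = 0"
  by (auto simp: indm_def)

text \<open>Steinitz exchange in the quotient by \<open>V\<close>, without forming the quotient. The
  space \<open>V\<close> may have infinite dimension, but writing each \<open>f i\<close> as an
  element of the span of \<open>B\<close> plus a correction in \<open>V\<close> uses finitely many
  corrections; a basis \<open>C\<close> of these is added on both sides and cancels from the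
  count.\<close>

lemma indm_card_le:
  fixes f :: "'i \<Rightarrow> 'k::field mpoly"
  assumes V: "mp.subspace V" and I: "finite I" and B: "finite B"
    and ind: "indm V I f" and sp: "\<And>i. i \<in> I \<Longrightarrow> f i \<in> mp.span (B \<union> V)"
  shows "card I \<le> card B"
proof -
  have inj: "inj_on f I"
  proof (rule inj_onI, rule ccontr)
    fix i j assume ij: "i \<in> I" "j \<in> I" "f i = f j" "i \<noteq> j"
    let ?c = "\<lambda>l. if l = i then 1 else if l = j then - 1 else (0::'k)"
    have "(\<Sum>l\<in>I. Cst (?c l) * f l) = (\<Sum>l\<in>{i, j}. Cst (?c l) * f l)"
      by (rule sum.mono_neutral_right) (use I ij in \<open>auto simp: rhomD[OF rhom_Cst]\<close>)
    also have "\<dots> = 0"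
      using ij rhom_uminus[OF rhom_Cst, of "1::'k"] by (simp add: rhomD[OF rhom_Cst])
    finally have "(\<Sum>l\<in>I. Cst (?c l) * f l) \<in> V" using mp.subspace_0[OF V] by simp
    then have "?c i = 0" using ij(1) by (rule indmD[OF ind, of ?c i])
    then show False by simp
  qed
  have ind': "u a = 0" if "(\<Sum>a\<in>f ` I. Cst (u a) * a) \<in> V" and a: "a \<in> f ` I" for u a
  proof -
    have "(\<Sum>i\<in>I. Cst (u (f i)) * f i) \<in> V" using that(1) by (simp add: sum.reindex[OF inj])
    moreover obtain i where "i \<in> I" "a = f i" using a by blast
    ultimately show ?thesis using indmD[OF ind, of "\<lambda>i. u (f i)" i] by simp
  qed
  have "\<forall>a\<in>f ` I. \<exists>b. b \<in> mp.span B \<and> a - b \<in> V"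
  proof
    fix a assume "a \<in> f ` I"
    then have "a \<in> mp.span (B \<union> V)" using sp by auto
    moreover have "mp.span V = V" using V by (simp add: mp.span_eq_iff)
    ultimately obtain x y where "a = x + y" "x \<in> mp.span B" "y \<in> V" unfolding mp.span_Un by auto
    then show "\<exists>b. b \<in> mp.span B \<and> a - b \<in> V" by (intro exI[of _ x]) simp
  qed
  from bchoice[OF this] obtain b where b: "\<forall>a\<in>f ` I. b a \<in> mp.span B \<and> a - b a \<in> V" ..
  define v where "v a = a - b a" for a
  have bv: "b a \<in> mp.span B \<and> v a \<in> V \<and> a = b a + v a" if "a \<in> f ` I" for a
    using bspec[OF b that] by (simp add: v_def)
  obtain C where C: "C \<subseteq> v ` f ` I" "mp.independent C" "v ` f ` I \<subseteq> mp.span C"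
    using mp.maximal_independent_subset[of "v ` f ` I"] by metis
  have finC: "finite C" using C(1) I finite_subset by blast
  have CV: "C \<subseteq> V" using C(1) bv by auto
  have disj: "f ` I \<inter> C = {}"
  proof (rule ccontr)
    assume "f ` I \<inter> C \<noteq> {}"
    then obtain a where a: "a \<in> f ` I" "a \<in> V" using CV by auto
    have "(\<Sum>x\<in>f ` I. Cst (if x = a then 1 else 0) * x) = (\<Sum>x\<in>f ` I. if x = a then a else 0)"
      by (rule sum.cong) (auto simp: rhomD[OF rhom_Cst])
    also have "\<dots> \<in> V" using a I by (simp add: mp.subspace_0[OF V])
    finally have "(if a = a then 1 else (0::'k)) = 0"
      by (rule ind'[of "\<lambda>x. if x = a then 1 else 0"]) (rule a)
    then show False by simp
  qed
  have "mp.independent (f ` I \<union> C)"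
  proof
    assume "mp.dependent (f ` I \<union> C)"
    then obtain u x where u: "x \<in> f ` I \<union> C" "u x \<noteq> 0" "(\<Sum>x\<in>f ` I \<union> C. Cst (u x) * x) = 0"
      using I finC by (subst (asm) mp.dependent_finite) auto
    have e: "(\<Sum>x\<in>f ` I. Cst (u x) * x) + (\<Sum>x\<in>C. Cst (u x) * x) = 0"
      using u(3) I finC disj by (simp add: sum.union_disjoint)
    have "(\<Sum>x\<in>C. Cst (u x) * x) \<in> V"
      by (rule mp.subspace_sum[OF V], rule mp.subspace_scale[OF V]) (use CV in auto)
    then have "- (\<Sum>x\<in>C. Cst (u x) * x) \<in> V" by (rule mp.subspace_neg[OF V])
    moreover have "(\<Sum>x\<in>f ` I. Cst (u x) * x) = - (\<Sum>x\<in>C. Cst (u x) * x)"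
      using e by (simp add: eq_neg_iff_add_eq_0)
    ultimately have 1: "(\<Sum>x\<in>f ` I. Cst (u x) * x) \<in> V" by simp
    have 0: "\<forall>a\<in>f ` I. u a = 0" using ind'[OF 1] by blast
    have "(\<Sum>x\<in>f ` I. Cst (u x) * x) = 0"
      by (rule sum.neutral) (use 0 in \<open>simp add: Cst_0\<close>)
    then have "(\<Sum>x\<in>C. Cst (u x) * x) = 0" using e by simp
    then have "\<forall>a\<in>C. u a = 0" using C(2) finC by (subst (asm) mp.dependent_finite) auto
    then show False using 0 u by auto
  qed
  moreover have "f ` I \<union> C \<subseteq> mp.span (B \<union> C)"
  proof -
    have "a \<in> mp.span (B \<union> C)" if "a \<in> f ` I" for a
    proof -
      have "b a \<in> mp.span (B \<union> C)" "v a \<in> mp.span (B \<union> C)"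
        using bv[OF that] C(3) that mp.span_mono[of B "B \<union> C"] mp.span_mono[of C "B \<union> C"] by blast+
      then have "b a + v a \<in> mp.span (B \<union> C)" by (rule mp.span_add)
      then show ?thesis using bv[OF that] by simp
    qed
    then show ?thesis using mp.span_superset[of "B \<union> C"] by blast
  qed
  ultimately have "card (f ` I \<union> C) \<le> card (B \<union> C)"
    using mp.independent_span_bound[of "B \<union> C"] B finC by auto
  also have "\<dots> \<le> card B + card C" by (rule card_Un_le)
  finally show ?thesis using I finC disj by (simp add: card_Un_disjoint card_image[OF inj])
qed

lemma indm_insertI:
  assumes V: "mp.subspace V" and "finite M" "m \<notin> M" "indm V M (\<lambda>x. x)" "m \<notin> mp.span (M \<union> V)"
  shows "indm V (insert m M) (\<lambda>x. x)"
  unfolding indm_def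
proof (intro allI impI)
  fix c assume "(\<Sum>i\<in>insert m M. Cst (c i) * i) \<in> V"
  then have c: "Cst (c m) * m + (\<Sum>i\<in>M. Cst (c i) * i) \<in> V" using assms by simp
  have sp: "(\<Sum>i\<in>M. Cst (c i) * i) \<in> mp.span (M \<union> V)"
    by (rule mp.span_sum, rule mp.span_scale, rule mp.span_base) auto
  have "c m = 0"
  proof (rule ccontr)
    assume n: "c m \<noteq> 0"
    have "Cst (c m) * m \<in> mp.span (M \<union> V)"
      using mp.span_diff[OF mp.span_base[of _ "M \<union> V", OF UnI2[OF c]] sp] by simp
    then have "Cst (inverse (c m)) * (Cst (c m) * m) \<in> mp.span (M \<union> V)" by (rule mp.span_scale)
    moreover have "Cst (inverse (c m)) * (Cst (c m) * m) = m"
      using n by (rule Cst_inverse)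
    ultimately show False using assms(5) by metis
  qed
  moreover from this have "(\<Sum>i\<in>M. Cst (c i) * i) \<in> V" using c by (simp add: Cst_0)
  ultimately show "\<forall>i\<in>insert m M. c i = 0" using indmD[OF assms(4), of c] by blast
qed

lemma indm_spanning_subset:
  assumes V: "mp.subspace V" and "finite M"
  shows "\<exists>M0 \<subseteq> M. indm V M0 (\<lambda>x. x) \<and> M \<subseteq> mp.span (M0 \<union> V)"
  using assms(2)
proof (induction M rule: finite_induct)
  case empty
  then show ?case by (simp add: indm_def)
next
  case (insert m M)
  then obtain M0 where M0: "M0 \<subseteq> M" "indm V M0 (\<lambda>x. x)" "M \<subseteq> mp.span (M0 \<union> V)" by blast
  show ?case
  proof (cases "m \<in> mp.span (M0 \<union> V)")
    case True
    then show ?thesis using M0 by (intro exI[of _ M0]) auto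
  next
    case False
    have "finite M0" "m \<notin> M0" using M0 insert finite_subset by blast+
    then have "indm V (insert m M0) (\<lambda>x. x)" using indm_insertI[OF V _ _ M0(2) False] by blast
    moreover have "insert m M \<subseteq> mp.span (insert m M0 \<union> V)"
      using M0(3) mp.span_mono[of "M0 \<union> V" "insert m M0 \<union> V"] mp.span_base[of m "insert m M0 \<union> V"] by auto
    ultimately show ?thesis using M0(1) by (intro exI[of _ "insert m M0"]) auto
  qed
qed

text \<open>\<open>V\<close> is any set and its span is what counts, so that a union such as
  \<open>J \<union> W s\<close> stands for a sum of subspaces.\<close>

definition codim_le :: "'k::field mpoly set \<Rightarrow> nat \<Rightarrow> bool" where
  "codim_le V n \<longleftrightarrow> (\<exists>B. finite B \<and> card B \<le> n \<and> mp.span (B \<union> V) = UNIV)"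

lemma codim_le_mono: "codim_le V n \<Longrightarrow> V \<subseteq> V' \<Longrightarrow> n \<le> n' \<Longrightarrow> codim_le V' n'"
proof -
  assume "codim_le V n" "V \<subseteq> V'" "n \<le> n'"
  then obtain B where B: "finite B" "card B \<le> n" "mp.span (B \<union> V) = UNIV" by (auto simp: codim_le_def)
  have "mp.span (B \<union> V) \<subseteq> mp.span (B \<union> V')" using \<open>V \<subseteq> V'\<close> by (intro mp.span_mono) auto
  then show "codim_le V' n'" unfolding codim_le_def using B \<open>n \<le> n'\<close> by (intro exI[of _ B]) auto
qed

lemma codim_le_0: "1 \<in> V \<Longrightarrow> rm.subspace V \<Longrightarrow> codim_le V 0"
proof -
  assume "1 \<in> V" "rm.subspace V"
  then have "r * 1 \<in> V" for r by (rule rm.subspace_scale[rotated])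
  then have "V = UNIV" by auto
  then show ?thesis unfolding codim_le_def by (intro exI[of _ "{}"]) auto
qed

text \<open>Multiplication by \<open>a\<close> maps the quotient by \<open>V1\<close> into the
  quotient by \<open>V\<close>, and what remains is a quotient by \<open>V + (a)\<close>. Exactness
  in the middle adds the two bounds.\<close>

lemma codim_le_colon:
  assumes V1: "codim_le V1 n1" and V2: "codim_le V2 n2"
    and 1: "\<And>v. v \<in> V1 \<Longrightarrow> a * v \<in> mp.span V"
    and 2: "V2 \<subseteq> mp.span (V \<union> range (\<lambda>r. a * r))"
  shows "codim_le V (n1 + n2)"
proof -
  obtain B1 where B1: "finite B1" "card B1 \<le> n1" "mp.span (B1 \<union> V1) = UNIV"
    using V1 by (auto simp: codim_le_def)
  obtain B2 where B2: "finite B2" "card B2 \<le> n2" "mp.span (B2 \<union> V2) = UNIV"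
    using V2 by (auto simp: codim_le_def)
  let ?B = "B2 \<union> (\<lambda>r. a * r) ` B1"
  have a: "a * r \<in> mp.span (?B \<union> V)" for r
  proof -
    have "r \<in> mp.span (B1 \<union> V1)" using B1 by simp
    then show ?thesis
    proof (induction rule: mp.span_induct_alt)
      case (step c x y)
      have "a * x \<in> mp.span (?B \<union> V)"
      proof (cases "x \<in> B1")
        case True
        then show ?thesis by (intro mp.span_base) auto
      next
        case False
        then have "a * x \<in> mp.span V" using step(1) 1 by blast
        then show ?thesis using mp.span_mono[of V "?B \<union> V"] by blast
      qed
      from mp.span_add[OF mp.span_scale[OF this, of c] step(2)]
      have "Cst c * (a * x) + a * y \<in> mp.span (?B \<union> V)" .
      moreover have "a * (Cst c * x + y) = Cst c * (a * x) + a * y" by (simp add: algebra_simps)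
      ultimately show ?case by (simp only:)
    qed (simp add: mp.span_zero)
  qed
  have "B2 \<union> V2 \<subseteq> mp.span (?B \<union> V)"
  proof -
    have "V \<union> range (\<lambda>r. a * r) \<subseteq> mp.span (?B \<union> V)"
      using a mp.span_superset[of "?B \<union> V"] by blast
    then have "mp.span (V \<union> range (\<lambda>r. a * r)) \<subseteq> mp.span (?B \<union> V)" by (simp add: mp.span_minimal)
    then show ?thesis using 2 mp.span_superset[of "?B \<union> V"] by blast
  qed
  then have "mp.span (B2 \<union> V2) \<subseteq> mp.span (?B \<union> V)" by (rule mp.span_minimal) (rule mp.subspace_span)
  then have "mp.span (?B \<union> V) = UNIV" unfolding B2(3) by (rule top.extremum_uniqueI)
  moreover have "card ?B \<le> n1 + n2"
    using card_Un_le[of B2 "(\<lambda>r. a * r) ` B1"] card_image_le[OF B1(1), of "\<lambda>r. a * r"] B1(2) B2(2) by linarith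
  moreover have "finite ?B" using B1(1) B2(1) by blast
  ultimately show ?thesis unfolding codim_le_def by blast
qed

subsection \<open>Noetherianity\<close>

text \<open>There is a monotone subsequence in one direction or the other; a decreasing sequence of
  naturals is constant once it has reached its minimum.\<close>

lemma nat_mono_subseq:
  fixes f :: "nat \<Rightarrow> nat"
  shows "\<exists>r::nat \<Rightarrow> nat. strict_mono r \<and> mono (\<lambda>i. f (r i))"
proof -
  obtain r where r: "strict_mono r" "monoseq (\<lambda>n. f (r n))" using seq_monosub[of f] by auto
  show ?thesis
  proof (cases "\<forall>m n. m \<le> n \<longrightarrow> f (r m) \<le> f (r n)")
    case True
    then show ?thesis using r by (auto simp: mono_def)
  next
    case False
    then have dec: "\<And>m n. m \<le> n \<Longrightarrow> f (r n) \<le> f (r m)" using r(2) by (auto simp: monoseq_def)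
    obtain k where k: "\<And>n. f (r k) \<le> f (r n)"
      using ex_has_least_nat[of "\<lambda>_. True" 0 "\<lambda>n. f (r n)"] by auto
    have "f (r (k + n)) = f (r k)" for n using dec[of k "k + n"] k[of "k + n"] by simp
    then show ?thesis using r(1)
      by (intro exI[of _ "\<lambda>n. r (k + n)"]) (auto simp: mono_def strict_mono_def)
  qed
qed

lemma dickson_subseq:
  fixes a :: "nat \<Rightarrow> nat \<Rightarrow> nat"
  shows "\<exists>r::nat \<Rightarrow> nat. strict_mono r \<and> (\<forall>l<n. mono (\<lambda>i. a (r i) l))"
proof (induction n)
  case 0
  then show ?case by (auto intro: exI[of _ id] simp: strict_mono_id)
next
  case (Suc n)
  then obtain r :: "nat \<Rightarrow> nat" where r: "strict_mono r" "\<forall>l<n. mono (\<lambda>i. a (r i) l)" by blast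
  obtain r' :: "nat \<Rightarrow> nat" where r': "strict_mono r'" "mono (\<lambda>i. a (r (r' i)) n)"
    using nat_mono_subseq[of "\<lambda>i. a (r i) n"] by blast
  have "mono (\<lambda>i. a (r (r' i)) l)" if "l < n" for l
    using r(2) that r'(1) unfolding mono_def by (simp add: strict_mono_less_eq)
  then show ?case using r r' by (intro exI[of _ "\<lambda>i. r (r' i)"]) (auto simp: less_Suc_eq strict_mono_def)
qed

lemma dickson:
  fixes a :: "nat \<Rightarrow> nat \<Rightarrow>\<^sub>0 nat"
  assumes "\<And>i. a i \<in> vset n"
  shows "\<exists>i j \<mu>. i < j \<and> a j = a i + \<mu> \<and> \<mu> \<in> vset n"
proof -
  obtain r :: "nat \<Rightarrow> nat" where r: "strict_mono r" "\<forall>l<n. mono (\<lambda>i. lkp (a (r i)) l)"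
    using dickson_subseq[of n "\<lambda>i. lkp (a i)"] by blast
  have le: "lkp (a (r 0)) l \<le> lkp (a (r 1)) l" for l
  proof (cases "l < n")
    case True then show ?thesis using r(2) by (simp add: mono_def)
  next
    case False
    then have "l \<notin> kys (a (r 0))" using assms by auto
    then show ?thesis by (simp add: in_keys_iff)
  qed
  define \<mu> where "\<mu> = a (r 1) - a (r 0)"
  have "a (r 1) = a (r 0) + \<mu>"
    by (rule poly_mapping_eqI) (use le in \<open>simp add: \<mu>_def lookup_add lookup_minus\<close>)
  moreover have "\<mu> \<in> vset n"
    using assms[of "r 1"] by (auto simp: \<mu>_def in_keys_iff lookup_minus subset_iff)
  moreover have "r 0 < r 1" using r(1) by (simp add: strict_mono_def)
  ultimately show ?thesis by blast
qed

text \<open>Total degree first, ties broken by the linear order on exponent vectors. Comparing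
  degrees first leaves only finitely many smaller monomials in n variables, so that
  \<open>mrank\<close> below is a well-founded measure.\<close>

definition prec :: "(nat \<Rightarrow>\<^sub>0 nat) \<Rightarrow> (nat \<Rightarrow>\<^sub>0 nat) \<Rightarrow> bool" where
  "prec m m' \<longleftrightarrow> mdeg m < mdeg m' \<or> (mdeg m = mdeg m' \<and> m < m')"

lemma prec_trans: "prec a b \<Longrightarrow> prec b c \<Longrightarrow> prec a c"
  and prec_total: "a \<noteq> b \<Longrightarrow> prec a b \<or> prec b a"
  and prec_irrefl: "\<not> prec a a"
  by (auto simp: prec_def)

lemma prec_add: "prec a b \<Longrightarrow> prec (a + c) (b + c)"
  by (auto simp: prec_def mdeg_add)

definition mrank :: "nat \<Rightarrow> (nat \<Rightarrow>\<^sub>0 nat) \<Rightarrow> nat" where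
  "mrank n m = card {m' \<in> vset n. prec m' m}"

lemma mrank_mono:
  assumes "prec a b" "a \<in> vset n"
  shows "mrank n a < mrank n b"
  unfolding mrank_def
proof (rule psubset_card_mono)
  show "finite {m' \<in> vset n. prec m' b}"
    by (rule finite_subset[OF _ finite_vset_le[of n "mdeg b"]]) (auto simp: prec_def)
  show "{m' \<in> vset n. prec m' a} \<subset> {m' \<in> vset n. prec m' b}"
    using assms prec_trans prec_irrefl by blast
qed

definition lead :: "'k::comm_ring_1 mpoly \<Rightarrow> (nat \<Rightarrow>\<^sub>0 nat) \<Rightarrow> bool" where
  "lead F m \<longleftrightarrow> m \<in> kys F \<and> (\<forall>m'\<in>kys F. m' \<noteq> m \<longrightarrow> prec m' m)"

lemma ex_lead:
  assumes "F \<noteq> 0" shows "\<exists>m. lead F m"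
proof -
  have "finite A \<Longrightarrow> A \<noteq> {} \<Longrightarrow> \<exists>m\<in>A. \<forall>m'\<in>A. m' \<noteq> m \<longrightarrow> prec m' m" for A
  proof (induction A rule: finite_ne_induct)
    case (insert x A)
    then show ?case using prec_total prec_trans by (metis insert_iff)
  qed auto
  from this[of "kys F"] show ?thesis using assms by (auto simp: lead_def)
qed

lemma kset_Compl_vset:
  "kset (- vset n) \<subseteq> rm.span (Vr ` {n..} :: 'k::comm_ring_1 mpoly set)"
proof
  fix F :: "'k mpoly" assume "F \<in> kset (- vset n)"
  then show "F \<in> rm.span (Vr ` {n..})"
  proof (induction rule: kset_induct)
    case (single m c)
    then obtain j where j: "j \<in> kys m" "n \<le> j" by (metis Compl_iff lessThan_iff mem_Collect_eq not_less subsetI)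
    have "m = sgl j 1 + (m - sgl j 1)"
      by (rule poly_mapping_eqI) (use j in \<open>auto simp: lookup_add lookup_minus lookup_single when_def in_keys_iff\<close>)
    then have "sgl m c = sgl (m - sgl j 1) c * Vr j"
      by (metis Vr_def mult.commute mult.right_neutral mult_single)
    moreover have "sgl (m - sgl j 1) c * Vr j \<in> rm.span (Vr ` {n..})"
      by (rule rm.span_scale, rule rm.span_base) (use j in auto)
    ultimately show ?case by metis
  qed (auto intro: rm.span_zero rm.span_add)
qed

text \<open>The ring has infinitely many variables, so finite generation is claimed for ideals
  containing all variables from n on, and modulo these. If it failed, one could choose forever
  elements outside the ideal generated so far, each with the smallest possible leading monomial. By
  Dickson's lemma one leading monomial divides a later one; cancelling the later leading term
  contradicts the minimal choice.\<close>

theorem hilbert_basis: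
  fixes I :: "'k::field mpoly set"
  assumes I: "rm.subspace I" "Vr ` {n..} \<subseteq> I"
  shows "\<exists>G. finite G \<and> I = rm.span (G \<union> Vr ` {n..})"
proof (rule ccontr)
  assume no: "\<not> ?thesis"
  define J where "J G = rm.span (G \<union> Vr ` {n..} :: 'k mpoly set)" for G
  have Jsub: "rm.subspace (J G)" and JG: "G \<subseteq> J G" for G
    by (auto simp: J_def rm.span_base)
  define Q where "Q G x \<longleftrightarrow> (\<exists>m. x \<in> I \<and> x \<in> PV n \<and> x \<notin> J G \<and> lead x m \<and>
      (\<forall>y m'. y \<in> I \<and> y \<in> PV n \<and> y \<notin> J G \<and> lead y m' \<longrightarrow> mrank n m \<le> mrank n m'))" for G x
  have "\<exists>x. Q G x" if G: "finite G" "G \<subseteq> I" for G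
  proof -
    have "J G \<subseteq> I" unfolding J_def using G(2) I by (intro rm.span_minimal) auto
    moreover have "J G \<noteq> I" using no G unfolding J_def by blast
    ultimately obtain x where x: "x \<in> I" "x \<notin> J G" by blast
    have "prt (- vset n) x \<in> rm.span (Vr ` {n..})" using kset_Compl_vset[of n] prt_kset by blast
    then have "prt (- vset n) x \<in> J G"
      unfolding J_def using rm.span_mono[of "Vr ` {n..}" "G \<union> Vr ` {n..}"] by auto
    moreover have "prt (- vset n) x \<in> I"
      using \<open>J G \<subseteq> I\<close> calculation by auto
    moreover have "prt (vset n) x = x - prt (- vset n) x"
      using prt_compl[of x "vset n"] by (simp add: algebra_simps)
    ultimately have x': "prt (vset n) x \<in> I" "prt (vset n) x \<notin> J G"
      using x rm.subspace_diff[OF I(1) x(1)] rm.subspace_add[OF Jsub, of "prt (vset n) x" G "prt (- vset n) x"]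
      by auto
    then have "prt (vset n) x \<noteq> 0" using rm.subspace_0[OF Jsub, of G] by auto
    then obtain m where "lead (prt (vset n) x) m" using ex_lead[of "prt (vset n) x"] by blast
    define P where "P p \<longleftrightarrow> fst p \<in> I \<and> fst p \<in> PV n \<and> fst p \<notin> J G \<and> lead (fst p) (snd p)" for p
    have "P (prt (vset n) x, m)" using x' \<open>lead (prt (vset n) x) m\<close> by (auto simp: P_def)
    then obtain p where "P p" "\<And>p'. P p' \<Longrightarrow> mrank n (snd p) \<le> mrank n (snd p')"
      using ex_has_least_nat[of P _ "\<lambda>p. mrank n (snd p)"] by blast
    then show ?thesis unfolding Q_def P_def by (intro exI[of _ "fst p"] exI[of _ "snd p"]) auto
  qed
  then obtain nxt where nxt: "\<And>G. finite G \<Longrightarrow> G \<subseteq> I \<Longrightarrow> Q G (nxt G)" by metis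
  define S where "S = rec_nat {} (\<lambda>_ G. insert (nxt G) G)"
  have S0: "S 0 = {}" and SSuc: "S (Suc k) = insert (nxt (S k)) (S k)" for k by (auto simp: S_def)
  have SI: "finite (S k) \<and> S k \<subseteq> I" for k
  proof (induction k)
    case (Suc k)
    then have "Q (S k) (nxt (S k))" using nxt by blast
    then show ?case using Suc by (auto simp: SSuc Q_def)
  qed (simp add: S0)
  then have Q: "Q (S k) (nxt (S k))" for k using nxt by blast
  have Smono: "i \<le> j \<Longrightarrow> S i \<subseteq> S j" for i j
    by (rule lift_Suc_mono_le[of S]) (auto simp: SSuc)
  from choice[OF allI[OF Q[unfolded Q_def]]] obtain lm
    where lm': "\<forall>k. nxt (S k) \<in> I \<and> nxt (S k) \<in> PV n \<and> nxt (S k) \<notin> J (S k) \<and> lead (nxt (S k)) (lm k) \<and>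
      (\<forall>y m'. y \<in> I \<and> y \<in> PV n \<and> y \<notin> J (S k) \<and> lead y m' \<longrightarrow> mrank n (lm k) \<le> mrank n m')" ..
  then have lm: "nxt (S k) \<in> I \<and> nxt (S k) \<in> PV n \<and> nxt (S k) \<notin> J (S k) \<and> lead (nxt (S k)) (lm k)" for k by blast
  have lmin: "y \<in> I \<Longrightarrow> y \<in> PV n \<Longrightarrow> y \<notin> J (S k) \<Longrightarrow> lead y m' \<Longrightarrow> mrank n (lm k) \<le> mrank n m'" for k y m'
    using lm' by blast
  have "lm k \<in> vset n" for k using lm[of k] by (auto simp: lead_def kset_def)
  then obtain i j \<mu> where ij: "i < j" "lm j = lm i + \<mu>" "\<mu> \<in> vset n" using dickson by meson
  define g g' where "g = nxt (S i)" and "g' = nxt (S j)"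
  define c where "c = lkp g' (lm j) / lkp g (lm i)"
  define h where "h = g' - sgl \<mu> c * g"
  have gl: "lead g (lm i)" "lead g' (lm j)" using lm by (auto simp: g_def g'_def)
  have gn: "lkp g (lm i) \<noteq> 0" using gl by (simp add: lead_def in_keys_iff)
  have gS: "g \<in> J (S j)"
    using Smono[of "Suc i" j] ij(1) JG[of "S j"] by (auto simp: SSuc g_def)
  have "h \<in> I" unfolding h_def
    using lm[of i] lm[of j] by (intro rm.subspace_diff rm.subspace_scale I) (auto simp: g_def g'_def)
  moreover have "h \<in> PV n" unfolding h_def
    using lm[of i] lm[of j] ij(3) by (intro kset_minus PV_mult) (auto simp: g_def g'_def intro: kset_single)
  moreover have hJ: "h \<notin> J (S j)"
  proof
    assume "h \<in> J (S j)"
    then have "h + sgl \<mu> c * g \<in> J (S j)" using gS Jsub by (intro rm.subspace_add rm.subspace_scale) auto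
    then show False using lm[of j] by (simp add: h_def g'_def)
  qed
  moreover obtain m where m: "lead h m"
    using ex_lead[of h] hJ rm.subspace_0[OF Jsub, of "S j"] by auto
  ultimately have "mrank n (lm j) \<le> mrank n m" using lmin by blast
  moreover have "prec m (lm j)"
  proof -
    have keys: "kys (sgl \<mu> c * g) \<subseteq> {\<mu> + x | x. x \<in> kys g}"
      using keys_mult[of "sgl \<mu> c" g] by (auto split: if_splits)
    have "lkp h (lm j) = 0"
      using lkp_sgl_mult[of \<mu> c g "lm i"] gn by (simp add: h_def lookup_minus ij(2) add.commute c_def)
    moreover have mh: "m \<in> kys h" using m by (simp add: lead_def)
    ultimately have ne: "m \<noteq> lm j" by (auto simp: in_keys_iff)
    have "m \<in> kys g' \<or> m \<in> kys (sgl \<mu> c * g)"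
      using mh unfolding h_def by (auto simp: in_keys_iff lookup_minus)
    then show ?thesis
    proof
      assume "m \<in> kys g'" then show ?thesis using gl(2) ne by (simp add: lead_def)
    next
      assume "m \<in> kys (sgl \<mu> c * g)"
      then obtain x where x: "m = \<mu> + x" "x \<in> kys g" using keys by blast
      then have "prec x (lm i)" using gl(1) ne ij(2) by (auto simp: lead_def add.commute)
      then show ?thesis using prec_add[of x "lm i" \<mu>] by (simp add: x ij(2) add.commute)
    qed
  qed
  then have "mrank n m < mrank n (lm j)"
    using m \<open>h \<in> PV n\<close> by (intro mrank_mono) (auto simp: kset_def lead_def)
  ultimately show False by simp
qed

text \<open>Zorn's lemma: the union of a chain is generated, beyond the variables from n on, by
  finitely many elements, and these already lie in a single member of the chain.\<close>

lemma noetherian_maximal: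
  fixes \<F> :: "'k::field mpoly set set"
  assumes "I0 \<in> \<F>" "\<And>I. I \<in> \<F> \<Longrightarrow> rm.subspace I \<and> Vr ` {n..} \<subseteq> I"
  shows "\<exists>I\<in>\<F>. I0 \<subseteq> I \<and> (\<forall>I'\<in>\<F>. I \<subseteq> I' \<longrightarrow> I' = I)"
proof -
  let ?G = "{I \<in> \<F>. I0 \<subseteq> I}"
  have "\<exists>M\<in>?G. \<forall>Z\<in>?G. M \<subseteq> Z \<longrightarrow> Z = M"
  proof (rule subset_Zorn_nonempty)
    show "?G \<noteq> {}" using assms by auto
    fix C assume C: "C \<noteq> {}" "subset.chain ?G C"
    have CF: "C \<subseteq> ?G" using C(2) by (auto simp: subset_chain_def)
    have sub: "rm.subspace (\<Union>C)"
    proof (unfold rm.subspace_def, intro conjI ballI allI)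
      show "0 \<in> \<Union>C" using C(1) CF assms(2) rm.subspace_0 by blast
      fix x y assume "x \<in> \<Union>C" "y \<in> \<Union>C"
      then obtain A B where AB: "A \<in> C" "B \<in> C" "x \<in> A" "y \<in> B" by blast
      then have "A \<subseteq> B \<or> B \<subseteq> A" using C(2) by (auto simp: subset_chain_def)
      then obtain D where D: "D \<in> C" "x \<in> D" "y \<in> D" using AB by blast
      then have "x + y \<in> D" using CF assms(2) by (intro rm.subspace_add) auto
      then show "x + y \<in> \<Union>C" using D(1) by blast
    next
      fix c x assume "x \<in> \<Union>C"
      then obtain D where D: "D \<in> C" "x \<in> D" by blast
      then have "c * x \<in> D" using CF assms(2) by (intro rm.subspace_scale) auto
      then show "c * x \<in> \<Union>C" using D(1) by blast
    qed
    moreover have "Vr ` {n..} \<subseteq> \<Union>C" using C(1) CF assms(2) by blast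
    ultimately obtain G where G: "finite G" "\<Union>C = rm.span (G \<union> Vr ` {n..})"
      using hilbert_basis[of "\<Union>C" n] by auto
    have "G \<subseteq> \<Union>C" using G(2) rm.span_superset[of "G \<union> Vr ` {n..}"] by blast
    then obtain A where A: "A \<in> C" "G \<subseteq> A"
      using finite_subset_Union_chain[OF G(1) _ C(1), of ?G] C(2) by blast
    have "rm.subspace A \<and> Vr ` {n..} \<subseteq> A" using assms(2)[of A] A(1) CF by blast
    then have "\<Union>C \<subseteq> A" unfolding G(2) using A(2) by (intro rm.span_minimal) auto
    then have "\<Union>C = A" using A by blast
    then show "\<Union>C \<in> ?G" using A CF by auto
  qed
  then obtain M where M: "M \<in> ?G" "\<forall>Z\<in>?G. M \<subseteq> Z \<longrightarrow> Z = M" by (rule bexE)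
  show ?thesis
  proof (intro bexI[of _ M] conjI ballI impI)
    fix I' assume I': "I' \<in> \<F>" "M \<subseteq> I'"
    then have "I' \<in> ?G" using M(1) by auto
    then show "I' = M" using M(2) I'(2) by blast
  qed (use M(1) in auto)
qed

subsection \<open>Growth of the Hilbert function\<close>

definition is_prime :: "'r::comm_ring_1 set \<Rightarrow> bool" where
  "is_prime p \<longleftrightarrow> rm.subspace p \<and> 1 \<notin> p \<and> (\<forall>a b. a * b \<in> p \<longrightarrow> a \<in> p \<or> b \<in> p)"

text \<open>A Hilbert-Samuel function of order \<open>s ^ d\<close>. When \<open>W s\<close> is the
  s-th power of the maximal ideal of a point, this expresses that the local dimension of the zero
  locus of \<open>J\<close> is at most \<open>d\<close>.\<close>

definition growth_le :: "(nat \<Rightarrow> 'k::field mpoly set) \<Rightarrow> nat \<Rightarrow> 'k mpoly set \<Rightarrow> bool" where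
  "growth_le W d J \<longleftrightarrow> (\<exists>C. \<forall>s. codim_le (J \<union> W s) (C * (s + 1) ^ d))"

lemma growth_leI: "(\<And>s. codim_le (J \<union> W s) (C * (s + 1) ^ d)) \<Longrightarrow> growth_le W d J"
  unfolding growth_le_def by (rule exI) (rule allI)

lemma growth_le_mono: "growth_le W d J \<Longrightarrow> J \<subseteq> J' \<Longrightarrow> growth_le W d J'"
proof -
  assume "growth_le W d J" and J: "J \<subseteq> J'"
  then obtain C where C: "codim_le (J \<union> W s) (C * (s + 1) ^ d)" for s unfolding growth_le_def by auto
  have "codim_le (J' \<union> W s) (C * (s + 1) ^ d)" for s
    by (rule codim_le_mono[OF C _ order_refl]) (use J in auto)
  then show "growth_le W d J'" unfolding growth_le_def by auto
qed

lemma growth_le_exp: "growth_le W d J \<Longrightarrow> d \<le> d' \<Longrightarrow> growth_le W d' J"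
proof -
  assume "growth_le W d J" and d: "d \<le> d'"
  then obtain C where C: "codim_le (J \<union> W s) (C * (s + 1) ^ d)" for s unfolding growth_le_def by auto
  have "codim_le (J \<union> W s) (C * (s + 1) ^ d')" for s
    by (rule codim_le_mono[OF C order_refl]) (use d in \<open>auto intro!: mult_le_mono2 power_increasing\<close>)
  then show "growth_le W d' J" unfolding growth_le_def by auto
qed

text \<open>The Hilbert functions satisfy \<open>H\<^sub>J \<le> H\<^bsub>J + (a)\<^esub> + H\<^bsub>J : a\<^esub>\<close>, so an ideal that is maximal
  among those of growth exceeding \<open>d\<close> is prime.\<close>

lemma prime_of_growth:
  fixes J :: "'k::field mpoly set"
  assumes J: "rm.subspace J" "Vr ` {n..} \<subseteq> J" and W: "\<And>s. rm.subspace (W s)"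
    and g: "\<not> growth_le W d J"
  shows "\<exists>p. is_prime p \<and> J \<subseteq> p \<and> \<not> growth_le W d p"
proof -
  let ?F = "{I. rm.subspace I \<and> Vr ` {n..} \<subseteq> I \<and> \<not> growth_le W d I}"
  obtain p where p: "p \<in> ?F" "J \<subseteq> p" and mx: "\<And>I'. I' \<in> ?F \<Longrightarrow> p \<subseteq> I' \<Longrightarrow> I' = p"
  proof -
    have "J \<in> ?F" using J g by simp
    moreover have "\<And>I. I \<in> ?F \<Longrightarrow> rm.subspace I \<and> Vr ` {n..} \<subseteq> I" by simp
    ultimately have "\<exists>I\<in>?F. J \<subseteq> I \<and> (\<forall>I'\<in>?F. I \<subseteq> I' \<longrightarrow> I' = I)" by (rule noetherian_maximal)
    then obtain p where "p \<in> ?F" "J \<subseteq> p" "\<forall>I'\<in>?F. p \<subseteq> I' \<longrightarrow> I' = p" by auto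
    then show thesis by (intro that[of p]) (blast+)
  qed
  have ps: "rm.subspace p" using p by simp
  have "is_prime p"
    unfolding is_prime_def
  proof (intro conjI allI impI)
    show "rm.subspace p" by (rule ps)
    show "1 \<notin> p"
    proof
      assume "1 \<in> p"
      then have "codim_le p 0" using codim_le_0[of p] ps by simp
      then have "codim_le (p \<union> W s) (0 * (s + 1) ^ d)" for s by (rule codim_le_mono) auto
      then have "growth_le W d p" by (rule growth_leI)
      then show False using p(1) by simp
    qed
    fix a b assume ab: "a * b \<in> p"
    show "a \<in> p \<or> b \<in> p"
    proof (rule ccontr)
      assume n: "\<not> (a \<in> p \<or> b \<in> p)"
      \<comment> \<open>By maximality of \<open>p\<close>, both the colon ideal, which contains
        \<open>b\<close>, and the sum with the ideal of \<open>a\<close> have growth at most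
        \<open>d\<close>; the exact sequence then gives \<open>p\<close> itself growth at most
        \<open>d\<close>.\<close>
      define I1 where "I1 = {r. a * r \<in> p}"
      define I2 where "I2 = rm.span (insert a p)"
      have I1: "rm.subspace I1" "p \<subseteq> I1" "b \<in> I1"
        using ps ab
        by (auto simp: I1_def rm.subspace_def distrib_left mult.left_commute[of a])
      have I2: "rm.subspace I2" "p \<subseteq> I2" "a \<in> I2"
        by (auto simp: I2_def rm.span_base)
      have "growth_le W d I1" "growth_le W d I2"
        using mx[of I1] mx[of I2] I1 I2 n p(1) by auto
      then obtain C1 C2 where C: "\<And>s. codim_le (I1 \<union> W s) (C1 * (s + 1) ^ d)"
        "\<And>s. codim_le (I2 \<union> W s) (C2 * (s + 1) ^ d)" unfolding growth_le_def by auto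
      have "codim_le (p \<union> W s) ((C1 + C2) * (s + 1) ^ d)" for s
      proof -
        have "codim_le (p \<union> W s) (C1 * (s + 1) ^ d + C2 * (s + 1) ^ d)"
        proof (rule codim_le_colon[OF C(1)[of s] C(2)[of s], of a])
          fix v assume "v \<in> I1 \<union> W s"
          then show "a * v \<in> mp.span (p \<union> W s)"
            using rm.subspace_scale[OF W, of v s a] by (intro mp.span_base) (auto simp: I1_def)
        next
          have "I2 \<subseteq> mp.span ((p \<union> W s) \<union> range (\<lambda>r. a * r))"
          proof
            fix x assume "x \<in> I2"
            then obtain k where "x - k * a \<in> rm.span p" unfolding I2_def by (auto simp: rm.span_insert)
            then have "x - k * a \<in> p" using ps by (simp add: rm.span_eq_iff[THEN iffD2])
            then have "(x - k * a) + a * k \<in> mp.span ((p \<union> W s) \<union> range (\<lambda>r. a * r))"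
              by (intro mp.span_add mp.span_base) auto
            then show "x \<in> mp.span ((p \<union> W s) \<union> range (\<lambda>r. a * r))" by (simp add: mult.commute)
          qed
          then show "I2 \<union> W s \<subseteq> mp.span ((p \<union> W s) \<union> range (\<lambda>r. a * r))"
            using mp.span_superset[of "(p \<union> W s) \<union> range (\<lambda>r. a * r)"] by auto
        qed
        then show ?thesis by (simp only: add_mult_distrib)
      qed
      then have "growth_le W d p" by (rule growth_leI)
      then show False using p by simp
    qed
  qed
  then show ?thesis using p by blast
qed

subsection \<open>A Nullstellensatz for prime ideals\<close>

lemma primeD:
  assumes "is_prime p"
  shows "rm.subspace p" "1 \<notin> p" "a * b \<in> p \<Longrightarrow> a \<in> p \<or> b \<in> p"
  using assms by (auto simp: is_prime_def)

lemma prime_power: "is_prime p \<Longrightarrow> a ^ m \<in> p \<Longrightarrow> a \<in> p"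
  by (induction m) (auto dest: primeD)

section \<open>Polynomials in one distinguished variable and pseudo-division\<close>

lemma PV_decompose:
  assumes "F \<in> PV (Suc n)"
  shows "\<exists>P. (\<forall>i. coeff P i \<in> PV n) \<and> F = poly P (Vr n)"
  using assms
proof (induction rule: kset_induct)
  case (single m c)
  let ?e = "lkp m n" and ?m = "m - sgl n (lkp m n)"
  have "m = ?m + sgl n ?e"
    by (rule poly_mapping_eqI) (simp add: lookup_add lookup_minus lookup_single when_def)
  then have "sgl m c = sgl ?m c * Vr n ^ ?e"
    by (simp add: Vr_power mult_single)
  moreover have "?m \<in> vset n"
    using single by (auto simp: in_keys_iff lookup_minus lookup_single when_def less_Suc_eq subset_iff split: if_splits)
  ultimately show ?case
    by (intro exI[of _ "monom (sgl ?m c) ?e"]) (auto simp: poly_monom kset_single)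
next
  case (add F G)
  then obtain P Q where "\<forall>i. coeff P i \<in> PV n" "F = poly P (Vr n)" "\<forall>i. coeff Q i \<in> PV n" "G = poly Q (Vr n)"
    by auto
  then show ?case by (intro exI[of _ "P + Q"]) (auto simp: kset_add)
qed (auto intro: exI[of _ 0])

definition cpoly :: "nat \<Rightarrow> 'k::comm_ring_1 mpoly poly set" where
  "cpoly n = {P. \<forall>i. coeff P i \<in> PV n}"

lemma cpoly_0 [simp]: "0 \<in> cpoly n"
  and cpoly_add: "P \<in> cpoly n \<Longrightarrow> Q \<in> cpoly n \<Longrightarrow> P + Q \<in> cpoly n"
  and cpoly_diff: "P \<in> cpoly n \<Longrightarrow> Q \<in> cpoly n \<Longrightarrow> P - Q \<in> cpoly n"
  and cpoly_smult: "c \<in> PV n \<Longrightarrow> P \<in> cpoly n \<Longrightarrow> smult c P \<in> cpoly n"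
  and cpoly_monom: "c \<in> PV n \<Longrightarrow> monom c k \<in> cpoly n"
  and cpoly_coeff: "P \<in> cpoly n \<Longrightarrow> coeff P i \<in> PV n"
  by (auto simp: cpoly_def kset_add kset_minus PV_mult)

lemma cpoly_mult: "P \<in> cpoly n \<Longrightarrow> Q \<in> cpoly n \<Longrightarrow> P * Q \<in> cpoly n"
  by (auto simp: cpoly_def coeff_mult intro!: kset_sum PV_mult)

lemma PV_mono: "n \<le> n' \<Longrightarrow> F \<in> PV n \<Longrightarrow> F \<in> PV n'"
  by (erule kset_mono[rotated]) auto

lemma cpoly_poly: "P \<in> cpoly n \<Longrightarrow> poly P (Vr n) \<in> PV (Suc n)"
  unfolding poly_altdef
  by (intro kset_sum PV_mult PV_power PV_Vr PV_mono[of n "Suc n"] cpoly_coeff) auto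

lemma poly_map_poly_rhom: "rhom h \<Longrightarrow> poly (map_poly h P) (h x) = h (poly P x)"
  by (induction P) (auto simp: map_poly_pCons rhomD)

lemma poly_in_ideal:
  assumes "rm.subspace p" "\<And>i. coeff P i \<in> p" shows "poly P x \<in> p"
  unfolding poly_altdef
  by (intro rm.subspace_sum[OF assms(1)]) (metis assms mult.commute rm.subspace_scale)

text \<open>Top coefficients lying in \<open>p\<close> may be dropped without changing the class
  modulo \<open>p\<close>. Afterwards the leading coefficient is nonzero modulo \<open>p\<close>, as
  arguments with degrees over a domain require.\<close>

lemma cpoly_strip:
  assumes p: "rm.subspace p" and P: "P \<in> cpoly n" and i: "coeff P i \<notin> p"
  shows "\<exists>P' \<in> cpoly n. degree P' \<le> degree P \<and> lead_coeff P' \<notin> p \<and> poly P x - poly P' x \<in> p"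
proof -
  have bd: "coeff P i \<notin> p \<Longrightarrow> i \<le> degree P" for i
    using rm.subspace_0[OF p] le_degree by metis
  obtain k where k: "coeff P k \<notin> p" "\<And>j. coeff P j \<notin> p \<Longrightarrow> j \<le> k"
    using ex_has_greatest_nat[of "\<lambda>i. coeff P i \<notin> p" i "\<lambda>i. i" "Suc (degree P)"] i bd
    by (auto simp: less_Suc_eq_le)
  define P' where "P' = (\<Sum>j\<le>k. monom (coeff P j) j)"
  have cf: "coeff P' j = (if j \<le> k then coeff P j else 0)" for j
    by (simp add: P'_def coeff_sum coeff_monom)
  have k0: "coeff P k \<noteq> 0" using k rm.subspace_0[OF p] by metis
  have "degree P' = k"
    by (rule antisym) (auto intro!: degree_le le_degree simp: cf k0)
  moreover have "poly (P - P') x \<in> p"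
    by (rule poly_in_ideal[OF p]) (use k rm.subspace_0[OF p] in \<open>auto simp: cf\<close>)
  moreover have "P' \<in> cpoly n" using P by (auto simp: cpoly_def cf)
  ultimately show ?thesis using k bd by (intro bexI[of _ P']) (auto simp: cf)
qed

text \<open>Multiplying by a power of the leading coefficient of \<open>f\<close> replaces division
  by it, so all coefficients remain polynomials in the first n variables.\<close>

lemma cpoly_division:
  assumes f: "f \<in> cpoly n" "0 < degree f"
  shows "H \<in> cpoly n \<Longrightarrow> \<exists>m. \<exists>Q\<in>cpoly n. \<exists>R\<in>cpoly n. smult (lead_coeff f ^ m) H = Q * f + R \<and> degree R < degree f"
proof (induction "degree H" arbitrary: H rule: less_induct)
  case less
  show ?case
  proof (cases "degree H < degree f")
    case True
    then show ?thesis using less.prems by (intro exI[of _ 0] bexI[of _ 0] bexI[of _ H]) auto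
  next
    case False
    let ?c = "lead_coeff f" and ?M = "monom (lead_coeff H) (degree H - degree f)"
    define H' where "H' = smult ?c H - ?M * f"
    have M: "?M \<in> cpoly n" using less.prems by (intro cpoly_monom cpoly_coeff)
    have H': "H' \<in> cpoly n" unfolding H'_def
      using less.prems f M by (intro cpoly_diff cpoly_smult cpoly_mult cpoly_coeff)
    have "degree H' \<le> degree H"
      unfolding H'_def
    proof (rule degree_diff_le)
      have "degree (?M * f) \<le> degree ?M + degree f" by (rule degree_mult_le)
      also have "\<dots> \<le> degree H" using False degree_monom_le[of "lead_coeff H" "degree H - degree f"] by linarith
      finally show "degree (?M * f) \<le> degree H" .
    qed (rule degree_smult_le)
    moreover have "coeff H' (degree H) = 0"
    proof -
      have "coeff (?M * f) (degree H) = lead_coeff H * lead_coeff f"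
        using False by (simp only: coeff_monom_mult) simp
      then show ?thesis unfolding H'_def coeff_diff coeff_smult by (simp only: mult.commute diff_self)
    qed
    ultimately have "degree H' < degree H"
      using eq_zero_or_degree_less[of H' "degree H"] f(2) False by auto
    from less.hyps[OF this H'] obtain m Q R where QR: "Q \<in> cpoly n" "R \<in> cpoly n"
      "smult (?c ^ m) H' = Q * f + R" "degree R < degree f" by auto
    have "smult (?c ^ Suc m) H = smult (?c ^ m) H' + smult (?c ^ m) (?M * f)"
      unfolding H'_def smult_diff_right by (simp add: mult.commute)
    also have "\<dots> = (Q + smult (?c ^ m) ?M) * f + R"
      by (simp add: QR(3) distrib_right)
    finally have "smult (?c ^ Suc m) H = (Q + smult (?c ^ m) ?M) * f + R" .
    moreover have "Q + smult (?c ^ m) ?M \<in> cpoly n"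
      using QR M f by (intro cpoly_add cpoly_smult PV_power cpoly_coeff)
    ultimately show ?thesis using QR by (intro exI[of _ "Suc m"] bexI[of _ "Q + smult (?c ^ m) ?M"] bexI[of _ R]) auto
  qed
qed

lemma infinite_alg_closed: "infinite (UNIV :: 'K::alg_closed_field set)"
proof
  assume fin: "finite (UNIV :: 'K set)"
  let ?P = "(\<Prod>a\<in>(UNIV :: 'K set). [:- a, 1:]) + 1"
  have "degree (\<Prod>a\<in>(UNIV :: 'K set). [:- a, 1:]) = card (UNIV :: 'K set)"
    by (subst degree_prod_eq_sum_degree) auto
  moreover have "card (UNIV :: 'K set) > 0" using fin by (simp add: card_gt_0_iff)
  ultimately have "degree ?P > 0" by (subst degree_add_eq_left) auto
  then obtain x where "poly ?P x = 0" using alg_closed_imp_poly_has_root by blast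
  moreover have "poly (\<Prod>a\<in>(UNIV :: 'K set). [:- a, 1:]) x = 0"
    using fin by (simp add: poly_prod prod_zero_iff)
  ultimately show False by simp
qed

lemma rhom_field_inj: "rhom \<phi> \<Longrightarrow> \<phi> c = 0 \<longleftrightarrow> c = 0" for c :: "'k::field" and \<phi> :: "'k \<Rightarrow> 'l::field"
  by (metis mult_zero_left rhomD(1,2,4) right_inverse zero_neq_one)

lemma meval_PV_upd: "F \<in> PV n \<Longrightarrow> meval \<phi> F (z(n := b)) = meval \<phi> F z"
  by (rule meval_cong_keys) (auto simp: kset_def)

lemma meval_poly_upd:
  assumes "rhom \<phi>" "P \<in> cpoly n"
  shows "meval \<phi> (poly P (Vr n)) (z(n := b)) = poly (map_poly (\<lambda>c. meval \<phi> c z) P) b"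
proof -
  let ?h = "\<lambda>c. meval \<phi> c (z(n := b))"
  have h: "rhom ?h" by (rule meval_rhom[OF assms(1)])
  have "meval \<phi> (poly P (Vr n)) (z(n := b)) = poly (map_poly ?h P) (?h (Vr n))"
    using poly_map_poly_rhom[OF h] by simp
  also have "map_poly ?h P = map_poly (\<lambda>c. meval \<phi> c z) P"
    using assms(2) by (intro poly_eqI) (simp add: coeff_map_poly meval_hom[OF assms(1)] meval_PV_upd cpoly_coeff)
  also have "?h (Vr n) = b" by (subst meval_Vr[OF assms(1)]) simp
  finally show ?thesis .
qed

lemma PV_0_Cst:
  assumes "F \<in> PV 0" shows "\<exists>c. F = Cst c"
proof -
  have "prt {0} F = F" using assms by (intro prt_same) (auto simp: kset_def)
  then have "F = Cst (lkp F 0)"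
    by (metis Cst_def lkp_prt lookup_single_eq lookup_single_not_eq poly_mapping_eqI singletonD)
  then show ?thesis by blast
qed

text \<open>Induction on n, eliminating the last variable x. If every element of \<open>p\<close>
  has all its coefficients in \<open>p\<close>, then x is transcendental modulo \<open>p\<close> and
  may take almost any value. Otherwise x is algebraic, and its value is a root of a relation
  \<open>f\<close> of least degree. In that case the condition on \<open>g\<close> is passed down
  through a multiple of \<open>g\<close> that is congruent modulo \<open>p\<close> to some
  \<open>w\<close> free of x; it plays the part of a norm.\<close>

theorem nullstellensatz_prime:
  fixes \<phi> :: "'k::field \<Rightarrow> 'K::alg_closed_field"
  assumes \<phi>: "rhom \<phi>" and p: "is_prime p" and "g \<in> PV n" "g \<notin> p"
  shows "\<exists>z. (\<forall>F\<in>p \<inter> PV n. meval \<phi> F z = 0) \<and> meval \<phi> g z \<noteq> 0"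
  using assms(3,4)
proof (induction n arbitrary: g)
  case 0
  note c = PV_0_Cst
  have z: "F = 0" if F: "F \<in> p" "F \<in> PV 0" for F
  proof -
    obtain d where d: "F = Cst d" using c[OF F(2)] by blast
    have "d = 0"
    proof (rule ccontr)
      assume "d \<noteq> 0"
      then have "Cst (inverse d) * F = 1" using Cst_inverse[of d 1] by (simp add: d)
      then show False using rm.subspace_scale[OF primeD(1)[OF p] F(1), of "Cst (inverse d)"] primeD(2)[OF p] by simp
    qed
    then show ?thesis by (simp add: d Cst_0)
  qed
  obtain d where d: "g = Cst d" using c[OF 0(1)] by blast
  have "d \<noteq> 0" using 0(2) rm.subspace_0[OF primeD(1)[OF p]] d Cst_0 by metis
  then have "meval \<phi> g (\<lambda>_. 0) \<noteq> 0"
    using rhom_field_inj[OF \<phi>, of d] by (simp add: d meval_Cst[OF \<phi>])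
  moreover have "meval \<phi> F (\<lambda>_. 0) = 0" if "F \<in> p \<inter> PV 0" for F
    using z[OF IntD1[OF that] IntD2[OF that]] by (simp add: meval_def)
  ultimately show ?case by (intro exI[of _ "\<lambda>_. 0"] conjI ballI)
next
  case (Suc n)
  note pI = primeD(1)[OF p]
  let ?x = "Vr n :: 'k mpoly"
  have dec: "\<exists>P\<in>cpoly n. F = poly P ?x" if "F \<in> PV (Suc n)" for F :: "'k mpoly"
    using PV_decompose[OF that] by (auto simp: cpoly_def)
  obtain G where G: "G \<in> cpoly n" "g = poly G ?x" using dec[OF Suc.prems(1)] by (rule bexE)
  show ?case
  proof (cases "\<forall>P\<in>cpoly n. poly P ?x \<in> p \<longrightarrow> (\<forall>i. coeff P i \<in> p)")
    case True
    obtain i where i: "coeff G i \<notin> p" using poly_in_ideal[OF pI, of G ?x] G Suc.prems(2) by auto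
    from Suc.IH[OF cpoly_coeff[OF G(1)] i] obtain z
      where zz: "(\<forall>F\<in>p \<inter> PV n. meval \<phi> F z = 0) \<and> meval \<phi> (coeff G i) z \<noteq> 0" by (rule exE)
    note z = conjunct1[OF zz] conjunct2[OF zz]
    let ?G = "map_poly (\<lambda>c. meval \<phi> c z) G"
    have "coeff ?G i \<noteq> 0" using z(2) by (simp add: coeff_map_poly meval_hom[OF \<phi>])
    then have "?G \<noteq> 0" by auto
    then have "finite {b. poly ?G b = 0}" by (rule poly_roots_finite)
    then obtain b where b: "poly ?G b \<noteq> 0"
      using infinite_alg_closed[where 'K='K] by (metis (mono_tags, lifting) UNIV_I finite_subset mem_Collect_eq subsetI)
    have "meval \<phi> F (z(n := b)) = 0" if F: "F \<in> p \<inter> PV (Suc n)" for F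
    proof -
      obtain P where P: "P \<in> cpoly n" "F = poly P ?x" using dec[OF IntD2[OF F]] by (rule bexE)
      then have "\<forall>i. coeff P i \<in> p \<inter> PV n" using True F cpoly_coeff by auto
      then have "map_poly (\<lambda>c. meval \<phi> c z) P = 0"
        using z(1) by (intro poly_eqI) (simp add: coeff_map_poly meval_hom[OF \<phi>])
      then show ?thesis unfolding P(2) meval_poly_upd[OF \<phi> P(1)] by simp
    qed
    moreover have "meval \<phi> g (z(n := b)) \<noteq> 0" unfolding G(2) meval_poly_upd[OF \<phi> G(1)] by (rule b)
    ultimately show ?thesis by (intro exI[of _ "z(n := b)"] conjI ballI)
  next
    case False
    define A where "A f \<longleftrightarrow> f \<in> cpoly n \<and> poly f ?x \<in> p \<and> lead_coeff f \<notin> p" for f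
    have strip: "\<exists>P'. A P' \<and> degree P' \<le> degree P"
      if P: "P \<in> cpoly n" "poly P ?x \<in> p" "coeff P i \<notin> p" for P i
    proof -
      obtain P' where P': "P' \<in> cpoly n" "degree P' \<le> degree P" "lead_coeff P' \<notin> p" "poly P ?x - poly P' ?x \<in> p"
        using cpoly_strip[OF pI P(1,3), of ?x] by blast
      have "poly P' ?x \<in> p" using rm.subspace_diff[OF pI P(2) P'(4)] by simp
      then show ?thesis using P' unfolding A_def by blast
    qed
    obtain f0 where "A f0" using False strip by blast
    then obtain f where f: "A f" and fmin: "\<And>f'. A f' \<Longrightarrow> degree f \<le> degree f'"
      using ex_has_least_nat[of A f0 degree] by blast
    have fc: "f \<in> cpoly n" and fp: "poly f ?x \<in> p" and fl: "lead_coeff f \<notin> p" using f by (auto simp: A_def)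
    have small: "coeff R i \<in> p" if R: "R \<in> cpoly n" "poly R ?x \<in> p" "degree R < degree f" for R i
    proof (rule ccontr)
      assume i: "coeff R i \<notin> p"
      obtain P' where P': "A P' \<and> degree P' \<le> degree R" using strip[OF R(1,2) i] by (rule exE)
      then show False using fmin[of P'] R(3) by simp
    qed
    have e: "0 < degree f"
    proof (rule ccontr)
      assume "\<not> 0 < degree f"
      then obtain a where "f = [:a:]" by (elim degree_eq_zeroE[OF not_gr_zero[THEN iffD1]])
      then show False using fp fl by simp
    qed
    \<comment> \<open>Multiples of \<open>g\<close> modulo \<open>p\<close> that do not vanish
      modulo \<open>p\<close>. One of least degree in the last variable will turn out to be constant
      in it.\<close>
    define B where "B W \<longleftrightarrow> W \<in> cpoly n \<and> poly W ?x \<notin> p \<and> lead_coeff W \<notin> p \<and>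
      (\<exists>v\<in>PV (Suc n). poly W ?x - v * g \<in> p)" for W
    have stripB: "\<exists>P'. B P' \<and> degree P' \<le> degree P"
      if P: "P \<in> cpoly n" "poly P ?x \<notin> p" "v \<in> PV (Suc n)" "poly P ?x - v * g \<in> p" for P v
    proof -
      obtain i where "coeff P i \<notin> p" using poly_in_ideal[OF pI, of P ?x] P(2) by blast
      then obtain P' where P': "P' \<in> cpoly n" "degree P' \<le> degree P" "lead_coeff P' \<notin> p" "poly P ?x - poly P' ?x \<in> p"
        using cpoly_strip[OF pI P(1), of i ?x] by blast
      have "poly P' ?x \<notin> p" using rm.subspace_add[OF pI P'(4), of "poly P' ?x"] P(2) by auto
      moreover have "poly P' ?x - v * g \<in> p" using rm.subspace_diff[OF pI P(4) P'(4)] by simp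
      ultimately have "B P'" unfolding B_def using P' P(3) by blast
      then show ?thesis using P'(2) by blast
    qed
    have "1 \<in> PV (Suc n)" "poly G ?x - 1 * g \<in> p" using G(2) rm.subspace_0[OF pI] by simp_all
    then obtain W0 where "B W0" using stripB[OF G(1)] G(2) Suc.prems(2) by blast
    then obtain W where W: "B W" and Wmin: "\<And>W'. B W' \<Longrightarrow> degree W \<le> degree W'"
      using ex_has_least_nat[of B W0 degree] by blast
    obtain v where v: "v \<in> PV (Suc n)" "poly W ?x - v * g \<in> p" using W by (auto simp: B_def)
    have Wc: "W \<in> cpoly n" and Wp: "poly W ?x \<notin> p" and Wl: "lead_coeff W \<notin> p" using W by (auto simp: B_def)
    \<comment> \<open>Suppose the degree is positive. Division of \<open>W\<close> by
      \<open>f\<close> and minimality of \<open>W\<close> give a degree below that of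
      \<open>f\<close>. Division of \<open>f\<close> by \<open>W\<close> leaves a remainder in
      \<open>p\<close>, hence a quotient in \<open>p\<close>. Both have smaller degree than
      \<open>f\<close>, so all their coefficients lie in \<open>p\<close>, and then so does a
      product of leading coefficients.\<close>
    have W0: "degree W = 0"
    proof (rule ccontr)
      assume d: "degree W \<noteq> 0"
      let ?c = "lead_coeff f" and ?w = "lead_coeff W"
      have lt: "degree W < degree f"
      proof -
        obtain m Q R where QR: "Q \<in> cpoly n" "R \<in> cpoly n" "smult (?c ^ m) W = Q * f + R" "degree R < degree f"
          using cpoly_division[OF fc e Wc] by (elim exE bexE conjE)
        have eq: "poly R ?x = ?c ^ m * poly W ?x - poly Q ?x * poly f ?x"
          using arg_cong[OF QR(3), of "\<lambda>P. poly P ?x"] by simp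
        have "?c ^ m * poly W ?x \<notin> p" using primeD(3)[OF p] prime_power[OF p] fl Wp by blast
        moreover have qf: "poly Q ?x * poly f ?x \<in> p" by (rule rm.subspace_scale[OF pI fp])
        ultimately have "poly R ?x \<notin> p" using rm.subspace_add[OF pI _ qf, of "poly R ?x"] by (auto simp: eq)
        moreover have "poly R ?x - (?c ^ m * v) * g \<in> p"
        proof -
          have "?c ^ m * (poly W ?x - v * g) - poly Q ?x * poly f ?x \<in> p"
            by (rule rm.subspace_diff[OF pI rm.subspace_scale[OF pI v(2)] qf])
          then show ?thesis by (simp add: eq algebra_simps)
        qed
        moreover have "?c ^ m * v \<in> PV (Suc n)"
          by (intro PV_mult PV_power v PV_mono[of n "Suc n"] cpoly_coeff[OF fc]) auto
        ultimately obtain R' where "B R'" "degree R' \<le> degree R" using stripB[OF QR(2)] by blast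
        then show ?thesis using Wmin[of R'] QR(4) by simp
      qed
      obtain m Q R where QR: "Q \<in> cpoly n" "R \<in> cpoly n" "smult (?w ^ m) f = Q * W + R" "degree R < degree W"
        using cpoly_division[OF Wc _ fc] d by auto
      have eq: "poly R ?x = ?w ^ m * poly f ?x - poly Q ?x * poly W ?x"
        using arg_cong[OF QR(3), of "\<lambda>P. poly P ?x"] by simp
      have wf: "?w ^ m * poly f ?x \<in> p" by (rule rm.subspace_scale[OF pI fp])
      have Rp: "poly R ?x \<in> p"
      proof (rule ccontr)
        assume R: "poly R ?x \<notin> p"
        have "?w ^ m * poly f ?x - poly Q ?x * (poly W ?x - v * g) \<in> p"
          by (rule rm.subspace_diff[OF pI wf rm.subspace_scale[OF pI v(2)]])
        then have "poly R ?x - (- poly Q ?x * v) * g \<in> p" by (simp add: eq algebra_simps)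
        moreover have "- poly Q ?x * v \<in> PV (Suc n)"
          by (intro PV_mult kset_uminus v cpoly_poly QR)
        ultimately obtain R' where "B R'" "degree R' \<le> degree R" using stripB[OF QR(2) R] by blast
        then show False using Wmin[of R'] QR(4) by simp
      qed
      have "poly Q ?x * poly W ?x \<in> p" using rm.subspace_diff[OF pI wf Rp] by (simp add: eq)
      then have Qp: "poly Q ?x \<in> p" using primeD(3)[OF p] Wp by blast
      have "degree Q < degree f"
      proof (cases "Q = 0")
        case False
        have "W \<noteq> 0" using d by auto
        then have "degree Q + degree W = degree (Q * W)" using False by (simp add: degree_mult_eq)
        also have "Q * W = smult (?w ^ m) f - R" using QR(3) by simp
        also have "degree \<dots> \<le> degree f"
          using QR(4) lt by (intro degree_diff_le degree_smult_le) auto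
        finally show ?thesis using d by simp
      qed (use e in simp)
      then have Qc: "coeff Q i \<in> p" for i using small[OF QR(1) Qp] by blast
      have Rc: "coeff R i \<in> p" for i using small[OF QR(2) Rp] QR(4) lt by simp
      have "coeff (Q * W + R) i \<in> p" for i
      proof -
        have "coeff (Q * W) i \<in> p"
          unfolding coeff_mult
          by (intro rm.subspace_sum[OF pI]) (metis Qc mult.commute rm.subspace_scale[OF pI])
        then show ?thesis using rm.subspace_add[OF pI _ Rc] by simp
      qed
      then have "?w ^ m * ?c \<in> p" using QR(3) by (metis coeff_smult)
      then show False using primeD(3)[OF p] prime_power[OF p] fl Wl by blast
    qed
    define w where "w = lead_coeff W"
    have Ww: "poly W ?x = w" using W0 by (elim degree_eq_zeroE) (simp add: w_def)
    \<comment> \<open>Keeping the leading coefficient of \<open>f\<close> nonzero too makes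
      \<open>f\<close> specialise to a polynomial of positive degree, which has a root, and allows
      the factors introduced by pseudo-division to be cancelled.\<close>
    have "w * lead_coeff f \<notin> p" using primeD(3)[OF p] fl Wl w_def by blast
    moreover have "w * lead_coeff f \<in> PV n" unfolding w_def by (intro PV_mult cpoly_coeff fc Wc)
    ultimately have "\<exists>z. (\<forall>F\<in>p \<inter> PV n. meval \<phi> F z = 0) \<and> meval \<phi> (w * lead_coeff f) z \<noteq> 0"
      using Suc.IH[of "w * lead_coeff f"] by simp
    then obtain z where zz: "(\<forall>F\<in>p \<inter> PV n. meval \<phi> F z = 0) \<and> meval \<phi> (w * lead_coeff f) z \<noteq> 0"
      by (rule exE)
    note z = conjunct1[OF zz] conjunct2[OF zz]
    have wz: "meval \<phi> w z \<noteq> 0" and cz: "meval \<phi> (lead_coeff f) z \<noteq> 0"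
      using z(2) by (auto simp: meval_hom[OF \<phi>])
    let ?f = "map_poly (\<lambda>c. meval \<phi> c z) f"
    have "coeff ?f (degree f) \<noteq> 0" using cz by (simp add: coeff_map_poly meval_hom[OF \<phi>])
    then have "0 < degree ?f" using e le_degree[of ?f "degree f"] by linarith
    then obtain b where b: "poly ?f b = 0" using alg_closed_imp_poly_has_root by blast
    let ?z = "z(n := b)"
    have fz: "meval \<phi> (poly f ?x) ?z = 0" unfolding meval_poly_upd[OF \<phi> fc] by (rule b)
    have van: "meval \<phi> F ?z = 0" if F: "F \<in> p \<inter> PV (Suc n)" for F
    proof -
      obtain H where H: "H \<in> cpoly n" "F = poly H ?x" using dec[OF IntD2[OF F]] by (rule bexE)
      obtain m Q R where QR: "Q \<in> cpoly n" "R \<in> cpoly n" "smult (lead_coeff f ^ m) H = Q * f + R" "degree R < degree f"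
        using cpoly_division[OF fc e H(1)] by (elim exE bexE conjE)
      have eq: "lead_coeff f ^ m * F = poly Q ?x * poly f ?x + poly R ?x"
        using arg_cong[OF QR(3), of "\<lambda>P. poly P ?x"] by (simp add: H(2))
      have "poly R ?x = lead_coeff f ^ m * F - poly Q ?x * poly f ?x" by (simp add: eq)
      moreover have "lead_coeff f ^ m * F - poly Q ?x * poly f ?x \<in> p"
        using F by (intro rm.subspace_diff rm.subspace_scale pI fp) auto
      ultimately have "poly R ?x \<in> p" by simp
      then have "\<forall>i. coeff R i \<in> p \<inter> PV n" using small[OF QR(2)] QR(2,4) cpoly_coeff by blast
      then have "map_poly (\<lambda>c. meval \<phi> c z) R = 0"
        using z(1) by (intro poly_eqI) (simp add: coeff_map_poly meval_hom[OF \<phi>])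
      then have "meval \<phi> (poly R ?x) ?z = 0" unfolding meval_poly_upd[OF \<phi> QR(2)] by simp
      then have "meval \<phi> (lead_coeff f ^ m * F) ?z = 0" unfolding eq by (simp add: meval_hom[OF \<phi>] fz)
      then show ?thesis using cz by (simp add: meval_hom[OF \<phi>] meval_PV_upd cpoly_coeff[OF fc])
    qed
    have "poly W ?x - v * g \<in> p \<inter> PV (Suc n)"
      using v by (auto intro!: kset_minus PV_mult Suc.prems cpoly_poly Wc)
    from van[OF this] have "meval \<phi> v ?z * meval \<phi> g ?z = meval \<phi> w ?z" by (simp add: Ww meval_hom[OF \<phi>])
    also have "\<dots> = meval \<phi> w z" unfolding w_def by (rule meval_PV_upd[OF cpoly_coeff[OF Wc]])
    finally have "meval \<phi> g ?z \<noteq> 0" using wz by auto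
    then show ?thesis using van by (intro exI[of _ ?z] conjI ballI)
  qed
qed

subsection \<open>Homogeneous ideals\<close>

definition hp :: "nat \<Rightarrow> 'k::comm_ring_1 mpoly \<Rightarrow> 'k mpoly" where
  "hp d F = prt {m. mdeg m = d} F"

lemma hp_add: "hp d (F + G) = hp d F + hp d G" and hp_0 [simp]: "hp d 0 = 0"
  and hp_single: "hp d (sgl m c) = (if mdeg m = d then sgl m c else 0)"
  by (simp_all add: hp_def prt_add prt_single)

lemma hp_single_mult:
  fixes F :: "'k::comm_ring_1 mpoly"
  shows "hp d (sgl \<mu> c * F) = (if mdeg \<mu> \<le> d then sgl \<mu> c * hp (d - mdeg \<mu>) F else 0)"
proof (induction F rule: mpoly_induct)
  case (single m a)
  then show ?case by (auto simp: mult_single hp_single mdeg_add)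
qed (auto simp: distrib_left hp_add)

lemma hp_mult:
  fixes F G :: "'k::comm_ring_1 mpoly"
  shows "hp n (F * G) = (\<Sum>k\<le>n. hp k F * hp (n - k) G)"
proof (induction F rule: mpoly_induct)
  case (single m c)
  have "(\<Sum>k\<le>n. hp k (sgl m c) * hp (n - k) G) = (\<Sum>k\<le>n. if k = mdeg m then sgl m c * hp (n - mdeg m) G else 0)"
    by (rule sum.cong) (auto simp: hp_single)
  then show ?case by (simp add: hp_single_mult)
qed (simp add: hp_add distrib_right sum.distrib)

lemma sum_hp: "F = (\<Sum>d\<in>mdeg ` kys F. hp d F)"
proof (rule poly_mapping_eqI)
  fix m
  have "(\<Sum>d\<in>mdeg ` kys F. lkp (hp d F) m) = (\<Sum>d\<in>mdeg ` kys F. if d = mdeg m then lkp F m else 0)"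
    by (rule sum.cong) (auto simp: hp_def lkp_prt)
  then show "lkp F m = lkp (\<Sum>d\<in>mdeg ` kys F. hp d F) m"
    by (auto simp: lookup_sum in_keys_iff)
qed

text \<open>For an ideal \<open>p\<close> this is the largest homogeneous ideal inside it.\<close>

definition star :: "'k::comm_ring_1 mpoly set \<Rightarrow> 'k mpoly set" where
  "star p = {F. \<forall>d. hp d F \<in> p}"

lemma star_subset: "rm.subspace p \<Longrightarrow> star p \<subseteq> p"
proof
  fix F assume p: "rm.subspace p" and F: "F \<in> star p"
  have "(\<Sum>d\<in>mdeg ` kys F. hp d F) \<in> p"
    by (rule rm.subspace_sum[OF p]) (use F in \<open>simp add: star_def\<close>)
  then show "F \<in> p" using sum_hp[of F] by simp
qed

lemma star_ideal:
  assumes p: "rm.subspace p" shows "rm.subspace (star p)"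
  unfolding rm.subspace_def
proof (intro conjI ballI allI)
  show "0 \<in> star p" by (simp add: star_def rm.subspace_0[OF p])
  show "F + G \<in> star p" if "F \<in> star p" "G \<in> star p" for F G
    using that by (simp add: star_def hp_add rm.subspace_add[OF p])
  show "r * F \<in> star p" if F: "F \<in> star p" for r F
  proof (induction r rule: mpoly_induct)
    case (single m c)
    then show ?case
      using F by (simp add: star_def hp_single_mult rm.subspace_0[OF p] rm.subspace_scale[OF p])
  qed (simp add: star_def distrib_right hp_add rm.subspace_add[OF p])
qed

lemma hp_hp: "hp d (hp e F) = (if d = e then hp d F else 0)"
  by (rule poly_mapping_eqI) (auto simp: hp_def lkp_prt)

lemma star_star: "rm.subspace p \<Longrightarrow> star (star p) = star p"
  by (auto simp: star_def hp_hp rm.subspace_0)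

lemma star_mono: "p \<subseteq> p' \<Longrightarrow> star p \<subseteq> star p'"
  by (auto simp: star_def)

text \<open>If \<open>a\<close> and \<open>b\<close> both have components outside \<open>p\<close>,
  let those of lowest degrees i and j be taken. Modulo \<open>p\<close> their product is the
  component of degree i + j of \<open>a * b\<close>.\<close>

lemma star_prime:
  assumes p: "is_prime p" shows "is_prime (star p)"
  unfolding is_prime_def
proof (intro conjI allI impI)
  note pI = primeD(1)[OF p]
  show "rm.subspace (star p)" by (rule star_ideal[OF pI])
  show "1 \<notin> star p" using star_subset[OF pI] primeD(2)[OF p] by blast
  fix a b assume ab: "a * b \<in> star p"
  show "a \<in> star p \<or> b \<in> star p"
  proof (rule ccontr)
    assume "\<not> (a \<in> star p \<or> b \<in> star p)"
    then obtain i0 j0 where ij0: "hp i0 a \<notin> p" "hp j0 b \<notin> p" by (auto simp: star_def)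
    have "\<exists>i. hp i a \<notin> p \<and> (\<forall>k<i. \<not> hp k a \<notin> p)"
      by (rule exists_least_iff[THEN iffD1]) (rule exI, rule ij0(1))
    then obtain i where i: "hp i a \<notin> p" "\<forall>k<i. \<not> hp k a \<notin> p" by (elim exE conjE)
    have "\<exists>j. hp j b \<notin> p \<and> (\<forall>k<j. \<not> hp k b \<notin> p)"
      by (rule exists_least_iff[THEN iffD1]) (rule exI, rule ij0(2))
    then obtain j where j: "hp j b \<notin> p" "\<forall>k<j. \<not> hp k b \<notin> p" by (elim exE conjE)
    have E: "hp (i + j) (a * b) = hp i a * hp j b + (\<Sum>k\<in>{..i + j} - {i}. hp k a * hp (i + j - k) b)"
      unfolding hp_mult by (subst sum.remove[of _ i]) auto
    have S: "(\<Sum>k\<in>{..i + j} - {i}. hp k a * hp (i + j - k) b) \<in> p"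
    proof (rule rm.subspace_sum[OF pI])
      fix k assume "k \<in> {..i + j} - {i}"
      then consider "k < i" | "i + j - k < j" by (cases "k < i") auto
      then show "hp k a * hp (i + j - k) b \<in> p"
      proof cases
        case 1
        then have "hp k a \<in> p" using i(2) by simp
        from rm.subspace_scale[OF pI this, of "hp (i + j - k) b"] show ?thesis by (simp only: mult.commute)
      next
        case 2
        then show ?thesis using j(2) by (intro rm.subspace_scale[OF pI]) simp
      qed
    qed
    have H: "hp (i + j) (a * b) \<in> p" using ab by (simp add: star_def)
    from rm.subspace_diff[OF pI H S] have "hp i a * hp j b \<in> p" unfolding E by (simp only: add_diff_cancel_right')
    from primeD(3)[OF p this] show False using i(1) j(1) by simp
  qed
qed

lemma forms_star:
  assumes "rm.subspace p" "F \<in> p" "F \<in> forms n d" shows "F \<in> star p"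
proof -
  have "hp e F = (if e = d then F else 0)" for e
    using assms(3) prt_same[of F "{m. mdeg m = e}"] prt_disjoint[of F "{m. mdeg m = d}" "{m. mdeg m = e}"]
    by (auto simp: hp_def forms_eq kset_def)
  then show ?thesis using assms(1,2) by (simp add: star_def rm.subspace_0)
qed

lemma Vr_forms: "i < n \<Longrightarrow> Vr i \<in> forms n 1"
  by (auto simp: forms_eq Vr_def kset_def)

subsection \<open>Chains of homogeneous primes from local growth\<close>

text \<open>Translation taking \<open>z\<close> to the origin, where the order of vanishing can be
  read off from the degrees of the monomials.\<close>

definition shift :: "(nat \<Rightarrow> 'k::comm_ring_1) \<Rightarrow> 'k mpoly \<Rightarrow> 'k mpoly" where
  "shift z F = psub (\<lambda>i. Vr i + Cst (z i)) F"

lemma rhom_shift: "rhom (shift z)"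
  unfolding shift_def by (rule rhom_psub)

lemma shift_Vr [simp]: "shift z (Vr i) = Vr i + Cst (z i)" and shift_Cst [simp]: "shift z (Cst c) = Cst c"
  by (simp_all add: shift_def)

lemma shift_shift: "shift z (shift y F) = shift (\<lambda>i. z i + y i) F"
proof -
  have "shift z (Vr i + Cst (y i)) = Vr i + Cst (z i + y i)" for i
    by (simp add: rhomD[OF rhom_shift] rhomD[OF rhom_Cst] add.assoc)
  then show ?thesis unfolding shift_def psub_psub by (simp add: shift_def)
qed

lemma shift_0: "shift (\<lambda>_. 0) F = F"
  by (simp add: shift_def rhomD[OF rhom_Cst])

lemma shift_inverse: "shift z (shift (\<lambda>i. - z i) F) = F" "shift (\<lambda>i. - z i) (shift z F) = F"
  by (simp_all add: shift_shift shift_0)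

lemma mdeg_eq_0: "mdeg m = 0 \<longleftrightarrow> m = 0"
  by (metis lkp_le_mdeg le_zero_eq lookup_zero mdeg_0 poly_mapping_eqI)

lemma meval_zero: "rhom \<phi> \<Longrightarrow> meval \<phi> F (\<lambda>_. 0) = \<phi> (lkp F 0)"
proof (induction F rule: mpoly_induct)
  case (single m c)
  show ?case
  proof (cases "m = 0")
    case False
    then obtain i where "i \<in> kys m" by (metis ex_in_conv keys_eq_empty)
    then have "(\<Prod>i\<in>kys m. (0 :: 'b) ^ lkp m i) = 0" by (intro prod_zero bexI[of _ i]) (auto simp: in_keys_iff power_0_left)
    then show ?thesis using single False by (simp add: meval_single rhomD lookup_single)
  qed (use single in \<open>simp add: meval_single rhomD\<close>)
qed (simp add: meval_hom lookup_add rhomD)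

abbreviation ev :: "(nat \<Rightarrow> 'k::comm_ring_1) \<Rightarrow> 'k mpoly \<Rightarrow> 'k" where
  "ev z F \<equiv> meval (\<lambda>x. x) F z"

lemma lkp_shift_0: "lkp (shift z F) 0 = ev z F"
proof -
  have "ev (\<lambda>_. 0) (shift z F) = ev z F"
    unfolding shift_def by (simp add: meval_psub[OF rhom_id] meval_hom[OF rhom_id] meval_Vr[OF rhom_id] meval_Cst[OF rhom_id])
  then show ?thesis by (simp add: meval_zero[OF rhom_id])
qed

text \<open>The polynomials vanishing at \<open>z\<close> to order at least
  \<open>s\<close>.\<close>

definition Wz :: "(nat \<Rightarrow> 'k::comm_ring_1) \<Rightarrow> nat \<Rightarrow> 'k mpoly set" where
  "Wz z s = {F. shift z F \<in> dge s}"

lemma dge_ideal: "rm.subspace (dge s)"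
  unfolding rm.subspace_def
  by (auto intro: kset_add kset_mult[of _ UNIV _ "{m. s \<le> mdeg m}"] simp: mdeg_add)

lemma dge_0 [simp]: "dge 0 = UNIV" by (auto simp: kset_def)

lemma dge_1: "F \<in> dge (Suc 0) \<longleftrightarrow> lkp F 0 = 0"
  by (auto simp: kset_def in_keys_iff subset_iff Suc_le_eq mdeg_eq_0 neq0_conv[symmetric] simp del: neq0_conv)

lemma Wz_ideal: "rm.subspace (Wz z s)"
  using dge_ideal[of s] by (auto simp: rm.subspace_def Wz_def rhomD[OF rhom_shift])

lemma Wz_0 [simp]: "Wz z 0 = UNIV" by (simp add: Wz_def)

lemma Wz_1: "F \<in> Wz z (Suc 0) \<longleftrightarrow> ev z F = 0"
  by (simp add: Wz_def dge_1 lkp_shift_0)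

lemma Wz_mult: "F \<in> Wz z a \<Longrightarrow> G \<in> Wz z b \<Longrightarrow> F * G \<in> Wz z (a + b)"
  using dge_mult by (simp add: Wz_def rhomD[OF rhom_shift])

lemma Wz_power: "F \<in> Wz z (Suc 0) \<Longrightarrow> F ^ s \<in> Wz z s"
  using dge_power[of "shift z F" "Suc 0" s] by (simp add: Wz_def rhom_power[OF rhom_shift])

text \<open>Multiplication by \<open>t\<close> raises the order at \<open>z\<close>, so the Hilbert
  function of \<open>J\<close> increases from s to s + 1 by at most the value at s + 1 of that of
  \<open>J + (t)\<close>. Summation gives one more power of s: a hypersurface through
  \<open>z\<close> lowers the local dimension by at most one.\<close>

lemma growth_step:
  assumes J: "rm.subspace J" and t: "ev z t = 0"
    and g: "growth_le (Wz z) d (rm.span (insert t J))"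
  shows "growth_le (Wz z) (Suc d) J"
proof -
  obtain C where "\<forall>s. codim_le (rm.span (insert t J) \<union> Wz z s) (C * (s + 1) ^ d)"
    using g unfolding growth_le_def by (rule exE)
  then have C: "codim_le (rm.span (insert t J) \<union> Wz z s) (C * (s + 1) ^ d)" for s by (rule spec)
  have "codim_le (J \<union> Wz z s) (C * s * (s + 1) ^ d)" for s
  proof (induction s)
    case 0
    have "codim_le (UNIV :: 'a mpoly set) 0" by (rule codim_le_0) auto
    then show ?case by simp
  next
    case (Suc s)
    have "codim_le (J \<union> Wz z (Suc s)) (C * s * (s + 1) ^ d + C * (Suc s + 1) ^ d)"
    proof (rule codim_le_colon[OF Suc C[of "Suc s"], of t])
      fix v assume "v \<in> J \<union> Wz z s"
      then have "t * v \<in> J \<union> Wz z (Suc s)"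
        using rm.subspace_scale[OF J, of v t] Wz_mult[of t z "Suc 0" v s] t by (auto simp: Wz_1)
      then show "t * v \<in> mp.span (J \<union> Wz z (Suc s))" by (rule mp.span_base)
    next
      let ?V = "(J \<union> Wz z (Suc s)) \<union> range (\<lambda>r. t * r)"
      have "x \<in> mp.span ?V" if x: "x \<in> rm.span (insert t J)" for x
      proof -
        obtain k where "x - k * t \<in> rm.span J" using x by (auto simp: rm.span_insert)
        then have "x - k * t \<in> J" using J by (simp add: rm.span_eq_iff[THEN iffD2])
        then have "(x - k * t) + t * k \<in> mp.span ?V" by (intro mp.span_add mp.span_base) auto
        then show ?thesis by (simp add: mult.commute)
      qed
      then show "rm.span (insert t J) \<union> Wz z (Suc s) \<subseteq> mp.span ?V"
        using mp.span_superset[of ?V] by auto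
    qed
    moreover have "C * s * (s + 1) ^ d + C * (Suc s + 1) ^ d \<le> C * Suc s * (Suc s + 1) ^ d"
    proof -
      have "(s + 1) ^ d \<le> (Suc s + 1) ^ d" by (rule power_mono) auto
      then have "C * s * (s + 1) ^ d \<le> C * s * (Suc s + 1) ^ d" by (rule mult_le_mono2)
      then show ?thesis by (simp add: algebra_simps)
    qed
    ultimately show ?case by (rule codim_le_mono[OF _ order_refl])
  qed
  moreover have "C * s * (s + 1) ^ d \<le> C * (s + 1) ^ Suc d" for s by (simp add: algebra_simps)
  ultimately have "codim_le (J \<union> Wz z s) (C * (s + 1) ^ Suc d)" for s
    by (rule codim_le_mono[OF _ order_refl])
  then show ?thesis by (rule growth_leI)
qed

text \<open>\<open>F\<close> is a unit near \<open>z\<close>: the polynomial G = 1 - F / F(z)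
  vanishes at \<open>z\<close>, so \<open>G ^ s\<close> lies in \<open>Wz z s\<close>, while
  \<open>1 - G ^ s\<close> is a multiple of \<open>F\<close>. Together \<open>J\<close> and
  \<open>Wz z s\<close> span everything.\<close>

lemma growth_unit:
  assumes J: "rm.subspace J" and F: "F \<in> J" "ev z F \<noteq> 0"
  shows "growth_le (Wz z) d J"
proof -
  define G where "G = 1 - Cst (inverse (ev z F)) * F"
  have G: "G \<in> Wz z (Suc 0)"
    using F(2) by (simp add: Wz_1 G_def meval_hom[OF rhom_id] meval_Cst[OF rhom_id])
  have "codim_le (J \<union> Wz z s) 0" for s
  proof -
    have "r \<in> mp.span (J \<union> Wz z s)" for r
    proof -
      have "1 - G ^ s = (\<Sum>i<s. G ^ i) * (1 - G)" by (simp add: one_diff_power_eq mult.commute)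
      also have "1 - G = Cst (inverse (ev z F)) * F" by (simp add: G_def)
      finally have "1 - G ^ s \<in> J" using rm.subspace_scale[OF J rm.subspace_scale[OF J F(1)]] by simp
      then have 1: "r * (1 - G ^ s) \<in> J" by (rule rm.subspace_scale[OF J])
      have "r * G ^ s \<in> Wz z s" by (rule rm.subspace_scale[OF Wz_ideal Wz_power[OF G]])
      then have "r * (1 - G ^ s) + r * G ^ s \<in> mp.span (J \<union> Wz z s)"
        using 1 by (intro mp.span_add mp.span_base) auto
      then show ?thesis by (simp add: algebra_simps)
    qed
    then show ?thesis unfolding codim_le_def by (intro exI[of _ "{}"]) auto
  qed
  then have "codim_le (J \<union> Wz z s) (0 * (s + 1) ^ d)" for s by simp
  then show ?thesis by (rule growth_leI)
qed

lemma ideal_of_point: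
  assumes J: "rm.subspace J" and x: "\<And>i. Vr i - Cst (z i) \<in> J" and F: "ev z F = 0"
  shows "F \<in> J"
proof -
  let ?A = "{G. shift (\<lambda>i. - z i) G \<in> J}"
  have "rm.subspace ?A" using J by (simp add: rm.subspace_def rhomD[OF rhom_shift])
  moreover have "Vr ` {0..} \<subseteq> ?A" using x by (auto simp: Cst_uminus)
  ultimately have A: "rm.span (Vr ` {0..}) \<subseteq> ?A" by (intro rm.span_minimal)
  have "shift z F \<in> kset (- vset 0)"
    using F by (simp add: kset_def flip: lkp_shift_0) (auto simp: in_keys_iff)
  with kset_Compl_vset[of 0] have "shift z F \<in> rm.span (Vr ` {0..})" by (rule subsetD)
  then have "shift z F \<in> ?A" by (rule subsetD[OF A])
  then show ?thesis by (simp add: shift_inverse)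
qed

text \<open>The ideal contains the equations of the line through the origin and \<open>z\<close>.
  Adding the equation that fixes coordinate j leaves the single point \<open>z\<close>, with growth
  0.\<close>

lemma growth_line:
  fixes J :: "'k::field mpoly set"
  assumes J: "rm.subspace J" and z: "z j \<noteq> 0" and t: "\<And>i. Cst (z j) * Vr i - Cst (z i) * Vr j \<in> J"
  shows "growth_le (Wz z) (Suc 0) J"
proof (rule growth_step[OF J])
  let ?w = "Vr j - Cst (z j)" and ?J = "rm.span (insert (Vr j - Cst (z j)) J)"
  show "ev z ?w = 0" by (simp add: meval_hom[OF rhom_id] meval_Vr[OF rhom_id] meval_Cst[OF rhom_id])
  have JJ: "rm.subspace ?J" by simp
  have "Vr i - Cst (z i) \<in> ?J" for i
  proof -
    have "Cst (inverse (z j)) * (Cst (z j) * Vr i - Cst (z i) * Vr j) \<in> ?J"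
      by (rule rm.subspace_scale[OF JJ]) (use t in \<open>simp add: rm.span_base\<close>)
    moreover have "Cst (inverse (z j)) * Cst (z i) * ?w \<in> ?J"
      by (rule rm.subspace_scale[OF JJ]) (simp add: rm.span_base)
    ultimately have "Cst (inverse (z j)) * (Cst (z j) * Vr i - Cst (z i) * Vr j) + Cst (inverse (z j)) * Cst (z i) * ?w \<in> ?J"
      by (rule rm.subspace_add[OF JJ])
    moreover have "Cst (inverse (z j)) * (Cst (z j) * Vr i - Cst (z i) * Vr j) + Cst (inverse (z j)) * Cst (z i) * ?w
       = Cst (inverse (z j)) * (Cst (z j) * Vr i) - Cst (inverse (z j)) * (Cst (z j) * Cst (z i))"
      by (simp add: algebra_simps)
    ultimately show ?thesis by (simp only: Cst_inverse[OF z])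
  qed
  then have m: "F \<in> ?J" if "ev z F = 0" for F by (rule ideal_of_point[OF JJ _ that])
  have "codim_le (?J \<union> Wz z s) (1 * (s + 1) ^ 0)" for s
  proof -
    have "F \<in> mp.span ({1} \<union> (?J \<union> Wz z s))" for F
    proof -
      have "F - Cst (ev z F) \<in> ?J"
        by (rule m) (simp add: meval_hom[OF rhom_id] meval_Cst[OF rhom_id])
      then have "Cst (ev z F) * 1 + (F - Cst (ev z F)) \<in> mp.span ({1} \<union> (?J \<union> Wz z s))"
        by (intro mp.span_add mp.span_scale mp.span_base) auto
      then show ?thesis by simp
    qed
    then show ?thesis unfolding codim_le_def by (intro exI[of _ "{1}"]) auto
  qed
  then show "growth_le (Wz z) 0 ?J" by (rule growth_leI)
qed

text \<open>One prime per step. A prime over \<open>J\<close> with the same lower bound on growth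
  exists, and its homogeneous part is smaller, hence grows at least as fast. As long as the growth
  exceeds that of the line through \<open>z\<close>, one of the linear forms defining this line lies
  outside the prime; adding it gives a larger homogeneous ideal whose growth has dropped by at most
  one. All the primes vanish at \<open>z\<close> because an ideal containing a unit at
  \<open>z\<close> has no growth.\<close>

theorem homogeneous_prime_chain:
  fixes J :: "'k::field mpoly set"
  assumes z: "z j \<noteq> 0" "\<And>i. n \<le> i \<Longrightarrow> z i = 0"
    and J: "rm.subspace J" "star J = J" "Vr ` {n..} \<subseteq> J" and g: "\<not> growth_le (Wz z) d J"
  shows "\<exists>p. (\<forall>i\<le>d. is_prime (p i) \<and> star (p i) = p i \<and> J \<subseteq> p i \<and> (\<forall>F\<in>p i. ev z F = 0)) \<and>
    (\<forall>i<d. p (Suc i) \<subset> p i)"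
  using J g
proof (induction d arbitrary: J)
  case (0 J)
  obtain p where p: "is_prime p" "J \<subseteq> p" "\<not> growth_le (Wz z) 0 p"
    using prime_of_growth[OF 0(1,3) Wz_ideal 0(4)] by auto
  note pI = primeD(1)[OF p(1)]
  have "star p \<subseteq> p" by (rule star_subset[OF pI])
  moreover have "J \<subseteq> star p" using star_mono[OF p(2)] 0(2) by simp
  moreover have "\<forall>F\<in>p. ev z F = 0" using growth_unit[OF pI] p(3) by auto
  ultimately show ?case using star_prime[OF p(1)] star_star[OF pI] by (intro exI[of _ "\<lambda>_. star p"]) auto
next
  case (Suc d J)
  obtain p0 where p0: "is_prime p0" "J \<subseteq> p0" "\<not> growth_le (Wz z) (Suc d) p0"
    using prime_of_growth[OF Suc.prems(1,3) Wz_ideal Suc.prems(4)] by auto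
  note pI = primeD(1)[OF p0(1)]
  define p where "p = star p0"
  have p: "is_prime p" "star p = p" "J \<subseteq> p" "p \<subseteq> p0"
    using star_mono[OF p0(2)] Suc.prems(2) star_prime[OF p0(1)] star_star[OF pI] star_subset[OF pI]
    by (auto simp: p_def)
  have pI': "rm.subspace p" by (rule primeD(1)[OF p(1)])
  have pz: "\<forall>F\<in>p. ev z F = 0" using growth_unit[OF pI] p0(3) p(4) by auto
  have png: "\<not> growth_le (Wz z) (Suc d) p" using growth_le_mono[OF _ p(4), of "Wz z" "Suc d"] p0(3) by auto
  then have "\<not> growth_le (Wz z) (Suc 0) p" using growth_le_exp[of "Wz z" "Suc 0" p "Suc d"] by auto
  then obtain i where i: "Cst (z j) * Vr i - Cst (z i) * Vr j \<notin> p"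
    using growth_line[OF pI', of z j] z(1) by auto
  define t where "t = Cst (z j) * Vr i - Cst (z i) * (Vr j :: 'k mpoly)"
  have t: "t \<notin> p" using i by (simp add: t_def)
  have tz: "ev z t = 0"
    by (simp add: t_def meval_hom[OF rhom_id] meval_Vr[OF rhom_id] meval_Cst[OF rhom_id])
  define J' where "J' = rm.span (insert t p)"
  have J': "rm.subspace J'" "p \<subseteq> J'" "t \<in> J'" by (auto simp: J'_def rm.span_base)
  have "t \<in> forms (Suc (max i j)) 1"
    unfolding t_def forms_eq
    by (intro kset_minus kset_Cst_mult Vr_forms[unfolded forms_eq]) auto
  then have "insert t p \<subseteq> star J'" using forms_star[OF J'(1,3)] star_mono[OF J'(2)] p(2) by auto
  then have "J' \<subseteq> star J'" unfolding J'_def using star_ideal[OF J'(1)] by (intro rm.span_minimal) (auto simp: J'_def)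
  then have sJ': "star J' = J'" using star_subset[OF J'(1)] by auto
  have "\<not> growth_le (Wz z) d J'" using growth_step[OF pI' tz] png by (auto simp: J'_def)
  moreover have "Vr ` {n..} \<subseteq> J'" using Suc.prems(3) p(3) J'(2) by auto
  ultimately obtain q where q: "\<forall>i\<le>d. is_prime (q i) \<and> star (q i) = q i \<and> J' \<subseteq> q i \<and> (\<forall>F\<in>q i. ev z F = 0)"
    "\<forall>i<d. q (Suc i) \<subset> q i"
    using Suc.IH[OF J'(1) sJ'] by auto
  define r where "r i = (if i \<le> d then q i else p)" for i
  have "is_prime (r i) \<and> star (r i) = r i \<and> J \<subseteq> r i \<and> (\<forall>F\<in>r i. ev z F = 0)" if "i \<le> Suc d" for i
  proof (cases "i \<le> d")
    case True
    then have qi: "is_prime (q i) \<and> star (q i) = q i \<and> J' \<subseteq> q i \<and> (\<forall>F\<in>q i. ev z F = 0)"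
      using q(1) by simp
    then have "J \<subseteq> q i" using p(3) J'(2) by blast
    then show ?thesis using qi True by (simp add: r_def)
  qed (use p pz in \<open>simp add: r_def\<close>)
  moreover have "r (Suc i) \<subset> r i" if "i < Suc d" for i
  proof (cases "i = d")
    case True
    have "J' \<subseteq> q d" using q(1) by simp
    then have "p \<subseteq> q d" "t \<in> q d" using J'(2,3) by blast+
    then have "p \<subset> q d" using t by blast
    then show ?thesis using True by (simp add: r_def)
  next
    case False
    then show ?thesis using q(2) that by (simp add: r_def)
  qed
  ultimately show ?case by (intro exI[of _ r]) auto
qed

subsection \<open>Irreducible subsets and dimension\<close>

lemma irreducible_subtopology_iff:
  assumes "Z \<subseteq> topspace T"
  shows "irreducible_space (subtopology T Z) \<longleftrightarrow>
    Z \<noteq> {} \<and> (\<forall>A B. closedin T A \<and> closedin T B \<and> Z \<subseteq> A \<union> B \<longrightarrow> Z \<subseteq> A \<or> Z \<subseteq> B)"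
proof -
  have top: "topspace (subtopology T Z) = Z" using assms by auto
  show ?thesis
  proof
    assume irr: "irreducible_space (subtopology T Z)"
    have "Z \<subseteq> A \<or> Z \<subseteq> B" if AB: "closedin T A" "closedin T B" "Z \<subseteq> A \<union> B" for A B
    proof -
      have "closedin (subtopology T Z) (A \<inter> Z)" "closedin (subtopology T Z) (B \<inter> Z)"
        using AB by (auto simp: closedin_subtopology)
      moreover have "(A \<inter> Z) \<union> (B \<inter> Z) = Z" using AB(3) by auto
      ultimately have "A \<inter> Z = Z \<or> B \<inter> Z = Z"
        using irr unfolding irreducible_space_def top by meson
      then show ?thesis by auto
    qed
    then show "Z \<noteq> {} \<and> (\<forall>A B. closedin T A \<and> closedin T B \<and> Z \<subseteq> A \<union> B \<longrightarrow> Z \<subseteq> A \<or> Z \<subseteq> B)"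
      using irr unfolding irreducible_space_def top by auto
  next
    assume Z: "Z \<noteq> {} \<and> (\<forall>A B. closedin T A \<and> closedin T B \<and> Z \<subseteq> A \<union> B \<longrightarrow> Z \<subseteq> A \<or> Z \<subseteq> B)"
    show "irreducible_space (subtopology T Z)"
      unfolding irreducible_space_def top
    proof (intro conjI allI impI)
      fix A B assume AB: "closedin (subtopology T Z) A \<and> closedin (subtopology T Z) B \<and> A \<union> B = Z"
      then obtain A' B' where A: "closedin T A'" "A = A' \<inter> Z" and B: "closedin T B'" "B = B' \<inter> Z"
        by (auto simp: closedin_subtopology)
      have "Z \<subseteq> A' \<union> B'" using AB A(2) B(2) by auto
      then have "Z \<subseteq> A' \<or> Z \<subseteq> B'" using Z A(1) B(1) by auto
      then show "A = Z \<or> B = Z" using A(2) B(2) by auto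
    qed (use Z in simp)
  qed
qed

text \<open>Zorn's lemma. If the union of a chain is covered by two closed sets and lies in neither,
  a point outside the first and a point outside the second belong to a common member, which would
  then not be irreducible.\<close>

lemma ex_irreducible_component:
  assumes S: "S \<subseteq> topspace T" "irreducible_space (subtopology T S)"
  shows "\<exists>M\<in>irreducible_components T. S \<subseteq> M"
proof -
  let ?G = "{Z. S \<subseteq> Z \<and> Z \<subseteq> topspace T \<and> irreducible_space (subtopology T Z)}"
  have "\<exists>M\<in>?G. \<forall>Z\<in>?G. M \<subseteq> Z \<longrightarrow> Z = M"
  proof (rule subset_Zorn_nonempty)
    show "?G \<noteq> {}" using S by auto
    fix C assume C: "C \<noteq> {}" "subset.chain ?G C"
    have CG: "C \<subseteq> ?G" using C(2) by (auto simp: subset_chain_def)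
    have top: "\<Union>C \<subseteq> topspace T" using CG by auto
    have Sub: "S \<subseteq> \<Union>C" using C(1) CG by blast
    have "irreducible_space (subtopology T (\<Union>C))"
      unfolding irreducible_subtopology_iff[OF top]
    proof (intro conjI allI impI)
      have "S \<noteq> {}" using S(2) unfolding irreducible_subtopology_iff[OF S(1)] by (rule conjunct1)
      then show "\<Union>C \<noteq> {}" using Sub by blast
      fix A B assume AB: "closedin T A \<and> closedin T B \<and> \<Union>C \<subseteq> A \<union> B"
      show "\<Union>C \<subseteq> A \<or> \<Union>C \<subseteq> B"
      proof (rule ccontr)
        assume "\<not> (\<Union>C \<subseteq> A \<or> \<Union>C \<subseteq> B)"
        then obtain x y D1 D2 where xy: "D1 \<in> C" "x \<in> D1" "x \<notin> A" "D2 \<in> C" "y \<in> D2" "y \<notin> B" by auto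
        then have "D1 \<subseteq> D2 \<or> D2 \<subseteq> D1" using C(2) by (auto simp: subset_chain_def)
        then obtain D where D: "D \<in> C" "x \<in> D" "y \<in> D" using xy by auto
        then have "D \<subseteq> topspace T" "irreducible_space (subtopology T D)" using CG by auto
        moreover have "D \<subseteq> A \<union> B" using AB D(1) by auto
        ultimately have "D \<subseteq> A \<or> D \<subseteq> B" using AB irreducible_subtopology_iff[of D T] by auto
        then show False using D xy by auto
      qed
    qed
    then show "\<Union>C \<in> ?G" using top Sub by simp
  qed
  then obtain M where M: "M \<in> ?G" "\<forall>Z\<in>?G. M \<subseteq> Z \<longrightarrow> Z = M" by (rule bexE)
  have "M \<in> irreducible_components T"
    unfolding irreducible_components_def
  proof (intro CollectI conjI allI impI)
    fix Z' assume Z': "M \<subseteq> Z' \<and> Z' \<subseteq> topspace T \<and> irreducible_space (subtopology T Z')"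
    then have "Z' \<in> ?G" using M(1) by auto
    then show "Z' = M" using M(2) Z' by auto
  qed (use M(1) in auto)
  then show ?thesis using M(1) by (intro bexI[of _ M]) auto
qed

text \<open>The dimension is a supremum over components, so the whole chain must lie in one of them:
  a component containing its largest set.\<close>

lemma scheme_dim_ge:
  assumes Z: "\<And>i. i \<le> l \<Longrightarrow> closedin T (Z i) \<and> irreducible_space (subtopology T (Z i))"
    and lt: "\<And>i. i < l \<Longrightarrow> Z i \<subset> Z (Suc i)"
  shows "ereal (real l) \<le> scheme_dim T"
proof -
  have mono: "i \<le> l \<Longrightarrow> Z i \<subseteq> Z l" for i
  proof (induction rule: inc_induct)
    case (step n)
    then show ?case using lt[of n] by auto
  qed simp
  have "Z l \<subseteq> topspace T" using Z[of l] closedin_subset by auto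
  then obtain M where M: "M \<in> irreducible_components T" "Z l \<subseteq> M"
    using ex_irreducible_component[of "Z l" T] Z[of l] by auto
  have sub: "Z i \<subseteq> M" if "i \<le> l" for i using mono[OF that] M(2) by auto
  have "closedin (subtopology T M) (Z i) \<and> irreducible_space (subtopology (subtopology T M) (Z i))"
    if "i \<le> l" for i
  proof
    show "closedin (subtopology T M) (Z i)"
      using Z[OF that] sub[OF that] by (auto simp: closedin_subtopology)
    have "M \<inter> Z i = Z i" using sub[OF that] by auto
    then show "irreducible_space (subtopology (subtopology T M) (Z i))"
      using Z[OF that] by (simp add: subtopology_subtopology)
  qed
  then have "ereal (real l) \<le> krull_dim (subtopology T M)"
    unfolding krull_dim_def by (intro Sup_upper CollectI exI[of _ l] exI[of _ Z] conjI) (use lt in auto)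
  also have "\<dots> \<le> scheme_dim T" unfolding scheme_dim_def by (rule SUP_upper[OF M(1)])
  finally show ?thesis .
qed

section \<open>Closed sets and points of projective space\<close>

lemma closedin_zariski:
  assumes \<phi>: "rhom (\<phi> :: 'k::field \<Rightarrow> 'l::field)"
  shows "closedin (zariski \<phi> n) A \<longleftrightarrow> (\<exists>S \<subseteq> (\<Union>d. forms n d). A = proj_zeros \<phi> n S)"
proof -
  note op = openin_zariski[of \<phi> n, OF rhomD[OF \<phi>]]
  have "(1 :: 'k mpoly) \<in> forms n 0" by (auto simp: forms_eq kset_def)
  moreover have "proj_zeros \<phi> n {1} = {}"
    by (auto simp: proj_zeros_def proj_space_def proj_pt_def meval_hom[OF \<phi>] intro!: exI[of _ 1])
  ultimately have "openin (zariski \<phi> n) (proj_space n)"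
    unfolding op by (intro exI[of _ "{1}"]) auto
  moreover have "V \<subseteq> proj_space n" if "openin (zariski \<phi> n) V" for V
    using that unfolding op by auto
  ultimately have top: "topspace (zariski \<phi> n) = proj_space n"
    by (metis openin_subset openin_topspace subset_antisym)
  have z: "proj_zeros \<phi> n S \<subseteq> proj_space n" for S by (auto simp: proj_zeros_def)
  show ?thesis
    unfolding closedin_def top op
  proof (intro iffI; elim conjE exE)
    fix S assume S: "A \<subseteq> proj_space n" "S \<subseteq> (\<Union>d. forms n d)" "proj_space n - A = proj_space n - proj_zeros \<phi> n S"
    then have "A = proj_zeros \<phi> n S" using z[of S] by auto
    then show "\<exists>S\<subseteq>(\<Union>d. forms n d). A = proj_zeros \<phi> n S" using S(2) by auto
  next
    fix S assume "S \<subseteq> (\<Union>d. forms n d)" "A = proj_zeros \<phi> n S"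
    then show "A \<subseteq> proj_space n \<and> (\<exists>S\<subseteq>(\<Union>d. forms n d). proj_space n - A = proj_space n - proj_zeros \<phi> n S)"
      using z[of S] by auto
  qed
qed

lemma topspace_zariski:
  assumes \<phi>: "rhom (\<phi> :: 'k::field \<Rightarrow> 'l::field)"
  shows "topspace (zariski \<phi> n) = proj_space n"
proof -
  have "closedin (zariski \<phi> n) (proj_space n)"
    unfolding closedin_zariski[OF \<phi>] by (intro exI[of _ "{}"]) (auto simp: proj_zeros_def)
  moreover have "topspace (zariski \<phi> n) \<subseteq> proj_space n"
    using closedin_topspace[of "zariski \<phi> n"] unfolding closedin_zariski[OF \<phi>] by (auto simp: proj_zeros_def)
  ultimately show ?thesis using closedin_subset by auto
qed

lemma proj_pt_self: "x \<in> proj_pt x"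
  unfolding proj_pt_def by (intro CollectI exI[of _ 1]) simp

lemma proj_space_nonempty: "P \<in> proj_space n \<Longrightarrow> \<exists>x. x \<in> P"
  using proj_pt_self by (auto simp: proj_space_def)

lemma forms_PV: "F \<in> forms n d \<Longrightarrow> F \<in> PV n"
  by (auto simp: forms_eq kset_def)

lemma forms_vanish_pt:
  assumes "F \<in> forms n d" "c \<noteq> (0::'l::field)"
  shows "meval \<phi> F (\<lambda>i. c * x i) = 0 \<longleftrightarrow> meval \<phi> F x = 0"
  using assms by (simp add: meval_scale)

text \<open>A set \<open>W\<close> of points that contains the open part \<open>g \<noteq> 0\<close> of the zero locus of each prime of a
  chain has at least the dimension given by the length of the chain.\<close>

theorem scheme_dim_ge_prime_chain:
  fixes p :: "nat \<Rightarrow> 'k::field mpoly set" and \<phi> :: "'k \<Rightarrow> 'K::alg_closed_field"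
  assumes \<phi>: "rhom \<phi>"
    and p: "\<And>i. i \<le> d \<Longrightarrow> is_prime (p i) \<and> star (p i) = p i \<and> Vr ` {n..} \<subseteq> p i \<and> g \<notin> p i"
    and lt: "\<And>i. i < d \<Longrightarrow> p (Suc i) \<subset> p i"
    and g: "g \<in> forms n e" "0 < e"
    and W: "W \<subseteq> proj_space n"
    and sub: "\<And>z. (\<exists>i. z i \<noteq> 0) \<Longrightarrow> (\<forall>i\<ge>n. z i = 0) \<Longrightarrow> (\<forall>F\<in>p d \<inter> PV n. meval \<phi> F z = 0) \<Longrightarrow>
      meval \<phi> g z \<noteq> 0 \<Longrightarrow> proj_pt z \<in> W"
  shows "ereal (real d) \<le> scheme_dim (subtopology (zariski \<phi> n) W)"
proof -
  define Q where "Q i = (\<Union>e. forms n e) \<inter> p i" for i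
  define Z where "Z i = W \<inter> proj_zeros \<phi> n (Q i)" for i
  have pdec: "p d \<subseteq> p i" if "i \<le> d" for i
    using that
  proof (induction rule: inc_induct)
    case (step k)
    then show ?case using lt[of k] by auto
  qed simp
  \<comment> \<open>The Nullstellensatz is applied to \<open>a * g\<close> instead of
    \<open>a\<close>, which places the point in the open part where \<open>g\<close> does not
    vanish. As \<open>g\<close> has positive degree, the point is not the zero vector and so defines
    a projective point.\<close>
  have dense: "\<exists>P\<in>Z i. \<forall>x\<in>P. meval \<phi> a x \<noteq> 0" if i: "i \<le> d" and a: "a \<in> forms n k" "a \<notin> p i" for i a k
  proof -
    have pi: "is_prime (p i)" "g \<notin> p i" using p[OF i] by auto
    have "a * g \<notin> p i" using primeD(3)[OF pi(1), of a g] pi(2) a(2) by auto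
    moreover have ag: "a * g \<in> forms n (k + e)" using a(1) g(1) by (rule forms_mult)
    ultimately have "\<exists>z. (\<forall>F\<in>p i \<inter> PV n. meval \<phi> F z = 0) \<and> meval \<phi> (a * g) z \<noteq> 0"
      using nullstellensatz_prime[OF \<phi> pi(1) forms_PV[OF ag]] by simp
    then obtain y where y: "(\<forall>F\<in>p i \<inter> PV n. meval \<phi> F y = 0) \<and> meval \<phi> (a * g) y \<noteq> 0" by (rule exE)
    define z where "z j = (if j < n then y j else 0)" for j
    have yz: "meval \<phi> F z = meval \<phi> F y" if "F \<in> PV n" for F
      by (rule meval_cong_keys) (use that in \<open>auto simp: z_def kset_def\<close>)
    have ne: "meval \<phi> a z \<noteq> 0" "meval \<phi> g z \<noteq> 0"
      using y yz[OF forms_PV[OF ag]] by (auto simp: meval_hom[OF \<phi>])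
    have van: "\<forall>F\<in>p i \<inter> PV n. meval \<phi> F z = 0" using y yz by simp
    have z0: "\<exists>j. z j \<noteq> 0"
    proof (rule ccontr)
      assume "\<not> (\<exists>j. z j \<noteq> 0)"
      then have "z = (\<lambda>j. 0 * z j)" by auto
      then have "meval \<phi> g z = 0 ^ e * meval \<phi> g z" using meval_scale[OF g(1), of \<phi> 0 z] by simp
      then show False using ne(2) by (simp add: zero_power[OF g(2)])
    qed
    have zn: "\<forall>j\<ge>n. z j = 0" by (simp add: z_def)
    have "\<forall>F\<in>p d \<inter> PV n. meval \<phi> F z = 0" using van pdec[OF i] by auto
    then have "proj_pt z \<in> W" using sub[OF z0 zn] ne(2) by simp
    moreover have "proj_pt z \<in> proj_zeros \<phi> n (Q i)"
    proof -
      have "meval \<phi> F (\<lambda>j. c * z j) = 0" if F: "F \<in> Q i" for F c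
      proof -
        obtain k' where k': "F \<in> forms n k'" "F \<in> p i" using F by (auto simp: Q_def)
        then have "meval \<phi> F z = 0" using van forms_PV[OF k'(1)] by simp
        then show ?thesis using meval_scale[OF k'(1), of \<phi> c z] by simp
      qed
      then show ?thesis using z0 zn by (auto simp: proj_zeros_def proj_space_def proj_pt_def)
    qed
    moreover have "\<forall>x\<in>proj_pt z. meval \<phi> a x \<noteq> 0"
      using ne(1) by (auto simp: proj_pt_def meval_scale[OF a(1)])
    ultimately show ?thesis unfolding Z_def by (intro bexI[of _ "proj_pt z"]) auto
  qed
  have ZW: "Z i \<subseteq> W" for i by (auto simp: Z_def)
  have clos: "closedin (subtopology (zariski \<phi> n) W) (Z i)" for i
  proof -
    have "closedin (zariski \<phi> n) (proj_zeros \<phi> n (Q i))"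
      unfolding closedin_zariski[OF \<phi>] by (intro exI[of _ "Q i"]) (auto simp: Q_def)
    then show ?thesis unfolding closedin_subtopology Z_def by (intro exI conjI) auto
  qed
  have irr: "irreducible_space (subtopology (subtopology (zariski \<phi> n) W) (Z i))" if i: "i \<le> d" for i
  proof -
    have pi: "is_prime (p i)" using p[OF i] by auto
    have top: "Z i \<subseteq> topspace (subtopology (zariski \<phi> n) W)"
      using ZW[of i] W by (auto simp: topspace_zariski[OF \<phi>])
    have notin: "\<exists>a k. a \<in> forms n k \<and> a \<notin> p i \<and> (\<forall>P\<in>A. \<forall>x\<in>P. meval \<phi> a x = 0)"
      if A: "closedin (subtopology (zariski \<phi> n) W) A" and nA: "\<not> Z i \<subseteq> A" for A
    proof -
      obtain S where S: "S \<subseteq> (\<Union>d. forms n d)" "A = proj_zeros \<phi> n S \<inter> W"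
        using A by (auto simp: closedin_subtopology closedin_zariski[OF \<phi>])
      obtain P where P: "P \<in> Z i" "P \<notin> A" using nA by auto
      have Pp: "P \<in> proj_space n" "P \<in> W" "P \<in> proj_zeros \<phi> n (Q i)" using P W by (auto simp: Z_def)
      then obtain a x where a: "a \<in> S" "x \<in> P" "meval \<phi> a x \<noteq> 0" using P(2) S(2) by (auto simp: proj_zeros_def)
      then obtain k where k: "a \<in> forms n k" using S(1) by auto
      have "a \<notin> p i"
      proof
        assume "a \<in> p i"
        then have "a \<in> Q i" using k by (auto simp: Q_def)
        then show False using Pp(3) a by (auto simp: proj_zeros_def)
      qed
      moreover have "\<forall>P\<in>A. \<forall>x\<in>P. meval \<phi> a x = 0" using a(1) S(2) by (auto simp: proj_zeros_def)
      ultimately show ?thesis using k by auto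
    qed
    show ?thesis
      unfolding irreducible_subtopology_iff[OF top]
    proof (intro conjI allI impI)
      have "1 \<in> forms n 0" by (auto simp: forms_eq kset_def)
      then show "Z i \<noteq> {}" using dense[OF i, of 1 0] primeD(2)[OF pi] by auto
      fix A B
      assume AB: "closedin (subtopology (zariski \<phi> n) W) A \<and> closedin (subtopology (zariski \<phi> n) W) B \<and> Z i \<subseteq> A \<union> B"
      show "Z i \<subseteq> A \<or> Z i \<subseteq> B"
      proof (rule ccontr)
        assume "\<not> (Z i \<subseteq> A \<or> Z i \<subseteq> B)"
        then have n: "\<not> Z i \<subseteq> A" "\<not> Z i \<subseteq> B" by auto
        obtain a k where a: "a \<in> forms n k" "a \<notin> p i" "\<forall>P\<in>A. \<forall>x\<in>P. meval \<phi> a x = 0"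
          using notin[OF _ n(1)] AB by auto
        obtain b k' where b: "b \<in> forms n k'" "b \<notin> p i" "\<forall>P\<in>B. \<forall>x\<in>P. meval \<phi> b x = 0"
          using notin[OF _ n(2)] AB by auto
        have "a * b \<notin> p i" using primeD(3)[OF pi, of a b] a(2) b(2) by auto
        then obtain P where P: "P \<in> Z i" "\<forall>x\<in>P. meval \<phi> (a * b) x \<noteq> 0"
          using dense[OF i forms_mult[OF a(1) b(1)]] by auto
        have "P \<in> proj_space n" using P(1) W by (auto simp: Z_def)
        then obtain x where x: "x \<in> P" using proj_space_nonempty by blast
        have "P \<in> A \<or> P \<in> B" using P(1) AB by auto
        then have "meval \<phi> a x = 0 \<or> meval \<phi> b x = 0" using a(3) b(3) x by auto
        then show False using P(2) x by (auto simp: meval_hom[OF \<phi>])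
      qed
    qed
  qed
  have str: "Z i \<subset> Z (Suc i)" if i: "i < d" for i
  proof -
    have "Z i \<subseteq> Z (Suc i)" using lt[OF i] by (auto simp: Z_def Q_def proj_zeros_def)
    moreover have "\<exists>P\<in>Z (Suc i). P \<notin> Z i"
    proof -
      have pi: "is_prime (p i)" "star (p i) = p i" "Vr ` {n..} \<subseteq> p i" using p[of i] i by auto
      have pS: "is_prime (p (Suc i))" "star (p (Suc i)) = p (Suc i)" "Vr ` {n..} \<subseteq> p (Suc i)" using p[of "Suc i"] i by auto
      note pI = primeD(1)[OF pi(1)] and pSI = primeD(1)[OF pS(1)]
      obtain F where F: "F \<in> p i" "F \<notin> p (Suc i)" using lt[OF i] by auto
      then have "F \<notin> star (p (Suc i))" "F \<in> star (p i)" using pi pS by auto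
      then obtain k where k: "hp k F \<notin> p (Suc i)" "hp k F \<in> p i" by (auto simp: star_def)
      \<comment> \<open>A homogeneous component of \<open>F\<close> that still separates the two
        primes, stripped of the variables from n on, which lie in both.\<close>
      define a where "a = prt (vset n) (hp k F)"
      have b: "prt (- vset n) (hp k F) \<in> p (Suc i)"
        by (rule subsetD[OF rm.span_minimal[OF pS(3) pSI] subsetD[OF kset_Compl_vset prt_kset]])
      have e: "hp k F = a + prt (- vset n) (hp k F)" unfolding a_def by (rule prt_compl)
      have "a \<notin> p (Suc i)" using k(1) e rm.subspace_add[OF pSI _ b, of a] by auto
      moreover have "a \<in> p i"
      proof -
        have "prt (- vset n) (hp k F) \<in> p i" using b lt[OF i] by auto
        from rm.subspace_diff[OF pI k(2) this] show ?thesis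
          by (simp only: a_def prt_eq_diff[of "vset n"])
      qed
      moreover have "a \<in> forms n k"
        by (auto simp: a_def forms_eq hp_def prt_prt kset_def kys_prt)
      ultimately obtain P where P: "P \<in> Z (Suc i)" "\<forall>x\<in>P. meval \<phi> a x \<noteq> 0"
        using dense[of "Suc i" a k] i by auto
      have "P \<in> proj_space n" using P(1) W by (auto simp: Z_def)
      then obtain x where x: "x \<in> P" using proj_space_nonempty by blast
      have "a \<in> Q i" using \<open>a \<in> p i\<close> \<open>a \<in> forms n k\<close> by (auto simp: Q_def)
      then have "P \<notin> Z i" using P(2) x by (auto simp: Z_def proj_zeros_def)
      then show ?thesis using P(1) by auto
    qed
    ultimately show ?thesis by auto
  qed
  show ?thesis by (rule scheme_dim_ge[of d _ Z, OF conjI[OF clos irr] str])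
qed

subsection \<open>Counting exponents\<close>

lemma lkp_sum_sgl:
  fixes f :: "nat \<Rightarrow> nat"
  shows "lkp (\<Sum>i<n. sgl i (f i)) l = (if l < n then f l else 0)"
proof -
  have "lkp (\<Sum>i<n. sgl i (f i)) l = (\<Sum>i<n. if i = l then f l else 0)"
    by (simp add: lookup_sum lookup_single when_def cong: if_cong)
  then show ?thesis by simp
qed

lemma mdeg_vset: "m \<in> vset n \<Longrightarrow> mdeg m = (\<Sum>i<n. lkp m i)"
  using wdg_superset[of "{..<n}" m "\<lambda>_. 1"] by (simp add: mdeg_wdg)

lemma card_exponents_le: "card {m \<in> vset n. mdeg m \<le> d} \<le> (d + 1) ^ n"
proof -
  let ?h = "\<lambda>m :: nat \<Rightarrow>\<^sub>0 nat. restrict (lkp m) {..<n}"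
  have "inj_on ?h {m \<in> vset n. mdeg m \<le> d}"
  proof (rule inj_onI)
    fix m m' assume m: "m \<in> {m \<in> vset n. mdeg m \<le> d}" "m' \<in> {m \<in> vset n. mdeg m \<le> d}" "?h m = ?h m'"
    show "m = m'"
    proof (rule poly_mapping_eqI)
      fix i show "lkp m i = lkp m' i"
      proof (cases "i < n")
        case True
        then show ?thesis using fun_cong[OF m(3), of i] by simp
      next
        case False
        then have "i \<notin> kys m" "i \<notin> kys m'" using m(1,2) by auto
        then show ?thesis by (simp add: in_keys_iff)
      qed
    qed
  qed
  moreover have "?h ` {m \<in> vset n. mdeg m \<le> d} \<subseteq> {..<n} \<rightarrow>\<^sub>E {..d}"
  proof (rule image_subsetI)
    fix m :: "nat \<Rightarrow>\<^sub>0 nat" assume "m \<in> {m \<in> vset n. mdeg m \<le> d}"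
    then have "lkp m i \<le> d" for i using lkp_le_mdeg[of m i] by simp
    then show "?h m \<in> {..<n} \<rightarrow>\<^sub>E {..d}" by simp
  qed
  ultimately have "card {m \<in> vset n. mdeg m \<le> d} \<le> card ({..<n} \<rightarrow>\<^sub>E {..d})"
    by (rule card_inj_on_le) (simp add: finite_PiE)
  then show ?thesis by (simp add: card_PiE)
qed

lemma card_exponents_ge: "(t + 1) ^ n \<le> card {m \<in> vset n. mdeg m \<le> n * t}"
proof -
  let ?h = "\<lambda>f :: nat \<Rightarrow> nat. (\<Sum>i<n. sgl i (f i))"
  have "inj_on ?h ({..<n} \<rightarrow>\<^sub>E {..t})"
  proof (rule inj_onI)
    fix f g assume fg: "f \<in> {..<n} \<rightarrow>\<^sub>E {..t}" "g \<in> {..<n} \<rightarrow>\<^sub>E {..t}" "?h f = ?h g"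
    show "f = g"
    proof (rule PiE_ext[OF fg(1,2)])
      fix i assume "i \<in> {..<n}"
      then show "f i = g i" using arg_cong[OF fg(3), of "\<lambda>m. lkp m i"] by (simp add: lkp_sum_sgl)
    qed
  qed
  moreover have "?h ` ({..<n} \<rightarrow>\<^sub>E {..t}) \<subseteq> {m \<in> vset n. mdeg m \<le> n * t}"
  proof (rule image_subsetI)
    fix f assume f: "f \<in> {..<n} \<rightarrow>\<^sub>E {..t}"
    have v: "?h f \<in> vset n" by (auto simp: in_keys_iff lkp_sum_sgl split: if_splits)
    have "mdeg (?h f) = (\<Sum>i<n. f i)" using mdeg_vset[OF v] by (simp add: lkp_sum_sgl)
    also have "\<dots> \<le> (\<Sum>i<n. t)" by (rule sum_mono) (use f in auto)
    finally show "?h f \<in> {m \<in> vset n. mdeg m \<le> n * t}" using v by simp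
  qed
  ultimately have "card ({..<n} \<rightarrow>\<^sub>E {..t}) \<le> card {m \<in> vset n. mdeg m \<le> n * t}"
    by (rule card_inj_on_le[OF _ _ finite_vset_le])
  then show ?thesis by (simp add: card_PiE)
qed

lemma power_dominates: "\<exists>t. C * (n * t + 1) ^ j < (t + 1) ^ Suc j" for C n j :: nat
proof -
  define t where "t = C * (n + 1) ^ j"
  have "n * t + 1 \<le> (n + 1) * (t + 1)" by simp
  then have "(n * t + 1) ^ j \<le> ((n + 1) * (t + 1)) ^ j" by (rule power_mono) simp
  then have "C * (n * t + 1) ^ j \<le> C * ((n + 1) * (t + 1)) ^ j" by (rule mult_le_mono2)
  also have "\<dots> = t * (t + 1) ^ j"
    by (simp only: power_mult_distrib t_def[symmetric] mult.assoc[symmetric])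
  also have "\<dots> < (t + 1) ^ Suc j" by simp
  finally show ?thesis by blast
qed

subsection \<open>Algebraic independence modulo a prime ideal\<close>

definition aind :: "'k::field mpoly set \<Rightarrow> nat \<Rightarrow> (nat \<Rightarrow> 'k mpoly) \<Rightarrow> bool" where
  "aind p j w \<longleftrightarrow> (\<forall>Q\<in>PV j. psub w Q \<in> p \<longrightarrow> Q = 0)"

abbreviation mnm :: "(nat \<Rightarrow>\<^sub>0 nat) \<Rightarrow> 'k::field mpoly" where "mnm m \<equiv> sgl m 1"

lemma psub_single: "psub w (sgl m c) = Cst c * psub w (mnm m)"
  by (simp add: meval_single Cst_0 Cst_1)

lemma psub_mnm: "psub w (mnm m) = (\<Prod>i\<in>kys m. w i ^ lkp m i)"
  by (simp add: meval_single Cst_0 Cst_1)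

lemma psub_mnm_vset: "m \<in> vset r \<Longrightarrow> psub w (mnm m) = (\<Prod>i<r. w i ^ lkp m i)"
  unfolding psub_mnm by (rule prod.mono_neutral_left) (auto simp: in_keys_iff)

lemma psub_mono_add: "psub w (mnm (a + b)) = psub w (mnm a) * psub w (mnm b)"
  using psub_hom(4)[of "mnm a" "mnm b" w] by (simp add: mult_single)

lemma psub_in_span:
  assumes "G \<in> kset A" shows "psub w G \<in> mp.span ((\<lambda>m. psub w (mnm m)) ` A)"
  using assms
proof (induction rule: kset_induct)
  case (single m c)
  then show ?case unfolding psub_single[where w = w and m = m and c = c] by (intro mp.span_scale mp.span_base) auto
qed (auto simp: psub_hom mp.span_zero intro: mp.span_add)

lemma span_mult_mod:
  assumes p: "rm.subspace p" and x: "x \<in> mp.span (M1 \<union> p)" and y: "y \<in> mp.span (M2 \<union> p)"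
    and M: "\<And>a b. a \<in> M1 \<Longrightarrow> b \<in> M2 \<Longrightarrow> a * b \<in> mp.span (M3 \<union> p)"
  shows "x * y \<in> mp.span (M3 \<union> p)"
proof -
  have pp: "a \<in> p \<Longrightarrow> a * b \<in> mp.span (M3 \<union> p)" "b \<in> p \<Longrightarrow> a * b \<in> mp.span (M3 \<union> p)" for a b
  proof -
    show "a * b \<in> mp.span (M3 \<union> p)" if "a \<in> p"
      using rm.subspace_scale[OF p that, of b] unfolding mult.commute[of b a] by (intro mp.span_base) simp
    show "a * b \<in> mp.span (M3 \<union> p)" if "b \<in> p"
      using rm.subspace_scale[OF p that, of a] by (intro mp.span_base) simp
  qed
  have 1: "a * y \<in> mp.span (M3 \<union> p)" if a: "a \<in> M1" for a
    using y
  proof (induction rule: mp.span_induct_alt)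
    case (step c b z)
    have "a * b \<in> mp.span (M3 \<union> p)" using step(1) M[OF a, of b] pp(2)[of b a] by auto
    from mp.span_add[OF mp.span_scale[OF this, of c] step(2)]
    show ?case by (simp add: algebra_simps)
  qed (simp add: mp.span_zero)
  show ?thesis
    using x
  proof (induction rule: mp.span_induct_alt)
    case (step c a z)
    have "a * y \<in> mp.span (M3 \<union> p)" using step(1) 1[of a] pp(1)[of a y] by auto
    from mp.span_add[OF mp.span_scale[OF this, of c] step(2)]
    show ?case by (simp add: algebra_simps)
  qed (simp add: mp.span_zero)
qed

lemma algebraic_relation:
  assumes p: "is_prime p" and w: "aind p j w" and v: "\<not> aind p (Suc j) (w(j := v))"
  shows "\<exists>e \<Gamma>. 0 < e \<and> (\<forall>i. \<Gamma> i \<in> PV j) \<and> psub w (\<Gamma> e) \<notin> p \<and> (\<Sum>i\<le>e. psub w (\<Gamma> i) * v ^ i) \<in> p"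
proof -
  note pI = primeD(1)[OF p]
  obtain Q where Q: "Q \<in> PV (Suc j)" "psub (w(j := v)) Q \<in> p" "Q \<noteq> 0"
    using v by (auto simp: aind_def)
  obtain P where P: "\<forall>i. coeff P i \<in> PV j" "Q = poly P (Vr j)" using PV_decompose[OF Q(1)] by auto
  have sum: "psub (w(j := v)) Q = (\<Sum>i\<le>degree P. psub w (coeff P i) * v ^ i)"
    unfolding P(2) poly_altdef using P(1) by (simp add: psub_hom meval_PV_upd)
  have "P \<noteq> 0" using Q(3) P(2) by auto
  then have "coeff P (degree P) \<noteq> 0" by simp
  then have ex: "psub w (coeff P (degree P)) \<notin> p" using w P(1) unfolding aind_def by auto
  define e where "e = degree P"
  have S: "(\<Sum>i\<le>e. psub w (coeff P i) * v ^ i) \<in> p" using Q(2) sum by (simp add: e_def)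
  have "0 < e"
  proof (rule ccontr)
    assume "\<not> 0 < e"
    then have "e = 0" by simp
    then have "psub w (coeff P e) \<in> p" using S by simp
    then show False using ex by (simp add: e_def)
  qed
  then show ?thesis using ex S P(1) by (intro exI[of _ e] exI[of _ "coeff P"]) (auto simp: e_def)
qed

text \<open>Clearing denominators by powers of the leading coefficients of the algebraic relations
  bounds the growth of an algebra that is algebraic over \<open>j\<close> independent elements.\<close>

lemma growth_algebraic:
  fixes p :: "'k::field mpoly set"
  assumes p: "is_prime p" and w: "aind p j w" and v: "\<And>l. l < r \<Longrightarrow> \<not> aind p (Suc j) (w(j := v l))"
  shows "\<exists>C. \<forall>s (I :: 'i set) f. finite I \<longrightarrow> (\<forall>i\<in>I. f i \<in> psub v ` (PV r \<inter> dle s)) \<longrightarrow> indm p I f \<longrightarrow>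
    card I \<le> C * (s + 1) ^ j"
proof -
  note pI = primeD(1)[OF p]
  have "\<forall>l\<in>{..<r}. \<exists>y. 0 < fst y \<and> (\<forall>i. snd y i \<in> PV j) \<and> psub w (snd y (fst y)) \<notin> p \<and>
      (\<Sum>i\<le>fst y. psub w (snd y i) * v l ^ i) \<in> p"
  proof
    fix l assume "l \<in> {..<r}"
    then obtain e \<Gamma> where "0 < e \<and> (\<forall>i. \<Gamma> i \<in> PV j) \<and> psub w (\<Gamma> e) \<notin> p \<and> (\<Sum>i\<le>e. psub w (\<Gamma> i) * v l ^ i) \<in> p"
      using algebraic_relation[OF p w v[of l]] by auto
    then show "\<exists>y. 0 < fst y \<and> (\<forall>i. snd y i \<in> PV j) \<and> psub w (snd y (fst y)) \<notin> p \<and>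
      (\<Sum>i\<le>fst y. psub w (snd y i) * v l ^ i) \<in> p" by (intro exI[of _ "(e, \<Gamma>)"]) simp
  qed
  from bchoice[OF this] obtain y where y: "\<forall>l\<in>{..<r}. 0 < fst (y l) \<and> (\<forall>i. snd (y l) i \<in> PV j) \<and>
      psub w (snd (y l) (fst (y l))) \<notin> p \<and> (\<Sum>i\<le>fst (y l). psub w (snd (y l) i) * v l ^ i) \<in> p" ..
  define e \<Gamma> where "e l = fst (y l)" and "\<Gamma> l = snd (y l)" for l
  have e: "0 < e l" and \<Gamma>: "\<Gamma> l i \<in> PV j" and top: "psub w (\<Gamma> l (e l)) \<notin> p"
    and rel: "(\<Sum>i\<le>e l. psub w (\<Gamma> l i) * v l ^ i) \<in> p" if "l < r" for l i
    using y that by (auto simp: e_def \<Gamma>_def)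
  define \<delta> where "\<delta> = Max (insert 0 (\<Union>l<r. \<Union>i\<le>e l. mdeg ` kys (\<Gamma> l i)))"
  have \<delta>: "\<Gamma> l i \<in> kset {m \<in> vset j. mdeg m \<le> \<delta>}" if "l < r" "i \<le> e l" for l i
  proof -
    have "mdeg m \<le> \<delta>" if "m \<in> kys (\<Gamma> l i)" for m
      unfolding \<delta>_def by (rule Max_ge) (use that \<open>l < r\<close> \<open>i \<le> e l\<close> in auto)
    then show ?thesis using \<Gamma>[OF that(1), of i] by (auto simp: kset_def)
  qed
  define c where "c l = psub w (\<Gamma> l (e l))" for l
  define E where "E d = {m \<in> vset j. mdeg m \<le> d}" for d
  have mulE: "psub w G * (psub w (mnm \<alpha>) * x) \<in> mp.span ((\<lambda>m. psub w (mnm m) * x) ` E (\<delta> + d))"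
    if G: "G \<in> kset (E \<delta>)" and \<alpha>: "\<alpha> \<in> E d" for G \<alpha> x d
    using G
  proof (induction rule: kset_induct)
    case (single m a)
    have "m + \<alpha> \<in> E (\<delta> + d)" using single \<alpha> vset_add[of m j \<alpha>] by (auto simp: E_def mdeg_add)
    then have "Cst a * (psub w (mnm (m + \<alpha>)) * x) \<in> mp.span ((\<lambda>m. psub w (mnm m) * x) ` E (\<delta> + d))"
      by (intro mp.span_scale mp.span_base) auto
    then show ?case unfolding psub_single[where w = w and m = m and c = a] psub_mono_add by (simp only: mult.assoc)
  next
    case (add F G)
    from mp.span_add[OF add(3,4)] show ?case by (simp only: psub_hom distrib_right)
  qed (simp add: psub_hom mp.span_zero)
  define N where "N l d = (\<lambda>(m, i). psub w (mnm m) * v l ^ i) ` (E d \<times> {..<e l})" for l d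
  have subN: "(\<lambda>m. psub w (mnm m) * v l ^ i) ` E d \<subseteq> N l d" if "i < e l" for l d i
    using that by (auto simp: N_def)
  have Nmono: "N l d \<subseteq> N l d'" if "d \<le> d'" for l d d'
    using that by (auto simp: N_def E_def)
  have stepc: "c l * x \<in> mp.span (N l (\<delta> + d) \<union> p)" if l: "l < r" and x: "x \<in> mp.span (N l d \<union> p)" for l d x
    using x
  proof (induction rule: mp.span_induct_alt)
    case (step a g x)
    have "c l * g \<in> mp.span (N l (\<delta> + d) \<union> p)"
    proof (cases "g \<in> p")
      case True
      then show ?thesis using rm.subspace_scale[OF pI] by (intro mp.span_base) auto
    next
      case False
      then obtain \<alpha> i where g: "g = psub w (mnm \<alpha>) * v l ^ i" "\<alpha> \<in> E d" "i < e l"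
        using step(1) by (auto simp: N_def)
      have "c l * g \<in> mp.span ((\<lambda>m. psub w (mnm m) * v l ^ i) ` E (\<delta> + d))"
        unfolding g(1) c_def by (rule mulE[OF \<delta>[OF l order_refl, folded E_def] g(2)])
      then show ?thesis using mp.span_mono[of _ "N l (\<delta> + d) \<union> p"] subN[OF g(3)] by blast
    qed
    from mp.span_add[OF mp.span_scale[OF this, of a] step(2)] show ?case by (simp add: algebra_simps)
  qed (simp add: mp.span_zero)
  \<comment> \<open>Every factor \<open>v l\<close> brings its own factor \<open>c l\<close>. When
    the exponent reaches \<open>e l\<close>, the relation rewrites \<open>c l * v l ^ e l\<close>
    through lower powers, and the degree in \<open>w\<close> rises by at most
    \<open>\<delta>\<close>.\<close>
  have stepv: "c l * v l * x \<in> mp.span (N l (\<delta> + d) \<union> p)" if l: "l < r" and x: "x \<in> mp.span (N l d \<union> p)" for l d x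
    using x
  proof (induction rule: mp.span_induct_alt)
    case (step a g x)
    have "c l * v l * g \<in> mp.span (N l (\<delta> + d) \<union> p)"
    proof (cases "g \<in> p")
      case True
      then show ?thesis using rm.subspace_scale[OF pI] by (intro mp.span_base) auto
    next
      case False
      then obtain \<alpha> i where g: "g = psub w (mnm \<alpha>) * v l ^ i" "\<alpha> \<in> E d" "i < e l"
        using step(1) by (auto simp: N_def)
      have gen: "psub w (\<Gamma> l k) * (psub w (mnm \<alpha>) * v l ^ i') \<in> mp.span (N l (\<delta> + d) \<union> p)"
        if "k \<le> e l" "i' < e l" for k i'
      proof -
        have "psub w (\<Gamma> l k) * (psub w (mnm \<alpha>) * v l ^ i') \<in> mp.span ((\<lambda>m. psub w (mnm m) * v l ^ i') ` E (\<delta> + d))"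
          by (rule mulE[OF \<delta>[OF l that(1), folded E_def] g(2)])
        then show ?thesis using mp.span_mono[of _ "N l (\<delta> + d) \<union> p"] subN[OF that(2)] by blast
      qed
      have eq: "c l * v l * g = psub w (\<Gamma> l (e l)) * (psub w (mnm \<alpha>) * v l ^ Suc i)"
        by (simp add: c_def g(1) mult_ac)
      show ?thesis
      proof (cases "Suc i < e l")
        case True
        then show ?thesis unfolding eq by (intro gen) auto
      next
        case False
        then have ei: "Suc i = e l" using g(3) by simp
        have "psub w (mnm \<alpha>) * (\<Sum>i\<le>e l. psub w (\<Gamma> l i) * v l ^ i) \<in> p"
          by (rule rm.subspace_scale[OF pI rel[OF l]])
        then have 1: "psub w (mnm \<alpha>) * (\<Sum>i\<le>e l. psub w (\<Gamma> l i) * v l ^ i) \<in> mp.span (N l (\<delta> + d) \<union> p)"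
          by (intro mp.span_base) auto
        have "(\<Sum>i<e l. psub w (\<Gamma> l i) * (psub w (mnm \<alpha>) * v l ^ i)) \<in> mp.span (N l (\<delta> + d) \<union> p)"
          by (rule mp.span_sum) (use gen in auto)
        from mp.span_diff[OF 1 this]
        have "psub w (mnm \<alpha>) * (\<Sum>i\<le>e l. psub w (\<Gamma> l i) * v l ^ i) -
          (\<Sum>i<e l. psub w (\<Gamma> l i) * (psub w (mnm \<alpha>) * v l ^ i)) \<in> mp.span (N l (\<delta> + d) \<union> p)" .
        moreover have "psub w (mnm \<alpha>) * (\<Sum>i\<le>e l. psub w (\<Gamma> l i) * v l ^ i) -
          (\<Sum>i<e l. psub w (\<Gamma> l i) * (psub w (mnm \<alpha>) * v l ^ i)) = c l * v l * g"
          unfolding eq ei lessThan_Suc_atMost[symmetric] sum.lessThan_Suc distrib_left sum_distrib_left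
          by (simp add: mult_ac)
        ultimately show ?thesis by simp
      qed
    qed
    from mp.span_add[OF mp.span_scale[OF this, of a] step(2)] show ?case by (simp add: algebra_simps)
  qed (simp add: mp.span_zero)
  have pow: "c l ^ n * v l ^ n \<in> mp.span (N l (\<delta> * n) \<union> p)" if l: "l < r" for l n
  proof (induction n)
    case 0
    have "1 \<in> N l 0"
      unfolding N_def by (rule image_eqI[of _ _ "(0, 0)"]) (use e[OF l] in \<open>auto simp: E_def psub_hom\<close>)
    then show ?case by (auto intro: mp.span_base)
  next
    case (Suc n)
    from stepv[OF l Suc] show ?case by (simp add: mult_ac)
  qed
  have pow': "c l ^ s * v l ^ n \<in> mp.span (N l (\<delta> * s) \<union> p)" if l: "l < r" and n: "n \<le> s" for l n s
    using n
  proof (induction rule: dec_induct)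
    case base
    show ?case by (rule pow[OF l])
  next
    case (step k)
    from stepc[OF l step(3)] show ?case by (simp add: mult_ac)
  qed
  \<comment> \<open>Products with each exponent of \<open>v l\<close> reduced below
    \<open>e l\<close> and a coefficient monomial of degree at most \<open>d\<close> in
    \<open>w\<close>. Only the latter depends on \<open>d\<close>, so their number is of order
    \<open>d ^ j\<close>.\<close>
  define M where "M q d = (\<lambda>(m, \<beta>). psub w (mnm m) * (\<Prod>l<q. v l ^ \<beta> l)) ` (E d \<times> Pi\<^sub>E {..<q} (\<lambda>l. {..<e l}))" for q d
  have prod: "(\<Prod>l<q. c l ^ s * v l ^ \<beta> l) \<in> mp.span (M q (q * (\<delta> * s)) \<union> p)"
    if "q \<le> r" and \<beta>: "\<forall>l<q. \<beta> l \<le> s" for q \<beta> s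
    using that
  proof (induction q)
    case 0
    have "1 \<in> M 0 0"
      unfolding M_def by (rule image_eqI[of _ _ "(0, \<lambda>_. undefined)"]) (auto simp: E_def psub_hom)
    then show ?case by (auto intro: mp.span_base)
  next
    case (Suc q)
    then have IH: "(\<Prod>l<q. c l ^ s * v l ^ \<beta> l) \<in> mp.span (M q (q * (\<delta> * s)) \<union> p)" by simp
    have q: "c q ^ s * v q ^ \<beta> q \<in> mp.span (N q (\<delta> * s) \<union> p)" using Suc.prems by (intro pow') auto
    have "(\<Prod>l<q. c l ^ s * v l ^ \<beta> l) * (c q ^ s * v q ^ \<beta> q) \<in> mp.span (M (Suc q) (Suc q * (\<delta> * s)) \<union> p)"
    proof (rule span_mult_mod[OF pI IH q])
      fix a b assume "a \<in> M q (q * (\<delta> * s))" "b \<in> N q (\<delta> * s)"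
      then obtain m b1 m' i where ab: "a = psub w (mnm m) * (\<Prod>l<q. v l ^ b1 l)" "m \<in> E (q * (\<delta> * s))"
        "b1 \<in> Pi\<^sub>E {..<q} (\<lambda>l. {..<e l})" "b = psub w (mnm m') * v q ^ i" "m' \<in> E (\<delta> * s)" "i < e q"
        by (auto simp: M_def N_def)
      have AB: "a * b = psub w (mnm (m + m')) * (\<Prod>l<Suc q. v l ^ (b1(q := i)) l)"
        unfolding ab psub_mono_add by (simp add: mult_ac)
      have EE: "m + m' \<in> E (Suc q * (\<delta> * s))"
        using ab(2,5) vset_add[of m j m'] by (auto simp: E_def mdeg_add)
      have BB: "b1(q := i) \<in> Pi\<^sub>E {..<Suc q} (\<lambda>l. {..<e l})"
        using ab(3,6) by (auto simp: PiE_def extensional_def Pi_def less_Suc_eq)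
      have "a * b \<in> M (Suc q) (Suc q * (\<delta> * s))"
        unfolding M_def AB
        by (rule image_eqI[of _ _ "(m + m', b1(q := i))"]) (simp only: prod.case, rule SigmaI[OF EE BB])
      then show "a * b \<in> mp.span (M (Suc q) (Suc q * (\<delta> * s)) \<union> p)" by (intro mp.span_base) auto
    qed
    then show ?case by simp
  qed
  \<comment> \<open>A common denominator. It lies outside the prime \<open>p\<close>, so
    multiplication by its powers preserves independence modulo \<open>p\<close>.\<close>
  define cc where "cc = (\<Prod>l<r. c l)"
  have ccp: "cc \<notin> p"
  proof -
    have "(\<Prod>l<q. c l) \<notin> p" if "q \<le> r" for q
      using that
    proof (induction q)
      case (Suc q)
      then show ?case using primeD(3)[OF p, of "\<Prod>l<q. c l" "c q"] top[of q] by (auto simp: c_def)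
    qed (use primeD(2)[OF p] in simp)
    then show ?thesis by (simp add: cc_def)
  qed
  have all: "cc ^ s * psub v G \<in> mp.span (M r (r * (\<delta> * s)) \<union> p)" if "G \<in> PV r \<inter> dle s" for G s
  proof -
    have "G \<in> kset {m \<in> vset r. mdeg m \<le> s}" using that by (auto simp: kset_def)
    then show ?thesis
    proof (induction rule: kset_induct)
      case (single m a)
      have ms: "m \<in> vset r" "mdeg m \<le> s" using single by auto
      have "psub v (mnm m) = (\<Prod>l<r. v l ^ lkp m l)" by (rule psub_mnm_vset[OF ms(1)])
      then have "cc ^ s * psub v (mnm m) = (\<Prod>l<r. c l ^ s * v l ^ lkp m l)"
        by (simp add: cc_def prod.distrib prod_power_distrib)
      also have "\<dots> \<in> mp.span (M r (r * (\<delta> * s)) \<union> p)"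
        using lkp_le_mdeg[of m] ms(2) by (intro prod) (auto intro: order_trans)
      finally have "cc ^ s * psub v (mnm m) \<in> mp.span (M r (r * (\<delta> * s)) \<union> p)" .
      from mp.span_scale[OF this, of a] show ?case unfolding psub_single[where w = v and m = m and c = a] by (simp only: mult.left_commute)
    next
      case (add F G)
      from mp.span_add[OF add(3,4)] show ?case by (simp only: psub_hom distrib_left)
    qed (simp add: psub_hom mp.span_zero)
  qed
  define CC where "CC = (r * \<delta> + 1) ^ j * card (Pi\<^sub>E {..<r} (\<lambda>l. {..<e l}))"
  have finE: "finite (E d)" for d unfolding E_def by (rule finite_vset_le)
  have cardM: "finite (M r (r * (\<delta> * s)))" "card (M r (r * (\<delta> * s))) \<le> CC * (s + 1) ^ j" for s
  proof -
    show "finite (M r (r * (\<delta> * s)))" unfolding M_def by (intro finite_imageI finite_cartesian_product finE finite_PiE) auto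
    have "card (M r (r * (\<delta> * s))) \<le> card (E (r * (\<delta> * s)) \<times> Pi\<^sub>E {..<r} (\<lambda>l. {..<e l}))"
      unfolding M_def by (intro card_image_le finite_cartesian_product finE finite_PiE) auto
    also have "\<dots> = card (E (r * (\<delta> * s))) * card (Pi\<^sub>E {..<r} (\<lambda>l. {..<e l}))" by (rule card_cartesian_product)
    also have "\<dots> \<le> (r * (\<delta> * s) + 1) ^ j * card (Pi\<^sub>E {..<r} (\<lambda>l. {..<e l}))"
      using card_exponents_le[of j "r * (\<delta> * s)"] by (intro mult_le_mono1) (simp add: E_def)
    also have "(r * (\<delta> * s) + 1) ^ j \<le> ((r * \<delta> + 1) * (s + 1)) ^ j" by (rule power_mono) (auto simp: algebra_simps)
    finally have "card (M r (r * (\<delta> * s))) \<le> ((r * \<delta> + 1) * (s + 1)) ^ j * card (Pi\<^sub>E {..<r} (\<lambda>l. {..<e l}))"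
      by simp
    also have "\<dots> = CC * (s + 1) ^ j" by (simp only: CC_def power_mult_distrib mult_ac)
    finally show "card (M r (r * (\<delta> * s))) \<le> CC * (s + 1) ^ j" .
  qed
  show ?thesis
  proof (intro exI[of _ CC] allI impI)
    fix s and I :: "'i set" and f
    assume I: "finite I" and f: "\<forall>i\<in>I. f i \<in> psub v ` (PV r \<inter> dle s)" and ind: "indm p I f"
    have ind': "indm p I (\<lambda>i. cc ^ s * f i)"
      unfolding indm_def
    proof (intro allI impI)
      fix a assume "(\<Sum>i\<in>I. Cst (a i) * (cc ^ s * f i)) \<in> p"
      then have "cc ^ s * (\<Sum>i\<in>I. Cst (a i) * f i) \<in> p" by (simp add: sum_distrib_left mult.left_commute)
      then have "(\<Sum>i\<in>I. Cst (a i) * f i) \<in> p" using primeD(3)[OF p] prime_power[OF p] ccp by auto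
      then show "\<forall>i\<in>I. a i = 0" by (intro ballI) (rule indmD[OF ind, of a])
    qed
    have "card I \<le> card (M r (r * (\<delta> * s)))"
    proof (rule indm_card_le[OF ideal_subspace[OF pI] I cardM(1) ind'])
      fix i assume "i \<in> I"
      then obtain G where "G \<in> PV r \<inter> dle s" "f i = psub v G" using f by auto
      then show "cc ^ s * f i \<in> mp.span (M r (r * (\<delta> * s)) \<union> p)" using all by simp
    qed
    also have "\<dots> \<le> CC * (s + 1) ^ j" by (rule cardM(2))
    finally show "card I \<le> CC * (s + 1) ^ j" .
  qed
qed

lemma aind_indm_mono:
  assumes "aind p j w" "finite A" "A \<subseteq> vset j"
  shows "indm p A (\<lambda>m. psub w (mnm m))"
  unfolding indm_def
proof (intro allI impI ballI)
  fix c i assume s: "(\<Sum>m\<in>A. Cst (c m) * psub w (mnm m)) \<in> p" and i: "i \<in> A"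
  have "psub w (\<Sum>m\<in>A. sgl m (c m)) = (\<Sum>m\<in>A. Cst (c m) * psub w (mnm m))"
    by (simp add: psub_hom psub_single[where c = "c _"])
  moreover have "(\<Sum>m\<in>A. sgl m (c m)) \<in> PV j"
    using assms(3) by (intro kset_sum kset_single) auto
  ultimately have "(\<Sum>m\<in>A. sgl m (c m)) = 0" using assms(1) s by (auto simp: aind_def)
  then have "(\<Sum>m\<in>A. lkp (sgl m (c m)) i) = 0" by (metis lookup_sum lookup_zero)
  moreover have "(\<Sum>m\<in>A. lkp (sgl m (c m)) i) = (\<Sum>m\<in>A. if m = i then c i else 0)"
    by (rule sum.cong) (auto simp: lookup_single when_def)
  ultimately show "c i = 0" using assms(2) i by simp
qed

subsection \<open>Generic linear combinations\<close>

text \<open>The coefficients of the Lagrange polynomials of the nodes form the inverse matrix,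
  because a monomial of degree below r is the interpolation of its own values.\<close>

lemma vandermonde_left_inverse:
  fixes \<tau> :: "nat \<Rightarrow> 'k::field"
  assumes inj: "inj_on \<tau> {..<r}"
  shows "\<exists>\<beta>. \<forall>l<r. \<forall>l'<r. (\<Sum>i<r. \<beta> l i * \<tau> i ^ l') = (if l = l' then 1 else 0)"
proof -
  define P where "P i = (\<Prod>k\<in>{..<r} - {i}. smult (inverse (\<tau> i - \<tau> k)) [:- \<tau> k, 1:])" for i
  have deg: "degree (P i) < r" if "i < r" for i
  proof -
    have "degree (P i) \<le> (\<Sum>k\<in>{..<r} - {i}. degree (smult (inverse (\<tau> i - \<tau> k)) [:- \<tau> k, 1:]))"
      unfolding P_def
      by (rule order_trans[OF degree_prod_sum_le]) (simp_all only: o_def order_refl finite_Diff finite_lessThan)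
    also have "\<dots> \<le> (\<Sum>k\<in>{..<r} - {i}. 1)"
      by (rule sum_mono, rule order_trans[OF degree_smult_le]) simp
    also have "\<dots> < r" using that by (simp add: card_Diff_singleton)
    finally show ?thesis .
  qed
  have val: "poly (P i) (\<tau> j) = (if i = j then 1 else 0)" if ij: "i < r" "j < r" for i j
  proof (cases "i = j")
    case True
    have "poly (smult (inverse (\<tau> i - \<tau> k)) [:- \<tau> k, 1:]) (\<tau> i) = 1" if "k \<in> {..<r} - {i}" for k
    proof -
      have "\<tau> i - \<tau> k \<noteq> 0" using inj that ij by (auto simp: inj_on_def)
      then have "inverse (\<tau> i - \<tau> k) * (\<tau> i - \<tau> k) = 1" by (rule left_inverse)
      then show ?thesis by (simp add: algebra_simps)
    qed
    then have "poly (P i) (\<tau> i) = 1" unfolding P_def poly_prod by (intro prod.neutral) blast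
    then show ?thesis using True by simp
  next
    case False
    then have "\<exists>k\<in>{..<r} - {i}. poly (smult (inverse (\<tau> i - \<tau> k)) [:- \<tau> k, 1:]) (\<tau> j) = 0"
      using ij by (intro bexI[of _ j]) auto
    then have "poly (P i) (\<tau> j) = 0" unfolding P_def poly_prod by (intro prod_zero) auto
    then show ?thesis using False by simp
  qed
  have "(\<Sum>i<r. coeff (P i) l * \<tau> i ^ l') = (if l = l' then 1 else 0)" if "l < r" "l' < r" for l l'
  proof -
    let ?D = "monom 1 l' - (\<Sum>i<r. smult (\<tau> i ^ l') (P i))"
    have root: "poly ?D (\<tau> j) = 0" if j: "j < r" for j
    proof -
      have "(\<Sum>i<r. \<tau> i ^ l' * poly (P i) (\<tau> j)) = (\<Sum>i<r. if i = j then \<tau> j ^ l' else 0)"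
        by (rule sum.cong) (use val j in auto)
      then show ?thesis using j by (simp add: poly_monom poly_sum)
    qed
    have "?D = 0"
    proof (rule ccontr)
      assume nz: "?D \<noteq> 0"
      have "\<tau> ` {..<r} \<subseteq> {x. poly ?D x = 0}" using root by auto
      then have "card (\<tau> ` {..<r}) \<le> card {x. poly ?D x = 0}" by (rule card_mono[OF poly_roots_finite[OF nz]])
      then have "r \<le> card {x. poly ?D x = 0}" using card_image[OF inj] by simp
      also have "\<dots> \<le> degree ?D" using card_poly_roots_bound[OF nz] by simp
      also have "\<dots> < r"
        using that deg by (intro degree_diff_less degree_sum_less)
          (auto simp: degree_monom_eq intro: le_less_trans[OF degree_smult_le])
      finally show False by simp
    qed
    then have "coeff ?D l = 0" by simp
    then show ?thesis by (auto simp: coeff_sum mult.commute)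
  qed
  then show ?thesis by (intro exI[of _ "\<lambda>l i. coeff (P i) l"]) auto
qed

text \<open>The combination runs along a moment curve. If infinitely many parameters were bad for
  some z, then r of them would suffice to recover all \<open>\<zeta> l\<close> by inverting a
  Vandermonde matrix, which \<open>H\<close> excludes. So each z forbids finitely many parameters,
  and one parameter serves all z.\<close>

lemma generic_independent:
  fixes p :: "'z \<Rightarrow> 'k::field mpoly set"
  assumes inf: "infinite (UNIV :: 'k set)" and Z: "finite Z"
    and H: "\<And>z v. z \<in> Z \<Longrightarrow> (\<And>i. i < r \<Longrightarrow> \<not> aind (p z) (Suc j) (w(j := v i))) \<Longrightarrow>
      (\<And>l. l < r \<Longrightarrow> \<exists>\<beta>. \<zeta> l = (\<Sum>i<r. Cst (\<beta> i) * v i)) \<Longrightarrow> False"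
  shows "\<exists>\<tau>. \<forall>z\<in>Z. aind (p z) (Suc j) (w(j := (\<Sum>l<r. Cst (\<tau> ^ l) * \<zeta> l)))"
proof -
  define v where "v \<tau> = (\<Sum>l<r. Cst (\<tau> ^ l) * \<zeta> l)" for \<tau>
  define Bad where "Bad z = {\<tau>. \<not> aind (p z) (Suc j) (w(j := v \<tau>))}" for z
  have "finite (Bad z)" if z: "z \<in> Z" for z
  proof (rule ccontr)
    assume "infinite (Bad z)"
    then obtain T where T: "finite T" "card T = r" "T \<subseteq> Bad z" using infinite_arbitrarily_large by blast
    then obtain h where h: "bij_betw h {0..<r} T" using ex_bij_betw_nat_finite by blast
    then have inj: "inj_on h {..<r}" by (simp add: bij_betw_def atLeast0LessThan)
    have hT: "h i \<in> Bad z" if "i < r" for i using h T(3) that by (auto simp: bij_betw_def)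
    obtain \<beta> where \<beta>: "\<forall>l<r. \<forall>l'<r. (\<Sum>i<r. \<beta> l i * h i ^ l') = (if l = l' then 1 else 0)"
      using vandermonde_left_inverse[OF inj] by auto
    show False
    proof (rule H[OF z, of "\<lambda>i. v (h i)"])
      fix i assume "i < r"
      then show "\<not> aind (p z) (Suc j) (w(j := v (h i)))" using hT by (simp add: Bad_def)
    next
      fix l assume l: "l < r"
      have "(\<Sum>i<r. Cst (\<beta> l i) * v (h i)) = (\<Sum>i<r. \<Sum>l'<r. Cst (\<beta> l i * h i ^ l') * \<zeta> l')"
        by (simp add: v_def sum_distrib_left Cst_mult mult.assoc)
      also have "\<dots> = (\<Sum>l'<r. \<Sum>i<r. Cst (\<beta> l i * h i ^ l') * \<zeta> l')" by (rule sum.swap)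
      also have "\<dots> = (\<Sum>l'<r. Cst (\<Sum>i<r. \<beta> l i * h i ^ l') * \<zeta> l')"
        by (simp add: rhom_sum[OF rhom_Cst] sum_distrib_right)
      also have "\<dots> = (\<Sum>l'<r. if l' = l then \<zeta> l else 0)"
        by (rule sum.cong) (use \<beta> l in \<open>auto simp: Cst_0 Cst_1\<close>)
      also have "\<dots> = \<zeta> l" using l by simp
      finally have "\<zeta> l = (\<Sum>i<r. Cst (\<beta> l i) * v (h i))" by (rule sym)
      then show "\<exists>\<beta>. \<zeta> l = (\<Sum>i<r. Cst (\<beta> i) * v (h i))" by (intro exI[of _ "\<beta> l"])
    qed
  qed
  then have "finite (\<Union>z\<in>Z. Bad z)" using Z by blast
  then have "(\<Union>z\<in>Z. Bad z) \<noteq> UNIV" using inf by auto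
  then obtain \<tau> where "\<tau> \<notin> (\<Union>z\<in>Z. Bad z)" by blast
  then have "\<forall>z\<in>Z. aind (p z) (Suc j) (w(j := v \<tau>))" unfolding Bad_def by blast
  then show ?thesis unfolding v_def by (rule exI)
qed

text \<open>The monomials of degree below s in d variables grow at least like \<open>s ^ d\<close>,
  up to a constant: allowing every exponent up to t costs total degree d t.\<close>

lemma growth_exponent_le:
  assumes c: "\<And>s. card {\<alpha> \<in> vset d. mdeg \<alpha> < s} \<le> C * (s + 1) ^ D"
  shows "d \<le> D"
proof (rule ccontr)
  assume "\<not> d \<le> D"
  then have d: "Suc D \<le> d" by simp
  obtain t where t: "C * 2 ^ D * (d * t + 1) ^ D < (t + 1) ^ Suc D"
    using power_dominates[of "C * 2 ^ D" d D] by auto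
  have "(t + 1) ^ Suc D \<le> (t + 1) ^ d" using d by (intro power_increasing) auto
  also have "\<dots> \<le> card {\<alpha> \<in> vset d. mdeg \<alpha> \<le> d * t}" by (rule card_exponents_ge)
  also have "{\<alpha> \<in> vset d. mdeg \<alpha> \<le> d * t} = {\<alpha> \<in> vset d. mdeg \<alpha> < d * t + 1}" by auto
  also have "card \<dots> \<le> C * (d * t + 1 + 1) ^ D" by (rule c)
  also have "\<dots> \<le> C * (2 * (d * t + 1)) ^ D" by (intro mult_le_mono2 power_mono) auto
  also have "\<dots> = C * 2 ^ D * (d * t + 1) ^ D" by (simp only: power_mult_distrib mult.assoc)
  finally show False using t by simp
qed

lemma indm_mnm_dge:
  assumes A: "finite A" "\<And>m. m \<in> A \<Longrightarrow> mdeg m < s"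
  shows "indm (dge s) A mnm"
  unfolding indm_def
proof (intro allI impI ballI)
  fix c :: "_ \<Rightarrow> 'a" and i assume h: "(\<Sum>m\<in>A. Cst (c m) * mnm m) \<in> dge s" and i: "i \<in> A"
  have "(\<Sum>m\<in>A. lkp (Cst (c m) * mnm m) i) = (\<Sum>m\<in>A. if m = i then c i else 0)"
    by (rule sum.cong) (auto simp: lkp_Cst_mult lookup_single when_def)
  then have "lkp (\<Sum>m\<in>A. Cst (c m) * mnm m) i = c i" using A(1) i by (simp add: lookup_sum)
  moreover have "i \<notin> kys (\<Sum>m\<in>A. Cst (c m) * mnm m)" using h A(2)[OF i] by (auto simp: kset_def)
  ultimately show "c i = 0" by (simp add: in_keys_iff)
qed

lemma dge_prod_mdeg:
  assumes "\<And>i. i \<in> kys m \<Longrightarrow> w i \<in> dge 1"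
  shows "(\<Prod>i\<in>kys m. w i ^ lkp m i) \<in> dge (mdeg m)"
  using dge_prod_wdg[of m w "\<lambda>_. 1", OF assms] by (simp only: mdeg_wdg[symmetric])

lemma ex_min_measure:
  fixes f :: "'x \<Rightarrow> nat"
  assumes "x \<in> A" shows "\<exists>x\<in>A. \<forall>y\<in>A. f x \<le> f y"
  using ex_has_least_nat[of "\<lambda>x. x \<in> A" x f, OF assms] by auto

lemma lex_decrease:
  fixes a b c d s :: nat
  assumes "a + 1 \<le> b" "c \<le> s" shows "a * (s + 1) + c < b * (s + 1) + d"
proof -
  have "(a + 1) * (s + 1) \<le> b * (s + 1)" using assms(1) by (rule mult_le_mono1)
  then show ?thesis using assms(2) by (simp add: algebra_simps)
qed

lemma span_ideal_Un:
  assumes "mp.subspace A" "mp.subspace B" "x \<in> mp.span (A \<union> B)"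
  shows "\<exists>a\<in>A. \<exists>b\<in>B. x = a + b"
proof -
  obtain a b where ab: "x = a + b" "a \<in> mp.span A" "b \<in> mp.span B"
    using assms(3) unfolding mp.span_Un by auto
  have "a \<in> A" "b \<in> B"
    using ab(2,3) unfolding mp.span_eq_iff[THEN iffD2, OF assms(1)] mp.span_eq_iff[THEN iffD2, OF assms(2)] .
  then show ?thesis using ab(1) by auto
qed

subsection \<open>The initial ideal of a bigraded presentation\<close>

text \<open>In the polynomial ring with variables \<open>Y\<^sub>i\<close> (\<open>i < N\<close>) and \<open>F\<^sub>l\<close> (variable \<open>N + l\<close>, \<open>l < m\<close>),
  \<open>Th\<close> sends \<open>Y\<^sub>i\<close> to \<open>x\<^sub>i\<close> and \<open>F\<^sub>l\<close> to the given polynomials.  Bidegrees are ordered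
  lexicographically, the degree in the \<open>F\<^sub>l\<close> first; \<open>bz\<close> consists of the initial forms of the kernel
  of \<open>Th\<close>, so the quotient by \<open>bz\<close> is the graded ring of the maximal-adic filtration on the graded
  ring of the ideal generated by the given polynomials.\<close>

locale cone =
  fixes N m :: nat and F :: "nat \<Rightarrow> 'k::field mpoly"
  assumes F_dge: "\<And>l. l < m \<Longrightarrow> F l \<in> dge (Suc 0)" and F_PV: "\<And>l. l < m \<Longrightarrow> F l \<in> PV N"
begin

definition thv :: "nat \<Rightarrow> 'k mpoly" where
  "thv i = (if i < N then Vr i else if i < N + m then F (i - N) else 0)"

abbreviation Th :: "'k mpoly \<Rightarrow> 'k mpoly" where "Th \<equiv> psub thv"

definition dY :: "(nat \<Rightarrow>\<^sub>0 nat) \<Rightarrow> nat" where "dY = wdg (\<lambda>i. if i < N then 1 else 0)"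
definition dF :: "(nat \<Rightarrow>\<^sub>0 nat) \<Rightarrow> nat" where "dF = wdg (\<lambda>i. if i < N then 0 else 1)"

lemma dY_add: "dY (a + b) = dY a + dY b" and dF_add: "dF (a + b) = dF a + dF b"
  by (simp_all add: dY_def dF_def wdg_add)

lemma mdeg_dY_dF: "mdeg a = dF a + dY a"
  unfolding mdeg_def dY_def dF_def wdg_def sum.distrib[symmetric] by (rule sum.cong) auto

definition T :: "nat \<Rightarrow> nat \<Rightarrow> 'k mpoly set" where
  "T i j = kset {\<mu>. i < dF \<mu> \<or> (i = dF \<mu> \<and> j \<le> dY \<mu>)}"

definition bh :: "nat \<Rightarrow> nat \<Rightarrow> 'k mpoly set" where
  "bh i j = kset {\<mu>. dF \<mu> = i \<and> dY \<mu> = j}"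

definition bp :: "nat \<Rightarrow> nat \<Rightarrow> 'k mpoly \<Rightarrow> 'k mpoly" where
  "bp i j = prt {\<mu>. dF \<mu> = i \<and> dY \<mu> = j}"

definition bz :: "'k mpoly set" where
  "bz = {\<Phi>. \<forall>i j. Th (bp i j \<Phi>) \<in> Th ` T i (Suc j)}"

lemma bzD: "a \<in> bz \<Longrightarrow> \<exists>x. Th (bp i j a) = Th x \<and> x \<in> T i (Suc j)"
proof -
  assume "a \<in> bz"
  then have "Th (bp i j a) \<in> Th ` T i (Suc j)" unfolding bz_def by simp
  then show ?thesis by (elim imageE) (intro exI conjI)
qed

lemma T_mult: "a \<in> T i j \<Longrightarrow> b \<in> T i' j' \<Longrightarrow> a * b \<in> T (i + i') (j + j')"
  unfolding T_def by (erule (1) kset_mult) (auto simp: dF_add dY_add)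

lemma T_0 [simp]: "0 \<in> T i j"
  and T_add: "a \<in> T i j \<Longrightarrow> b \<in> T i j \<Longrightarrow> a + b \<in> T i j"
  and T_uminus: "a \<in> T i j \<Longrightarrow> - a \<in> T i j"
  by (simp_all add: T_def kset_add kset_uminus)

lemma T_sum: "(\<And>l. l \<in> I \<Longrightarrow> f l \<in> T i j) \<Longrightarrow> sum f I \<in> T i j"
  by (simp add: T_def kset_sum)

lemma T_lex: "i < i' \<or> (i = i' \<and> j \<le> j') \<Longrightarrow> a \<in> T i' j' \<Longrightarrow> a \<in> T i j"
  unfolding T_def by (erule kset_mono[rotated]) auto

lemma bh_T: "a \<in> bh i j \<Longrightarrow> a \<in> T i j"
  unfolding T_def bh_def by (erule kset_mono[rotated]) auto

lemma bh_mult: "a \<in> bh i j \<Longrightarrow> b \<in> bh i' j' \<Longrightarrow> a * b \<in> bh (i + i') (j + j')"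
  unfolding bh_def by (erule (1) kset_mult) (auto simp: dF_add dY_add)

lemma bp_single_mult:
  "bp i j (sgl \<mu> c * \<Phi>) = (if dF \<mu> \<le> i \<and> dY \<mu> \<le> j then sgl \<mu> c * bp (i - dF \<mu>) (j - dY \<mu>) \<Phi> else 0)"
proof (induction \<Phi> rule: mpoly_induct)
  case (single m a)
  then show ?case by (auto simp: bp_def mult_single prt_single dF_add dY_add)
qed (auto simp: distrib_left bp_def prt_add)

lemma bz_ideal: "rm.subspace bz"
  unfolding rm.subspace_def
proof (intro conjI ballI allI)
  have 0: "0 \<in> Th ` T i j" for i j by (rule image_eqI[of _ _ 0]) (simp_all add: psub_hom)
  show "0 \<in> bz" using 0 by (simp add: bz_def bp_def psub_hom)
  show add: "a + b \<in> bz" if ab: "a \<in> bz" "b \<in> bz" for a b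
    unfolding bz_def
  proof (intro CollectI allI)
    fix i j
    obtain x y where "Th (bp i j a) = Th x" "x \<in> T i (Suc j)" "Th (bp i j b) = Th y" "y \<in> T i (Suc j)"
      using bzD[OF ab(1), of i j] bzD[OF ab(2), of i j] by (elim exE conjE)
    then have "Th (bp i j (a + b)) = Th (x + y)" "x + y \<in> T i (Suc j)"
      by (simp_all add: bp_def prt_add psub_hom T_add)
    then show "Th (bp i j (a + b)) \<in> Th ` T i (Suc j)" by (rule image_eqI)
  qed
  fix r a assume a: "a \<in> bz"
  show "r * a \<in> bz"
  proof (induction r rule: mpoly_induct)
    case (single \<mu> c)
    show ?case
      unfolding bz_def
    proof (intro CollectI allI)
      fix i j
      show "Th (bp i j (sgl \<mu> c * a)) \<in> Th ` T i (Suc j)"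
      proof (cases "dF \<mu> \<le> i \<and> dY \<mu> \<le> j")
        case True
        obtain x where x: "Th (bp (i - dF \<mu>) (j - dY \<mu>) a) = Th x" "x \<in> T (i - dF \<mu>) (Suc (j - dY \<mu>))"
          using bzD[OF a, of "i - dF \<mu>" "j - dY \<mu>"] by (elim exE conjE)
        have "sgl \<mu> c \<in> T (dF \<mu>) (dY \<mu>)" by (auto simp: T_def intro: kset_single)
        from T_mult[OF this x(2)] have "sgl \<mu> c * x \<in> T i (Suc j)" using True by simp
        moreover have "Th (bp i j (sgl \<mu> c * a)) = Th (sgl \<mu> c * x)"
          using True by (simp add: bp_single_mult psub_hom x(1))
        ultimately show ?thesis by (intro image_eqI)
      next
        case False
        then show ?thesis using 0 by (auto simp: bp_single_mult psub_hom)
      qed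
    qed
  qed (simp add: distrib_right add)
qed

lemma bz_initial:
  assumes "\<Phi> \<in> bh i j" "Th \<Phi> \<in> Th ` T i (Suc j)" shows "\<Phi> \<in> bz"
  unfolding bz_def
proof (intro CollectI allI)
  fix i' j'
  show "Th (bp i' j' \<Phi>) \<in> Th ` T i' (Suc j')"
  proof (cases "i' = i \<and> j' = j")
    case True
    then have "bp i' j' \<Phi> = \<Phi>" unfolding bp_def using assms(1) by (intro prt_same) (simp add: bh_def)
    then show ?thesis using True assms(2) by simp
  next
    case False
    then have "bp i' j' \<Phi> = 0" unfolding bp_def using assms(1)
      by (intro prt_disjoint[of _ "{\<mu>. dF \<mu> = i \<and> dY \<mu> = j}"]) (auto simp: bh_def)
    then show ?thesis by (intro image_eqI[of _ _ 0]) (simp_all add: psub_hom)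
  qed
qed

lemma bz_Vr: "Vr ` {N + m..} \<subseteq> bz"
proof (rule image_subsetI)
  fix i assume "i \<in> {N + m..}"
  then have "Vr i \<in> bh 1 0" "Th (Vr i) = 0" by (auto simp: bh_def dF_def dY_def thv_def intro: Vr_kset)
  then show "Vr i \<in> bz" by (intro bz_initial[of _ 1 0] image_eqI[of _ _ 0]) (simp_all add: psub_hom)
qed

lemma thv_dge: "thv i \<in> dge 1"
  using F_dge by (auto simp: thv_def intro: Vr_kset)

lemma Th_mnm_dge: "Th (mnm \<mu>) \<in> dge (mdeg \<mu>)"
  unfolding psub_mnm by (rule dge_prod_mdeg) (rule thv_dge)

lemma Th_mnm_zero: "\<mu> \<notin> vset (N + m) \<Longrightarrow> Th (mnm \<mu>) = 0"
proof -
  assume "\<mu> \<notin> vset (N + m)"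
  then obtain i where "i \<in> kys \<mu>" "\<not> i < N + m" by auto
  then show ?thesis unfolding psub_mnm
    by (intro prod_zero bexI[of _ i]) (auto simp: thv_def in_keys_iff power_0_left)
qed

lemma Th_PV: "G \<in> PV N \<Longrightarrow> Th G = G"
proof -
  assume G: "G \<in> PV N"
  have "i < N" if "\<mu> \<in> kys G" "i \<in> kys \<mu>" for \<mu> i using G that by (auto simp: kset_def)
  then have "Th G = psub Vr G" by (intro meval_cong_keys) (simp add: thv_def)
  then show ?thesis by simp
qed

text \<open>Passing to initial forms loses no dimension. Choose monomials spanning the quotient by
  \<open>bz\<close> and \<open>dge s\<close>. Modulo \<open>bz\<close> every monomial is a
  combination of these, and the image of the error is an image of terms of higher bidegree, to which
  the same applies. Hence the images of the chosen monomials span all polynomials in the coordinates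
  modulo \<open>dge s\<close>.\<close>

lemma card_le_codim_bz:
  assumes "codim_le (bz \<union> dge s) n"
  shows "card {\<mu> \<in> vset N. mdeg \<mu> < s} \<le> n"
proof -
  obtain B where B: "finite B" "card B \<le> n" "mp.span (B \<union> (bz \<union> dge s)) = UNIV"
    using assms by (auto simp: codim_le_def)
  define V where "V = mp.span (bz \<union> dge s)"
  have Vs: "mp.subspace V" by (simp add: V_def)
  have BV: "mp.span (B \<union> V) = UNIV"
  proof -
    have "B \<union> (bz \<union> dge s) \<subseteq> B \<union> V" unfolding V_def using mp.span_superset[of "bz \<union> dge s"] by blast
    from mp.span_mono[OF this] show ?thesis using B(3) by blast
  qed
  define M where "M = {\<mu> \<in> vset (N + m). mdeg \<mu> < s}"
  have finM: "finite M" unfolding M_def by (rule finite_subset[OF _ finite_vset_le[of "N + m" s]]) auto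
  obtain M0 where M0: "M0 \<subseteq> mnm ` M" "indm V M0 (\<lambda>x. x)" "mnm ` M \<subseteq> mp.span (M0 \<union> V)"
    using indm_spanning_subset[OF Vs finite_imageI[OF finM, of mnm]] by auto
  have finM0: "finite M0" using finite_subset[OF M0(1)] finM by blast
  have c0: "card M0 \<le> n"
    using indm_card_le[OF Vs finM0 B(1) M0(2)] BV B(2) by auto
  define K where "K = mp.span (Th ` M0 \<union> dge s)"
  have K: "mp.subspace K" by (simp add: K_def)
  have Kd: "x \<in> K" if "x \<in> dge s" for x unfolding K_def using that by (intro mp.span_base) simp
  \<comment> \<open>The measure decreases as the bidegree increases lexicographically. Monomials of
    total degree at least \<open>s\<close> end the recursion, since \<open>Th\<close> maps them into
    \<open>dge s\<close>.\<close>
  have main: "Th (mnm \<mu>) \<in> K" if "\<mu> \<in> M" for \<mu>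
    using that
  proof (induction "(s - dF \<mu>) * (s + 1) + (s - dY \<mu>)" arbitrary: \<mu> rule: less_induct)
    case (less \<mu>)
    let ?i = "dF \<mu>" and ?j = "dY \<mu>"
    have ij: "?i + ?j < s" using less.prems by (simp add: M_def mdeg_dY_dF)
    have "mnm \<mu> \<in> mp.span (M0 \<union> V)" using M0(3) less.prems by auto
    then obtain x y where xy: "mnm \<mu> = x + y" "x \<in> mp.span M0" "y \<in> mp.span V" unfolding mp.span_Un by auto
    have "y \<in> V" using xy(3) Vs by (simp add: mp.span_eq_iff[THEN iffD2])
    then obtain b d where bd: "b \<in> bz" "d \<in> dge s" "y = b + d"
      unfolding V_def using span_ideal_Un[OF ideal_subspace[OF bz_ideal] kset_subspace] by blast
    have "bp ?i ?j d = 0" unfolding bp_def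
      by (rule prt_disjoint[OF bd(2)]) (use ij in \<open>auto simp: mdeg_dY_dF\<close>)
    moreover have "bp ?i ?j (mnm \<mu>) = mnm \<mu>" by (simp add: bp_def prt_single)
    ultimately have e: "mnm \<mu> = bp ?i ?j x + bp ?i ?j b"
      using arg_cong[OF xy(1), of "bp ?i ?j"] by (simp add: bd(3) bp_def prt_add)
    have "Th (bp ?i ?j x) \<in> K"
      using xy(2)
    proof (induction rule: mp.span_induct_alt)
      case (step c a z)
      have "Th (bp ?i ?j a) \<in> K"
      proof -
        obtain \<nu> where a: "a = mnm \<nu>" using step(1) M0(1) by auto
        have "Th a \<in> K" unfolding K_def using step(1) by (intro mp.span_base) simp
        then show ?thesis using a by (auto simp: bp_def prt_single psub_hom mp.subspace_0[OF K])
      qed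
      from mp.subspace_add[OF K mp.subspace_scale[OF K this, of c] step(2)]
      show ?case by (simp add: bp_def prt_add prt_Cst_mult psub_hom)
    qed (simp add: bp_def psub_hom mp.subspace_0[OF K])
    moreover have "Th (bp ?i ?j b) \<in> K"
    proof -
      obtain \<Psi> where \<Psi>: "Th (bp ?i ?j b) = Th \<Psi>" "\<Psi> \<in> T ?i (Suc ?j)"
        using bzD[OF bd(1), of ?i ?j] by (elim exE conjE)
      have "Th \<Psi> \<in> K" using \<Psi>(2)[unfolded T_def]
      proof (induction rule: kset_induct)
        case (single \<nu> c)
        have "Th (mnm \<nu>) \<in> K"
        proof (cases "\<nu> \<in> M")
          case True
          then have n: "dF \<nu> + dY \<nu> < s" by (simp add: M_def mdeg_dY_dF)
          have "(s - dF \<nu>) * (s + 1) + (s - dY \<nu>) < (s - ?i) * (s + 1) + (s - ?j)"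
          proof (cases "?i < dF \<nu>")
            case True
            then have "s - dF \<nu> + 1 \<le> s - ?i" using n by simp
            then show ?thesis by (rule lex_decrease) simp
          next
            case False
            then have "dF \<nu> = ?i" "?j < dY \<nu>" using single by auto
            then show ?thesis using n by simp
          qed
          then show ?thesis using less.hyps[OF _ True] by simp
        next
          case False
          show ?thesis
          proof (cases "\<nu> \<in> vset (N + m)")
            case True
            then have "s \<le> mdeg \<nu>" using False by (simp add: M_def)
            then have "Th (mnm \<nu>) \<in> dge s" using Th_mnm_dge[of \<nu>] by (auto simp: kset_def)
            then show ?thesis by (rule Kd)
          next
            case False
            then show ?thesis using Th_mnm_zero mp.subspace_0[OF K] by simp
          qed
        qed
        from mp.subspace_scale[OF K this, of c] show ?case
          unfolding psub_single[where w = thv and m = \<nu> and c = c] .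
      next
        case (add G H)
        from mp.subspace_add[OF K add(3,4)] show ?case by (simp only: psub_hom)
      qed (simp add: psub_hom mp.subspace_0[OF K])
      then show ?thesis by (simp only: \<Psi>(1))
    qed
    ultimately have "Th (bp ?i ?j x) + Th (bp ?i ?j b) \<in> K" by (rule mp.subspace_add[OF K])
    then have "Th (bp ?i ?j x + bp ?i ?j b) \<in> K" by (simp only: psub_hom)
    then show ?case by (simp only: e[symmetric])
  qed
  let ?A = "{\<mu> \<in> vset N. mdeg \<mu> < s}"
  have finA: "finite ?A" by (rule finite_subset[OF _ finite_vset_le[of N s]]) auto
  have "card ?A \<le> card (Th ` M0)"
  proof (rule indm_card_le[OF kset_subspace finA finite_imageI[OF finM0] indm_mnm_dge[OF finA]])
    fix \<mu> assume \<mu>: "\<mu> \<in> ?A"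
    then have "\<mu> \<in> M" by (auto simp: M_def)
    then have "Th (mnm \<mu>) \<in> K" by (rule main)
    moreover have "Th (mnm \<mu>) = mnm \<mu>" using \<mu> by (intro Th_PV kset_single) simp
    ultimately show "mnm \<mu> \<in> mp.span (Th ` M0 \<union> dge s)" by (simp add: K_def)
  qed simp
  also have "\<dots> \<le> card M0" by (rule card_image_le[OF finM0])
  finally show ?thesis using c0 by simp
qed

text \<open>A prime over the initial ideal on which dimension at least \<open>N\<close> survives.
  All algebraic independence at the given point is measured modulo such a prime.\<close>

lemma ex_prime:
  assumes "0 < N"
  shows "\<exists>p. is_prime p \<and> bz \<subseteq> p \<and> \<not> growth_le dge (N - 1) p"
proof (rule prime_of_growth[OF bz_ideal bz_Vr])
  show "rm.subspace (dge s)" for s by (rule dge_ideal)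
  show "\<not> growth_le dge (N - 1) bz"
  proof
    assume "growth_le dge (N - 1) bz"
    then obtain C where C: "\<forall>s. codim_le (bz \<union> dge s) (C * (s + 1) ^ (N - 1))"
      unfolding growth_le_def by (rule exE)
    have "N \<le> N - 1" by (rule growth_exponent_le[of N C]) (rule card_le_codim_bz[OF spec[OF C]])
    then show False using assms by simp
  qed
qed

definition JF :: "'k mpoly set" where "JF = rm.span (F ` {..<m} \<union> Vr ` {N..})"

text \<open>In degree 0 with respect to the equations, \<open>bz\<close> contains the initial forms
  of the ideal \<open>JF\<close>: if a combination of monomials in \<open>w\<close> lies in
  \<open>JF\<close> modulo \<open>dge s\<close>, its part of lowest degree lies in
  \<open>bz\<close>, hence in \<open>p\<close>. Independence modulo \<open>p\<close> thus makes the
  monomials of degree below \<open>s\<close> independent modulo \<open>JF\<close> and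
  \<open>dge s\<close>, and the growth of \<open>JF\<close> bounds their number.\<close>

lemma independent_forms_le:
  assumes p: "bz \<subseteq> p" and w: "\<And>l. l < d \<Longrightarrow> w l \<in> kset {sgl i 1 | i. i < N}" "aind p d w"
    and g: "growth_le dge D JF"
  shows "d \<le> D"
proof -
  obtain C where "\<forall>s. codim_le (JF \<union> dge s) (C * (s + 1) ^ D)"
    using g unfolding growth_le_def by (rule exE)
  then have C: "codim_le (JF \<union> dge s) (C * (s + 1) ^ D)" for s by (rule spec)
  \<comment> \<open>Sets all variables from \<open>N\<close> on to zero, so that elements of
    \<open>JF\<close> become combinations of the \<open>F l\<close> with coefficients in the
    coordinates.\<close>
  define \<rho> where "\<rho> = psub (\<lambda>i. if i < N then Vr i else 0 :: 'k mpoly)"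
  have \<rho>h: "rhom \<rho>" unfolding \<rho>_def by (rule rhom_psub)
  have \<rho>PV: "\<rho> G \<in> PV N" for G
    unfolding \<rho>_def by (rule kset_psub[of _ UNIV]) (auto intro!: PV_prod PV_power PV_Vr)
  have \<rho>id: "\<rho> G = G" if "G \<in> PV N" for G
  proof -
    have "\<rho> G = psub Vr G" unfolding \<rho>_def by (rule meval_cong_keys) (use that in \<open>auto simp: kset_def\<close>)
    then show ?thesis by simp
  qed
  have \<rho>dge: "\<rho> G \<in> dge k" if "G \<in> dge k" for G k
    unfolding \<rho>_def
  proof (rule kset_psub[OF that])
    fix \<mu> :: "nat \<Rightarrow>\<^sub>0 nat" assume "\<mu> \<in> {\<mu>. k \<le> mdeg \<mu>}"
    moreover have "(\<Prod>i\<in>kys \<mu>. (if i < N then Vr i else 0 :: 'k mpoly) ^ lkp \<mu> i) \<in> dge (mdeg \<mu>)"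
      by (rule dge_prod_mdeg) (auto intro: Vr_kset)
    ultimately show "(\<Prod>i\<in>kys \<mu>. (if i < N then Vr i else 0 :: 'k mpoly) ^ lkp \<mu> i) \<in> dge k"
      by (auto simp: kset_def)
  qed
  have PVT: "G \<in> Th ` T 0 k" if "G \<in> PV N" "G \<in> dge k" for G k
  proof -
    have "dF \<mu> = 0 \<and> k \<le> dY \<mu>" if "\<mu> \<in> kys G" for \<mu>
    proof -
      have "dF \<mu> = 0" unfolding dF_def wdg_def using that \<open>G \<in> PV N\<close> by (auto simp: kset_def)
      then show ?thesis using that \<open>G \<in> dge k\<close> mdeg_dY_dF[of \<mu>] by (auto simp: kset_def)
    qed
    then have "G \<in> T 0 k" by (auto simp: T_def kset_def)
    then show ?thesis by (intro image_eqI[of _ _ G]) (simp_all add: Th_PV[OF that(1)])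
  qed
  have Tadd: "a + b \<in> Th ` T i k" if ab: "a \<in> Th ` T i k" "b \<in> Th ` T i k" for a b i k
  proof -
    obtain x y where xy: "a = Th x" "b = Th y" "x \<in> T i k" "y \<in> T i k" using ab by auto
    show ?thesis by (rule image_eqI[of _ _ "x + y"]) (simp_all add: psub_hom xy T_add)
  qed
  have Tum: "- a \<in> Th ` T i k" if ab: "a \<in> Th ` T i k" for a i k
  proof -
    obtain x where xy: "a = Th x" "x \<in> T i k" using ab by auto
    show ?thesis by (rule image_eqI[of _ _ "- x"]) (simp_all add: psub_hom xy T_uminus)
  qed
  \<comment> \<open>Here the precedence of the degree in the equations matters: a multiple of
    \<open>F l\<close> is the image of something of degree at least 1 in them, which lies beyond
    every bidegree (0, k).\<close>
  have \<rho>J: "\<rho> b \<in> Th ` T 0 k" if "b \<in> JF" for b k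
    using that unfolding JF_def
  proof (induction rule: rm.span_induct_alt)
    case base
    show ?case by (rule image_eqI[of _ _ 0]) (simp_all add: psub_hom rhomD[OF \<rho>h])
  next
    case (step c x y)
    have "\<rho> (c * x) \<in> Th ` T 0 k"
    proof (cases "x \<in> F ` {..<m}")
      case True
      then obtain l where l: "l < m" "x = F l" by auto
      have "Vr (N + l) \<in> T 1 0" by (auto simp: T_def dF_def dY_def intro: Vr_kset)
      moreover have "\<rho> c \<in> T 0 0" by (auto simp: T_def kset_def)
      ultimately have "\<rho> c * Vr (N + l) \<in> T 0 k" using T_mult[of "\<rho> c" 0 0 "Vr (N + l)" 1 0] T_lex[of 0 1 k 0] by simp
      moreover have "\<rho> (c * x) = Th (\<rho> c * Vr (N + l))"
        using l F_PV by (simp add: psub_hom Th_PV \<rho>PV rhomD[OF \<rho>h] \<rho>id thv_def)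
      ultimately show ?thesis by (intro image_eqI)
    next
      case False
      then obtain i where "N \<le> i" "x = Vr i" using step(1) by auto
      then have "\<rho> (c * x) = 0" by (simp add: rhomD[OF \<rho>h]) (simp add: \<rho>_def)
      then show ?thesis by (intro image_eqI[of _ _ 0]) (simp_all add: psub_hom)
    qed
    from Tadd[OF this step(2)] show ?case by (simp only: rhomD[OF \<rho>h])
  qed
  have wPV: "w l \<in> PV N" "w l \<in> dge 1" "w l \<in> bh 0 1" if "l < d" for l
    using w(1)[OF that] by (auto intro: kset_mono[rotated] simp: bh_def dF_def dY_def)
  have wprod: "psub w (mnm \<alpha>) \<in> PV N" "psub w (mnm \<alpha>) \<in> dge (mdeg \<alpha>)" "psub w (mnm \<alpha>) \<in> bh 0 (mdeg \<alpha>)"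
    if "\<alpha> \<in> vset d" for \<alpha>
  proof -
    have wl: "l \<in> kys \<alpha> \<Longrightarrow> l < d" for l using that by auto
    show "psub w (mnm \<alpha>) \<in> PV N" unfolding psub_mnm by (intro PV_prod PV_power wPV wl)
    show "psub w (mnm \<alpha>) \<in> dge (mdeg \<alpha>)" unfolding psub_mnm
      by (rule dge_prod_mdeg) (intro wPV wl)
    have pw: "a ^ n \<in> bh 0 n" if "a \<in> bh 0 1" for a n
    proof (induction n)
      case (Suc n)
      from bh_mult[OF that Suc] show ?case by simp
    qed (auto simp: bh_def dF_def dY_def intro: one_kset)
    have "A \<subseteq> kys \<alpha> \<Longrightarrow> (\<Prod>l\<in>A. w l ^ lkp \<alpha> l) \<in> bh 0 (\<Sum>l\<in>A. lkp \<alpha> l)" for A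
    proof (induction A rule: infinite_finite_induct)
      case (insert l A)
      then have "w l ^ lkp \<alpha> l \<in> bh 0 (lkp \<alpha> l)" using pw wPV(3) wl by auto
      from bh_mult[OF this, of "\<Prod>l\<in>A. w l ^ lkp \<alpha> l" 0] insert show ?case by auto
    qed (auto simp: bh_def dF_def dY_def intro: one_kset)
    then show "psub w (mnm \<alpha>) \<in> bh 0 (mdeg \<alpha>)" unfolding psub_mnm mdeg_def by blast
  qed
  have "card {\<alpha> \<in> vset d. mdeg \<alpha> < s} \<le> C * (s + 1) ^ D" for s
  proof -
    let ?A = "{\<alpha> \<in> vset d. mdeg \<alpha> < s}"
    have finA: "finite ?A" by (rule finite_subset[OF _ finite_vset_le[of d s]]) auto
    define V where "V = mp.span (JF \<union> dge s)"
    have Vs: "mp.subspace V" by (simp add: V_def)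
    obtain B where B: "finite B" "card B \<le> C * (s + 1) ^ D" "mp.span (B \<union> (JF \<union> dge s)) = UNIV"
      using C[of s] by (auto simp: codim_le_def)
    have BV: "mp.span (B \<union> V) = UNIV"
    proof -
      have "B \<union> (JF \<union> dge s) \<subseteq> B \<union> V" unfolding V_def using mp.span_superset[of "JF \<union> dge s"] by blast
      from mp.span_mono[OF this] show ?thesis using B(3) by blast
    qed
    have "indm V ?A (\<lambda>\<alpha>. psub w (mnm \<alpha>))"
      unfolding indm_def
    proof (intro allI impI)
      fix c assume cV: "(\<Sum>\<alpha>\<in>?A. Cst (c \<alpha>) * psub w (mnm \<alpha>)) \<in> V"
      show "\<forall>\<alpha>\<in>?A. c \<alpha> = 0"
      proof (rule ccontr)
        assume "\<not> (\<forall>\<alpha>\<in>?A. c \<alpha> = 0)"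
        then obtain \<alpha>1 where "\<alpha>1 \<in> {\<alpha> \<in> ?A. c \<alpha> \<noteq> 0}" by auto
        then have "\<exists>x\<in>{\<alpha> \<in> ?A. c \<alpha> \<noteq> 0}. \<forall>y\<in>{\<alpha> \<in> ?A. c \<alpha> \<noteq> 0}. mdeg x \<le> mdeg y"
          by (rule ex_min_measure)
        then obtain \<alpha>0 where \<alpha>0: "\<alpha>0 \<in> {\<alpha> \<in> ?A. c \<alpha> \<noteq> 0}" "\<forall>y\<in>{\<alpha> \<in> ?A. c \<alpha> \<noteq> 0}. mdeg \<alpha>0 \<le> mdeg y"
          by (rule bexE)
        define j where "j = mdeg \<alpha>0"
        have j: "\<alpha>0 \<in> ?A" "c \<alpha>0 \<noteq> 0" "mdeg \<alpha>0 = j" using \<alpha>0(1) by (simp_all add: j_def)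
        have jmin: "j \<le> mdeg \<alpha>" if "\<alpha> \<in> ?A" "c \<alpha> \<noteq> 0" for \<alpha>
          using bspec[OF \<alpha>0(2), of \<alpha>] that by (simp add: j_def)
        define A1 A2 where "A1 = {\<alpha> \<in> ?A. mdeg \<alpha> = j}" and "A2 = {\<alpha> \<in> ?A. mdeg \<alpha> > j}"
        define \<Psi> where "\<Psi> = (\<Sum>\<alpha>\<in>A1. Cst (c \<alpha>) * psub w (mnm \<alpha>))"
        define H where "H = (\<Sum>\<alpha>\<in>A2. Cst (c \<alpha>) * psub w (mnm \<alpha>))"
        have split: "(\<Sum>\<alpha>\<in>?A. Cst (c \<alpha>) * psub w (mnm \<alpha>)) = \<Psi> + H"
        proof -
          have "(\<Sum>\<alpha>\<in>?A. Cst (c \<alpha>) * psub w (mnm \<alpha>)) = (\<Sum>\<alpha>\<in>A1 \<union> A2. Cst (c \<alpha>) * psub w (mnm \<alpha>))"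
          proof (rule sum.mono_neutral_right[OF finA])
            show "\<forall>i\<in>?A - (A1 \<union> A2). Cst (c i) * psub w (mnm i) = 0"
            proof
              fix \<alpha> assume "\<alpha> \<in> ?A - (A1 \<union> A2)"
              then have "\<alpha> \<in> ?A" "\<not> j \<le> mdeg \<alpha>" by (auto simp: A1_def A2_def)
              then have "c \<alpha> = 0" using jmin by blast
              then show "Cst (c \<alpha>) * psub w (mnm \<alpha>) = 0" by (simp add: Cst_0)
            qed
          qed (auto simp: A1_def A2_def)
          also have "\<dots> = \<Psi> + H" unfolding \<Psi>_def H_def
          proof (rule sum.union_disjoint)
            show "finite A1" "finite A2" by (rule finite_subset[OF _ finA], force simp: A1_def A2_def)+
          qed (auto simp: A1_def A2_def)
          finally show ?thesis .
        qed
        have \<Psi>: "\<Psi> \<in> PV N" "\<Psi> \<in> bh 0 j"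
        proof -
          show "\<Psi> \<in> PV N" unfolding \<Psi>_def using wprod(1) by (auto intro!: kset_sum kset_Cst_mult simp: A1_def)
          have "psub w (mnm \<alpha>) \<in> bh 0 j" if "\<alpha> \<in> A1" for \<alpha> using wprod(3)[of \<alpha>] that by (simp add: A1_def)
          then show "\<Psi> \<in> bh 0 j" unfolding \<Psi>_def bh_def by (intro kset_sum kset_Cst_mult)
        qed
        have H: "H \<in> PV N" "H \<in> dge (Suc j)"
        proof -
          show "H \<in> PV N" unfolding H_def using wprod(1) by (auto intro!: kset_sum kset_Cst_mult simp: A2_def)
          have "psub w (mnm \<alpha>) \<in> dge (Suc j)" if "\<alpha> \<in> A2" for \<alpha>
            using wprod(2)[of \<alpha>] that by (auto simp: A2_def kset_def)
          then show "H \<in> dge (Suc j)" unfolding H_def by (intro kset_sum kset_Cst_mult)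
        qed
        obtain b e where be: "b \<in> JF" "e \<in> dge s" "\<Psi> + H = b + e"
        proof -
          have "mp.subspace JF" unfolding JF_def by (rule ideal_subspace) simp
          moreover have "\<Psi> + H \<in> mp.span (JF \<union> dge s)" using cV by (simp only: V_def split)
          ultimately show thesis using span_ideal_Un[OF _ kset_subspace, of JF "\<Psi> + H"] that by auto
        qed
        have "j < s" using j by simp
        then have e: "e \<in> dge (Suc j)" using be(2) by (auto simp: kset_def)
        have "\<Psi> = \<rho> b + (\<rho> e + - H)"
          using arg_cong[OF be(3), of \<rho>] by (simp add: rhomD[OF \<rho>h] \<rho>id \<Psi> H algebra_simps)
        moreover have "\<rho> b + (\<rho> e + - H) \<in> Th ` T 0 (Suc j)"
          by (intro Tadd Tum \<rho>J be PVT \<rho>PV \<rho>dge e H)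
        ultimately have "Th \<Psi> \<in> Th ` T 0 (Suc j)" using Th_PV[OF \<Psi>(1)] by simp
        then have "\<Psi> \<in> p" using bz_initial[OF \<Psi>(2)] p by blast
        moreover have "\<Psi> = psub w (\<Sum>\<alpha>\<in>A1. sgl \<alpha> (c \<alpha>))"
          unfolding \<Psi>_def by (simp add: psub_hom psub_single[where c = "c _"])
        moreover have "(\<Sum>\<alpha>\<in>A1. sgl \<alpha> (c \<alpha>)) \<in> PV d" by (intro kset_sum kset_single) (auto simp: A1_def)
        ultimately have "(\<Sum>\<alpha>\<in>A1. sgl \<alpha> (c \<alpha>)) = 0" using w(2) unfolding aind_def by auto
        then have "(\<Sum>\<alpha>\<in>A1. lkp (sgl \<alpha> (c \<alpha>)) \<alpha>0) = 0" by (metis lookup_sum lookup_zero)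
        moreover have "(\<Sum>\<alpha>\<in>A1. lkp (sgl \<alpha> (c \<alpha>)) \<alpha>0) = (\<Sum>\<alpha>\<in>A1. if \<alpha> = \<alpha>0 then c \<alpha>0 else 0)"
          by (rule sum.cong) (auto simp: lookup_single when_def)
        moreover have "\<alpha>0 \<in> A1" using j by (simp add: A1_def)
        moreover have "finite A1" by (rule finite_subset[OF _ finA]) (force simp: A1_def)
        ultimately show False using j(2) by simp
      qed
    qed
    then have "card ?A \<le> card B" using indm_card_le[OF Vs finA B(1)] BV by auto
    then show ?thesis using B(2) by simp
  qed
  then show ?thesis by (rule growth_exponent_le)
qed

end

subsection \<open>Extension of scalars\<close>

definition lift :: "('a::comm_ring_1 \<Rightarrow> 'k::comm_ring_1) \<Rightarrow> 'a mpoly \<Rightarrow> 'k mpoly" where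
  "lift \<phi> F = meval (\<lambda>c. Cst (\<phi> c)) F Vr"

lemma rhom_lift: "rhom \<phi> \<Longrightarrow> rhom (lift \<phi>)"
  unfolding lift_def by (rule meval_rhom) (rule rhom_comp[OF rhom_Cst])

lemma lift_Vr: "rhom \<phi> \<Longrightarrow> lift \<phi> (Vr i) = Vr i"
  unfolding lift_def by (rule meval_Vr) (rule rhom_comp[OF rhom_Cst])

lemma lift_Cst: "rhom \<phi> \<Longrightarrow> lift \<phi> (Cst c) = Cst (\<phi> c)"
  unfolding lift_def by (rule meval_Cst) (rule rhom_comp[OF rhom_Cst])

lemma lift_single: "rhom \<phi> \<Longrightarrow> lift \<phi> (sgl m c) = sgl m (\<phi> c)"
  unfolding lift_def sgl_eq[of m "\<phi> c"]
  by (rule meval_single) (simp add: rhomD[OF rhom_Cst] rhomD)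

lemma lift_kset: "rhom \<phi> \<Longrightarrow> F \<in> kset A \<Longrightarrow> lift \<phi> F \<in> kset A"
  by (erule kset_induct) (auto simp: lift_single rhomD[OF rhom_lift] kset_single kset_add)

lemma lift_shift:
  assumes \<phi>: "rhom \<phi>" shows "lift \<phi> (shift z F) = shift (\<lambda>i. \<phi> (z i)) (lift \<phi> F)"
proof (induction F rule: mpoly_induct)
  case (single m c)
  have "lift \<phi> (shift z (Vr i)) = shift (\<lambda>i. \<phi> (z i)) (lift \<phi> (Vr i))" for i
    by (simp add: lift_Vr[OF \<phi>] lift_Cst[OF \<phi>] rhomD[OF rhom_lift[OF \<phi>]])
  then show ?case
    unfolding sgl_eq[of m c]
    by (simp only: rhomD[OF rhom_lift[OF \<phi>]] rhomD[OF rhom_shift] rhom_prod[OF rhom_lift[OF \<phi>]] rhom_prod[OF rhom_shift]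
        rhom_power[OF rhom_lift[OF \<phi>]] rhom_power[OF rhom_shift] lift_Cst[OF \<phi>] shift_Cst)
qed (simp add: rhomD[OF rhom_lift[OF \<phi>]] rhomD[OF rhom_shift])

lemma shift_PV: "F \<in> PV n \<Longrightarrow> shift z F \<in> PV n"
  unfolding shift_def by (rule PV_psub) (auto intro: kset_add PV_Vr)

lemma cone_lift:
  assumes "rhom \<phi>" "\<And>l. l < m \<Longrightarrow> f l \<in> PV N" "\<And>l. l < m \<Longrightarrow> ev z (f l) = 0"
  shows "cone N m (\<lambda>l. lift \<phi> (shift z (f l)))"
proof
  fix l assume l: "l < m"
  have "shift z (f l) \<in> dge (Suc 0)" using assms(3)[OF l] by (simp add: dge_1 lkp_shift_0)
  then show "lift \<phi> (shift z (f l)) \<in> dge (Suc 0)" by (rule lift_kset[OF assms(1)])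
  show "lift \<phi> (shift z (f l)) \<in> PV N" by (intro lift_kset[OF assms(1)] shift_PV assms(2) l)
qed

text \<open>Translation carries \<open>Wz z s\<close> into \<open>dge s\<close>, and a spanning set
  over the small field still spans after extension of scalars, since it produces all
  monomials.\<close>

lemma growth_lift:
  fixes \<phi> :: "'a::field \<Rightarrow> 'k::field"
  assumes \<phi>: "rhom \<phi>" and z: "\<And>i. N \<le> i \<Longrightarrow> z i = 0"
    and g: "growth_le (Wz z) D (rm.span (f ` {..<m} \<union> Vr ` {N..}))"
  shows "growth_le dge D (rm.span ((\<lambda>l. lift \<phi> (shift z (f l))) ` {..<m} \<union> Vr ` {N..}))"
    (is "growth_le dge D ?J'")
proof -
  let ?J = "rm.span (f ` {..<m} \<union> Vr ` {N..})"
  define h where "h F = lift \<phi> (shift z F)" for F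
  have h: "rhom h" unfolding h_def by (rule rhom_comp[OF rhom_lift[OF \<phi>] rhom_shift])
  have hJ: "h x \<in> ?J'" if "x \<in> ?J" for x
    using that
  proof (induction rule: rm.span_induct_alt)
    case (step c x y)
    have "h x \<in> ?J'"
    proof (cases "x \<in> f ` {..<m}")
      case True
      then show ?thesis by (intro rm.span_base) (auto simp: h_def)
    next
      case False
      then obtain i where "N \<le> i" "x = Vr i" using step(1) by auto
      then have "h x = Vr i" using z by (simp add: h_def lift_Vr[OF \<phi>] Cst_0)
      then show ?thesis using \<open>N \<le> i\<close> by (intro rm.span_base) auto
    qed
    from rm.span_add[OF rm.span_scale[OF this, of "h c"] step(2)] show ?case by (simp only: rhomD[OF h])
  qed (simp only: rhomD[OF h] rm.span_zero)
  obtain C where "\<forall>s. codim_le (?J \<union> Wz z s) (C * (s + 1) ^ D)"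
    using g unfolding growth_le_def by (rule exE)
  then have C: "codim_le (?J \<union> Wz z s) (C * (s + 1) ^ D)" for s by (rule spec)
  have "codim_le (?J' \<union> dge s) (C * (s + 1) ^ D)" for s
  proof -
    obtain B where B: "finite B" "card B \<le> C * (s + 1) ^ D" "mp.span (B \<union> (?J \<union> Wz z s)) = UNIV"
      using C[of s] by (auto simp: codim_le_def)
    let ?U = "h ` B \<union> (?J' \<union> dge s)"
    have hx: "h x \<in> mp.span ?U" for x
    proof -
      have "x \<in> mp.span (B \<union> (?J \<union> Wz z s))" using B(3) by simp
      then show ?thesis
      proof (induction rule: mp.span_induct_alt)
        case (step c x y)
        have "h x \<in> ?U"
        proof -
          consider "x \<in> B" | "x \<in> ?J" | "x \<in> Wz z s" using step(1) by blast
          then show ?thesis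
          proof cases
            case 2
            then show ?thesis using hJ by blast
          next
            case 3
            then have "h x \<in> dge s" unfolding h_def Wz_def by (intro lift_kset[OF \<phi>]) simp
            then show ?thesis by blast
          qed blast
        qed
        then have "h x \<in> mp.span ?U" by (rule mp.span_base)
        from mp.span_add[OF mp.span_scale[OF this, of "\<phi> c"] step(2)]
        have "Cst (\<phi> c) * h x + h y \<in> mp.span ?U" .
        moreover have "h (Cst c) = Cst (\<phi> c)" by (simp add: h_def lift_Cst[OF \<phi>])
        ultimately show ?case by (simp only: rhomD[OF h])
      qed (simp only: rhomD[OF h] mp.span_zero)
    qed
    have "x \<in> mp.span ?U" for x
    proof (induction x rule: mpoly_induct)
      case (single m c)
      have "h (shift (\<lambda>i. - z i) (sgl m 1)) = sgl m 1"
        by (simp add: h_def shift_inverse lift_single[OF \<phi>] rhomD[OF \<phi>])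
      then have "sgl m 1 \<in> mp.span ?U" using hx[of "shift (\<lambda>i. - z i) (sgl m 1)"] by simp
      from mp.span_scale[OF this, of c] show ?case by (simp add: Cst_def mult_single)
    qed (rule mp.span_add)
    then have "mp.span ?U = UNIV" by blast
    moreover have "card (h ` B) \<le> C * (s + 1) ^ D" using card_image_le[OF B(1), of h] B(2) by simp
    ultimately show ?thesis unfolding codim_le_def using B(1) by (intro exI[of _ "h ` B"]) auto
  qed
  then show ?thesis by (rule growth_leI)
qed

subsection \<open>Simultaneous transcendence bases\<close>

lemma span_linear_form:
  fixes r :: nat
  assumes "x \<in> mp.span (v ` {..<r})"
  shows "\<exists>G \<in> PV r \<inter> dle 1. x = psub v G"
  using assms
proof (induction rule: mp.span_induct_alt)
  case base
  show ?case by (intro bexI[of _ 0]) (auto simp: psub_hom)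
next
  case (step c x y)
  then obtain l G where "l < r" "x = v l" "G \<in> PV r \<inter> dle 1" "y = psub v G" by auto
  then show ?case
    by (intro bexI[of _ "Cst c * Vr l + G"]) (auto simp: psub_hom intro!: kset_add kset_Cst_mult PV_Vr intro: Vr_kset)
qed

lemma mnm_psub_dle:
  assumes "\<mu> \<in> vset d" "\<And>l. l < d \<Longrightarrow> G l \<in> PV r \<inter> dle 1"
  shows "psub G (mnm \<mu>) \<in> PV r \<inter> dle (mdeg \<mu>)"
proof
  have l: "l \<in> kys \<mu> \<Longrightarrow> l < d" for l using assms(1) by auto
  show "psub G (mnm \<mu>) \<in> PV r" unfolding psub_mnm using assms(2) l by (intro PV_prod PV_power) auto
  have "(\<Prod>i\<in>kys \<mu>. G i ^ lkp \<mu> i) \<in> dle (wdg (\<lambda>_. 1) \<mu>)" by (rule dle_prod_wdg) (use assms(2) l in auto)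
  then show "psub G (mnm \<mu>) \<in> dle (mdeg \<mu>)" unfolding psub_mnm by (simp only: mdeg_wdg[symmetric])
qed

text \<open>Invariance of transcendence degree by counting: the monomials in \<open>w'\<close> grow
  like \<open>s ^ d\<close>, whereas polynomials of degree s in elements algebraic over j
  independent ones contribute only order \<open>s ^ j\<close> dimensions modulo
  \<open>p\<close>.\<close>

lemma independent_le_algebraic:
  fixes p :: "'k::field mpoly set" and r d :: nat
  assumes p: "is_prime p" and w: "aind p j w" and v: "\<And>l. l < r \<Longrightarrow> \<not> aind p (Suc j) (w(j := v l))"
    and w': "\<And>l. l < d \<Longrightarrow> w' l \<in> mp.span (v ` {..<r})" "aind p d w'"
  shows "d \<le> j"
proof -
  obtain C where C: "\<forall>s (I :: (nat \<Rightarrow>\<^sub>0 nat) set) f. finite I \<longrightarrow> (\<forall>i\<in>I. f i \<in> psub v ` (PV r \<inter> dle s)) \<longrightarrow> indm p I f \<longrightarrow>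
    card I \<le> C * (s + 1) ^ j"
    using growth_algebraic[OF p w v] by (rule exE)
  have "\<forall>l\<in>{..<d}. \<exists>G. G \<in> PV r \<inter> dle 1 \<and> w' l = psub v G"
    using span_linear_form[OF w'(1)] by blast
  from bchoice[OF this] obtain G where G: "\<forall>l\<in>{..<d}. G l \<in> PV r \<inter> dle 1 \<and> w' l = psub v (G l)" ..
  have "card {\<alpha> \<in> vset d. mdeg \<alpha> < s} \<le> C * (s + 1) ^ j" for s
  proof -
    let ?A = "{\<alpha> \<in> vset d. mdeg \<alpha> < s}"
    have finA: "finite ?A" by (rule finite_subset[OF _ finite_vset_le[of d s]]) auto
    have "psub w' (mnm \<alpha>) \<in> psub v ` (PV r \<inter> dle s)" if \<alpha>: "\<alpha> \<in> ?A" for \<alpha>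
    proof (rule image_eqI)
      show "psub w' (mnm \<alpha>) = psub v (psub G (mnm \<alpha>))"
        unfolding psub_psub by (rule meval_cong_keys) (use \<alpha> G in auto)
      have "psub G (mnm \<alpha>) \<in> PV r \<inter> dle (mdeg \<alpha>)" by (rule mnm_psub_dle) (use \<alpha> G in auto)
      then show "psub G (mnm \<alpha>) \<in> PV r \<inter> dle s" using \<alpha> by (auto simp: kset_def)
    qed
    then have "\<forall>\<alpha>\<in>?A. psub w' (mnm \<alpha>) \<in> psub v ` (PV r \<inter> dle s)" by blast
    moreover have "indm p ?A (\<lambda>\<alpha>. psub w' (mnm \<alpha>))" by (rule aind_indm_mono[OF w'(2) finA]) auto
    ultimately show ?thesis using spec[OF spec[OF spec[OF C, of s], of ?A], of "\<lambda>\<alpha>. psub w' (mnm \<alpha>)"] finA by simp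
  qed
  then show ?thesis by (rule growth_exponent_le)
qed

text \<open>Since the \<open>v l\<close> span the coordinates linearly, every polynomial of degree
  below s is a combination of monomials of degree below s in them. A maximal independent set of
  these monomials modulo \<open>p\<close> has order \<open>s ^ j\<close> elements.\<close>

lemma growth_le_algebraic:
  fixes p :: "'k::field mpoly set" and r n :: nat
  assumes p: "is_prime p" "Vr ` {n..} \<subseteq> p" and w: "aind p j w"
    and v: "\<And>l. l < r \<Longrightarrow> \<not> aind p (Suc j) (w(j := v l))"
    and x: "\<And>i. i < n \<Longrightarrow> Vr i \<in> mp.span (v ` {..<r})"
  shows "growth_le dge j p"
proof -
  note pI = primeD(1)[OF p(1)]
  obtain C where C: "\<forall>s (I :: 'k mpoly set) f. finite I \<longrightarrow> (\<forall>i\<in>I. f i \<in> psub v ` (PV r \<inter> dle s)) \<longrightarrow> indm p I f \<longrightarrow>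
    card I \<le> C * (s + 1) ^ j"
    using growth_algebraic[OF p(1) w v] by (rule exE)
  have "\<forall>i\<in>{..<n}. \<exists>G. G \<in> PV r \<inter> dle 1 \<and> Vr i = psub v G"
    using span_linear_form[OF x] by blast
  from bchoice[OF this] obtain G where G: "\<forall>i\<in>{..<n}. G i \<in> PV r \<inter> dle 1 \<and> Vr i = psub v (G i)" ..
  have "codim_le (p \<union> dge s) (C * (s + 1) ^ j)" for s
  proof -
    define A where "A = {\<alpha> \<in> vset r. mdeg \<alpha> < s}"
    have finA: "finite A" unfolding A_def by (rule finite_subset[OF _ finite_vset_le[of r s]]) auto
    define M where "M = (\<lambda>\<alpha>. psub v (mnm \<alpha>)) ` A"
    have finM: "finite M" unfolding M_def by (rule finite_imageI[OF finA])
    obtain M0 where M0: "M0 \<subseteq> M" "indm p M0 (\<lambda>x. x)" "M \<subseteq> mp.span (M0 \<union> p)"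
      using indm_spanning_subset[OF ideal_subspace[OF pI] finM] by (elim exE conjE)
    have finM0: "finite M0" using finite_subset[OF M0(1) finM] .
    have "\<forall>i\<in>M0. i \<in> psub v ` (PV r \<inter> dle s)"
    proof
      fix i assume "i \<in> M0"
      then obtain \<alpha> where "\<alpha> \<in> A" "i = psub v (mnm \<alpha>)" using M0(1) by (auto simp: M_def)
      then show "i \<in> psub v ` (PV r \<inter> dle s)"
        by (intro image_eqI[of _ _ "mnm \<alpha>"]) (auto simp: A_def intro!: kset_single)
    qed
    then have c: "card M0 \<le> C * (s + 1) ^ j"
      using spec[OF spec[OF spec[OF C, of s], of M0], of "\<lambda>x. x"] finM0 M0(2) by simp
    let ?U = "M0 \<union> (p \<union> dge s)"
    have MU: "M \<subseteq> mp.span ?U" using M0(3) mp.span_mono[of "M0 \<union> p" ?U] by blast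
    have mon: "mnm \<mu> \<in> mp.span ?U" for \<mu> :: "nat \<Rightarrow>\<^sub>0 nat"
    proof -
      consider "\<mu> \<notin> vset n" | "s \<le> mdeg \<mu>" | "\<mu> \<in> vset n" "mdeg \<mu> < s" by fastforce
      then show ?thesis
      proof cases
        case 1
        then have "(mnm \<mu> :: 'k mpoly) \<in> kset (- vset n)" by (intro kset_single) simp
        then have "(mnm \<mu> :: 'k mpoly) \<in> rm.span (Vr ` {n..})" by (rule subsetD[OF kset_Compl_vset])
        then have "mnm \<mu> \<in> p" by (rule subsetD[OF rm.span_minimal[OF p(2) pI]])
        then show ?thesis by (intro mp.span_base) simp
      next
        case 2
        then have "(mnm \<mu> :: 'k mpoly) \<in> dge s" by (intro kset_single) simp
        then show ?thesis by (intro mp.span_base) simp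
      next
        case 3
        have "mnm \<mu> = psub Vr (mnm \<mu>)" by simp
        also have "\<dots> = psub (\<lambda>i. psub v (G i)) (mnm \<mu>)"
          by (rule meval_cong_keys) (use 3 G in auto)
        also have "\<dots> = psub v (psub G (mnm \<mu>))" by (simp only: psub_psub)
        finally have e: "mnm \<mu> = psub v (psub G (mnm \<mu>))" .
        have "psub G (mnm \<mu>) \<in> PV r \<inter> dle (mdeg \<mu>)" by (rule mnm_psub_dle[OF 3(1)]) (use G in auto)
        then have "psub G (mnm \<mu>) \<in> kset A" using 3(2) by (auto simp: kset_def A_def)
        from psub_in_span[OF this, of v] have "mnm \<mu> \<in> mp.span M" by (simp only: e[symmetric] M_def)
        then show ?thesis using mp.span_minimal[OF MU mp.subspace_span] by blast
      qed
    qed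
    have "F \<in> mp.span ?U" for F
    proof (induction F rule: mpoly_induct)
      case (single \<mu> a)
      from mp.span_scale[OF mon, of a \<mu>] show ?case by (simp add: Cst_def mult_single)
    qed (rule mp.span_add)
    then have "mp.span ?U = UNIV" by blast
    then show ?thesis unfolding codim_le_def using finM0 c by (intro exI[of _ M0]) auto
  qed
  then show ?thesis by (rule growth_leI)
qed

lemma not_aind_self: "l < j \<Longrightarrow> 0 \<in> p \<Longrightarrow> \<not> aind p (Suc j) (w(j := w l))"
proof
  assume l: "l < j" "0 \<in> p" and a: "aind p (Suc j) (w(j := w l))"
  have "Vr l - Vr j \<in> (PV (Suc j) :: 'a mpoly set)" using l by (intro kset_minus PV_Vr) auto
  moreover have "psub (w(j := w l)) (Vr l - Vr j) = 0" using l by (simp add: psub_hom)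
  ultimately have "Vr l - Vr j = (0 :: 'a mpoly)" using a l unfolding aind_def by auto
  then have "lkp (Vr l) (sgl l 1) = lkp (Vr j :: 'a mpoly) (sgl l 1)" by simp
  then have "sgl j 1 = (sgl l 1 :: nat \<Rightarrow>\<^sub>0 nat)" by (simp add: Vr_def lookup_single when_def split: if_splits)
  then have "lkp (sgl j 1) l = lkp (sgl l 1 :: nat \<Rightarrow>\<^sub>0 nat) l" by simp
  then show False using l(1) by (simp add: lookup_single)
qed

text \<open>An algebraic relation over the first d elements is one over the first j. The last
  variable has to be renamed from d to j, and the reverse renaming shows that the relation remains
  nonzero.\<close>

lemma not_aind_mono:
  assumes d: "d \<le> j" and a: "\<not> aind p (Suc d) (w(d := y))" shows "\<not> aind p (Suc j) (w(j := y))"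
proof
  assume b: "aind p (Suc j) (w(j := y))"
  obtain Q where Q: "Q \<in> PV (Suc d)" "psub (w(d := y)) Q \<in> p" "Q \<noteq> 0" using a by (auto simp: aind_def)
  define Q' where "Q' = psub (\<lambda>i. if i = d then Vr j else Vr i) Q"
  have keys: "m \<in> kys Q \<Longrightarrow> i \<in> kys m \<Longrightarrow> i < Suc d" for m i using Q(1) by (auto simp: kset_def)
  have "Q' \<in> PV (Suc j)" unfolding Q'_def using d by (intro PV_psub[OF Q(1)]) (auto intro!: PV_Vr)
  moreover have "psub (w(j := y)) Q' = psub (w(d := y)) Q"
    unfolding Q'_def psub_psub by (rule meval_cong_keys) (use keys d in force)
  ultimately have "Q' = 0" using b Q(2) unfolding aind_def by auto
  moreover have "psub (\<lambda>i. if i = j then Vr d else Vr i) Q' = psub Vr Q"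
    unfolding Q'_def psub_psub by (rule meval_cong_keys) (use keys d in force)
  ultimately show False using Q(3) by (simp add: psub_hom)
qed

lemma aind_0: "is_prime p \<Longrightarrow> aind p 0 w"
  unfolding aind_def
proof (intro ballI impI)
  fix Q assume p: "is_prime p" and Q: "Q \<in> PV 0" "psub w Q \<in> p"
  obtain c where c: "Q = Cst c" using PV_0_Cst[OF Q(1)] by (rule exE)
  have "c = 0"
  proof (rule ccontr)
    assume "c \<noteq> 0"
    then have "Cst (inverse c) * psub w Q = 1" using Cst_inverse[of c 1] by (simp add: c)
    then show False using rm.subspace_scale[OF primeD(1)[OF p] Q(2), of "Cst (inverse c)"] primeD(2)[OF p] by simp
  qed
  then show "Q = 0" by (simp add: c Cst_0)
qed

text \<open>The first \<open>d\<close> elements are combinations of the \<open>Y\<^sub>i\<close>, the others are combinations of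
  \<open>F\<^sub>i, F\<^bsub>i+1\<^esub>, \<dots>\<close> in which \<open>F\<^sub>i\<close> occurs.\<close>

definition wform :: "nat \<Rightarrow> nat \<Rightarrow> nat \<Rightarrow> (nat \<Rightarrow> 'k::field) \<Rightarrow> nat \<Rightarrow> 'k mpoly" where
  "wform N m d \<tau> l = (if l < d then \<Sum>i<N. Cst (\<tau> l ^ i) * Vr i
     else \<Sum>i<m - (l - d). Cst (\<tau> l ^ i) * Vr (N + (l - d) + i))"

lemma wform_upd: "(wform N m d \<tau>)(l := wform N m d (\<tau>(l := t)) l) = wform N m d (\<tau>(l := t))"
  by (rule ext) (simp add: wform_def)

lemma simultaneous_basis:
  fixes P :: "'z \<Rightarrow> 'k::field mpoly set"
  assumes inf: "infinite (UNIV :: 'k set)" and Z: "finite Z" and dN: "d \<le> N"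
    and P: "\<And>z. z \<in> Z \<Longrightarrow> is_prime (P z) \<and> Vr ` {N + m..} \<subseteq> P z \<and> \<not> growth_le dge (N - 1) (P z)"
    and d1: "\<And>z. z \<in> Z \<Longrightarrow> \<exists>w. (\<forall>l<d. w l \<in> mp.span (Vr ` {..<N})) \<and> aind (P z) d w"
    and d2: "\<And>z w. z \<in> Z \<Longrightarrow> (\<forall>l<Suc d. w l \<in> mp.span (Vr ` {..<N})) \<Longrightarrow> \<not> aind (P z) (Suc d) w"
  shows "\<exists>\<tau>. \<forall>z\<in>Z. aind (P z) N (wform N m d \<tau>)"
proof -
  have Yspan: "wform N m d \<tau> l \<in> mp.span (Vr ` {..<N})" if "l < d" for \<tau> :: "nat \<Rightarrow> 'k" and l
    using that unfolding wform_def by (simp, intro mp.span_sum mp.span_scale mp.span_base) auto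
  have "j \<le> N \<Longrightarrow> \<exists>\<tau>. \<forall>z\<in>Z. aind (P z) j (wform N m d \<tau>)" for j
  proof (induction j)
    case 0
    then show ?case using aind_0 P by (intro exI[of _ "\<lambda>_. 0"]) auto
  next
    case (Suc j)
    then obtain \<tau> where \<tau>: "\<forall>z\<in>Z. aind (P z) j (wform N m d \<tau>)" by auto
    let ?w = "wform N m d \<tau>"
    define r where "r = (if j < d then N else m - (j - d))"
    define \<zeta> where "\<zeta> i = (if j < d then Vr i else Vr (N + (j - d) + i) :: 'k mpoly)" for i
    have "\<exists>t. \<forall>z\<in>Z. aind (P z) (Suc j) (?w(j := (\<Sum>l<r. Cst (t ^ l) * \<zeta> l)))"
    proof (rule generic_independent[OF inf Z])
      fix z v assume z: "z \<in> Z" and v: "\<And>i. i < r \<Longrightarrow> \<not> aind (P z) (Suc j) (?w(j := v i))"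
        and \<zeta>v: "\<And>l. l < r \<Longrightarrow> \<exists>\<beta>. \<zeta> l = (\<Sum>i<r. Cst (\<beta> i) * v i)"
      have \<zeta>s: "\<zeta> l \<in> mp.span (v ` {..<r})" if l: "l < r" for l
      proof -
        obtain \<beta> where "\<zeta> l = (\<Sum>i<r. Cst (\<beta> i) * v i)" using \<zeta>v[OF l] by (rule exE)
        then show ?thesis by (simp only:) (intro mp.span_sum mp.span_scale mp.span_base, auto)
      qed
      have pz: "is_prime (P z)" "Vr ` {N + m..} \<subseteq> P z" "\<not> growth_le dge (N - 1) (P z)" using P[OF z] by auto
      note pI = primeD(1)[OF pz(1)]
      have wz: "aind (P z) j ?w" using \<tau> z by auto
      show False
      proof (cases "j < d")
        case True
        obtain w' where w': "\<forall>l<d. w' l \<in> mp.span (Vr ` {..<N})" "aind (P z) d w'" using d1[OF z] by auto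
        have "Vr ` {..<N} \<subseteq> mp.span (v ` {..<r})" using \<zeta>s True by (auto simp: r_def \<zeta>_def)
        then have "mp.span (Vr ` {..<N}) \<subseteq> mp.span (v ` {..<r})" by (rule mp.span_minimal) simp
        then have w'v: "w' l \<in> mp.span (v ` {..<r})" if "l < d" for l using w'(1) that by blast
        have "d \<le> j" by (rule independent_le_algebraic[OF pz(1) wz v w'v w'(2)])
        then show False using True by simp
      next
        case False
        then have jd: "d \<le> j" by simp
        define i where "i = j - d"
        \<comment> \<open>Elements algebraic over the first j whose span contains every variable:
          the coordinates, the combinations of equations chosen so far, and the failing
          candidates.\<close>
        define v' where "v' x = (if x < N then Vr x else if x < N + i then ?w (d + (x - N)) else v (x - N - i))" for x
        define r' where "r' = N + i + r"
        have r: "r = m - i" using False by (simp add: r_def i_def)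
        have alg: "\<not> aind (P z) (Suc j) (?w(j := v' l))" if l: "l < r'" for l
        proof -
          consider "l < N" | "N \<le> l" "l < N + i" | "N + i \<le> l" by linarith
          then show ?thesis
          proof cases
            case 1
            have "\<forall>k<Suc d. (?w(d := Vr l)) k \<in> mp.span (Vr ` {..<N})"
              using Yspan 1 by (auto simp: less_Suc_eq intro: mp.span_base)
            then have "\<not> aind (P z) (Suc d) (?w(d := Vr l))" by (rule d2[OF z])
            then show ?thesis using not_aind_mono[OF jd] 1 by (simp add: v'_def)
          next
            case 2
            then have "d + (l - N) < j" using jd by (simp add: i_def)
            from not_aind_self[OF this rm.subspace_0[OF pI], of ?w] show ?thesis using 2 by (simp add: v'_def)
          next
            case 3
            then have "l - N - i < r" using l by (simp add: r'_def)
            then show ?thesis using v 3 by (simp add: v'_def)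
          qed
        qed
        let ?S = "mp.span (v' ` {..<r'})"
        have vS: "v ` {..<r} \<subseteq> ?S"
        proof (rule image_subsetI)
          fix x assume "x \<in> {..<r}"
          then have "v x = v' (N + i + x)" "N + i + x < r'" by (auto simp: v'_def r'_def)
          then show "v x \<in> ?S" by (intro mp.span_base) auto
        qed
        \<comment> \<open>Descending induction on \<open>a\<close>. From \<open>i\<close> on, the
          variable is a combination of the candidates; below \<open>i\<close>, the element
          \<open>?w (d + a)\<close> is this variable plus later ones. The triangular shape of
          \<open>wform\<close> is what allows solving backwards.\<close>
        have FS: "a < m \<Longrightarrow> Vr (N + a) \<in> ?S" for a
        proof (induction "m - a" arbitrary: a rule: less_induct)
          case (less a)
          show ?case
          proof (cases "a < i")
            case False
            then have "a - i < r" using less.prems r by simp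
            then have "\<zeta> (a - i) \<in> mp.span (v ` {..<r})" by (rule \<zeta>s)
            moreover have "\<zeta> (a - i) = Vr (N + a)" using False jd by (simp add: \<zeta>_def i_def)
            ultimately show ?thesis using mp.span_minimal[OF vS mp.subspace_span] by auto
          next
            case True
            have da: "\<not> d + a < d" "d + a - d = a" by auto
            obtain k where k: "m - a = Suc k" using less.prems by (metis Suc_diff_Suc)
            have eq: "?w (d + a) = Vr (N + a) + (\<Sum>l<k. Cst (\<tau> (d + a) ^ Suc l) * Vr (N + a + Suc l))"
              unfolding wform_def by (simp only: da if_False k sum.lessThan_Suc_shift) (simp add: Cst_1)
            have 1: "?w (d + a) \<in> ?S"
            proof -
              have "?w (d + a) = v' (N + a)" "N + a < r'" using True by (auto simp: v'_def r'_def)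
              then show ?thesis by (intro mp.span_base) auto
            qed
            have 2: "(\<Sum>l<k. Cst (\<tau> (d + a) ^ Suc l) * Vr (N + a + Suc l)) \<in> ?S"
            proof (intro mp.span_sum mp.span_scale)
              fix l assume "l \<in> {..<k}"
              then have "a + Suc l < m" "m - (a + Suc l) < m - a" using k by auto
              from less.hyps[OF this(2,1)] show "Vr (N + a + Suc l) \<in> ?S" by (simp only: add.assoc)
            qed
            from mp.span_diff[OF 1 2] show ?thesis unfolding eq by (simp only: add_diff_cancel_right')
          qed
        qed
        have all: "Vr x \<in> ?S" if x: "x < N + m" for x
        proof (cases "x < N")
          case True
          then have "Vr x = v' x" "x < r'" by (auto simp: v'_def r'_def)
          then show ?thesis by (intro mp.span_base) auto
        next
          case False
          then show ?thesis using FS[of "x - N"] x by simp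
        qed
        have "growth_le dge j (P z)" by (rule growth_le_algebraic[OF pz(1,2) wz alg all])
        then have "growth_le dge (N - 1) (P z)" by (rule growth_le_exp) (use Suc.prems in simp)
        then show False using pz(3) by simp
      qed
    qed
    then obtain t where t: "\<forall>z\<in>Z. aind (P z) (Suc j) (?w(j := (\<Sum>l<r. Cst (t ^ l) * \<zeta> l)))" by (rule exE)
    have "(\<Sum>l<r. Cst (t ^ l) * \<zeta> l) = wform N m d (\<tau>(j := t)) j"
      by (simp add: wform_def r_def \<zeta>_def)
    then have "\<forall>z\<in>Z. aind (P z) (Suc j) (wform N m d (\<tau>(j := t)))"
      using t by (simp only: wform_upd)
    then show ?case by (intro exI[of _ "\<tau>(j := t)"])
  qed
  then show ?thesis by simp
qed

subsection \<open>Counting by degrees\<close>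

text \<open>Each exponent is divided with remainder by its weight: the quotients have weighted
  degree at most \<open>M\<close>, and there are \<open>\<Prod>l<N. \<delta> l\<close> systems of
  remainders.\<close>

lemma card_exponents_weighted:
  assumes \<delta>: "\<And>l. l < N \<Longrightarrow> 1 \<le> \<delta> l"
  shows "card {\<mu> \<in> vset N. mdeg \<mu> \<le> M} \<le> (\<Prod>l<N. \<delta> l) * card {\<mu> \<in> vset N. wdg \<delta> \<mu> \<le> M}"
    and "finite {\<mu> \<in> vset N. wdg \<delta> \<mu> \<le> M}"
proof -
  have w: "wdg \<delta> \<mu> = (\<Sum>l<N. \<delta> l * lkp \<mu> l)" if "\<mu> \<in> vset N" for \<mu>
    by (rule wdg_superset) (use that in auto)
  show fin: "finite {\<mu> \<in> vset N. wdg \<delta> \<mu> \<le> M}"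
  proof (rule finite_subset[OF _ finite_vset_le[of N M]], rule subsetI)
    fix \<mu> assume \<mu>: "\<mu> \<in> {\<mu> \<in> vset N. wdg \<delta> \<mu> \<le> M}"
    have "(\<Sum>l<N. lkp \<mu> l) \<le> (\<Sum>l<N. \<delta> l * lkp \<mu> l)" by (rule sum_mono) (use \<delta> in auto)
    then show "\<mu> \<in> {\<mu> \<in> vset N. mdeg \<mu> \<le> M}" using \<mu> w[of \<mu>] mdeg_vset[of \<mu> N] by simp
  qed
  let ?q = "\<lambda>\<mu>. (\<Sum>l<N. sgl l (lkp \<mu> l div \<delta> l)) :: nat \<Rightarrow>\<^sub>0 nat"
  let ?r = "\<lambda>\<mu>. restrict (\<lambda>l. lkp \<mu> l mod \<delta> l) {..<N}"
  let ?h = "\<lambda>\<mu>. (?q \<mu>, ?r \<mu>)"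
  let ?A = "{\<mu> \<in> vset N. mdeg \<mu> \<le> M}"
  have "inj_on ?h ?A"
  proof (rule inj_onI)
    fix \<mu> \<nu> assume m: "\<mu> \<in> ?A" "\<nu> \<in> ?A" "?h \<mu> = ?h \<nu>"
    show "\<mu> = \<nu>"
    proof (rule poly_mapping_eqI)
      fix l show "lkp \<mu> l = lkp \<nu> l"
      proof (cases "l < N")
        case True
        have "lkp (?q \<mu>) l = lkp (?q \<nu>) l" "?r \<mu> l = ?r \<nu> l" using m(3) by simp_all
        then have "lkp \<mu> l div \<delta> l = lkp \<nu> l div \<delta> l" "lkp \<mu> l mod \<delta> l = lkp \<nu> l mod \<delta> l"
          using True by (simp_all add: lkp_sum_sgl)
        then show ?thesis by (metis div_mult_mod_eq)
      next
        case False
        then have "l \<notin> kys \<mu>" "l \<notin> kys \<nu>" using m(1,2) by auto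
        then show ?thesis by (simp add: in_keys_iff)
      qed
    qed
  qed
  moreover have "?h ` ?A \<subseteq> {\<mu> \<in> vset N. wdg \<delta> \<mu> \<le> M} \<times> Pi\<^sub>E {..<N} (\<lambda>l. {..<\<delta> l})"
  proof (rule image_subsetI)
    fix \<mu> assume \<mu>: "\<mu> \<in> ?A"
    have v: "?q \<mu> \<in> vset N" by (auto simp: in_keys_iff lkp_sum_sgl split: if_splits)
    have "wdg \<delta> (?q \<mu>) = (\<Sum>l<N. \<delta> l * (lkp \<mu> l div \<delta> l))" using w[OF v] by (simp add: lkp_sum_sgl)
    also have "\<dots> \<le> (\<Sum>l<N. lkp \<mu> l)" by (rule sum_mono) simp
    also have "\<dots> \<le> M" using \<mu> mdeg_vset[of \<mu> N] by simp
    finally have "?q \<mu> \<in> {\<mu> \<in> vset N. wdg \<delta> \<mu> \<le> M}" using v by simp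
    moreover have "?r \<mu> \<in> Pi\<^sub>E {..<N} (\<lambda>l. {..<\<delta> l})" using \<delta> by (auto simp: Suc_le_eq)
    ultimately show "?h \<mu> \<in> {\<mu> \<in> vset N. wdg \<delta> \<mu> \<le> M} \<times> Pi\<^sub>E {..<N} (\<lambda>l. {..<\<delta> l})" by (rule SigmaI)
  qed
  ultimately have "card ?A \<le> card ({\<mu> \<in> vset N. wdg \<delta> \<mu> \<le> M} \<times> Pi\<^sub>E {..<N} (\<lambda>l. {..<\<delta> l}))"
    by (rule card_inj_on_le) (intro finite_cartesian_product fin finite_PiE, auto)
  then show "card ?A \<le> (\<Prod>l<N. \<delta> l) * card {\<mu> \<in> vset N. wdg \<delta> \<mu> \<le> M}"
    by (simp add: card_cartesian_product card_PiE mult.commute)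
qed

text \<open>The number of monomials grows polynomially, so it cannot be multiplied by a factor larger
  than 1 whenever the degree is raised by \<open>L\<close>.\<close>

lemma ratio_le:
  fixes x P L N :: nat
  assumes h: "\<And>M. x * card {\<mu> \<in> vset N. mdeg \<mu> \<le> M} \<le> P * card {\<mu> \<in> vset N. mdeg \<mu> \<le> M + L}"
  shows "x \<le> P"
proof (rule ccontr)
  assume "\<not> x \<le> P"
  then have x: "P + 1 \<le> x" by simp
  define B where "B M = card {\<mu> \<in> vset N. mdeg \<mu> \<le> M}" for M
  have B1: "1 \<le> B M" for M
  proof -
    have "0 \<in> {\<mu> \<in> vset N. mdeg \<mu> \<le> M}" by simp
    then have "card {\<mu> \<in> vset N. mdeg \<mu> \<le> M} \<noteq> 0" unfolding card_0_eq[OF finite_vset_le] by (rule ex_in_conv[THEN iffD1, OF exI])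
    then show ?thesis by (simp add: B_def)
  qed
  have step: "(P + 1) * B M \<le> P * B (M + L)" for M
    using order_trans[OF mult_le_mono1[OF x] h[of M]] by (simp add: B_def)
  have "P \<noteq> 0"
  proof
    assume "P = 0"
    then show False using step[of 0] B1[of 0] by simp
  qed
  then have P: "0 < real P" by simp
  define y where "y = 1 / real P"
  have y: "0 < y" and Py: "real P * y = 1" using P by (simp_all add: y_def)
  have grow: "(1 + y) ^ k \<le> real (B (k * L))" for k
  proof (induction k)
    case 0
    then show ?case using B1[of 0] by simp
  next
    case (Suc k)
    have "real ((P + 1) * B (k * L)) \<le> real (P * B (k * L + L))" using step[of "k * L"] by (simp only: of_nat_le_iff)
    then have "(real P + 1) * real (B (k * L)) \<le> real P * real (B (Suc k * L))"
      by (simp only: of_nat_mult of_nat_add of_nat_1 mult_Suc add.commute)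
    moreover have "real P * ((1 + y) * real (B (k * L))) = (real P + 1) * real (B (k * L))"
      by (simp only: mult.assoc[symmetric] distrib_left Py mult_1_right)
    ultimately have "real P * ((1 + y) * real (B (k * L))) \<le> real P * real (B (Suc k * L))" by (simp only:)
    then have "(1 + y) * real (B (k * L)) \<le> real (B (Suc k * L))" using P by (rule mult_left_le_imp_le)
    moreover have "(1 + y) * (1 + y) ^ k \<le> (1 + y) * real (B (k * L))" using Suc y by (intro mult_left_mono) auto
    ultimately show ?case by simp
  qed
  \<comment> \<open>The count at degree k L is polynomial of degree N in k. With k = (N + 1) t,
    Bernoulli's inequality bounds the exponential from below by a polynomial of degree N + 1 in t,
    so t would be bounded.\<close>
  have bound: "(real t + 1) \<le> real P ^ Suc N * real ((Suc N * L + 1) ^ N)" for t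
  proof -
    let ?k = "Suc N * t"
    have "1 + real t * y \<le> (1 + y) ^ t" using Bernoulli_inequality[of y t] y by simp
    then have "(1 + real t * y) ^ Suc N \<le> ((1 + y) ^ t) ^ Suc N" using y by (intro power_mono) auto
    also have "\<dots> = (1 + y) ^ ?k" by (simp only: power_mult[symmetric] mult.commute)
    also have "\<dots> \<le> real (B (?k * L))" by (rule grow)
    also have "\<dots> \<le> real ((?k * L + 1) ^ N)"
      using card_exponents_le[of N "?k * L"] unfolding B_def of_nat_le_iff .
    also have "\<dots> \<le> real (((Suc N * L + 1) * (t + 1)) ^ N)"
      by (simp only: of_nat_le_iff) (intro power_mono, auto simp: algebra_simps)
    finally have 1: "(1 + real t * y) ^ Suc N \<le> real ((Suc N * L + 1) ^ N) * (real t + 1) ^ N"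
      by (simp only: power_mult_distrib of_nat_mult of_nat_power of_nat_add of_nat_1)
    have "real t + 1 \<le> real P * (1 + real t * y)"
    proof -
      have "real P * (1 + real t * y) = real P + real t"
        by (simp only: distrib_left mult.left_commute[of "real P"] Py mult_1_right)
      then show ?thesis using \<open>P \<noteq> 0\<close> by linarith
    qed
    then have "(real t + 1) ^ Suc N \<le> (real P * (1 + real t * y)) ^ Suc N" by (intro power_mono) auto
    also have "\<dots> \<le> real P ^ Suc N * (real ((Suc N * L + 1) ^ N) * (real t + 1) ^ N)"
      unfolding power_mult_distrib using 1 P by (intro mult_left_mono) auto
    finally have "(real t + 1) * (real t + 1) ^ N \<le> (real P ^ Suc N * real ((Suc N * L + 1) ^ N)) * (real t + 1) ^ N"
      by (simp only: power_Suc mult.assoc)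
    then show ?thesis by (rule mult_right_le_imp_le) simp
  qed
  obtain t where "real P ^ Suc N * real ((Suc N * L + 1) ^ N) < real t" using reals_Archimedean2 by blast
  then show False using bound[of t] by simp
qed

text \<open>The products of \<open>e z\<close> with the monomials of weighted degree at most M in
  the \<open>\<theta> l\<close> are linearly independent and of degree at most M + L. So the number
  of points times the weighted count of monomials is at most the ordinary count for M + L. The
  weighted count is smaller than the ordinary one by a factor of at most the product of the weights,
  and the shift by L is harmless as M varies.\<close>

lemma card_points_le_of_independent:
  fixes e :: "'z \<Rightarrow> 'k::field mpoly"
  assumes S: "finite S" and e: "\<And>z. z \<in> S \<Longrightarrow> e z \<in> PV N \<inter> dle L"
    and \<theta>: "\<And>l. l < N \<Longrightarrow> \<theta> l \<in> PV N \<inter> dle (\<delta> l) \<and> 1 \<le> \<delta> l"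
    and ind: "\<And>C. (\<And>z. z \<in> S \<Longrightarrow> C z \<in> PV N) \<Longrightarrow> (\<Sum>z\<in>S. e z * psub \<theta> (C z)) = 0 \<Longrightarrow> \<forall>z\<in>S. C z = 0"
  shows "card S \<le> (\<Prod>l<N. \<delta> l)"
proof (rule ratio_le)
  fix M
  let ?W = "{\<mu> \<in> vset N. wdg \<delta> \<mu> \<le> M}" and ?A = "{\<mu> \<in> vset N. mdeg \<mu> \<le> M + L}"
  note cw = card_exponents_weighted[of N \<delta> M]
  have \<delta>1: "\<And>l. l < N \<Longrightarrow> 1 \<le> \<delta> l" using \<theta> by blast
  have finW: "finite ?W" by (rule cw(2)[OF \<delta>1])
  let ?f = "\<lambda>(z, \<alpha>). e z * psub \<theta> (mnm \<alpha>)"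
  have "indm {0} (S \<times> ?W) ?f"
    unfolding indm_def
  proof (intro allI impI ballI)
    fix c and y assume s: "(\<Sum>i\<in>S \<times> ?W. Cst (c i) * ?f i) \<in> {0}" and y: "y \<in> S \<times> ?W"
    define C where "C z = (\<Sum>\<alpha>\<in>?W. sgl \<alpha> (c (z, \<alpha>)))" for z
    have CPV: "C z \<in> PV N" for z unfolding C_def by (intro kset_sum kset_single) simp
    have "(\<Sum>z\<in>S. e z * psub \<theta> (C z)) = (\<Sum>z\<in>S. \<Sum>\<alpha>\<in>?W. Cst (c (z, \<alpha>)) * (e z * psub \<theta> (mnm \<alpha>)))"
      unfolding C_def by (simp add: psub_hom psub_single[where c = "c _"] sum_distrib_left mult.left_commute)
    also have "\<dots> = (\<Sum>i\<in>S \<times> ?W. Cst (c i) * ?f i)" by (simp add: sum.cartesian_product split_def)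
    finally have "(\<Sum>z\<in>S. e z * psub \<theta> (C z)) = 0" using s by simp
    then have "\<forall>z\<in>S. C z = 0" by (rule ind[OF CPV])
    moreover have y': "snd y \<in> ?W" using y by (simp only: mem_Times_iff)
    moreover have "fst y \<in> S" using y by (simp only: mem_Times_iff)
    ultimately have "C (fst y) = 0" by (simp only:)
    then have "lkp (C (fst y)) (snd y) = 0" by simp
    moreover have "lkp (C (fst y)) (snd y) = (\<Sum>\<alpha>\<in>?W. if \<alpha> = snd y then c y else 0)"
      unfolding C_def lookup_sum by (rule sum.cong) (auto simp: lookup_single when_def)
    ultimately show "c y = 0" using finW y' by (simp only: sum.delta if_True lookup_zero)
  qed
  then have "card (S \<times> ?W) \<le> card (mnm ` ?A :: 'k mpoly set)"
  proof (rule indm_card_le[rotated 3])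
    show "mp.subspace {0 :: 'k mpoly}" by simp
    show "finite (S \<times> ?W)" using S finW by (rule finite_cartesian_product)
    show "finite (mnm ` ?A :: 'k mpoly set)" by (intro finite_imageI finite_vset_le)
    fix i assume i: "i \<in> S \<times> ?W"
    obtain z \<alpha> where z: "i = (z, \<alpha>)" "z \<in> S" "\<alpha> \<in> ?W" using i by auto
    have l: "k \<in> kys \<alpha> \<Longrightarrow> k < N" for k using z(3) by auto
    have a: "psub \<theta> (mnm \<alpha>) \<in> PV N" unfolding psub_mnm using \<theta> l by (intro PV_prod PV_power) blast
    have b: "psub \<theta> (mnm \<alpha>) \<in> dle (wdg \<delta> \<alpha>)" unfolding psub_mnm using \<theta> l by (intro dle_prod_wdg) blast
    have "e z * psub \<theta> (mnm \<alpha>) \<in> PV N" using e[OF z(2)] a by (intro PV_mult) auto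
    moreover have "e z * psub \<theta> (mnm \<alpha>) \<in> dle (L + wdg \<delta> \<alpha>)" using e[OF z(2)] b by (intro dle_mult) auto
    ultimately have "e z * psub \<theta> (mnm \<alpha>) \<in> kset ?A" using z(3) by (force simp: kset_def)
    from psub_in_span[OF this, of Vr] have "e z * psub \<theta> (mnm \<alpha>) \<in> mp.span (mnm ` ?A)" by simp
    then show "?f i \<in> mp.span (mnm ` ?A \<union> {0})" using z(1) mp.span_mono[of "mnm ` ?A" "mnm ` ?A \<union> {0}"] by auto
  qed
  also have "\<dots> \<le> card ?A" by (rule card_image_le[OF finite_vset_le])
  finally have 1: "card S * card ?W \<le> card ?A" by (simp add: card_cartesian_product)
  have "card S * card {\<mu> \<in> vset N. mdeg \<mu> \<le> M} \<le> card S * ((\<Prod>l<N. \<delta> l) * card ?W)"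
    by (intro mult_le_mono2 cw(1) \<delta>1)
  also have "\<dots> = (\<Prod>l<N. \<delta> l) * (card S * card ?W)" by (simp only: mult_ac)
  also have "\<dots> \<le> (\<Prod>l<N. \<delta> l) * card ?A" using 1 by (rule mult_le_mono2)
  finally show "card S * card {\<mu> \<in> vset N. mdeg \<mu> \<le> M} \<le> (\<Prod>l<N. \<delta> l) * card ?A" .
qed

text \<open>For each other point a linear polynomial that is 1 at \<open>y\<close> and 0 at that
  point; these are multiplied. The degree bound enters the final count only as the shift L, so it
  may depend on the set.\<close>

lemma interpolation:
  fixes S :: "(nat \<Rightarrow> 'k::field) set"
  assumes S: "finite S" "\<And>z i. z \<in> S \<Longrightarrow> N \<le> i \<Longrightarrow> z i = 0" and y: "y \<in> S"
  shows "\<exists>e \<in> PV N \<inter> dle (card S). \<forall>z\<in>S. ev z e = (if z = y then 1 else 0)"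
proof -
  have "\<forall>z\<in>S - {y}. \<exists>i. i < N \<and> y i \<noteq> z i"
  proof
    fix z assume z: "z \<in> S - {y}"
    then have "y \<noteq> z" by auto
    then obtain i where i: "y i \<noteq> z i" unfolding fun_eq_iff by auto
    then show "\<exists>i. i < N \<and> y i \<noteq> z i" using S(2)[of z i] S(2)[OF y, of i] z by (intro exI[of _ i] conjI) (force simp: not_le[symmetric])+
  qed
  from bchoice[OF this] obtain i where i: "\<forall>z\<in>S - {y}. i z < N \<and> y (i z) \<noteq> z (i z)" ..
  define t where "t z = Cst (inverse (y (i z) - z (i z))) * (Vr (i z) - Cst (z (i z)))" for z
  define e where "e = (\<Prod>z\<in>S - {y}. t z)"
  have t: "t z \<in> PV N" "t z \<in> dle 1" if "z \<in> S - {y}" for z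
    unfolding t_def using i that by (auto intro!: kset_Cst_mult kset_minus PV_Vr intro: Vr_kset Cst_kset)
  have evt: "ev x (t z) = inverse (y (i z) - z (i z)) * (x (i z) - z (i z))" for x z
    by (simp add: t_def meval_hom[OF rhom_id] meval_Vr[OF rhom_id] meval_Cst[OF rhom_id])
  have "e \<in> PV N" unfolding e_def using t(1) by (rule PV_prod)
  moreover have "(\<Prod>z\<in>A. t z) \<in> dle (card A)" if "finite A" "A \<subseteq> S - {y}" for A
    using that
  proof (induction A rule: finite_induct)
    case (insert a A)
    then show ?case using dle_mult[of "t a" 1 "\<Prod>z\<in>A. t z" "card A"] t(2)[of a] by simp
  qed (auto intro: one_kset)
  then have "e \<in> dle (card (S - {y}))" unfolding e_def using S(1) by blast
  then have "e \<in> dle (card S)" by (rule kset_mono[rotated]) (use card_mono[OF S(1), of "S - {y}"] in auto)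
  moreover have "ev z e = (if z = y then 1 else 0)" if z: "z \<in> S" for z
  proof (cases "z = y")
    case True
    have "ev y (t x) = 1" if "x \<in> S - {y}" for x
      using i that unfolding evt by (intro left_inverse) auto
    then show ?thesis using True by (simp add: e_def meval_hom[OF rhom_id])
  next
    case False
    then have "ev z (t z) = 0" "z \<in> S - {y}" using z by (simp_all add: evt)
    then have "(\<Prod>x\<in>S - {y}. ev z (t x)) = 0" using S(1) by (intro prod_zero bexI[of _ z]) auto
    then show ?thesis using False by (simp add: e_def meval_hom[OF rhom_id])
  qed
  ultimately show ?thesis by (intro bexI[of _ e]) auto
qed

text \<open>A multiple of \<open>\<Prod>\<^sub>a (x\<^sub>i - a)\<close>, \<open>a\<close> ranging over the finite field, normalised so that its
  linear part at each rational point is the \<open>i\<close>-th local coordinate.\<close>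

definition gpoly :: "('a::{finite,field} \<Rightarrow> 'k::field) \<Rightarrow> nat \<Rightarrow> 'k mpoly" where
  "gpoly \<phi> i = Cst (inverse (\<Prod>a\<in>UNIV - {0}. - \<phi> a)) * (\<Prod>a\<in>UNIV. Vr i - Cst (\<phi> a))"

lemma gpoly_PV: "i < N \<Longrightarrow> gpoly \<phi> i \<in> PV N"
  unfolding gpoly_def by (intro kset_Cst_mult PV_prod kset_minus PV_Vr PV_Cst)

lemma gpoly_dle: "gpoly (\<phi> :: 'a::{finite,field} \<Rightarrow> 'k::field) i \<in> dle CARD('a)"
proof -
  have "finite A \<Longrightarrow> (\<Prod>a\<in>A. Vr i - Cst (\<phi> a)) \<in> dle (card A)" for A
  proof (induction A rule: finite_induct)
    case (insert a A)
    have "Vr i - Cst (\<phi> a) \<in> dle 1" by (auto intro!: kset_minus intro: Vr_kset Cst_kset)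
    from dle_mult[OF this insert(3)] show ?case using insert by simp
  qed (auto intro: one_kset)
  then show ?thesis unfolding gpoly_def by (intro kset_Cst_mult) simp
qed

text \<open>Translation by a rational vector merely permutes the elements of the finite field over
  which the product runs.\<close>

lemma gpoly_shift:
  assumes \<phi>: "rhom \<phi>" shows "shift (\<lambda>i. \<phi> (z i)) (gpoly \<phi> i) = gpoly \<phi> i"
proof -
  have "(\<Prod>a\<in>UNIV. Vr i - Cst (\<phi> (a - z i))) = (\<Prod>a\<in>UNIV. Vr i - Cst (\<phi> a))"
    by (rule prod.reindex_bij_witness[of _ "\<lambda>a. a + z i" "\<lambda>a. a - z i"]) auto
  moreover have "shift (\<lambda>i. \<phi> (z i)) (Vr i - Cst (\<phi> a)) = Vr i - Cst (\<phi> (a - z i))" for a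
    by (simp add: rhom_minus[OF rhom_shift] rhom_minus[OF \<phi>] rhom_minus[OF rhom_Cst])
  ultimately show ?thesis
    by (simp add: gpoly_def rhomD[OF rhom_shift] rhom_prod[OF rhom_shift])
qed

lemma gpoly_linear:
  fixes \<phi> :: "'a::{finite,field} \<Rightarrow> 'k::field"
  assumes \<phi>: "rhom \<phi>" shows "\<exists>h\<in>dge 1. (\<forall>N. i < N \<longrightarrow> h \<in> PV N) \<and> gpoly \<phi> i = Vr i + Vr i * h"
proof -
  define c where "c = (\<Prod>a\<in>UNIV - {0}. - \<phi> a)"
  have c: "c \<noteq> 0" unfolding c_def using rhom_field_inj[OF \<phi>] by (simp add: prod_zero_iff)
  define R where "R = (\<Prod>a\<in>UNIV - {0}. Vr i - Cst (\<phi> a))"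
  define h where "h = Cst (inverse c) * R - 1"
  have "(\<Prod>a\<in>UNIV. Vr i - Cst (\<phi> a)) = (Vr i - Cst (\<phi> 0)) * R"
    unfolding R_def by (rule prod.remove) auto
  then have "gpoly \<phi> i = Vr i + Vr i * h"
    by (simp add: gpoly_def c_def[symmetric] h_def rhomD[OF \<phi>] Cst_0 algebra_simps)
  moreover have "h \<in> dge 1"
  proof -
    have "ev (\<lambda>_. 0) h = 0"
      using c by (simp add: h_def R_def meval_hom[OF rhom_id] meval_Vr[OF rhom_id] meval_Cst[OF rhom_id] c_def[symmetric])
    then show ?thesis by (simp add: dge_1 meval_zero[OF rhom_id])
  qed
  moreover have "h \<in> PV N" if "i < N" for N
    unfolding h_def R_def using that by (intro kset_minus kset_Cst_mult PV_prod PV_Vr PV_Cst PV_1)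
  ultimately show ?thesis by (intro bexI[of _ h]) auto
qed

subsection \<open>Counting zeros\<close>

context cone
begin

lemma T_Cst_mult: "x \<in> T i j \<Longrightarrow> Cst c * x \<in> T i j" and bh_Cst_mult: "x \<in> bh i j \<Longrightarrow> Cst c * x \<in> bh i j"
  unfolding T_def bh_def by (rule kset_Cst_mult, assumption)+

text \<open>\<open>W\<close> is the component of \<open>Y\<close> in bidegree (i, j), and
  \<open>Y\<close> has no smaller monomials. \<open>W\<close> may be zero, so that sums and products
  need no discussion of cancellation.\<close>

definition leading :: "nat \<Rightarrow> nat \<Rightarrow> 'k mpoly \<Rightarrow> 'k mpoly \<Rightarrow> bool" where
  "leading i j Y W \<longleftrightarrow> W \<in> bh i j \<and> Y - W \<in> T i (Suc j)"

lemma leading_T: assumes "leading i j Y W" shows "Y \<in> T i j"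
proof -
  have "Y - W \<in> T i j" by (rule T_lex[of i i j "Suc j"]) (use assms in \<open>auto simp: leading_def\<close>)
  from T_add[OF this bh_T[of W i j]] show ?thesis using assms by (simp add: leading_def)
qed

lemma leading_1: "leading 0 0 1 1"
  unfolding leading_def bh_def by (auto intro!: one_kset simp: dF_def dY_def)

lemma leading_mult:
  assumes "leading i j Y W" "leading i' j' Y' W'" shows "leading (i + i') (j + j') (Y * Y') (W * W')"
proof -
  note a = assms[unfolded leading_def]
  have "(Y - W) * Y' \<in> T (i + i') (Suc j + j')" using a leading_T[OF assms(2)] by (intro T_mult) auto
  moreover have "W * (Y' - W') \<in> T (i + i') (j + Suc j')" using a by (intro T_mult[OF bh_T]) auto
  ultimately have "(Y - W) * Y' + W * (Y' - W') \<in> T (i + i') (Suc (j + j'))"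
    unfolding add_Suc add_Suc_right by (rule T_add)
  moreover have "(Y - W) * Y' + W * (Y' - W') = Y * Y' - W * W'" by (simp add: algebra_simps)
  ultimately show ?thesis using a by (auto simp: leading_def intro: bh_mult)
qed

lemma leading_power: "leading i j Y W \<Longrightarrow> leading (i * k) (j * k) (Y ^ k) (W ^ k)"
proof (induction k)
  case (Suc k)
  from leading_mult[OF Suc.prems Suc.IH[OF Suc.prems]] show ?case by simp
qed (simp add: leading_1)

lemma leading_prod:
  "finite A \<Longrightarrow> (\<And>l. l \<in> A \<Longrightarrow> leading (a l) (b l) (Y l) (W l)) \<Longrightarrow> leading (\<Sum>l\<in>A. a l) (\<Sum>l\<in>A. b l) (\<Prod>l\<in>A. Y l) (\<Prod>l\<in>A. W l)"
proof (induction A rule: finite_induct)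
  case (insert x A)
  have "leading (a x) (b x) (Y x) (W x)" by (rule insert.prems) simp
  moreover have "leading (\<Sum>l\<in>A. a l) (\<Sum>l\<in>A. b l) (\<Prod>l\<in>A. Y l) (\<Prod>l\<in>A. W l)"
    by (rule insert.IH) (rule insert.prems, simp)
  ultimately have "leading (a x + (\<Sum>l\<in>A. a l)) (b x + (\<Sum>l\<in>A. b l)) (Y x * (\<Prod>l\<in>A. Y l)) (W x * (\<Prod>l\<in>A. W l))"
    by (rule leading_mult)
  then show ?case by (simp only: sum.insert[OF insert.hyps] prod.insert[OF insert.hyps])
qed (simp add: leading_1)

text \<open>Here \<open>a l\<close> and \<open>b l\<close> are the two degrees of
  \<open>Y l\<close>. A monomial in the \<open>Y l\<close> starts in the bidegree formed by its two
  weighted degrees, so the component in question comes from those monomials of \<open>G\<close> that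
  have exactly these weights.\<close>

lemma leading_psub:
  assumes XW: "\<And>l. l < r \<Longrightarrow> leading (a l) (b l) (Y l) (W l)"
    and G: "G \<in> kset {\<alpha>. \<alpha> \<in> vset r \<and> (i < wdg a \<alpha> \<or> (i = wdg a \<alpha> \<and> j \<le> wdg b \<alpha>))}"
  shows "leading i j (psub Y G) (psub W (prt {\<alpha>. wdg a \<alpha> = i \<and> wdg b \<alpha> = j} G))"
  using G
proof (induction rule: kset_induct)
  case zero
  show ?case unfolding leading_def bh_def by (simp add: psub_hom)
next
  case (single \<alpha> c)
  have m: "leading (wdg a \<alpha>) (wdg b \<alpha>) (psub Y (mnm \<alpha>)) (psub W (mnm \<alpha>))"
    unfolding psub_mnm wdg_def by (rule leading_prod) (use single in \<open>auto intro!: leading_power XW\<close>)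
  show ?case
  proof (cases "wdg a \<alpha> = i \<and> wdg b \<alpha> = j")
    case True
    have "Cst c * (psub Y (mnm \<alpha>) - psub W (mnm \<alpha>)) \<in> T i (Suc j)" "Cst c * psub W (mnm \<alpha>) \<in> bh i j"
      using m True by (auto intro!: T_Cst_mult bh_Cst_mult simp: leading_def)
    then show ?thesis using True
      by (simp add: leading_def prt_single psub_single[where c = c] right_diff_distrib)
  next
    case False
    have "psub Y (mnm \<alpha>) \<in> T i (Suc j)"
      by (rule T_lex[OF _ leading_T[OF m]]) (use single False in auto)
    then have "Cst c * psub Y (mnm \<alpha>) \<in> T i (Suc j)" by (rule T_Cst_mult)
    then show ?thesis using False
      by (auto simp: leading_def prt_single psub_single[where c = c] psub_hom bh_def)
  qed
next
  case (add G H)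
  have "psub Y G + psub Y H - (psub W (prt {\<alpha>. wdg a \<alpha> = i \<and> wdg b \<alpha> = j} G) + psub W (prt {\<alpha>. wdg a \<alpha> = i \<and> wdg b \<alpha> = j} H)) \<in> T i (Suc j)"
    unfolding add_diff_add using add(3,4) by (intro T_add) (simp_all add: leading_def)
  then show ?case using add(3,4) by (simp add: leading_def prt_add psub_hom bh_def kset_add)
qed

text \<open>Among the factors \<open>e z\<close> only that of \<open>Q\<close> has a nonzero
  constant term, so the lowest part of the relation involves \<open>G Q\<close> alone. It is the
  initial form of an element of the kernel of \<open>Th\<close>, hence belongs to
  \<open>bz\<close>.\<close>

lemma leading_relation:
  assumes S: "finite S" "Q \<in> S"
    and XW: "\<And>l. l < r \<Longrightarrow> leading (a l) (b l) (Y l) (W l)"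
    and G: "\<And>z. z \<in> S \<Longrightarrow> G z \<in> kset {\<alpha>. \<alpha> \<in> vset r \<and> (i < wdg a \<alpha> \<or> (i = wdg a \<alpha> \<and> j \<le> wdg b \<alpha>))}"
    and e: "\<And>z. z \<in> S \<Longrightarrow> leading 0 0 (e z) (if z = Q then 1 else 0)"
    and rel: "Th (\<Sum>z\<in>S. e z * psub Y (G z)) = 0"
  shows "psub W (prt {\<alpha>. wdg a \<alpha> = i \<and> wdg b \<alpha> = j} (G Q)) \<in> bz"
proof (rule bz_initial)
  let ?P = "\<lambda>z. psub W (prt {\<alpha>. wdg a \<alpha> = i \<and> wdg b \<alpha> = j} (G z))"
  have l: "leading i j (e z * psub Y (G z)) ((if z = Q then 1 else 0) * ?P z)" if z: "z \<in> S" for z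
    using leading_mult[OF e[OF z] leading_psub[OF XW G[OF z]]] by (simp only: add_0)
  have "(\<Sum>z\<in>S. e z * psub Y (G z) - (if z = Q then 1 else 0) * ?P z) \<in> T i (Suc j)"
    by (rule T_sum) (use l in \<open>simp add: leading_def\<close>)
  moreover have "(\<Sum>z\<in>S. (if z = Q then 1 else 0) * ?P z) = (\<Sum>z\<in>S. if z = Q then ?P z else 0)"
    by (rule sum.cong) auto
  ultimately have "(\<Sum>z\<in>S. e z * psub Y (G z)) - ?P Q \<in> T i (Suc j)"
    using S by (simp add: sum_subtractf)
  from T_uminus[OF this] have "?P Q - (\<Sum>z\<in>S. e z * psub Y (G z)) \<in> T i (Suc j)" by simp
  moreover have "Th (?P Q) = Th (?P Q - (\<Sum>z\<in>S. e z * psub Y (G z)))" unfolding psub_hom(6) rel by simp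
  ultimately show "Th (?P Q) \<in> Th ` T i (Suc j)" by (rule image_eqI[rotated])
  show "?P Q \<in> bh i j" using leading_psub[OF XW G[OF S(2)]] by (simp add: leading_def)
qed

lemma PV_dge_T: assumes "G \<in> PV N" "G \<in> dge j" shows "G \<in> T 0 j"
proof -
  have "dF \<mu> = 0" if "\<mu> \<in> vset N" for \<mu> unfolding dF_def wdg_def using that by auto
  then have "0 = dF \<mu> \<and> j \<le> dY \<mu>" if "\<mu> \<in> kys G" for \<mu>
    using mdeg_dY_dF[of \<mu>] that assms unfolding kset_def by fastforce
  then show ?thesis unfolding T_def kset_def by blast
qed

end

text \<open>To see that the interpolating polynomials are independent over the algebra of the
  \<open>\<theta> l\<close>, take a relation and the least bidegree occurring in any of its
  coefficients, and let \<open>Q\<close> be a point at which it occurs. After translation of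
  \<open>Q\<close> to the origin, the lowest part of the relation is the lowest part of the
  coefficient at \<open>Q\<close>, evaluated at the elements of \<open>wform\<close>. It lies in
  \<open>P Q\<close>, and their independence makes it vanish.\<close>

lemma card_points_stratum:
  fixes \<phi> :: "'a::{finite,field} \<Rightarrow> 'k::field" and f :: "nat \<Rightarrow> 'a mpoly"
  assumes \<phi>: "rhom \<phi>" and f: "\<And>l. l < m \<Longrightarrow> f l \<in> PV N \<inter> dle (\<delta> l)"
    and \<delta>: "\<And>l. l < m \<Longrightarrow> 1 \<le> \<delta> l" "\<And>l l'. l \<le> l' \<Longrightarrow> l' < m \<Longrightarrow> \<delta> l' \<le> \<delta> l"
    and S: "finite S" "\<And>z i. z \<in> S \<Longrightarrow> N \<le> i \<Longrightarrow> z i = 0" "\<And>z l. z \<in> S \<Longrightarrow> l < m \<Longrightarrow> ev z (f l) = 0"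
    and P: "\<And>z. z \<in> S \<Longrightarrow> cone.bz N m (\<lambda>l. lift \<phi> (shift z (f l))) \<subseteq> P z \<and> aind (P z) N (wform N m d \<tau>)"
    and d: "d \<le> N"
  shows "card S \<le> (\<Prod>l<m. \<delta> l) * CARD('a) ^ d"
proof -
  \<comment> \<open>Global polynomials that near each point start with the elements of
    \<open>wform\<close>: \<open>gpoly\<close> takes the place of a coordinate, and the equations
    that of their variables.\<close>
  define \<theta> where "\<theta> l = (if l < d then \<Sum>i<N. Cst (\<tau> l ^ i) * gpoly \<phi> i
    else \<Sum>i<m - (l - d). Cst (\<tau> l ^ i) * lift \<phi> (f (l - d + i)))" for l
  \<comment> \<open>As the degrees decrease, a combination of the equations from index l - d on has
    degree at most \<open>\<delta> (l - d)\<close>. The value 1 covers indices past the last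
    equation, where the combination is an empty sum and the weight must still be positive.\<close>
  define \<delta>' where "\<delta>' l = (if l < d then CARD('a) else if l - d < m then \<delta> (l - d) else 1)" for l
  define \<sigma> where "\<sigma> z = (\<lambda>i. \<phi> (z i))" for z :: "nat \<Rightarrow> 'a"
  have inj: "inj \<sigma>"
  proof (rule injI)
    fix z y assume "\<sigma> z = \<sigma> y"
    then have "\<phi> (z i - y i) = 0" for i by (simp add: \<sigma>_def rhom_minus[OF \<phi>] fun_eq_iff)
    then show "z = y" unfolding rhom_field_inj[OF \<phi>] by auto
  qed
  have \<sigma>0: "\<sigma> z i = 0" if "z \<in> S" "N \<le> i" for z i
    unfolding \<sigma>_def S(2)[OF that] by (rule rhomD(1)[OF \<phi>])
  have "\<forall>y\<in>S. \<exists>e. e \<in> PV N \<inter> dle (card (\<sigma> ` S)) \<and> (\<forall>z\<in>S. ev (\<sigma> z) e = (if z = y then 1 else 0))"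
  proof
    fix y assume y: "y \<in> S"
    have "\<exists>e\<in>PV N \<inter> dle (card (\<sigma> ` S)). \<forall>z\<in>\<sigma> ` S. ev z e = (if z = \<sigma> y then 1 else 0)"
      by (rule interpolation) (use S(1) y \<sigma>0 in auto)
    then show "\<exists>e. e \<in> PV N \<inter> dle (card (\<sigma> ` S)) \<and> (\<forall>z\<in>S. ev (\<sigma> z) e = (if z = y then 1 else 0))"
      by (simp only: Bex_def ball_simps inj_eq[OF inj])
  qed
  from bchoice[OF this] obtain e where e: "\<And>y. y \<in> S \<Longrightarrow> e y \<in> PV N \<inter> dle (card (\<sigma> ` S))"
    "\<And>y z. y \<in> S \<Longrightarrow> z \<in> S \<Longrightarrow> ev (\<sigma> z) (e y) = (if z = y then 1 else 0)" by auto
  have \<delta>'1: "1 \<le> \<delta>' l" for l using \<delta>(1)[of "l - d"] by (auto simp: \<delta>'_def Suc_le_eq)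
  have "card S \<le> (\<Prod>l<N. \<delta>' l)"
  proof (rule card_points_le_of_independent[OF S(1) e(1)])
    fix l assume l: "l < N"
    have "\<theta> l \<in> PV N"
      unfolding \<theta>_def using f by (auto intro!: kset_sum kset_Cst_mult gpoly_PV lift_kset[OF \<phi>])
    moreover have "\<theta> l \<in> dle (\<delta>' l)"
    proof (cases "l < d")
      case True
      then show ?thesis unfolding \<theta>_def \<delta>'_def using gpoly_dle by (auto intro!: kset_sum kset_Cst_mult)
    next
      case False
      have "f (l - d + i) \<in> dle (\<delta>' l)" if "i < m - (l - d)" for i
      proof (rule kset_mono)
        show "f (l - d + i) \<in> dle (\<delta> (l - d + i))" using f that by auto
        have i: "l - d + i < m" "l - d < m" using that by linarith+
        have "\<delta> (l - d + i) \<le> \<delta> (l - d)" by (rule \<delta>(2)[OF le_add1 i(1)])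
        also have "\<delta> (l - d) = \<delta>' l" using i(2) False by (simp add: \<delta>'_def)
        finally show "{m. mdeg m \<le> \<delta> (l - d + i)} \<subseteq> {m. mdeg m \<le> \<delta>' l}" by auto
      qed
      then show ?thesis unfolding \<theta>_def using False by (auto intro!: kset_sum kset_Cst_mult lift_kset[OF \<phi>])
    qed
    ultimately show "\<theta> l \<in> PV N \<inter> dle (\<delta>' l) \<and> 1 \<le> \<delta>' l" using \<delta>'1 by simp
  next
    fix C assume C: "\<And>z. z \<in> S \<Longrightarrow> C z \<in> PV N" and rel: "(\<Sum>z\<in>S. e z * psub \<theta> (C z)) = 0"
    show "\<forall>z\<in>S. C z = 0"
    proof (rule ccontr)
      define a b where "a l = (if l < d then 0 else 1 :: nat)" and "b l = (if l < d then 1 else 0 :: nat)" for l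
      assume "\<not> (\<forall>z\<in>S. C z = 0)"
      then obtain z where "z \<in> S" "C z \<noteq> 0" by blast
      define K where "K = (\<Union>z\<in>S. kys (C z))"
      have "kys (C z) \<noteq> {}" using \<open>C z \<noteq> 0\<close> by simp
      then obtain \<alpha> where "\<alpha> \<in> K" using \<open>z \<in> S\<close> unfolding K_def by blast
      from ex_min_measure[OF this, of "wdg a"] obtain \<beta> where \<beta>: "\<beta> \<in> K" "\<forall>\<gamma>\<in>K. wdg a \<beta> \<le> wdg a \<gamma>"
        by (rule bexE)
      define i where "i = wdg a \<beta>"
      have "\<beta> \<in> {\<gamma> \<in> K. wdg a \<gamma> = i}" using \<beta>(1) by (simp add: i_def)
      from ex_min_measure[OF this, of "wdg b"] obtain \<gamma> where \<gamma>: "\<gamma> \<in> {\<gamma> \<in> K. wdg a \<gamma> = i}"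
        "\<forall>\<gamma>'\<in>{\<gamma> \<in> K. wdg a \<gamma> = i}. wdg b \<gamma> \<le> wdg b \<gamma>'" by (rule bexE)
      define j where "j = wdg b \<gamma>"
      obtain Q where Q: "Q \<in> S" "\<gamma> \<in> kys (C Q)" using \<gamma>(1) unfolding K_def by blast
      have lex: "i < wdg a \<alpha> \<or> (i = wdg a \<alpha> \<and> j \<le> wdg b \<alpha>)" if "z \<in> S" "\<alpha> \<in> kys (C z)" for z \<alpha>
      proof -
        have \<alpha>: "\<alpha> \<in> K" using that unfolding K_def by blast
        have "i \<le> wdg a \<alpha>" using bspec[OF \<beta>(2) \<alpha>] by (simp add: i_def)
        moreover have "j \<le> wdg b \<alpha>" if "wdg a \<alpha> = i" using bspec[OF \<gamma>(2), of \<alpha>] \<alpha> that by (simp add: j_def)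
        ultimately show ?thesis by (cases "wdg a \<alpha> = i") auto
      qed
      interpret c: cone N m "\<lambda>l. lift \<phi> (shift Q (f l))"
        by (rule cone_lift[OF \<phi>]) (use f S(3)[OF Q(1)] in auto)
      let ?w = "wform N m d \<tau>"
      have "\<forall>i. \<exists>h. h \<in> dge 1 \<and> (\<forall>N. i < N \<longrightarrow> h \<in> PV N) \<and> gpoly \<phi> i = Vr i + Vr i * h"
        using gpoly_linear[OF \<phi>] unfolding Bex_def by (rule allI)
      from choice[OF this] obtain h where h: "\<And>i. h i \<in> dge 1" "\<And>i N. i < N \<Longrightarrow> h i \<in> PV N" "\<And>i. gpoly \<phi> i = Vr i + Vr i * h i"
        by auto
      \<comment> \<open>At \<open>Q\<close> the polynomial \<open>gpoly\<close> is a coordinate plus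
        terms of order at least 2. So \<open>Y l\<close> is a preimage under \<open>Th\<close> of
        the translated \<open>\<theta> l\<close> and has \<open>?w l\<close> as its leading
        part.\<close>
      define Y where "Y l = ?w l + (if l < d then \<Sum>i<N. Cst (\<tau> l ^ i) * (Vr i * h i) else 0)" for l
      have lead: "c.leading (a l) (b l) (Y l) (?w l)" for l
      proof (cases "l < d")
        case True
        have "?w l \<in> c.bh 0 1" unfolding wform_def c.bh_def using True
          by (auto intro!: kset_sum kset_Cst_mult Vr_kset simp: c.dF_def c.dY_def)
        moreover have "(\<Sum>i<N. Cst (\<tau> l ^ i) * (Vr i * h i)) \<in> c.T 0 2"
        proof (intro c.T_sum c.T_Cst_mult c.PV_dge_T)
          fix i assume "i \<in> {..<N}"
          then show "Vr i * h i \<in> PV N" using h by (intro PV_mult PV_Vr) auto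
          have "Vr i * h i \<in> dge (1 + 1)" using h by (intro dge_mult Vr_kset) auto
          then show "Vr i * h i \<in> dge 2" by (simp only: one_add_one)
        qed
        ultimately show ?thesis using True by (simp add: c.leading_def Y_def a_def b_def numeral_2_eq_2)
      next
        case False
        have "?w l \<in> c.bh 1 0" unfolding wform_def c.bh_def using False
          by (auto intro!: kset_sum kset_Cst_mult Vr_kset simp: c.dF_def c.dY_def)
        then show ?thesis using False by (simp add: c.leading_def Y_def a_def b_def)
      qed
      have sh: "shift (\<sigma> Q) (\<theta> l) = c.Th (Y l)" for l
      proof (cases "l < d")
        case True
        have t: "c.Th (Vr i + Vr i * h i) = gpoly \<phi> i" if "i < N" for i
          unfolding h(3)[symmetric] by (rule c.Th_PV) (rule gpoly_PV[OF that])
        have "Y l = (\<Sum>i<N. Cst (\<tau> l ^ i) * (Vr i + Vr i * h i))"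
          using True by (simp add: Y_def wform_def sum.distrib distrib_left)
        then have "c.Th (Y l) = (\<Sum>i<N. Cst (\<tau> l ^ i) * gpoly \<phi> i)" using t by (simp add: psub_hom)
        then show ?thesis using True
          by (simp add: \<theta>_def rhom_sum[OF rhom_shift] rhomD[OF rhom_shift] \<sigma>_def gpoly_shift[OF \<phi>])
      next
        case False
        have t: "c.thv (N + k + i) = lift \<phi> (shift Q (f (k + i)))" if "i < m - k" for k i
          using that by (simp add: c.thv_def add.assoc)
        have "shift (\<sigma> Q) (\<theta> l) = (\<Sum>i<m - (l - d). Cst (\<tau> l ^ i) * lift \<phi> (shift Q (f (l - d + i))))"
          by (simp only: \<theta>_def False if_False rhom_sum[OF rhom_shift] rhomD[OF rhom_shift] shift_Cst lift_shift[OF \<phi>] \<sigma>_def)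
        moreover have "c.Th (Y l) = (\<Sum>i<m - (l - d). Cst (\<tau> l ^ i) * c.thv (N + (l - d) + i))"
          by (simp only: Y_def wform_def False if_False psub_hom psub_Vr psub_Cst add_0_right)
        moreover have "\<dots> = (\<Sum>i<m - (l - d). Cst (\<tau> l ^ i) * lift \<phi> (shift Q (f (l - d + i))))"
          by (rule sum.cong[OF refl]) (simp only: t lessThan_iff)
        ultimately show ?thesis by (simp only:)
      qed
      define e' :: "(nat \<Rightarrow> 'a) \<Rightarrow> 'k mpoly" where "e' z = shift (\<sigma> Q) (e z)" for z
      have e': "c.Th (e' z) = e' z" "c.leading 0 0 (e' z) (if z = Q then 1 else 0)" if z: "z \<in> S" for z
      proof -
        have PVe: "e' z \<in> PV N" unfolding e'_def using e(1)[OF z] by (intro shift_PV) auto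
        then show "c.Th (e' z) = e' z" by (rule c.Th_PV)
        let ?o = "if z = Q then 1 else 0"
        have "lkp (e' z) 0 = ?o" unfolding e'_def lkp_shift_0 using e(2)[OF z Q(1)] by auto
        then have "e' z - ?o \<in> dge (Suc 0)" unfolding dge_1 by (simp add: lookup_minus lookup_one)
        then have "e' z - ?o \<in> c.T 0 (Suc 0)" using PVe by (intro c.PV_dge_T) (auto intro: kset_minus)
        moreover have "?o \<in> c.bh 0 0" using c.leading_1 by (auto simp: c.leading_def c.bh_def)
        ultimately show "c.leading 0 0 (e' z) ?o" by (simp add: c.leading_def)
      qed
      have "c.Th (\<Sum>z\<in>S. e' z * psub Y (C z)) = (\<Sum>z\<in>S. e' z * psub (\<lambda>l. shift (\<sigma> Q) (\<theta> l)) (C z))"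
        unfolding sh by (simp add: psub_hom psub_psub e')
      also have "\<dots> = shift (\<sigma> Q) (\<Sum>z\<in>S. e z * psub \<theta> (C z))"
        unfolding e'_def by (simp add: shift_def psub_hom psub_psub)
      also have "\<dots> = 0" using rel rhomD(1)[OF rhom_shift] by simp
      finally have rel': "c.Th (\<Sum>z\<in>S. e' z * psub Y (C z)) = 0" .
      let ?A = "{\<alpha>. wdg a \<alpha> = i \<and> wdg b \<alpha> = j}"
      have "psub ?w (prt ?A (C Q)) \<in> c.bz"
      proof (rule c.leading_relation[OF S(1) Q(1) lead _ e'(2) rel'])
        fix z assume z: "z \<in> S"
        show "C z \<in> kset {\<alpha>. \<alpha> \<in> vset N \<and> (i < wdg a \<alpha> \<or> (i = wdg a \<alpha> \<and> j \<le> wdg b \<alpha>))}"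
          using C[OF z] lex[OF z] unfolding kset_def by blast
      qed
      then have "psub ?w (prt ?A (C Q)) \<in> P Q" using P[OF Q(1)] by blast
      moreover have "prt ?A (C Q) \<in> PV N" by (rule prt_subset[OF C[OF Q(1)]])
      ultimately have "prt ?A (C Q) = 0" using P[OF Q(1)] unfolding aind_def by blast
      then have "kys (prt ?A (C Q)) = {}" by simp
      then show False unfolding kys_prt using Q(2) \<gamma>(1) by (auto simp: j_def)
    qed
  qed
  also have "\<dots> = (\<Prod>l<d. CARD('a)) * (\<Prod>l<N - d. \<delta>' (d + l))"
  proof -
    have "(\<Prod>l<N. \<delta>' l) = (\<Prod>l<d. \<delta>' l) * (\<Prod>l\<in>{d..<N}. \<delta>' l)"
      using d by (simp only: lessThan_atLeast0 prod.atLeastLessThan_concat[of 0 d N \<delta>'] le0)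
    moreover have "(\<Prod>l\<in>{d..<N}. \<delta>' l) = (\<Prod>l<N - d. \<delta>' (d + l))"
      by (rule prod.reindex_bij_witness[of _ "\<lambda>l. d + l" "\<lambda>l. l - d"]) auto
    moreover have "(\<Prod>l<d. \<delta>' l) = (\<Prod>l<d. CARD('a))" by (rule prod.cong) (auto simp: \<delta>'_def)
    ultimately show ?thesis by simp
  qed
  \<comment> \<open>The range is enlarged so as to include all m equations. Added factors are at
    least 1, and those past the last equation are equal to 1.\<close>
  also have "\<dots> \<le> (\<Prod>l<d. CARD('a)) * (\<Prod>l<max m (N - d). \<delta>' (d + l))"
  proof (rule mult_le_mono2, rule dvd_imp_le)
    show "(\<Prod>l<N - d. \<delta>' (d + l)) dvd (\<Prod>l<max m (N - d). \<delta>' (d + l))"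
      by (rule prod_dvd_prod_subset) auto
    show "0 < (\<Prod>l<max m (N - d). \<delta>' (d + l))"
      by (rule prod_pos) (use \<delta>'1 in \<open>simp add: Suc_le_eq\<close>)
  qed
  also have "(\<Prod>l<max m (N - d). \<delta>' (d + l)) = (\<Prod>l<m. \<delta> l)"
    by (rule prod.mono_neutral_cong_right) (auto simp: \<delta>'_def)
  finally show ?thesis by (simp add: mult.commute)
qed

text \<open>The largest number of independent coordinate combinations modulo the prime at z depends
  on z, whereas a common system \<open>\<theta>\<close> needs a common number. The points are
  therefore grouped by this number, which never exceeds \<open>D\<close>, and the bounds of the
  groups form a geometric series with ratio at least 2.\<close>

theorem card_zeros_le:
  fixes \<phi> :: "'a::{finite,field} \<Rightarrow> 'k::field" and f :: "nat \<Rightarrow> 'a mpoly"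
  assumes \<phi>: "rhom \<phi>" and inf: "infinite (UNIV :: 'k set)" and f: "\<And>l. l < m \<Longrightarrow> f l \<in> PV N \<inter> dle (\<delta> l)"
    and \<delta>: "\<And>l. l < m \<Longrightarrow> 1 \<le> \<delta> l" "\<And>l l'. l \<le> l' \<Longrightarrow> l' < m \<Longrightarrow> \<delta> l' \<le> \<delta> l"
    and S: "finite S" "\<And>z i. z \<in> S \<Longrightarrow> N \<le> i \<Longrightarrow> z i = 0" "\<And>z l. z \<in> S \<Longrightarrow> l < m \<Longrightarrow> ev z (f l) = 0"
    and N: "0 < N" "D \<le> N"
    and g: "\<And>z. z \<in> S \<Longrightarrow> growth_le (Wz z) D (rm.span (f ` {..<m} \<union> Vr ` {N..}))"
  shows "card S \<le> 2 * (\<Prod>l<m. \<delta> l) * CARD('a) ^ D"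
proof -
  let ?ind = "\<lambda>p d. \<exists>w. (\<forall>l<d. w l \<in> mp.span (Vr ` {..<N})) \<and> aind p d w"
  let ?bz = "\<lambda>z. cone.bz N m (\<lambda>l. lift \<phi> (shift z (f l)))"
  have "\<exists>p d. is_prime p \<and> ?bz z \<subseteq> p \<and> Vr ` {N + m..} \<subseteq> p \<and> \<not> growth_le dge (N - 1) p \<and> d \<le> D \<and> ?ind p d \<and> \<not> ?ind p (Suc d)"
    if z: "z \<in> S" for z
  proof -
    interpret c: cone N m "\<lambda>l. lift \<phi> (shift z (f l))"
      by (rule cone_lift[OF \<phi>]) (use f S(3)[OF z] in auto)
    obtain p where p: "is_prime p" "c.bz \<subseteq> p" "\<not> growth_le dge (N - 1) p" using c.ex_prime[OF N(1)] by (elim exE conjE)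
    have gJ: "growth_le dge D c.JF"
      unfolding c.JF_def by (rule growth_lift[OF \<phi> S(2)[OF z] g[OF z]])
    have sp: "mp.span (Vr ` {..<N} :: 'k mpoly set) \<subseteq> kset {sgl i 1 | i. i < N}"
    proof
      fix x :: "'k mpoly" assume "x \<in> mp.span (Vr ` {..<N})"
      then show "x \<in> kset {sgl i 1 | i. i < N}"
        by (induction rule: mp.span_induct_alt) (auto intro!: kset_add kset_Cst_mult Vr_kset)
    qed
    have bound: "\<forall>d. ?ind p d \<longrightarrow> d \<le> D"
    proof (intro allI impI, elim exE conjE)
      fix d w assume w: "\<forall>l<d. w l \<in> mp.span (Vr ` {..<N})" "aind p d w"
      show "d \<le> D" by (rule c.independent_forms_le[OF p(2) _ w(2) gJ]) (use w(1) sp in blast)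
    qed
    have "?ind p 0" using aind_0[OF p(1), of Vr] by (intro exI[of _ Vr]) simp
    define I where "I = ?ind p"
    have "\<exists>d. I d \<and> (\<forall>d'. I d' \<longrightarrow> d' \<le> d)"
      by (rule ex_has_greatest_nat[of I 0 "\<lambda>d. d" "Suc D", unfolded less_Suc_eq_le]) (unfold I_def, fact+)
    then obtain d where d: "I d" "\<forall>d'. I d' \<longrightarrow> d' \<le> d" by (elim exE conjE)
    have "\<not> I (Suc d)" using d(2) by (auto simp del: not_less)
    moreover have "Vr ` {N + m..} \<subseteq> p" using c.bz_Vr p(2) by (rule subset_trans)
    moreover have "d \<le> D" by (rule bound[THEN spec, THEN mp, OF d(1)[unfolded I_def]])
    ultimately show ?thesis using p d(1) unfolding I_def by - (rule exI[of _ p], rule exI[of _ d], intro conjI)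
  qed
  then have "\<forall>z\<in>S. \<exists>p d. is_prime p \<and> ?bz z \<subseteq> p \<and> Vr ` {N + m..} \<subseteq> p \<and> \<not> growth_le dge (N - 1) p \<and> d \<le> D \<and> ?ind p d \<and> \<not> ?ind p (Suc d)"
    by (rule ballI)
  from bchoice[OF this] obtain P where
    "\<forall>z\<in>S. \<exists>d. is_prime (P z) \<and> ?bz z \<subseteq> P z \<and> Vr ` {N + m..} \<subseteq> P z \<and> \<not> growth_le dge (N - 1) (P z) \<and> d \<le> D \<and> ?ind (P z) d \<and> \<not> ?ind (P z) (Suc d)"
    by (rule exE)
  from bchoice[OF this] obtain d where P:
    "\<forall>z\<in>S. is_prime (P z) \<and> ?bz z \<subseteq> P z \<and> Vr ` {N + m..} \<subseteq> P z \<and> \<not> growth_le dge (N - 1) (P z) \<and> d z \<le> D \<and> ?ind (P z) (d z) \<and> \<not> ?ind (P z) (Suc (d z))"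
    by (rule exE)
  let ?S = "\<lambda>k. {z \<in> S. d z = k}"
  have stratum: "card (?S k) \<le> (\<Prod>l<m. \<delta> l) * CARD('a) ^ k" if k: "k \<le> D" for k
  proof -
    have kN: "k \<le> N" using k N(2) by simp
    have fin: "finite (?S k)" using S(1) by simp
    have "\<exists>\<tau>. \<forall>z\<in>?S k. aind (P z) N (wform N m k \<tau>)"
    proof (rule simultaneous_basis[OF inf fin kN])
      fix z assume "z \<in> ?S k"
      then have z: "z \<in> S" "d z = k" by auto
      show "is_prime (P z) \<and> Vr ` {N + m..} \<subseteq> P z \<and> \<not> growth_le dge (N - 1) (P z)" using bspec[OF P z(1)] by simp
      show "?ind (P z) k" using bspec[OF P z(1)] unfolding z(2) by (elim conjE)
    next
      fix z and w :: "nat \<Rightarrow> 'k mpoly"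
      assume "z \<in> ?S k" and w: "\<forall>l<Suc k. w l \<in> mp.span (Vr ` {..<N})"
      then have z: "z \<in> S" "d z = k" by auto
      have "\<not> ?ind (P z) (Suc k)" using bspec[OF P z(1)] unfolding z(2) by (elim conjE)
      then show "\<not> aind (P z) (Suc k) w" using w by blast
    qed
    then obtain \<tau> where \<tau>: "\<forall>z\<in>?S k. aind (P z) N (wform N m k \<tau>)" by (rule exE)
    show ?thesis
    proof (rule card_points_stratum[OF \<phi> f \<delta> fin])
      fix z assume z: "z \<in> ?S k"
      then show "?bz z \<subseteq> P z \<and> aind (P z) N (wform N m k \<tau>)" using P \<tau> by simp
    qed (use S kN in auto)
  qed
  have dD: "d z \<le> D" if "z \<in> S" for z using bspec[OF P that] by (elim conjE)
  have "S = (\<Union>k\<le>D. ?S k)" using dD by auto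
  then have "card S \<le> (\<Sum>k\<le>D. card (?S k))" using card_UN_le[of "{..D}" ?S] by simp
  also have "\<dots> \<le> (\<Sum>k\<le>D. (\<Prod>l<m. \<delta> l) * CARD('a) ^ k)" by (rule sum_mono) (rule stratum, simp)
  also have "\<dots> = (\<Prod>l<m. \<delta> l) * (\<Sum>k\<le>D. CARD('a) ^ k)" by (simp only: sum_distrib_left)
  also have "(\<Sum>k\<le>D. CARD('a) ^ k) \<le> 2 * CARD('a) ^ D"
  proof (induction D)
    case (Suc D)
    have "card {0, 1 :: 'a} \<le> CARD('a)" by (rule card_mono) auto
    then have "2 \<le> CARD('a)" by simp
    from mult_le_mono1[OF this, of "CARD('a) ^ D"] show ?case
      using Suc unfolding power_Suc sum.atMost_Suc by linarith
  qed simp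
  finally show ?thesis by (simp add: mult_ac)
qed

subsection \<open>Equations of the scheme of morphisms\<close>

lemma rhom_pconst: "rhom \<phi> \<Longrightarrow> rhom (\<lambda>c. [:\<phi> c:])"
  by (simp add: rhom_def one_pCons)

lemma rhom_poly: "rhom (\<lambda>p. poly p u)"
  by (simp add: rhom_def)

lemma rhom_map_poly: assumes h: "rhom h" shows "rhom (map_poly h)"
proof -
  have c: "coeff (map_poly h p) i = h (coeff p i)" for p i by (simp add: coeff_map_poly rhomD[OF h])
  show ?thesis unfolding rhom_def
    by (intro conjI allI poly_eqI)
      (simp_all add: c coeff_mult rhomD[OF h] rhom_sum[OF h] coeff_1)
qed

text \<open>The i-th binary form of \<open>mor_eval\<close>, dehomogenised at t = 1.\<close>

definition xpol :: "nat \<Rightarrow> (nat \<Rightarrow> 'l::comm_ring_1) \<Rightarrow> nat \<Rightarrow> 'l poly" where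
  "xpol e z i = (\<Sum>j\<le>e. monom (z (i * (e + 1) + j)) j)"

lemma coeff_xpol: "coeff (xpol e z i) k = (if k \<le> e then z (i * (e + 1) + k) else 0)"
  by (simp add: xpol_def coeff_sum)

lemma degree_xpol: "degree (xpol e z i) \<le> e"
  by (rule degree_le) (simp add: coeff_xpol)

text \<open>The form evaluated along the parametrised curve, as a polynomial in the affine
  coordinate of the projective line. The coefficient vector may come from any ring: taking the
  variables themselves gives the equations of the scheme of morphisms, taking numbers gives the
  values of these equations.\<close>

definition Fpol :: "('k::comm_ring_1 \<Rightarrow> 'l::comm_ring_1) \<Rightarrow> nat \<Rightarrow> 'k mpoly \<Rightarrow> (nat \<Rightarrow> 'l) \<Rightarrow> 'l poly" where
  "Fpol \<phi> e F z = meval (\<lambda>c. [:\<phi> c:]) F (xpol e z)"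

lemma map_poly_Fpol:
  assumes h: "rhom h"
  shows "map_poly h (Fpol \<phi> e F z) = Fpol (\<lambda>c. h (\<phi> c)) e F (\<lambda>i. h (z i))"
proof -
  have "map_poly h [:c:] = [:h c:]" for c using h by (intro poly_eqI) (auto simp: coeff_map_poly rhomD coeff_pCons split: nat.splits)
  moreover have "map_poly h (xpol e z i) = xpol e (\<lambda>i. h (z i)) i" for i
    by (rule poly_eqI) (simp add: coeff_map_poly rhomD[OF h] coeff_xpol)
  ultimately show ?thesis unfolding Fpol_def rhom_meval[OF rhom_map_poly[OF h]] by simp
qed

lemma poly_Fpol: "rhom \<phi> \<Longrightarrow> poly (Fpol \<phi> e F z) u = meval \<phi> F (\<lambda>i. poly (xpol e z i) u)"
  unfolding Fpol_def rhom_meval[OF rhom_poly] by simp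

definition cform :: "nat \<Rightarrow> 'k::comm_ring_1 mpoly \<Rightarrow> nat \<Rightarrow> 'k mpoly" where
  "cform e F k = coeff (Fpol Cst e F Vr) k"

lemma meval_cform:
  assumes \<phi>: "rhom \<phi>" shows "meval \<phi> (cform e F k) z = coeff (Fpol \<phi> e F z) k"
proof -
  have "map_poly (\<lambda>G. meval \<phi> G z) (Fpol Cst e F Vr) = Fpol \<phi> e F z"
    unfolding map_poly_Fpol[OF meval_rhom[OF \<phi>]] by (simp add: meval_Cst[OF \<phi>] meval_Vr[OF \<phi>])
  then show ?thesis unfolding cform_def by (metis coeff_map_poly meval_hom(1)[OF \<phi>])
qed

lemma forms_mult: "F \<in> forms n a \<Longrightarrow> G \<in> forms n b \<Longrightarrow> F * G \<in> forms n (a + b)"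
  unfolding forms_eq by (erule kset_mult, assumption) (auto simp: mdeg_add dest: keys_add[THEN subsetD])

lemma forms_0: "0 \<in> forms n d" and forms_1: "1 \<in> forms n 0" and forms_sum: "(\<And>i. i \<in> I \<Longrightarrow> f i \<in> forms n d) \<Longrightarrow> sum f I \<in> forms n d"
  and forms_Cst_mult: "F \<in> forms n d \<Longrightarrow> Cst c * F \<in> forms n d" and forms_uminus: "F \<in> forms n d \<Longrightarrow> - F \<in> forms n d"
  unfolding forms_eq by (simp_all add: kset_sum kset_Cst_mult kset_uminus one_kset)

lemma forms_prod: "finite I \<Longrightarrow> (\<And>i. i \<in> I \<Longrightarrow> f i \<in> forms n (d i)) \<Longrightarrow> (\<Prod>i\<in>I. f i) \<in> forms n (\<Sum>i\<in>I. d i)"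
proof (induction I rule: finite_induct)
  case (insert x I)
  have "f x * prod f I \<in> forms n (d x + sum d I)" using insert by (intro forms_mult) simp_all
  then show ?case using insert.hyps by simp
qed (simp add: forms_1)

text \<open>Records both degrees at once. A form of degree d contributes equations of degree d, and
  as the degree in the affine coordinate is at most d e, there are d e + 1 of them.\<close>

definition pforms :: "nat \<Rightarrow> nat \<Rightarrow> nat \<Rightarrow> 'k::comm_ring_1 mpoly poly set" where
  "pforms N e d = {p. \<forall>k. coeff p k \<in> forms N d \<and> (d * e < k \<longrightarrow> coeff p k = 0)}"

lemma pforms_mult: assumes "p \<in> pforms N e a" "q \<in> pforms N e b" shows "p * q \<in> pforms N e (a + b)"
proof -
  have "coeff p i * coeff q (k - i) = 0" if "(a + b) * e < k" "i \<le> k" for i k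
  proof (cases "a * e < i")
    case False
    then have "b * e < k - i" using that by (simp add: distrib_right)
    then show ?thesis using assms(2) by (simp add: pforms_def)
  qed (use assms(1) in \<open>simp add: pforms_def\<close>)
  then have "coeff (p * q) k = 0" if "(a + b) * e < k" for k
    unfolding coeff_mult by (intro sum.neutral) (use that in auto)
  moreover have "coeff (p * q) k \<in> forms N (a + b)" for k
    unfolding coeff_mult by (intro forms_sum forms_mult) (use assms in \<open>auto simp: pforms_def\<close>)
  ultimately show ?thesis by (simp add: pforms_def)
qed

lemma pforms_1: "1 \<in> pforms N e 0"
  by (auto simp: pforms_def coeff_1 forms_1 forms_0)

lemma pforms_power: "p \<in> pforms N e a \<Longrightarrow> p ^ k \<in> pforms N e (a * k)"
proof (induction k)
  case (Suc k)
  from pforms_mult[OF Suc.prems Suc.IH[OF Suc.prems]] show ?case by simp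
qed (simp add: pforms_1)

lemma pforms_prod:
  "finite I \<Longrightarrow> (\<And>i. i \<in> I \<Longrightarrow> f i \<in> pforms N e (d i)) \<Longrightarrow> (\<Prod>i\<in>I. f i) \<in> pforms N e (\<Sum>i\<in>I. d i)"
proof (induction I rule: finite_induct)
  case (insert x I)
  have "f x * prod f I \<in> pforms N e (d x + sum d I)" using insert by (intro pforms_mult) simp_all
  then show ?case using insert.hyps by simp
qed (simp add: pforms_1)

lemma xpol_pforms: assumes "i < n" shows "xpol e (Vr :: nat \<Rightarrow> 'k::comm_ring_1 mpoly) i \<in> pforms (n * (e + 1)) e 1"
proof -
  have "(Vr (i * (e + 1) + k) :: 'k mpoly) \<in> forms (n * (e + 1)) 1" if "k \<le> e" for k
  proof (rule Vr_forms)
    have "i * (e + 1) + k < (i + 1) * (e + 1)" using that by simp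
    also have "\<dots> \<le> n * (e + 1)" using assms by (intro mult_le_mono1) simp
    finally show "i * (e + 1) + k < n * (e + 1)" .
  qed
  then show ?thesis by (simp add: pforms_def coeff_xpol forms_0)
qed

lemma Fpol_pforms:
  fixes F :: "'k::comm_ring_1 mpoly"
  assumes "F \<in> forms n d" shows "Fpol Cst e F Vr \<in> pforms (n * (e + 1)) e d"
  using assms unfolding forms_eq
proof (induction rule: kset_induct)
  case zero
  then show ?case by (simp add: Fpol_def meval_hom[OF rhom_pconst[OF rhom_Cst]] pforms_def forms_0)
next
  case (single m c)
  have "(\<Prod>i\<in>kys m. xpol e (Vr :: nat \<Rightarrow> 'k mpoly) i ^ lkp m i) \<in> pforms (n * (e + 1)) e (\<Sum>i\<in>kys m. 1 * lkp m i)"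
  proof (rule pforms_prod)
    fix i assume "i \<in> kys m"
    then have "i < n" using single by auto
    then show "xpol e (Vr :: nat \<Rightarrow> 'k mpoly) i ^ lkp m i \<in> pforms (n * (e + 1)) e (1 * lkp m i)"
      by (intro pforms_power xpol_pforms)
  qed simp
  then have p: "(\<Prod>i\<in>kys m. xpol e (Vr :: nat \<Rightarrow> 'k mpoly) i ^ lkp m i) \<in> pforms (n * (e + 1)) e d"
    using single by (simp only: mult_1 mem_Collect_eq mdeg_def)
  have "Fpol Cst e (sgl m c) Vr = smult (Cst c) (\<Prod>i\<in>kys m. xpol e Vr i ^ lkp m i)"
    unfolding Fpol_def by (subst meval_single) (simp_all add: Cst_0)
  then show ?case using p by (simp add: pforms_def forms_Cst_mult)
next
  case (add F G)
  then show ?case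
    by (simp add: Fpol_def meval_hom[OF rhom_pconst[OF rhom_Cst]] pforms_def forms_eq kset_add)
qed

lemma cform_forms: "F \<in> forms n d \<Longrightarrow> cform e F k \<in> forms (n * (e + 1)) d"
  and cform_zero: "F \<in> forms n d \<Longrightarrow> d * e < k \<Longrightarrow> cform e F k = 0"
  using Fpol_pforms[of F n d e] by (simp_all add: pforms_def cform_def)

subsection \<open>Binary forms\<close>

definition bform :: "nat \<Rightarrow> 'k::field poly \<Rightarrow> 'k \<Rightarrow> 'k \<Rightarrow> 'k" where
  "bform e p s t = (\<Sum>j\<le>e. coeff p j * s ^ j * t ^ (e - j))"

lemma bform_nonzero: assumes "t \<noteq> 0" "degree p \<le> e" shows "bform e p s t = t ^ e * poly p (s / t)"
proof -
  have "poly p (s / t) = poly (\<Sum>j\<le>e. monom (coeff p j) j) (s / t)"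
    by (simp only: poly_as_sum_of_monoms'[OF assms(2)])
  then have "poly p (s / t) = (\<Sum>j\<le>e. coeff p j * (s / t) ^ j)" by (simp add: poly_sum poly_monom)
  moreover have "coeff p j * s ^ j * t ^ (e - j) = t ^ e * (coeff p j * (s / t) ^ j)" if "j \<le> e" for j
    using assms(1) that by (simp add: power_divide power_diff)
  then have "bform e p s t = (\<Sum>j\<le>e. t ^ e * (coeff p j * (s / t) ^ j))"
    unfolding bform_def by (intro sum.cong) simp_all
  ultimately show ?thesis by (simp only: sum_distrib_left)
qed

lemma bform_zero: "bform e p s 0 = coeff p e * s ^ e"
proof -
  have "bform e p s 0 = (\<Sum>j\<le>e. if j = e then coeff p e * s ^ e else 0)"
    unfolding bform_def by (rule sum.cong) auto
  then show ?thesis by simp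
qed

lemma bform_mult:
  assumes "degree p \<le> a" "degree q \<le> b" shows "bform (a + b) (p * q) s t = bform a p s t * bform b q s t"
proof (cases "t = 0")
  case True
  have "coeff p i * coeff q (a + b - i) = (if i = a then coeff p a * coeff q b else 0)" for i
    using assms coeff_eq_0[of p i] coeff_eq_0[of q "a + b - i"] by (cases "i < a"; cases "i = a") auto
  then have "coeff (p * q) (a + b) = coeff p a * coeff q b" by (simp add: coeff_mult)
  then show ?thesis using True by (simp add: bform_zero power_add)
next
  case False
  have "degree (p * q) \<le> a + b" using degree_mult_le[of p q] assms by simp
  then show ?thesis using False assms by (simp add: bform_nonzero power_add)
qed

section \<open>Bezout identities with bounded degrees\<close>

lemma bezout_poly:
  fixes x :: "nat \<Rightarrow> 'a::field poly"
  assumes prim: "\<And>p. (\<forall>i<n. p dvd x i) \<Longrightarrow> is_unit p"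
  shows "\<exists>a. (\<Sum>i<n. a i * x i) = 1"
proof -
  let ?I = "range (\<lambda>a. \<Sum>i<n. a i * x i)"
  have xI: "r * x j \<in> ?I" if "j < n" for j r
  proof (rule range_eqI)
    have "(\<Sum>i<n. (if i = j then r else 0) * x i) = (\<Sum>i<n. if i = j then r * x i else 0)" by (rule sum.cong) auto
    then show "r * x j = (\<Sum>i<n. (if i = j then r else 0) * x i)" using that by simp
  qed
  have mI: "r * p \<in> ?I" if p: "p \<in> ?I" for r p
  proof -
    obtain a where "p = (\<Sum>i<n. a i * x i)" using p by (rule rangeE)
    then have "r * p = (\<Sum>i<n. (r * a i) * x i)" by (simp add: sum_distrib_left mult.assoc)
    then show ?thesis by (rule image_eqI[of _ _ "\<lambda>i. r * a i"]) simp
  qed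
  have dI: "p - p' \<in> ?I" if p: "p \<in> ?I" "p' \<in> ?I" for p p'
  proof -
    obtain a where a: "p = (\<Sum>i<n. a i * x i)" using p(1) by (rule rangeE)
    obtain b where b: "p' = (\<Sum>i<n. b i * x i)" using p(2) by (rule rangeE)
    have "p - p' = (\<Sum>i<n. (a i - b i) * x i)" by (simp add: a b sum_subtractf left_diff_distrib)
    then show ?thesis by (rule image_eqI[of _ _ "\<lambda>i. a i - b i"]) simp
  qed
  have "\<exists>j<n. x j \<noteq> 0"
  proof (rule ccontr)
    assume "\<not> (\<exists>j<n. x j \<noteq> 0)"
    then have "is_unit (0 :: 'a poly)" by (intro prim) auto
    then show False by simp
  qed
  then obtain j where "j < n" "x j \<noteq> 0" by (elim exE conjE)
  then have "x j \<in> ?I - {0}" using xI[of j 1] by simp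
  from ex_min_measure[OF this, of degree] obtain p where p: "p \<in> ?I - {0}" "\<forall>y\<in>?I - {0}. degree p \<le> degree y"
    by (rule bexE)
  have "p dvd x i" if i: "i < n" for i
  proof (rule ccontr)
    assume "\<not> p dvd x i"
    then have nz: "x i mod p \<noteq> 0" by (simp add: dvd_eq_mod_eq_0)
    have "x i - (x i div p) * p \<in> ?I" using dI[OF _ mI, of "x i" p "x i div p"] xI[OF i, of 1] p(1) by simp
    then have "x i mod p \<in> ?I - {0}" using nz by (simp add: minus_div_mult_eq_mod)
    then have "degree p \<le> degree (x i mod p)" using p(2) by (rule bspec[rotated])
    moreover have "degree (x i mod p) < degree p" using degree_mod_less[of p "x i"] nz p(1) by auto
    ultimately show False by simp
  qed
  then have "is_unit p" by (intro prim allI impI)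
  then obtain r where "1 = p * r" by (rule dvdE)
  then have "1 \<in> ?I" using mI[of p r] p(1) by (simp add: mult.commute)
  then show ?thesis by (auto simp: image_iff)
qed

text \<open>Primitive polynomials of maximal degree \<open>e\<close> generate, as binary forms of degree \<open>e\<close>, all
  binary forms of degree \<open>2 e\<close>.\<close>

lemma bezout_degree:
  fixes x :: "nat \<Rightarrow> 'a::field poly"
  assumes prim: "\<And>p. (\<forall>i<n. p dvd x i) \<Longrightarrow> is_unit p"
    and deg: "\<And>i. i < n \<Longrightarrow> degree (x i) \<le> e" "j < n" "degree (x j) = e" "0 < e" and k: "k \<le> 2 * e"
  shows "\<exists>b. (\<forall>i<n. degree (b i) \<le> e) \<and> (\<Sum>i<n. b i * x i) = monom 1 k"
proof -
  obtain a where a: "(\<Sum>i<n. a i * x i) = 1" using bezout_poly[OF prim] by (rule exE)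
  have xj: "x j \<noteq> 0" using deg(3,4) by auto
  \<comment> \<open>All coefficients but the j-th are reduced modulo \<open>x j\<close>, which has
    the maximal degree e. The j-th coefficient \<open>c\<close> absorbs the quotients, and the
    identity itself then forces its degree to be at most e.\<close>
  define r where "r i = (monom 1 k * a i) mod x j" for i
  define q where "q i = (monom 1 k * a i) div x j" for i
  let ?R = "{..<n} - {j}"
  define c where "c = monom 1 k * a j + (\<Sum>i\<in>?R. q i * x i)"
  have split: "sum f {..<n} = f j + sum f ?R" for f :: "nat \<Rightarrow> 'a poly"
    using deg(2) by (intro sum.remove) auto
  have rq: "monom 1 k * a i = q i * x j + r i" for i unfolding r_def q_def by (simp only: div_mult_mod_eq)
  have "monom 1 k = monom 1 k * (\<Sum>i<n. a i * x i)" by (simp add: a)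
  also have "\<dots> = (\<Sum>i<n. (monom 1 k * a i) * x i)" by (simp only: sum_distrib_left mult.assoc)
  also have "\<dots> = monom 1 k * a j * x j + (\<Sum>i\<in>?R. (q i * x j + r i) * x i)" unfolding split rq[symmetric] ..
  also have "(\<Sum>i\<in>?R. (q i * x j + r i) * x i) = (\<Sum>i\<in>?R. q i * x i * x j + r i * x i)"
    by (rule sum.cong) (simp_all add: algebra_simps)
  also have "monom 1 k * a j * x j + \<dots> = c * x j + (\<Sum>i\<in>?R. r i * x i)"
    unfolding c_def by (simp only: distrib_right sum.distrib sum_distrib_right add.assoc)
  finally have eq: "monom 1 k = c * x j + (\<Sum>i\<in>?R. r i * x i)" .
  have rdeg: "degree (r i) \<le> e" for i using degree_mod_less[OF xj, of "monom 1 k * a i"] deg(3) by (auto simp: r_def)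
  have "degree (\<Sum>i\<in>?R. r i * x i) \<le> 2 * e"
  proof (rule degree_sum_le)
    fix i assume "i \<in> ?R"
    then show "degree (r i * x i) \<le> 2 * e" using degree_mult_le[of "r i" "x i"] rdeg[of i] deg(1)[of i] by auto
  qed simp
  moreover have "degree (monom (1::'a) k) \<le> 2 * e" using k by (simp add: degree_monom_eq)
  ultimately have "degree (monom 1 k - (\<Sum>i\<in>?R. r i * x i)) \<le> 2 * e" by (rule degree_diff_le[rotated])
  then have cx: "degree (c * x j) \<le> 2 * e" unfolding eq by simp
  have "degree c \<le> e"
  proof (cases "c = 0")
    case False
    then show ?thesis using cx xj deg(3) by (simp add: degree_mult_eq)
  qed simp
  moreover have "(\<Sum>i<n. (r(j := c)) i * x i) = monom 1 k"
    unfolding split eq by (intro arg_cong2[where f = "(+)"] sum.cong) auto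
  ultimately show ?thesis using rdeg by (intro exI[of _ "r(j := c)"]) auto
qed

subsection \<open>Neighbourhoods in the scheme of morphisms\<close>

lemma mor_eval_bform: "i < n \<Longrightarrow> mor_eval n e z s t i = bform e (xpol e z i) s t"
  unfolding mor_eval_def bform_def by (simp add: coeff_xpol)

text \<open>For t different from 0 one dehomogenises. The point at infinity follows because the
  value is a polynomial in t that vanishes at all nonzero elements of an infinite field.\<close>

lemma meval_mor_eval_zero:
  fixes \<phi> :: "'k::field \<Rightarrow> 'l::field"
  assumes \<phi>: "rhom \<phi>" and inf: "infinite (UNIV :: 'l set)" and F: "F \<in> forms n d" "Fpol \<phi> e F z = 0"
  shows "meval \<phi> F (mor_eval n e z s t) = 0"
proof -
  have nz: "meval \<phi> F (mor_eval n e z s t) = 0" if t: "t \<noteq> 0" for s t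
  proof -
    have "meval \<phi> F (mor_eval n e z s t) = meval \<phi> F (\<lambda>i. t ^ e * poly (xpol e z i) (s / t))"
    proof (rule meval_cong_keys)
      fix m i assume "m \<in> kys F" "i \<in> kys m"
      then have "i < n" using forms_PV[OF F(1)] by (auto simp: kset_def)
      then show "mor_eval n e z s t i = t ^ e * poly (xpol e z i) (s / t)"
        by (simp add: mor_eval_bform bform_nonzero[OF t degree_xpol])
    qed
    moreover have "meval \<phi> F (\<lambda>i. poly (xpol e z i) (s / t)) = 0" using F(2) poly_Fpol[OF \<phi>, of e F z "s / t"] by simp
    ultimately show ?thesis using t by (simp add: forms_vanish_pt[OF F(1)])
  qed
  show ?thesis
  proof (cases "t = 0")
    case True
    define p where "p = meval (\<lambda>c. [:\<phi> c:]) F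
      (\<lambda>i. if i < n then \<Sum>j\<le>e. monom (z (i * (e + 1) + j) * s ^ j) (e - j) else 0)"
    have p: "poly p t = meval \<phi> F (mor_eval n e z s t)" for t
    proof -
      have "(\<lambda>i. poly (if i < n then \<Sum>j\<le>e. monom (z (i * (e + 1) + j) * s ^ j) (e - j) else 0) t) = mor_eval n e z s t"
        by (rule ext) (simp add: mor_eval_def poly_sum poly_monom)
      then show ?thesis unfolding p_def rhom_meval[OF rhom_poly] by simp
    qed
    have "UNIV - {0} \<subseteq> {t. poly p t = 0}" using nz p by auto
    moreover have "infinite (UNIV - {0 :: 'l})" using inf by simp
    ultimately have "p = 0" using poly_roots_finite[of p] finite_subset by metis
    then show ?thesis using p[of 0] True by simp
  qed (rule nz)
qed

text \<open>Row k holds the coefficients of a combination of the binary forms, of degree 2 e, with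
  fixed multipliers \<open>b k\<close>. A nonzero determinant says that these combinations generate
  all binary forms of degree 2 e, an open condition on \<open>z\<close> that excludes common zeros
  on the projective line.\<close>

definition genmat :: "nat \<Rightarrow> nat \<Rightarrow> (nat \<Rightarrow> nat \<Rightarrow> 'a::field poly) \<Rightarrow> ('a \<Rightarrow> 'l::comm_ring_1) \<Rightarrow> (nat \<Rightarrow> 'l) \<Rightarrow> 'l mat" where
  "genmat n e b \<phi> z = mat (2 * e + 1) (2 * e + 1) (\<lambda>(k, k'). coeff (\<Sum>i<n. map_poly \<phi> (b k i) * xpol e z i) k')"

lemma genmat_hom:
  assumes h: "rhom h" and \<phi>: "rhom \<phi>"
  shows "h (det (genmat n e b \<phi> z)) = det (genmat n e b (\<lambda>c. h (\<phi> c)) (\<lambda>i. h (z i)))"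
proof -
  interpret comm_ring_hom h by unfold_locales (simp_all add: rhomD[OF h])
  have "map_mat h (genmat n e b \<phi> z) = genmat n e b (\<lambda>c. h (\<phi> c)) (\<lambda>i. h (z i))"
    unfolding genmat_def
    by (rule eq_matI)
      (simp_all add: coeff_sum coeff_mult coeff_map_poly coeff_xpol rhomD[OF h] rhomD[OF \<phi>] rhom_sum[OF h] if_distrib[of h] cong: if_cong)
  then show ?thesis unfolding hom_det[symmetric] by simp
qed

lemma genmat_form: "det (genmat n e b Cst Vr) \<in> forms (n * (e + 1)) (2 * e + 1)"
proof -
  let ?A = "genmat n e b Cst Vr"
  have entry: "?A $$ (k, k') \<in> forms (n * (e + 1)) 1" if "k < 2 * e + 1" "k' < 2 * e + 1" for k k'
  proof -
    have "coeff (map_poly Cst (b k i) * xpol e Vr i) k' \<in> forms (n * (e + 1)) 1" if "i < n" for i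
      unfolding coeff_mult using xpol_pforms[OF that, where e = e and ?'k = 'a]
      by (intro forms_sum) (simp add: coeff_map_poly Cst_0 pforms_def forms_Cst_mult)
    then have "(\<Sum>i<n. coeff (map_poly Cst (b k i) * xpol e Vr i) k') \<in> forms (n * (e + 1)) 1"
      by (intro forms_sum) (simp only: lessThan_iff)
    moreover have "?A $$ (k, k') = (\<Sum>i<n. coeff (map_poly Cst (b k i) * xpol e Vr i) k')"
      using that by (simp add: genmat_def coeff_sum)
    ultimately show ?thesis by (simp only:)
  qed
  have s: "signof p * F \<in> forms n' d" if "F \<in> forms n' d" for p n' d and F :: "'a mpoly"
    using that by (simp add: sign_def forms_uminus)
  have "(\<Prod>i = 0..<2 * e + 1. ?A $$ (i, p i)) \<in> forms (n * (e + 1)) (\<Sum>i = 0..<2 * e + 1. 1)"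
    if "p permutes {0..<2 * e + 1}" for p
    by (rule forms_prod) (use entry permutes_in_image[OF that] in auto)
  then have "(\<Prod>i = 0..<2 * e + 1. ?A $$ (i, p i)) \<in> forms (n * (e + 1)) (2 * e + 1)"
    if "p permutes {0..<2 * e + 1}" for p using that by simp
  moreover have "?A \<in> carrier_mat (2 * e + 1) (2 * e + 1)" by (simp add: genmat_def)
  ultimately show ?thesis by (auto simp only: det_def' mem_Collect_eq intro!: forms_sum s)
qed

text \<open>At a common zero every row combination vanishes, so the vector of all monomials of
  degree 2 e in s and t lies in the kernel of the matrix; it is nonzero since its first and last
  entries are powers of t and s.\<close>

lemma genmat_common_zero:
  fixes z :: "nat \<Rightarrow> 'l::field"
  assumes \<phi>: "rhom \<phi>" and b: "\<And>k i. i < n \<Longrightarrow> degree (b k i) \<le> e"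
    and st: "(s, t) \<noteq> (0, 0)" and zero: "\<And>i. i < n \<Longrightarrow> mor_eval n e z s t i = 0"
  shows "det (genmat n e b \<phi> z) = 0"
proof -
  let ?A = "genmat n e b \<phi> z" and ?v = "vec (2 * e + 1) (\<lambda>k. s ^ k * t ^ (2 * e - k))"
  have A: "?A \<in> carrier_mat (2 * e + 1) (2 * e + 1)" by (simp add: genmat_def)
  have "?v \<noteq> 0\<^sub>v (2 * e + 1)"
  proof
    assume v: "?v = 0\<^sub>v (2 * e + 1)"
    have "?v $ 0 = 0" "?v $ (2 * e) = 0" unfolding v by simp_all
    then show False using st by (cases "e = 0") auto
  qed
  moreover have "?A *\<^sub>v ?v = 0\<^sub>v (2 * e + 1)"
  proof (rule eq_vecI)
    fix k assume "k < dim_vec (0\<^sub>v (2 * e + 1) :: 'l vec)"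
    then have k: "k < 2 * e + 1" by simp
    let ?B = "\<lambda>i. map_poly \<phi> (b k i)"
    have "(?A *\<^sub>v ?v) $ k = (\<Sum>k'\<le>2 * e. coeff (\<Sum>i<n. ?B i * xpol e z i) k' * (s ^ k' * t ^ (2 * e - k')))"
      using k by (simp add: genmat_def scalar_prod_def atLeast0LessThan lessThan_Suc_atMost)
    also have "\<dots> = (\<Sum>i<n. bform (e + e) (?B i * xpol e z i) s t)"
      unfolding bform_def coeff_sum sum_distrib_right by (subst sum.swap) (simp add: mult_2 mult.assoc)
    also have "\<dots> = 0"
    proof (rule sum.neutral, rule ballI)
      fix i assume "i \<in> {..<n}"
      then have i: "i < n" by simp
      have "degree (?B i) \<le> e"
      proof (rule degree_le, intro allI impI)
        fix l assume "e < l"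
        then have "coeff (b k i) l = 0" using b[OF i, of k] by (intro coeff_eq_0) simp
        then show "coeff (?B i) l = 0" by (simp add: coeff_map_poly rhomD[OF \<phi>])
      qed
      then have "bform (e + e) (?B i * xpol e z i) s t = bform e (?B i) s t * bform e (xpol e z i) s t"
        by (rule bform_mult) (rule degree_xpol)
      then show "bform (e + e) (?B i * xpol e z i) s t = 0" using zero[OF i] mor_eval_bform[OF i, of e z s t] by simp
    qed
    finally show "(?A *\<^sub>v ?v) $ k = 0\<^sub>v (2 * e + 1) $ k" using k by simp
  qed (simp add: genmat_def)
  ultimately show ?thesis using det_0_iff_vec_prod_zero[OF A] by (meson vec_carrier)
qed

text \<open>\<open>g\<close> is a product of two factors. The first is the determinant of
  \<open>genmat\<close> with multipliers supplied by the Bezout identities at \<open>y\<close>,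
  where the matrix is the identity; nonvanishing excludes common zeros, so the forms define a
  morphism. The second is a coefficient of \<open>G\<close> along the curve, nonzero at
  \<open>y\<close>; nonvanishing ensures that the image meets the open subset.\<close>

lemma Mor_points_neighbourhood:
  fixes Fs :: "'a::{finite,field} mpoly list"
  assumes Fs: "\<And>F. F \<in> set Fs \<Longrightarrow> \<exists>d. F \<in> forms n d" and Gs: "G \<in> Gs" "G \<in> forms n d'"
    and prim: "\<And>p. (\<forall>i<n. p dvd xpol e y i) \<Longrightarrow> is_unit p"
    and deg: "j < n" "degree (xpol e y j) = e" "0 < e" and G: "Fpol (\<lambda>c. c) e G y \<noteq> 0"
  shows "\<exists>g dg. g \<in> forms (n * (e + 1)) dg \<and> 0 < dg \<and> ev y g \<noteq> 0 \<and>
    (\<forall>z. (\<exists>i. z i \<noteq> 0) \<longrightarrow> (\<forall>i\<ge>n * (e + 1). z i = 0) \<longrightarrow>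
      (\<forall>F\<in>set Fs. \<forall>k. meval to_ac (cform e F k) z = 0) \<longrightarrow> meval to_ac g z \<noteq> 0 \<longrightarrow>
      proj_pt z \<in> Mor_points n Fs Gs e)"
proof -
  let ?N = "n * (e + 1)"
  have inf: "infinite (UNIV :: 'a alg_closure set)" by (rule infinite_alg_closed)
  obtain k where k: "coeff (Fpol (\<lambda>c. c) e G y) k \<noteq> 0" using G by (metis leading_coeff_0_iff)
  have "\<forall>k. \<exists>b. k \<le> 2 * e \<longrightarrow> (\<forall>i<n. degree (b i) \<le> e) \<and> (\<Sum>i<n. b i * xpol e y i) = monom 1 k"
  proof
    fix k show "\<exists>b. k \<le> 2 * e \<longrightarrow> (\<forall>i<n. degree (b i) \<le> e) \<and> (\<Sum>i<n. b i * xpol e y i) = monom 1 k"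
    proof (cases "k \<le> 2 * e")
      case True
      from bezout_degree[of n "xpol e y" e j k, OF prim degree_xpol deg True] show ?thesis by simp
    qed simp
  qed
  from choice[OF this] obtain b0 where
    b0: "\<forall>k. k \<le> 2 * e \<longrightarrow> (\<forall>i<n. degree (b0 k i) \<le> e) \<and> (\<Sum>i<n. b0 k i * xpol e y i) = monom 1 k"
    by (rule exE)
  define b where "b k = (if k \<le> 2 * e then b0 k else (\<lambda>_. 0))" for k
  have bdeg: "degree (b k i) \<le> e" if "i < n" for k i using b0 that by (simp add: b_def)
  have by1: "genmat n e b (\<lambda>c. c) y = 1\<^sub>m (2 * e + 1)"
    unfolding genmat_def one_mat_def
  proof (rule cong_mat, rule refl, rule refl)
    fix k k' assume kk: "k < 2 * e + 1" "k' < 2 * e + 1"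
    have "map_poly (\<lambda>c. c) p = p" for p :: "'a poly" by (rule poly_eqI) (simp add: coeff_map_poly)
    then have "(\<Sum>i<n. map_poly (\<lambda>c. c) (b k i) * xpol e y i) = monom 1 k" using b0 kk(1) by (simp add: b_def)
    then show "(\<lambda>(k, k'). coeff (\<Sum>i<n. map_poly (\<lambda>c. c) (b k i) * xpol e y i) k') (k, k') = (\<lambda>(i, j). if i = j then 1 else 0) (k, k')"
      by simp
  qed
  define g where "g = det (genmat n e b Cst Vr) * cform e G k"
  have mg: "meval \<phi> g z = det (genmat n e b \<phi> z) * coeff (Fpol \<phi> e G z) k" if \<phi>: "rhom \<phi>"
    for \<phi> :: "'a \<Rightarrow> 'l::comm_ring_1" and z
    unfolding g_def by (simp add: meval_hom[OF \<phi>] meval_cform[OF \<phi>] genmat_hom[OF meval_rhom[OF \<phi>] rhom_Cst] meval_Cst[OF \<phi>] meval_Vr[OF \<phi>])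
  have gform: "g \<in> forms ?N (2 * e + 1 + d')" unfolding g_def by (rule forms_mult[OF genmat_form cform_forms[OF Gs(2)]])
  have "ev y g \<noteq> 0" unfolding mg[OF rhom_id] by1 using k by simp
  moreover have "proj_pt z \<in> Mor_points n Fs Gs e"
    if z: "\<exists>i. z i \<noteq> 0" "\<forall>i\<ge>?N. z i = 0" and van: "\<forall>F\<in>set Fs. \<forall>k. meval to_ac (cform e F k) z = 0"
      and gz: "meval to_ac g z \<noteq> 0" for z
  proof -
    have main: "(\<forall>s t. (s, t) \<noteq> (0, 0) \<longrightarrow> proj_pt (mor_eval n e z' s t) \<in> proj_zeros to_ac n (set Fs)) \<and>
      (\<exists>s t. (s, t) \<noteq> (0, 0) \<and> proj_pt (mor_eval n e z' s t) \<in> open_points to_ac n Fs Gs)" if z': "z' \<in> proj_pt z" for z'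
    proof -
      obtain c where c: "c \<noteq> 0" "z' = (\<lambda>i. c * z i)" using z' by (auto simp: proj_pt_def)
      have gz': "meval to_ac g z' \<noteq> 0" using gz unfolding c(2) forms_vanish_pt[OF gform c(1)] .
      then have dG: "det (genmat n e b to_ac z') \<noteq> 0" "Fpol to_ac e G z' \<noteq> 0" unfolding mg[OF rhom_to_ac] by auto
      have F0: "Fpol to_ac e F z' = 0" if F: "F \<in> set Fs" for F
      proof (rule poly_eqI)
        fix k
        obtain d where "F \<in> forms n d" using Fs[OF F] by (rule exE)
        from forms_vanish_pt[OF cform_forms[OF this] c(1)] van F
        have "meval to_ac (cform e F k) z' = 0" unfolding c(2) by blast
        then show "coeff (Fpol to_ac e F z') k = coeff 0 k" unfolding meval_cform[OF rhom_to_ac] by simp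
      qed
      have zeros: "proj_pt (mor_eval n e z' s t) \<in> proj_zeros to_ac n (set Fs)" if st: "(s, t) \<noteq> (0, 0)" for s t
      proof -
        have "\<exists>i. mor_eval n e z' s t i \<noteq> 0"
        proof (rule ccontr)
          assume "\<not> ?thesis"
          then have "det (genmat n e b to_ac z') = 0"
            by (intro genmat_common_zero[OF rhom_to_ac bdeg st]) auto
          then show False using dG(1) by simp
        qed
        then have "proj_pt (mor_eval n e z' s t) \<in> proj_space n"
          unfolding proj_space_def by (intro imageI) (auto simp: mor_eval_def)
        moreover have "meval to_ac F x = 0" if F: "F \<in> set Fs" and x: "x \<in> proj_pt (mor_eval n e z' s t)" for F x
        proof -
          obtain d where d: "F \<in> forms n d" using Fs[OF F] by (rule exE)
          obtain c where c: "c \<noteq> 0" "x = (\<lambda>i. c * mor_eval n e z' s t i)" using x by (auto simp: proj_pt_def)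
          show ?thesis unfolding c(2) forms_vanish_pt[OF d c(1)]
            by (rule meval_mor_eval_zero[OF rhom_to_ac inf d F0[OF F]])
        qed
        ultimately show ?thesis by (simp add: proj_zeros_def)
      qed
      have "\<exists>u. poly (Fpol to_ac e G z') u \<noteq> 0"
      proof (rule ccontr)
        assume "\<not> ?thesis"
        then have "{u. poly (Fpol to_ac e G z') u = 0} = UNIV" by auto
        then show False using poly_roots_finite[OF dG(2)] inf by simp
      qed
      then obtain u where u: "poly (Fpol to_ac e G z') u \<noteq> 0" by (rule exE)
      have "meval to_ac G (mor_eval n e z' u 1) = meval to_ac G (\<lambda>i. poly (xpol e z' i) u)"
      proof (rule meval_cong_keys)
        fix m i assume "m \<in> kys G" "i \<in> kys m"
        then have "i < n" using forms_PV[OF Gs(2)] by (auto simp: kset_def)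
        then show "mor_eval n e z' u 1 i = poly (xpol e z' i) u"
          by (simp add: mor_eval_bform bform_nonzero[OF _ degree_xpol])
      qed
      then have "meval to_ac G (mor_eval n e z' u 1) \<noteq> 0" using u by (simp add: poly_Fpol[OF rhom_to_ac])
      then have "proj_pt (mor_eval n e z' u 1) \<notin> proj_zeros to_ac n Gs"
        unfolding proj_zeros_def using Gs(1) proj_pt_self by blast
      then have "proj_pt (mor_eval n e z' u 1) \<in> open_points to_ac n Fs Gs"
        using zeros[of u 1] by (simp add: open_points_def)
      then show ?thesis using zeros by (intro conjI allI impI exI[of _ u] exI[of _ 1]) simp_all
    qed
    have "proj_pt z \<in> proj_space ?N" unfolding proj_space_def by (intro imageI) (use z in simp)
    then show ?thesis unfolding Mor_points_def using main by blast
  qed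
  ultimately show ?thesis using gform by (intro exI[of _ g] exI[of _ "2 * e + 1 + d'"]) simp
qed

subsection \<open>Rational points of given height\<close>

lemma rhom_Fract: "rhom (\<lambda>p :: 'k::field poly. Fraction_Field.Fract p 1)"
  by (simp add: rhom_def Fraction_Field.Zero_fract_def Fraction_Field.One_fract_def)

lemma Fract_eq_0: "Fraction_Field.Fract p 1 = 0 \<longleftrightarrow> p = (0 :: 'k::field poly)"
  by (simp add: Fraction_Field.Zero_fract_def eq_fract)

lemma proj_pt_eq: "v \<in> proj_pt w \<Longrightarrow> proj_pt v = proj_pt w"
proof -
  assume "v \<in> proj_pt w"
  then obtain c where c: "c \<noteq> 0" "v = (\<lambda>i. c * w i)" by (auto simp: proj_pt_def)
  have w: "w = (\<lambda>i. inverse c * v i)" using c by (simp add: mult.assoc[symmetric])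
  show ?thesis
  proof (intro equalityI subsetI)
    fix y assume "y \<in> proj_pt v"
    then obtain b where b: "b \<noteq> 0" "y = (\<lambda>i. b * v i)" by (auto simp: proj_pt_def)
    have "b * c \<noteq> 0" "y = (\<lambda>i. (b * c) * w i)" using b c by (simp_all add: mult.assoc)
    then show "y \<in> proj_pt w" unfolding proj_pt_def by (intro CollectI exI[of _ "b * c"] conjI)
  next
    fix y assume "y \<in> proj_pt w"
    then obtain b where b: "b \<noteq> 0" "y = (\<lambda>i. b * w i)" by (auto simp: proj_pt_def)
    have "b * inverse c \<noteq> 0" using b(1) c(1) by simp
    moreover have "y = (\<lambda>i. (b * inverse c) * v i)" unfolding b(2) by (subst w) (simp only: mult.assoc)
    ultimately show "y \<in> proj_pt v" unfolding proj_pt_def by (intro CollectI exI[of _ "b * inverse c"] conjI)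
  qed
qed

abbreviation fract_pt :: "nat \<Rightarrow> (nat \<Rightarrow> 'k::field poly) \<Rightarrow> nat \<Rightarrow> 'k poly fract" where
  "fract_pt n x \<equiv> (\<lambda>i. if i < n then Fraction_Field.Fract (x i) 1 else 0)"

lemma clear_denominators:
  fixes w :: "nat \<Rightarrow> 'k::field poly fract"
  shows "\<exists>c y. c \<noteq> 0 \<and> (\<forall>i<n. Fraction_Field.Fract (y i) 1 = c * w i)"
proof (induction n)
  case 0
  show ?case by (intro exI[of _ 1]) simp
next
  case (Suc n)
  then obtain c y where c: "c \<noteq> 0" "\<forall>i<n. Fraction_Field.Fract (y i) 1 = c * w i" by (elim exE conjE)
  obtain a b where ab: "c * w n = Fraction_Field.Fract a b" "b \<noteq> 0" by (cases "c * w n" rule: Fract_cases) auto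
  let ?c = "Fraction_Field.Fract b 1 * c" and ?y = "\<lambda>i. if i < n then b * y i else a"
  have "?c \<noteq> 0" using c(1) ab(2) by (simp add: Fract_eq_0)
  moreover have "Fraction_Field.Fract (?y i) 1 = ?c * w i" if "i < Suc n" for i
  proof (cases "i < n")
    case True
    then have "?c * w i = Fraction_Field.Fract b 1 * Fraction_Field.Fract (y i) 1" using c(2) by (simp add: mult.assoc)
    then show ?thesis using True by simp
  next
    case False
    then have "?c * w i = Fraction_Field.Fract b 1 * Fraction_Field.Fract a b" using that ab(1) by (simp add: less_Suc_eq mult.assoc)
    then show ?thesis using False ab(2) by (simp add: eq_fract)
  qed
  ultimately show ?case by (intro exI[of _ ?c] exI[of _ ?y]) simp
qed

text \<open>Among the polynomial representatives take one whose entry at a nonzero coordinate j has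
  least degree. Removing a common divisor of positive degree would lower it.\<close>

lemma ex_primitive_rep:
  fixes P :: "'k::field poly fract ppoint"
  assumes P: "P \<in> proj_space n" shows "\<exists>x. primitive_rep n P x"
proof -
  obtain w where w: "P = proj_pt w" "\<exists>i. w i \<noteq> 0" "\<forall>i\<ge>n. w i = 0" using P by (auto simp: proj_space_def)
  obtain j where j: "w j \<noteq> 0" using w(2) by (rule exE)
  then have jn: "j < n" using w(3) by (meson not_less)
  let ?A = "{x. fract_pt n x \<in> P}"
  obtain c y where c: "c \<noteq> 0" "\<forall>i<n. Fraction_Field.Fract (y i) 1 = c * w i" using clear_denominators[of n w] by (elim exE conjE)
  have "fract_pt n y = (\<lambda>i. c * w i)" using c(2) w(3) by auto
  then have "y \<in> ?A" using c(1) by (auto simp: w(1) proj_pt_def)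
  from ex_min_measure[OF this, of "\<lambda>x. degree (x j)"]
  obtain x where x: "x \<in> ?A" "\<forall>x'\<in>?A. degree (x j) \<le> degree (x' j)" by (rule bexE)
  have xj: "x j \<noteq> 0"
  proof
    assume "x j = 0"
    obtain b where b: "b \<noteq> 0" "fract_pt n x = (\<lambda>i. b * w i)" using x(1) by (auto simp: w(1) proj_pt_def)
    have "fract_pt n x j = b * w j" using b(2) by (rule fun_cong)
    then have "Fraction_Field.Fract (x j) 1 = b * w j" using jn by simp
    moreover have "Fraction_Field.Fract (x j) 1 = 0" using \<open>x j = 0\<close> by (simp only: Fract_eq_0)
    ultimately show False using b(1) j by simp
  qed
  have "is_unit p" if p: "\<forall>i<n. p dvd x i" for p
  proof -
    define x' where "x' i = x i div p" for i
    have x': "x i = p * x' i" if "i < n" for i using p that by (simp add: x'_def)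
    have p0: "p \<noteq> 0" "x' j \<noteq> 0" using x'[OF jn] xj by auto
    have "fract_pt n x i = Fraction_Field.Fract p 1 * fract_pt n x' i" for i using x' by simp
    then have "fract_pt n x = (\<lambda>i. Fraction_Field.Fract p 1 * fract_pt n x' i)" by (rule ext)
    then have "fract_pt n x \<in> proj_pt (fract_pt n x')" using p0(1) by (auto simp: proj_pt_def Fract_eq_0)
    then have "proj_pt (fract_pt n x) = proj_pt (fract_pt n x')" by (rule proj_pt_eq)
    moreover have "proj_pt (fract_pt n x) = P" unfolding w(1) by (rule proj_pt_eq) (use x(1) w(1) in simp)
    ultimately have "x' \<in> ?A" using proj_pt_self[of "fract_pt n x'"] by simp
    then have "degree (x j) \<le> degree (x' j)" using x(2) by (rule bspec[rotated])
    then have "degree p = 0" using x'[OF jn] p0 by (simp add: degree_mult_eq)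
    then show ?thesis using p0(1) by (simp add: is_unit_iff_degree)
  qed
  then show ?thesis using x(1) by (auto simp: primitive_rep_def)
qed

text \<open>The two representatives are related by a fraction u / v. The Bezout identity for
  \<open>x\<close> shows that v divides u, and since \<open>x'\<close> is primitive the quotient is
  a unit. Hence the height is well defined.\<close>

lemma primitive_rep_degree:
  fixes P :: "'k::field poly fract ppoint"
  assumes P: "P = proj_pt w" and x: "primitive_rep n P x" "primitive_rep n P x'" and i: "i < n"
  shows "degree (x' i) = degree (x i)"
proof -
  have "proj_pt (fract_pt n x) = P" unfolding P by (rule proj_pt_eq) (use x(1) P in \<open>simp add: primitive_rep_def\<close>)
  then have "fract_pt n x' \<in> proj_pt (fract_pt n x)" using x(2) by (simp add: primitive_rep_def)
  then obtain c where c: "c \<noteq> 0" "fract_pt n x' = (\<lambda>i. c * fract_pt n x i)" by (auto simp: proj_pt_def)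
  obtain u v where uv: "c = Fraction_Field.Fract u v" "v \<noteq> 0" by (cases c rule: Fract_cases) auto
  have vx: "v * x' i = u * x i" if "i < n" for i
  proof -
    have "fract_pt n x' i = c * fract_pt n x i" using c(2) by (rule fun_cong)
    then show ?thesis using that uv by (simp add: eq_fract mult.commute)
  qed
  have prim: "\<And>p. (\<forall>i<n. p dvd x i) \<Longrightarrow> is_unit p" "\<And>p. (\<forall>i<n. p dvd x' i) \<Longrightarrow> is_unit p"
    using x by (auto simp: primitive_rep_def)
  obtain a where a: "(\<Sum>i<n. a i * x i) = 1" using bezout_poly[OF prim(1)] by (rule exE)
  define r where "r = (\<Sum>i<n. a i * x' i)"
  have "v * r = (\<Sum>i<n. a i * (v * x' i))" by (simp add: r_def sum_distrib_left mult.left_commute)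
  also have "\<dots> = (\<Sum>i<n. u * (a i * x i))" by (rule sum.cong) (simp_all add: vx mult.left_commute)
  also have "\<dots> = u" by (simp add: sum_distrib_left[symmetric] a)
  finally have u: "u = v * r" ..
  have xr: "x' i = r * x i" if "i < n" for i using vx[OF that] uv(2) by (simp add: u mult.assoc)
  then have ru: "is_unit r" by (intro prim(2)) simp
  then have r0: "r \<noteq> 0" by auto
  then have "degree r = 0" using ru is_unit_iff_degree[OF r0] by simp
  then show ?thesis using xr[OF i] r0 by (cases "x i = 0") (simp_all add: degree_mult_eq)
qed

lemma height_primitive_rep:
  fixes P :: "'k::{finite,field} poly fract ppoint"
  assumes P: "P = proj_pt w" and x: "primitive_rep n P x"
  shows "height n P = CARD('k) ^ Max ((\<lambda>i. degree (x i)) ` {..<n})"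
  unfolding height_def
proof (rule the_equality)
  fix h assume "\<exists>x. primitive_rep n P x \<and> h = CARD('k) ^ Max ((\<lambda>i. degree (x i)) ` {..<n})"
  then obtain x' where x': "primitive_rep n P x'" "h = CARD('k) ^ Max ((\<lambda>i. degree (x' i)) ` {..<n})" by (elim exE conjE)
  have "(\<lambda>i. degree (x' i)) ` {..<n} = (\<lambda>i. degree (x i)) ` {..<n}"
    by (rule image_cong) (simp_all add: primitive_rep_degree[OF P x x'(1)])
  then show "h = CARD('k) ^ Max ((\<lambda>i. degree (x i)) ` {..<n})" using x'(2) by simp
qed (use x in blast)

lemma card_field_ge_2: "2 \<le> CARD('a::{finite,field})"
proof -
  have "card {0, 1 :: 'a} \<le> CARD('a)" by (rule card_mono) auto
  then show ?thesis by simp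
qed

text \<open>The vector lists the coefficients of a primitive representative; the height says that
  the largest degree is exactly e. The last conjunct recovers the point from the vector, so counting
  vectors counts points.\<close>

lemma open_point_coefficients:
  fixes Fs :: "'a::{finite,field} mpoly list"
  assumes P: "P \<in> open_points const_fract n Fs Gs" "height n P = CARD('a) ^ e"
    and Fs: "\<And>F. F \<in> set Fs \<Longrightarrow> \<exists>d. F \<in> forms n d" and Gs: "Gs \<subseteq> (\<Union>d. forms n d)"
  shows "\<exists>z. (\<forall>i\<ge>n * (e + 1). z i = 0) \<and> (\<forall>F\<in>set Fs. Fpol (\<lambda>c. c) e F z = 0) \<and>
    (\<exists>G\<in>Gs. Fpol (\<lambda>c. c) e G z \<noteq> 0) \<and> (\<forall>p. (\<forall>i<n. p dvd xpol e z i) \<longrightarrow> is_unit p) \<and>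
    (\<exists>j<n. degree (xpol e z j) = e) \<and> P = proj_pt (fract_pt n (xpol e z))"
proof -
  have Pp: "P \<in> proj_space n" "P \<in> proj_zeros const_fract n (set Fs)" "P \<notin> proj_zeros const_fract n Gs"
    using P(1) by (auto simp: open_points_def proj_zeros_def)
  obtain w where w: "P = proj_pt w" "\<exists>i. w i \<noteq> 0" "\<forall>i\<ge>n. w i = 0" using Pp(1) by (auto simp: proj_space_def)
  have n0: "0 < n" using w(2,3) by (metis gr0I le0)
  obtain x where x: "primitive_rep n P x" using ex_primitive_rep[OF Pp(1)] by (rule exE)
  let ?D = "(\<lambda>i. degree (x i)) ` {..<n}"
  have "CARD('a) ^ Max ?D = CARD('a) ^ e" using height_primitive_rep[OF w(1) x] P(2) by simp
  then have Max: "Max ?D = e" using card_field_ge_2[where ?'a = 'a] by (simp add: power_inject_exp)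
  define z where "z i = (if i < n * (e + 1) then coeff (x (i div (e + 1))) (i mod (e + 1)) else 0)" for i
  have xz: "xpol e z i = x i" if i: "i < n" for i
  proof (rule poly_eqI)
    fix k
    have "degree (x i) \<le> Max ?D" using i by (intro Max_ge) auto
    then have dx: "degree (x i) \<le> e" by (simp only: Max)
    show "coeff (xpol e z i) k = coeff (x i) k"
    proof (cases "k \<le> e")
      case True
      have "i * (e + 1) + k < (i + 1) * (e + 1)" using True by simp
      also have "\<dots> \<le> n * (e + 1)" using i by (intro mult_le_mono1) simp
      finally have 1: "i * (e + 1) + k < n * (e + 1)" .
      have "(k + i * (e + 1)) div (e + 1) = i" "(k + i * (e + 1)) mod (e + 1) = k"
        using True by (simp_all only: div_mult_self3 mod_mult_self3 div_mult_self1 mod_mult_self1) simp_all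
      then have "(i * (e + 1) + k) div (e + 1) = i" "(i * (e + 1) + k) mod (e + 1) = k" by (simp_all only: add.commute)
      then show ?thesis using 1 True unfolding coeff_xpol z_def by (simp only: if_True)
    next
      case False
      then show ?thesis using dx by (simp add: coeff_xpol coeff_eq_0)
    qed
  qed
  have fz: "fract_pt n (xpol e z) = fract_pt n x" using xz by auto
  have fP: "fract_pt n (xpol e z) \<in> P" using x unfolding fz primitive_rep_def by (elim conjE)
  then have Pz: "P = proj_pt (fract_pt n (xpol e z))" using proj_pt_eq[of _ w] w(1) by simp
  have ev: "meval const_fract F (fract_pt n (xpol e z)) = Fraction_Field.Fract (Fpol (\<lambda>c. c) e F z) 1" if F: "F \<in> forms n d" for F d
  proof -
    have "meval const_fract F (fract_pt n (xpol e z)) = meval const_fract F (\<lambda>i. Fraction_Field.Fract (xpol e z i) 1)"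
    proof (rule meval_cong_keys)
      fix m i assume "m \<in> kys F" "i \<in> kys m"
      then show "fract_pt n (xpol e z) i = Fraction_Field.Fract (xpol e z i) 1" using forms_PV[OF F] by (auto simp: kset_def)
    qed
    also have "\<dots> = Fraction_Field.Fract (Fpol (\<lambda>c. c) e F z) 1"
      unfolding Fpol_def rhom_meval[OF rhom_Fract] const_fract_def[abs_def] ..
    finally show ?thesis .
  qed
  have "Fpol (\<lambda>c. c) e F z = 0" if F: "F \<in> set Fs" for F
  proof -
    obtain d where d: "F \<in> forms n d" using Fs[OF F] by (rule exE)
    have "meval const_fract F (fract_pt n (xpol e z)) = 0" using Pp(2) F fP by (simp add: proj_zeros_def)
    then show ?thesis unfolding ev[OF d] Fract_eq_0 .
  qed
  moreover have "\<exists>G\<in>Gs. Fpol (\<lambda>c. c) e G z \<noteq> 0"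
  proof -
    obtain G y where G: "G \<in> Gs" "y \<in> P" "meval const_fract G y \<noteq> 0" using Pp(1,3) by (auto simp: proj_zeros_def)
    obtain d where d: "G \<in> forms n d" using G(1) Gs by blast
    obtain c where c: "c \<noteq> 0" "y = (\<lambda>i. c * fract_pt n (xpol e z) i)" using G(2) unfolding Pz by (auto simp: proj_pt_def)
    have "meval const_fract G (fract_pt n (xpol e z)) \<noteq> 0" using G(3) unfolding c(2) forms_vanish_pt[OF d c(1)] .
    then show ?thesis unfolding ev[OF d] Fract_eq_0 using G(1) by (rule bexI)
  qed
  moreover have "\<forall>p. (\<forall>i<n. p dvd xpol e z i) \<longrightarrow> is_unit p" using x xz by (simp add: primitive_rep_def)
  moreover have "\<exists>j<n. degree (xpol e z j) = e"
  proof -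
    have "e \<in> ?D" unfolding Max[symmetric] by (rule Max_in) (use n0 in auto)
    then show ?thesis using xz by auto
  qed
  ultimately show ?thesis using Pz by (intro exI[of _ z]) (simp add: z_def)
qed

subsection \<open>The list of equations\<close>

text \<open>Sorted by decreasing degree, so that a combination of the equations from some index on
  has at most the degree of the equation at that index. Each entry carries its degree, because the
  polynomial itself may be zero.\<close>

definition eqs :: "nat list \<Rightarrow> nat \<Rightarrow> 'k::comm_ring_1 mpoly list \<Rightarrow> (nat \<times> 'k mpoly) list" where
  "eqs ds e Fs = rev (sort_key fst (concat (map (\<lambda>l. map (\<lambda>k. (ds ! l, cform e (Fs ! l) k)) [0..<ds ! l * e + 1]) [0..<length ds])))"

lemma set_eqs: "set (eqs ds e Fs) = (\<Union>l\<in>{0..<length ds}. (\<lambda>k. (ds ! l, cform e (Fs ! l) k)) ` {0..<ds ! l * e + 1})"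
  by (simp only: eqs_def set_rev set_sort set_concat set_map set_upt image_image)

lemma eqs_antimono:
  assumes "l \<le> l'" "l' < length (eqs ds e Fs)" shows "fst (eqs ds e Fs ! l') \<le> fst (eqs ds e Fs ! l)"
proof -
  define xs where "xs = sort_key fst (concat (map (\<lambda>l. map (\<lambda>k. (ds ! l, cform e (Fs ! l) k)) [0..<ds ! l * e + 1]) [0..<length ds]))"
  have e: "eqs ds e Fs = rev xs" unfolding eqs_def xs_def ..
  have s: "sorted (map fst xs)" unfolding xs_def by (rule sorted_sort_key)
  have l: "l' < length xs" using assms(2) by (simp add: e)
  have "map fst xs ! (length xs - Suc l') \<le> map fst xs ! (length xs - Suc l)"
    by (rule sorted_nth_mono[OF s]) (use assms(1) l in auto)
  then show ?thesis using assms(1) l by (simp add: e rev_nth)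
qed

lemma prod_list_concat: "prod_list (map f (concat (map g ls))) = prod_list (map (\<lambda>l. prod_list (map f (g l))) ls)"
  for f :: "'a \<Rightarrow> 'b::comm_monoid_mult"
  by (induction ls) simp_all

lemma prod_eqs: "(\<Prod>l<length (eqs ds e Fs). fst (eqs ds e Fs ! l)) = (\<Prod>l<length ds. (ds ! l) ^ (ds ! l * e + 1))"
proof -
  let ?c = "concat (map (\<lambda>l. map (\<lambda>k. (ds ! l, cform e (Fs ! l) k)) [0..<ds ! l * e + 1]) [0..<length ds])"
  have "(\<Prod>l<length (eqs ds e Fs). fst (eqs ds e Fs ! l)) = prod_list (map fst (eqs ds e Fs))"
    by (simp add: prod.list_conv_set_nth atLeast0LessThan)
  also have "\<dots> = prod_mset (image_mset fst (mset ?c))"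
    unfolding prod_mset_prod_list[symmetric] mset_map eqs_def mset_rev mset_sort ..
  also have "\<dots> = prod_list (map fst ?c)" by (simp only: prod_mset_prod_list mset_map[symmetric])
  also have "\<dots> = prod_list (map (\<lambda>l. (ds ! l) ^ (ds ! l * e + 1)) [0..<length ds])"
    unfolding prod_list_concat by (simp add: comp_def map_replicate_const mult.commute)
  also have "\<dots> = (\<Prod>l\<in>set [0..<length ds]. (ds ! l) ^ (ds ! l * e + 1))"
    by (rule prod.distinct_set_conv_list[symmetric]) simp
  finally show ?thesis by (simp add: atLeast0LessThan)
qed

subsection \<open>The bound\<close>

text \<open>Adding the N remaining coordinate equations of \<open>z\<close> one by one leaves a
  single point, and each of them lowers the growth exponent by at most one. This ensures that a
  least growth exponent exists in the final argument.\<close>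

lemma growth_le_point:
  fixes J :: "'k::field mpoly set"
  shows "rm.subspace J \<Longrightarrow> (\<And>i. N \<le> i \<Longrightarrow> Vr i - Cst (z i) \<in> J) \<Longrightarrow> growth_le (Wz z) N J"
proof (induction N arbitrary: J)
  case 0
  show ?case
  proof (rule growth_leI)
    fix s
    have "F \<in> mp.span ({1} \<union> (J \<union> Wz z s))" for F
    proof -
      have "F - Cst (ev z F) \<in> J"
        by (rule ideal_of_point[OF 0(1), of z]) (use 0(2) in \<open>simp_all add: meval_hom[OF rhom_id] meval_Cst[OF rhom_id]\<close>)
      then have "F - Cst (ev z F) \<in> mp.span ({1} \<union> (J \<union> Wz z s))" by (intro mp.span_base) simp
      moreover have "Cst (ev z F) * 1 \<in> mp.span ({1} \<union> (J \<union> Wz z s))" by (intro mp.span_scale mp.span_base) simp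
      ultimately have "F - Cst (ev z F) + Cst (ev z F) * 1 \<in> mp.span ({1} \<union> (J \<union> Wz z s))" by (rule mp.span_add)
      then show ?thesis by simp
    qed
    then have "mp.span ({1} \<union> (J \<union> Wz z s)) = UNIV" by blast
    then show "codim_le (J \<union> Wz z s) (1 * (s + 1) ^ 0)" unfolding codim_le_def by (intro exI[of _ "{1}"]) simp
  qed
next
  case (Suc N)
  let ?t = "Vr N - Cst (z N)"
  show ?case
  proof (rule growth_step[OF Suc.prems(1), where z = z and t = ?t])
    show "ev z ?t = 0" by (simp add: meval_hom[OF rhom_id] meval_Vr[OF rhom_id] meval_Cst[OF rhom_id])
    show "growth_le (Wz z) N (rm.span (insert ?t J))"
    proof (rule Suc.IH[OF rm.subspace_span])
      fix i assume "N \<le> i"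
      then have "Vr i - Cst (z i) \<in> insert ?t J" using Suc.prems(2)[of i] by (cases "i = N") simp_all
      then show "Vr i - Cst (z i) \<in> rm.span (insert ?t J)" by (rule rm.span_base)
    qed
  qed
qed

lemma star_span_forms:
  fixes A :: "'k::field mpoly set"
  assumes A: "\<And>F. F \<in> A \<Longrightarrow> \<exists>n d. F \<in> forms n d" shows "star (rm.span A) = rm.span A"
proof (rule equalityI[OF star_subset[OF rm.subspace_span]])
  have "A \<subseteq> star (rm.span A)"
  proof
    fix F assume F: "F \<in> A"
    then obtain n d where "F \<in> forms n d" using A by blast
    then show "F \<in> star (rm.span A)" by (rule forms_star[OF rm.subspace_span rm.span_base[OF F]])
  qed
  then show "rm.span A \<subseteq> star (rm.span A)" by (rule rm.span_minimal) (rule star_ideal[OF rm.subspace_span])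
qed

text \<open>For \<open>d = 0\<close> there may be no smaller exponent at which the growth bound
  fails, so the chain of length 0 is given directly: the homogeneous part of the maximal ideal of
  \<open>z\<close>.\<close>

lemma prime_chain_point:
  fixes J :: "'k::field mpoly set"
  assumes z: "z j \<noteq> 0" "\<And>i. n \<le> i \<Longrightarrow> z i = 0" and J: "rm.subspace J" "star J = J" "Vr ` {n..} \<subseteq> J"
    and van: "\<forall>F\<in>J. ev z F = 0" and g: "d = 0 \<or> \<not> growth_le (Wz z) d J"
  shows "\<exists>p. (\<forall>i\<le>d. is_prime (p i) \<and> star (p i) = p i \<and> J \<subseteq> p i \<and> (\<forall>F\<in>p i. ev z F = 0)) \<and>
    (\<forall>i<d. p (Suc i) \<subset> p i)"
proof (cases "d = 0")
  case True
  let ?M = "{F. ev z F = 0}"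
  have M: "?M = Wz z (Suc 0)" using Wz_1[of _ z] by blast
  have Mi: "rm.subspace ?M" unfolding M by (rule Wz_ideal)
  have "is_prime ?M" unfolding is_prime_def using Mi by (auto simp: meval_hom[OF rhom_id])
  then have "is_prime (star ?M)" by (rule star_prime)
  moreover have "star (star ?M) = star ?M" by (rule star_star[OF Mi])
  moreover have "J \<subseteq> star ?M" using star_mono[of J ?M] J(2) van by auto
  moreover have "\<forall>F\<in>star ?M. ev z F = 0" using star_subset[OF Mi] by blast
  ultimately show ?thesis using True by (intro exI[of _ "\<lambda>_. star ?M"]) simp
next
  case False
  then show ?thesis using homogeneous_prime_chain[where z = z and j = j and n = n and J = J and d = d, OF z J] g by simp
qed


text \<open>A nonzero form of degree 0 is a nonzero constant and has no zeros, while an irreducible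
  space is nonempty.\<close>

lemma degrees_pos:
  fixes Fs :: "'a::field mpoly list"
  assumes "smooth_fano n Fs" "F \<in> set Fs" "F \<in> forms n d" "F \<noteq> 0" shows "1 \<le> d"
proof (rule ccontr)
  assume "\<not> 1 \<le> d"
  then have "d = 0" by simp
  then have d: "F \<in> forms n 0" using assms(3) by simp
  have "kys m = {}" if "mdeg m = 0" for m using that mdeg_eq_0[of m] by simp
  then have "F \<in> PV 0" using d by (auto simp: forms_eq kset_def)
  then obtain c where c: "F = Cst c" using PV_0_Cst by blast
  have "irreducible_space (subtopology (zariski to_ac n) (proj_zeros to_ac n (set Fs)))"
    using assms(1) by (simp add: smooth_fano_def Let_def)
  then obtain P where P: "P \<in> proj_zeros to_ac n (set Fs)" by (auto simp: irreducible_space_def)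
  then obtain x where "x \<in> P" using proj_space_nonempty[of P n] by (auto simp: proj_zeros_def)
  then have "meval to_ac F x = 0" using P assms(2) by (simp add: proj_zeros_def)
  then have "to_ac c = 0" by (simp add: c meval_Cst[OF rhom_to_ac])
  then show False using assms(4) by (simp add: c rhom_field_inj[OF rhom_to_ac] Cst_0)
qed

lemma ext_power_ge: "0 < q \<Longrightarrow> 1 \<le> q \<Longrightarrow> ereal (real d) \<le> x \<Longrightarrow> ereal (q ^ d) \<le> ext_power q x"
  by (cases x) (auto simp: ext_power_def powr_realpow[symmetric] intro: powr_mono)

lemma ext_power_nonneg: "0 \<le> ext_power q x"
  by (cases x) (auto simp: ext_power_def)

text \<open>One number serves both bounds: the least \<open>D\<close> such that the cone has growth
  at most D + 1 at every counted point. This exponent enters the count. By minimality some point has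
  growth beyond \<open>D\<close> when \<open>D\<close> is positive, and the chain of D + 1
  homogeneous primes through it gives projective dimension at least \<open>D\<close>. The two
  exponents differ by one because the count takes place on the affine cone.\<close>

lemma N_open_le:
  fixes Fs :: "'a::{finite,field} mpoly list"
  assumes len: "length Fs = length ds" and F: "\<forall>i<length ds. Fs ! i \<in> forms n (ds ! i) \<and> Fs ! i \<noteq> 0"
    and fano: "smooth_fano n Fs" and Gs: "Gs \<subseteq> (\<Union>d. forms n d)" and e: "1 \<le> e" and N: "N_open n Fs Gs e \<noteq> 0"
  shows "\<exists>D. N_open n Fs Gs e \<le> 2 * (\<Prod>l<length ds. (ds ! l) ^ (ds ! l * e + 1)) * CARD('a) ^ Suc D \<and>
    ereal (real D) \<le> scheme_dim (Mor_scheme n Fs Gs e)"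
proof -
  let ?N = "n * (e + 1)" and ?L = "eqs ds e Fs"
  define A where "A = {P \<in> open_points const_fract n Fs Gs. height n P = CARD('a) ^ e}"
  have NA: "N_open n Fs Gs e = card A" by (simp add: N_open_def A_def)
  have Fs: "\<exists>d. G \<in> forms n d" if G: "G \<in> set Fs" for G
  proof -
    obtain i where "i < length Fs" "G = Fs ! i" using G unfolding in_set_conv_nth by blast
    then show ?thesis using F len by auto
  qed
  have ds1: "1 \<le> ds ! i" if "i < length ds" for i
    using degrees_pos[OF fano, of "Fs ! i" "ds ! i"] F len that by simp
  define Z where "Z P z \<longleftrightarrow> (\<forall>i\<ge>?N. z i = 0) \<and> (\<forall>F\<in>set Fs. Fpol (\<lambda>c. c) e F z = 0) \<and>
    (\<exists>G\<in>Gs. Fpol (\<lambda>c. c) e G z \<noteq> 0) \<and> (\<forall>p. (\<forall>i<n. p dvd xpol e z i) \<longrightarrow> is_unit p) \<and>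
    (\<exists>j<n. degree (xpol e z j) = e) \<and> P = proj_pt (fract_pt n (xpol e z))" for P and z :: "nat \<Rightarrow> 'a"
  have "\<forall>P\<in>A. \<exists>z. Z P z"
  proof
    fix P assume "P \<in> A"
    then show "\<exists>z. Z P z" unfolding Z_def A_def by (intro open_point_coefficients[OF _ _ Fs Gs]) auto
  qed
  from bchoice[OF this] obtain z where z: "\<forall>P\<in>A. Z P (z P)" by (rule exE)
  define S where "S = z ` A"
  have zS: "\<exists>P. Z P y" if "y \<in> S" for y using that z unfolding S_def by blast
  have inj: "inj_on z A"
  proof (rule inj_onI)
    have eq: "R = proj_pt (fract_pt n (xpol e (z R)))" if "R \<in> A" for R
      using bspec[OF z that] unfolding Z_def by (elim conjE)
    fix P Q assume PQ: "P \<in> A" "Q \<in> A" "z P = z Q"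
    have "P = proj_pt (fract_pt n (xpol e (z P)))" by (rule eq[OF PQ(1)])
    also have "\<dots> = proj_pt (fract_pt n (xpol e (z Q)))" by (simp only: PQ(3))
    also have "\<dots> = Q" by (rule eq[OF PQ(2), symmetric])
    finally show "P = Q" .
  qed
  have Sz: "y i = 0" if "y \<in> S" "?N \<le> i" for y i using zS[OF that(1)] that(2) unfolding Z_def by blast
  have finS: "finite S"
  proof (rule finite_subset)
    show "S \<subseteq> {y. \<forall>x. (x \<in> {..<?N} \<longrightarrow> y x \<in> UNIV) \<and> (x \<notin> {..<?N} \<longrightarrow> y x = 0)}" using Sz by auto
    show "finite {y :: nat \<Rightarrow> 'a. \<forall>x. (x \<in> {..<?N} \<longrightarrow> y x \<in> UNIV) \<and> (x \<notin> {..<?N} \<longrightarrow> y x = 0)}"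
      by (rule finite_set_of_finite_funs) auto
  qed
  have cS: "card A = card S" unfolding S_def by (rule card_image[OF inj, symmetric])
  then have "S \<noteq> {}" using N NA by auto
  then obtain y0 where "y0 \<in> S" by blast
  then have n0: "0 < n" using zS[of y0] unfolding Z_def by auto
  define f where "f l = snd (?L ! l)" for l
  define \<delta> where "\<delta> l = fst (?L ! l)" for l
  let ?m = "length ?L"
  have mem: "\<exists>i k. i < length ds \<and> \<delta> l = ds ! i \<and> f l = cform e (Fs ! i) k" if "l < ?m" for l
  proof -
    have "?L ! l \<in> set ?L" using that by (rule nth_mem)
    then obtain i k where "i < length ds" "?L ! l = (ds ! i, cform e (Fs ! i) k)" unfolding set_eqs by auto
    then show ?thesis unfolding f_def \<delta>_def by (intro exI[of _ i] exI[of _ k]) simp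
  qed
  have \<delta>1: "1 \<le> \<delta> l" if "l < ?m" for l using mem[OF that] ds1 by auto
  have fform: "f l \<in> forms ?N (\<delta> l)" if l: "l < ?m" for l
  proof -
    obtain i k where ik: "i < length ds" "\<delta> l = ds ! i" "f l = cform e (Fs ! i) k" using mem[OF l] by blast
    show ?thesis unfolding ik(2,3) by (rule cform_forms) (use F ik(1) in blast)
  qed
  have fPV: "f l \<in> PV ?N \<inter> dle (\<delta> l)" if "l < ?m" for l
    using fform[OF that] unfolding forms_eq kset_def by auto
  have van: "ev y (f l) = 0" if y: "y \<in> S" and l: "l < ?m" for y l
  proof -
    obtain i k where ik: "i < length ds" "f l = cform e (Fs ! i) k" using mem[OF l] by blast
    then have "Fpol (\<lambda>c. c) e (Fs ! i) y = 0" using zS[OF y] len unfolding Z_def by auto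
    then show ?thesis unfolding ik(2) meval_cform[OF rhom_id] by simp
  qed
  define J where "J = rm.span (f ` {..<?m} \<union> Vr ` {?N..})"
  have JI: "rm.subspace J" unfolding J_def by (rule rm.subspace_span)
  have VJ: "Vr ` {?N..} \<subseteq> J" unfolding J_def by (rule subset_trans[OF Un_upper2 rm.span_superset])
  have fJ: "f l \<in> J" if "l < ?m" for l unfolding J_def by (rule rm.span_base) (use that in auto)
  have starJ: "star J = J"
    unfolding J_def
  proof (rule star_span_forms)
    fix G assume "G \<in> f ` {..<?m} \<union> Vr ` {?N..}"
    then consider l where "l < ?m" "G = f l" | i where "G = Vr i" by auto
    then show "\<exists>n d. G \<in> forms n d"
    proof cases
      case 1
      then show ?thesis using fform by blast
    next
      case 2
      then show ?thesis using Vr_forms[of i "Suc i"] by blast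
    qed
  qed
  have vanJ: "\<forall>G\<in>J. ev y G = 0" if y: "y \<in> S" for y
  proof -
    have "J \<subseteq> Wz y (Suc 0)" unfolding J_def
    proof (rule rm.span_minimal[OF _ Wz_ideal], rule subsetI)
      fix G assume "G \<in> f ` {..<?m} \<union> Vr ` {?N..}"
      then show "G \<in> Wz y (Suc 0)" unfolding Wz_1 using van[OF y] Sz[OF y] by (auto simp: meval_Vr[OF rhom_id])
    qed
    then show ?thesis using Wz_1[of _ y] by blast
  qed
  have gN: "growth_le (Wz y) ?N J" if y: "y \<in> S" for y
  proof (rule growth_le_point[OF JI])
    fix i assume "?N \<le> i"
    then show "Vr i - Cst (y i) \<in> J" using VJ Sz[OF y] by (auto simp: Cst_0)
  qed
  let ?P = "\<lambda>D. \<forall>y\<in>S. growth_le (Wz y) (Suc D) J"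
  have N0: "0 < ?N" using n0 by simp
  then have PN: "?P (?N - 1)" using gN by simp
  define D where "D = (LEAST D. ?P D)"
  have PD: "?P D" unfolding D_def by (rule LeastI[of ?P, OF PN])
  have DN: "D \<le> ?N - 1" unfolding D_def by (rule Least_le[of ?P, OF PN])
  have "card S \<le> 2 * (\<Prod>l<?m. \<delta> l) * CARD('a) ^ Suc D"
  proof (rule card_zeros_le[where N = ?N and m = ?m and f = f and \<delta> = \<delta> and S = S and D = "Suc D" and \<phi> = "to_ac :: 'a \<Rightarrow> 'a alg_closure"])
    show "rhom (to_ac :: 'a \<Rightarrow> 'a alg_closure)" by (rule rhom_to_ac)
    show "infinite (UNIV :: 'a alg_closure set)" by (rule infinite_alg_closed)
    show "f l \<in> PV ?N \<inter> dle (\<delta> l)" "1 \<le> \<delta> l" if "l < ?m" for l by (fact fPV[OF that], fact \<delta>1[OF that])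
    show "finite S" "0 < ?N" by (fact finS, fact N0)
    show "y i = 0" if "y \<in> S" "?N \<le> i" for y i by (rule Sz[OF that])
    show "ev y (f l) = 0" if "y \<in> S" "l < ?m" for y l by (rule van[OF that])
    show "\<delta> l' \<le> \<delta> l" if "l \<le> l'" "l' < ?m" for l l' unfolding \<delta>_def by (rule eqs_antimono[OF that])
    have "D \<le> a - 1 \<Longrightarrow> 0 < a \<Longrightarrow> Suc D \<le> a" for a :: nat by linarith
    from this[OF DN N0] show "Suc D \<le> ?N" .
    show "growth_le (Wz y) (Suc D) (rm.span (f ` {..<?m} \<union> Vr ` {?N..}))" if "y \<in> S" for y
      using PD that unfolding J_def by blast
  qed
  then have bound: "N_open n Fs Gs e \<le> 2 * (\<Prod>l<length ds. (ds ! l) ^ (ds ! l * e + 1)) * CARD('a) ^ Suc D"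
    unfolding NA cS \<delta>_def prod_eqs .
  \<comment> \<open>A single point of maximal growth suffices, since the dimension of the scheme is
    at least the local dimension at any of its points. For \<open>D = 0\<close> any counted point
    will do.\<close>
  have "\<exists>y\<in>S. D = 0 \<or> \<not> growth_le (Wz y) D J"
  proof (cases D)
    case 0
    then show ?thesis using \<open>y0 \<in> S\<close> by blast
  next
    case (Suc D')
    then have "\<not> ?P D'" using not_less_Least[of D' ?P] by (simp add: D_def[symmetric])
    then show ?thesis using Suc by blast
  qed
  then obtain y where y: "y \<in> S" "D = 0 \<or> \<not> growth_le (Wz y) D J" by (rule bexE)
  obtain P where P: "Z P y" using zS[OF y(1)] by (rule exE)
  obtain j where j: "j < n" "degree (xpol e y j) = e" using P unfolding Z_def by blast
  have "\<exists>i. y i \<noteq> 0"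
  proof (rule ccontr)
    assume "\<not> ?thesis"
    then have "xpol e y j = 0" by (intro poly_eqI) (simp add: coeff_xpol)
    then show False using j(2) e by simp
  qed
  then obtain i0 where i0: "y i0 \<noteq> 0" by (rule exE)
  have "\<exists>p. (\<forall>i\<le>D. is_prime (p i) \<and> star (p i) = p i \<and> J \<subseteq> p i \<and> (\<forall>F\<in>p i. ev y F = 0)) \<and>
    (\<forall>i<D. p (Suc i) \<subset> p i)"
    by (rule prime_chain_point[where z = y and j = i0 and n = ?N and J = J and d = D,
          OF i0 Sz[OF y(1)] JI starJ VJ vanJ[OF y(1)] y(2)])
  then obtain p where p: "\<forall>i\<le>D. is_prime (p i) \<and> star (p i) = p i \<and> J \<subseteq> p i \<and> (\<forall>F\<in>p i. ev y F = 0)"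
    "\<forall>i<D. p (Suc i) \<subset> p i" by (elim exE conjE)
  obtain G where G: "G \<in> Gs" "Fpol (\<lambda>c. c) e G y \<noteq> 0" using P unfolding Z_def by blast
  obtain d' where d': "G \<in> forms n d'" using Gs G(1) by blast
  have prim: "is_unit q" if "\<forall>i<n. q dvd xpol e y i" for q using P that unfolding Z_def by blast
  have e0: "0 < e" using e by simp
  have "\<exists>g dg. g \<in> forms ?N dg \<and> 0 < dg \<and> ev y g \<noteq> 0 \<and>
    (\<forall>z. (\<exists>i. z i \<noteq> 0) \<longrightarrow> (\<forall>i\<ge>?N. z i = 0) \<longrightarrow>
      (\<forall>F\<in>set Fs. \<forall>k. meval to_ac (cform e F k) z = 0) \<longrightarrow> meval to_ac g z \<noteq> 0 \<longrightarrow>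
      proj_pt z \<in> Mor_points n Fs Gs e)"
    by (rule Mor_points_neighbourhood[where n = n and e = e and y = y and Fs = Fs and Gs = Gs and G = G,
          OF Fs G(1) d' prim j e0 G(2)])
  then obtain g dg where g: "g \<in> forms ?N dg" "0 < dg" "ev y g \<noteq> 0" and
    gW: "\<forall>z. (\<exists>i. z i \<noteq> 0) \<longrightarrow> (\<forall>i\<ge>?N. z i = 0) \<longrightarrow> (\<forall>F\<in>set Fs. \<forall>k. meval to_ac (cform e F k) z = 0) \<longrightarrow>
      meval to_ac g z \<noteq> 0 \<longrightarrow> proj_pt z \<in> Mor_points n Fs Gs e" by (elim exE conjE)
  have "ereal (real D) \<le> scheme_dim (subtopology (zariski to_ac ?N) (Mor_points n Fs Gs e))"
  proof (rule scheme_dim_ge_prime_chain[OF rhom_to_ac _ _ g(1,2)])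
    fix i assume "i \<le> D"
    then have pi: "is_prime (p i)" "star (p i) = p i" "J \<subseteq> p i" "\<forall>F\<in>p i. ev y F = 0" using p(1) by blast+
    have "g \<notin> p i" using pi(4) g(3) by blast
    then show "is_prime (p i) \<and> star (p i) = p i \<and> Vr ` {?N..} \<subseteq> p i \<and> g \<notin> p i" using pi(1-3) VJ by blast
  next
    fix i assume "i < D"
    then show "p (Suc i) \<subset> p i" using p(2) by blast
  next
    show "Mor_points n Fs Gs e \<subseteq> proj_space ?N" by (auto simp: Mor_points_def)
  next
    fix x assume x: "\<exists>i. x i \<noteq> 0" "\<forall>i\<ge>?N. x i = 0" "\<forall>F\<in>p D \<inter> PV ?N. meval to_ac F x = 0" "meval to_ac g x \<noteq> 0"
    \<comment> \<open>Coefficients of index beyond d e vanish identically; the remaining ones are in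
      the list of equations and therefore in every prime of the chain.\<close>
    have "meval to_ac (cform e F k) x = 0" if FF: "F \<in> set Fs" for F k
    proof -
      obtain i where i: "i < length ds" "F = Fs ! i" using FF len unfolding in_set_conv_nth by auto
      have Ff: "F \<in> forms n (ds ! i)" using assms(2) i by blast
      show ?thesis
      proof (cases "ds ! i * e < k")
        case True
        then show ?thesis using cform_zero[OF Ff] by (simp add: meval_hom[OF rhom_to_ac])
      next
        case False
        then have "(ds ! i, cform e F k) \<in> set ?L" unfolding set_eqs i(2) using i(1) by (intro UN_I[of i]) auto
        then obtain l where "l < ?m" "f l = cform e F k" unfolding in_set_conv_nth f_def by auto
        then have "cform e F k \<in> J" using fJ[of l] by simp
        then have "cform e F k \<in> p D" using p(1) by blast
        moreover have "cform e F k \<in> PV ?N" by (rule forms_PV[OF cform_forms[OF Ff]])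
        ultimately show ?thesis using x(3) by blast
      qed
    qed
    then show "proj_pt x \<in> Mor_points n Fs Gs e" using gW x(1,2,4) by blast
  qed
  then show ?thesis using bound unfolding Mor_scheme_def by (intro exI[of _ D]) simp
qed

theorem theorem1p2:
  fixes ds :: "nat list"
  shows "\<exists>c::real. c > 0 \<and>
    (\<forall>(n::nat) (Fs :: 'a::{finite,field} mpoly list) (Gs :: 'a mpoly set) (e::nat).
       length Fs = length ds \<and>
       (\<forall>i<length ds. Fs ! i \<in> forms n (ds ! i) \<and> Fs ! i \<noteq> 0) \<and>
       smooth_fano n Fs \<and>
       Gs \<subseteq> (\<Union>d. forms n d) \<and>
       e \<ge> 1 \<longrightarrow>
       ereal (real (N_open n Fs Gs e)) \<le>
         ereal (c * (real (\<Prod>i<length ds. (ds ! i) ^ (ds ! i))) ^ e) *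
           ext_power (real CARD('a)) (scheme_dim (Mor_scheme n Fs Gs e)))"
proof -
  define q where "q = CARD('a)"
  have q: "2 \<le> q" unfolding q_def by (rule card_field_ge_2)
  \<comment> \<open>The factor 2 comes from the grouping of the points, q from the passage between
    the cone and the projective scheme, and the product of the degrees from having d_i e + 1
    equations where \<open>C ^ e\<close> accounts for d_i e. Taking the maximum with 1 keeps the
    constant positive for every list of degrees.\<close>
  define c where "c = real (2 * q * (\<Prod>i<length ds. max 1 (ds ! i)))"
  define C where "C = (\<Prod>i<length ds. (ds ! i) ^ (ds ! i))"
  have "0 < c" unfolding c_def using q by (simp add: prod_pos)
  moreover have "ereal (real (N_open n Fs Gs e)) \<le> ereal (c * real C ^ e) * ext_power (real q) (scheme_dim (Mor_scheme n Fs Gs e))"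
    if h: "length Fs = length ds" "\<forall>i<length ds. Fs ! i \<in> forms n (ds ! i) \<and> Fs ! i \<noteq> 0"
      "smooth_fano n Fs" "Gs \<subseteq> (\<Union>d. forms n d)" "1 \<le> e"
    for n e and Fs :: "'a mpoly list" and Gs
  proof (cases "N_open n Fs Gs e = 0")
    \<comment> \<open>Without points the scheme may be empty, of dimension -\<infinity>, and the
      right-hand side is then 0; its nonnegativity is enough.\<close>
    case True
    have "0 \<le> ereal (c * real C ^ e)" using \<open>0 < c\<close> by simp
    from ereal_0_le_mult[OF this ext_power_nonneg] show ?thesis using True by (simp add: zero_ereal_def[symmetric])
  next
    case False
    from N_open_le[OF h False] obtain D where D:
      "N_open n Fs Gs e \<le> 2 * (\<Prod>l<length ds. (ds ! l) ^ (ds ! l * e + 1)) * q ^ Suc D"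
      "ereal (real D) \<le> scheme_dim (Mor_scheme n Fs Gs e)" unfolding q_def by (elim exE conjE)
    let ?M = "\<Prod>i<length ds. max 1 (ds ! i)"
    have "(\<Prod>l<length ds. (ds ! l) ^ (ds ! l * e + 1)) = (\<Prod>l<length ds. ((ds ! l) ^ (ds ! l)) ^ e * ds ! l)"
      by (rule prod.cong) (simp_all only: power_add power_one_right power_mult)
    also have "\<dots> = C ^ e * (\<Prod>l<length ds. ds ! l)" unfolding C_def prod_power_distrib prod.distrib ..
    also have "\<dots> \<le> C ^ e * ?M" by (intro mult_le_mono2 prod_mono) auto
    finally have le: "2 * (\<Prod>l<length ds. (ds ! l) ^ (ds ! l * e + 1)) * q ^ Suc D \<le> 2 * (C ^ e * ?M) * q ^ Suc D"
      by (intro mult_le_mono) auto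
    have "N_open n Fs Gs e \<le> 2 * (C ^ e * ?M) * q ^ Suc D" by (rule order_trans[OF D(1) le])
    also have "\<dots> = (2 * q * ?M) * C ^ e * q ^ D" by (simp only: power_Suc mult_ac)
    finally have "N_open n Fs Gs e \<le> (2 * q * ?M) * C ^ e * q ^ D" .
    then have "real (N_open n Fs Gs e) \<le> real ((2 * q * (\<Prod>i<length ds. max 1 (ds ! i))) * C ^ e * q ^ D)"
      by (simp only: of_nat_le_iff)
    then have "real (N_open n Fs Gs e) \<le> c * real C ^ e * real q ^ D" by (simp only: c_def of_nat_mult of_nat_power)
    then have "ereal (real (N_open n Fs Gs e)) \<le> ereal (c * real C ^ e) * ereal (real q ^ D)" by simp
    also have "\<dots> \<le> ereal (c * real C ^ e) * ext_power (real q) (scheme_dim (Mor_scheme n Fs Gs e))"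
      by (intro ereal_mult_left_mono ext_power_ge D(2)) (use q \<open>0 < c\<close> in auto)
    finally show ?thesis .
  qed
  ultimately show ?thesis unfolding q_def C_def by (intro exI[of _ c] conjI allI impI) simp_all
qed

end
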